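(* Let $(\Gamma,\mathscr{G})$ be a graph of groups, $p\in\Gamma$, and let $T$ be its Bass–Serre tree with distinguished lift $\tilde p$ of $p$. There is a Galois correspondence between (connected) pointed covering maps $\rho\colon(\Lambda,\mathscr{L},q)\to(\Gamma,\mathscr{G},p)$ and subgroups $H\le\pi_1(\Gamma,\mathscr{G},p)$. The correspondence sends a covering map $\rho$ to the subgroup $\rho_\sharp(\pi_1(\Lambda,\mathscr{L},q))$ and sends a subgroup $H$ to the covering map $r\colon(H\backslash T,q)\to(\Gamma,\mathscr{G},p)$ induced by the action of $H$ on $T$, where $q$ is the image of $\tilde p$ under the covering projection $T\to H\backslash T$.
   Context: A graph of groups $(\Gamma,\mathscr{G})$ is a connected graph with vertex groups $\mathscr{G}_v$, edge groups $\mathscr{G}_e=\mathscr{G}_{\bar e}$ and monomorphisms $\iota_e\colon\mathscr{G}_e\to\mathscr{G}_{\tau(e)}$ ($\tau(e)$ the terminal vertex of the oriented edge $e$, $\bar e$ its reverse, $\mathrm{st}(v)=\{e:\tau(e)=v\}$). An ordinary graph is a graph of groups with all groups trivial. A path in $(\Gamma,\mathscr{G})$ is an edge path in $\Gamma$ (whose first and last terms may be segments of edges or empty) with elements of the corresponding vertex groups inserted at the vertices it meets. Homotopy rel endpoints is generated by inserting or deleting $\sigma\bar\sigma$ and replacing $g\,e\,\iota_e(h)\,g'$ by $g\,\iota_{\bar e}(h)\,e\,g'$, $h\in\mathscr{G}_e$. $\pi_1(\Gamma,\mathscr{G},p)$ is the group of homotopy classes of loops at $p$. The Bass–Serre tree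 $T$ is the tree, unique up to equivariant isomorphism, on which $\pi_1(\Gamma,\mathscr{G},p)$ acts without inversions with quotient $\Gamma$, inducing $\mathscr{G}$; taking $p$ to be a vertex, the vertices over $v$ are the homotopy classes of paths from $p$ to $v$ modulo right multiplication by $\mathscr{G}_v$, with $\tilde p$ the class of the constant path. A morphism $f\colon(\Lambda,\mathscr{L})\to(\Gamma,\mathscr{G})$ is a graph map (vertices to vertices, edges to edges or collapsed to vertices), homomorphisms $f_v\colon\mathscr{L}_v\to\mathscr{G}_{f(v)}$, $f_e\colon\mathscr{L}_e\to\mathscr{G}_{f(e)}$, and for each oriented edge $e$ an element $\delta_e\in\mathscr{G}_{f(\tau(e))}$ with $f_{\tau(e)}(\iota_e(h))=\delta_e\iota_{f(e)}(f_e(h))\delta_e^{-1}$ for $h\in\mathscr{L}_e$ ($\iota_{f(e)}$ the identity if $e$ is collapsed). It acts on paths by $g\mapsto f_v(g)$, $e\mapsto\delta_{\bar e}f(e)\delta_e^{-1}$, inducing a homomorphism $f_\sharp$ on $\pi_1$. If $f$ collapses no edge, define $f_{\mathrm{st}(v)}\colon\coprod_{e\in\mathrm{st}(v)}\mathscr{L}_v/\iota_e(\mathscr{L}_e)\times\{e\}\to\coprod_{e'\in\mathrm{st}(f(v))}\mathscr{G}_{f(v)}/\iota_{e'}(\mathscr{G}_{e'})\times\{e'\}$ by $([g],e)\mapsto([f_v(g)\delta_e],f(e))$. A covering map is a morphism collapsing no edge, surjective on graphs, with all $f_v,f_e$ monomorphisms and all $f_{\mathrm{st}(v)}$ bijections.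 The natural projection $\pi\colon T\to(\Gamma,\mathscr{G})$ is a covering map. For $H\le\pi_1(\Gamma,\mathscr{G},p)$, the action of $H$ on $T$ gives $H\backslash T$ the structure of a graph of groups, with covering projection $\rho_H\colon T\to H\backslash T$; $r\colon H\backslash T\to(\Gamma,\mathscr{G})$ is the covering map fitting in the commutative diagram of covering maps $r\rho_H=\pi$, which induces the inclusion of $H$ on fundamental groups and the identity of $T$ on Bass–Serre trees. In the correspondence, pointed covering maps $\rho_1,\rho_2$ of $(\Gamma,\mathscr{G},p)$ are identified when there is a basepoint-preserving isomorphism of graphs of groups $f$ with $\rho_2f=\rho_1$. That it is a Galois correspondence means that the two assignments are mutually inverse, with inclusion of subgroups corresponding to factorization of one pointed covering map through another.
   Formalization: Equality of pointed morphisms (ρ_2 f = ρ_1, rρ_H = π) is taken up to conjugating f_v, f_e and adjusting δ_e by vertex- and edge-group elements of the target that are trivial at the base point; with literal equality of this data the correspondence is false. *)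

theory Defs
  imports Complex_Main "HOL-Algebra.Left_Coset" "HOL-Algebra.Elementary_Groups"
begin

section \<open>Graphs of groups\<close>

text \<open>Graphs are in Serre's sense: the edges are oriented, \<open>bar\<close> is the fixed-point-free reversal
  and \<open>tgt\<close> the terminal vertex.\<close>

record ('v, 'e, 'g, 'h) graph_of_groups =
  verts :: "'v set"
  edges :: "'e set"
  bar :: "'e \<Rightarrow> 'e"
  tgt :: "'e \<Rightarrow> 'v"
  vgroup :: "'v \<Rightarrow> 'g monoid"
  egroup :: "'e \<Rightarrow> 'h monoid"
  einj :: "'e \<Rightarrow> 'h \<Rightarrow> 'g"

definition src :: "('v, 'e, 'g, 'h) graph_of_groups \<Rightarrow> 'e \<Rightarrow> 'v" where
  "src \<Gamma> e = tgt \<Gamma> (bar \<Gamma> e)"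

definition graph_of_groups :: "('v, 'e, 'g, 'h) graph_of_groups \<Rightarrow> bool" where
  "graph_of_groups \<Gamma> \<longleftrightarrow>
     verts \<Gamma> \<noteq> {} \<and>
     (\<forall>e\<in>edges \<Gamma>. bar \<Gamma> e \<in> edges \<Gamma> \<and> bar \<Gamma> (bar \<Gamma> e) = e \<and> bar \<Gamma> e \<noteq> e \<and> tgt \<Gamma> e \<in> verts \<Gamma>) \<and>
     (\<forall>u\<in>verts \<Gamma>. \<forall>v\<in>verts \<Gamma>. (u, v) \<in> ((\<lambda>e. (src \<Gamma> e, tgt \<Gamma> e)) ` edges \<Gamma>)\<^sup>*) \<and>
     (\<forall>v\<in>verts \<Gamma>. group (vgroup \<Gamma> v)) \<and>
     (\<forall>e\<in>edges \<Gamma>. group (egroup \<Gamma> e) \<and> egroup \<Gamma> (bar \<Gamma> e) = egroup \<Gamma> e \<and>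
        einj \<Gamma> e \<in> mon (egroup \<Gamma> e) (vgroup \<Gamma> (tgt \<Gamma> e)))"

text \<open>A point is a vertex or lies at parameter \<open>0 < t < 1\<close> of an edge \<open>e\<close>, parametrised from
  \<open>src e\<close> to \<open>tgt e\<close>. In the second case it also lies at parameter \<open>1 - t\<close> of the reverse edge,
  and it is encoded by the set of both descriptions.\<close>

datatype ('v, 'e) point = Vertex 'v | Interior "('e \<times> real) set"

definition edge_point :: "('v, 'e, 'g, 'h) graph_of_groups \<Rightarrow> 'e \<Rightarrow> real \<Rightarrow> ('v, 'e) point" where
  "edge_point \<Gamma> e t =
     (if t = 0 then Vertex (src \<Gamma> e)
      else if t = 1 then Vertex (tgt \<Gamma> e)
      else Interior {(e, t), (bar \<Gamma> e, 1 - t)})"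

definition points :: "('v, 'e, 'g, 'h) graph_of_groups \<Rightarrow> ('v, 'e) point set" where
  "points \<Gamma> = Vertex ` verts \<Gamma> \<union> {edge_point \<Gamma> e t | e t. e \<in> edges \<Gamma> \<and> 0 \<le> t \<and> t \<le> 1}"

fun map_point :: "('v \<Rightarrow> 'w) \<Rightarrow> ('e \<Rightarrow> 'f) \<Rightarrow> ('v, 'e) point \<Rightarrow> ('w, 'f) point" where
  "map_point fv fe (Vertex v) = Vertex (fv v)"
| "map_point fv fe (Interior S) = Interior ((\<lambda>(e, t). (fe e, t)) ` S)"

section \<open>Paths and homotopy\<close>

text \<open>\<open>Elt v g\<close> is a group element inserted at \<open>v\<close>, and \<open>Seg e s t\<close> is the part of the edge \<open>e\<close>
  from parameter \<open>s\<close> to parameter \<open>t\<close>. Proper segments are allowed everywhere in a path, so that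
  paths meeting inside an edge can be concatenated; the subdivision move below makes this
  the same, up to homotopy, as allowing them at the two ends only.\<close>

datatype ('v, 'e, 'g) letter = Elt 'v 'g | Seg 'e real real

type_synonym ('v, 'e, 'g) pclass = "('v, 'e, 'g) letter list set"

fun is_letter :: "('v, 'e, 'g, 'h) graph_of_groups \<Rightarrow> ('v, 'e, 'g) letter \<Rightarrow> bool" where
  "is_letter \<Gamma> (Elt v g) \<longleftrightarrow> v \<in> verts \<Gamma> \<and> g \<in> carrier (vgroup \<Gamma> v)"
| "is_letter \<Gamma> (Seg e s t) \<longleftrightarrow> e \<in> edges \<Gamma> \<and> 0 \<le> s \<and> s < t \<and> t \<le> 1"

fun start_pt :: "('v, 'e, 'g, 'h) graph_of_groups \<Rightarrow> ('v, 'e, 'g) letter \<Rightarrow> ('v, 'e) point" where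
  "start_pt \<Gamma> (Elt v g) = Vertex v"
| "start_pt \<Gamma> (Seg e s t) = edge_point \<Gamma> e s"

fun end_pt :: "('v, 'e, 'g, 'h) graph_of_groups \<Rightarrow> ('v, 'e, 'g) letter \<Rightarrow> ('v, 'e) point" where
  "end_pt \<Gamma> (Elt v g) = Vertex v"
| "end_pt \<Gamma> (Seg e s t) = edge_point \<Gamma> e t"

fun is_path ::
  "('v, 'e, 'g, 'h) graph_of_groups \<Rightarrow> ('v, 'e) point \<Rightarrow> ('v, 'e, 'g) letter list \<Rightarrow> ('v, 'e) point \<Rightarrow> bool"
where
  "is_path \<Gamma> x [] y \<longleftrightarrow> x = y \<and> x \<in> points \<Gamma>"
| "is_path \<Gamma> x (l # c) y \<longleftrightarrow> is_letter \<Gamma> l \<and> start_pt \<Gamma> l = x \<and> is_path \<Gamma> (end_pt \<Gamma> l) c y"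

inductive move ::
  "('v, 'e, 'g, 'h) graph_of_groups \<Rightarrow> ('v, 'e, 'g) letter list \<Rightarrow> ('v, 'e, 'g) letter list \<Rightarrow> bool"
  for \<Gamma>
where
  mult: "move \<Gamma> [Elt v g, Elt v g'] [Elt v (g \<otimes>\<^bsub>vgroup \<Gamma> v\<^esub> g')]"
| unit: "move \<Gamma> [Elt v \<one>\<^bsub>vgroup \<Gamma> v\<^esub>] []"
| subdivide: "move \<Gamma> [Seg e s t, Seg e t u] [Seg e s u]"
| cancel: "move \<Gamma> [Seg e s t, Seg (bar \<Gamma> e) (1 - t) (1 - s)] []"
| edge: "h \<in> carrier (egroup \<Gamma> e) \<Longrightarrow>
    move \<Gamma> [Seg e 0 1, Elt (tgt \<Gamma> e) (einj \<Gamma> e h)] [Elt (src \<Gamma> e) (einj \<Gamma> (bar \<Gamma> e) h), Seg e 0 1]"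

inductive homotopic ::
  "('v, 'e, 'g, 'h) graph_of_groups \<Rightarrow> ('v, 'e) point \<Rightarrow> ('v, 'e) point \<Rightarrow>
     ('v, 'e, 'g) letter list \<Rightarrow> ('v, 'e, 'g) letter list \<Rightarrow> bool"
  for \<Gamma> x y
where
  step: "move \<Gamma> a b \<Longrightarrow> is_path \<Gamma> x (c @ a @ d) y \<Longrightarrow> is_path \<Gamma> x (c @ b @ d) y \<Longrightarrow>
    homotopic \<Gamma> x y (c @ a @ d) (c @ b @ d)"
| refl: "is_path \<Gamma> x c y \<Longrightarrow> homotopic \<Gamma> x y c c"
| sym: "homotopic \<Gamma> x y c d \<Longrightarrow> homotopic \<Gamma> x y d c"
| trans: "homotopic \<Gamma> x y c d \<Longrightarrow> homotopic \<Gamma> x y d k \<Longrightarrow> homotopic \<Gamma> x y c k"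

definition hclass ::
  "('v, 'e, 'g, 'h) graph_of_groups \<Rightarrow> ('v, 'e) point \<Rightarrow> ('v, 'e) point \<Rightarrow>
     ('v, 'e, 'g) letter list \<Rightarrow> ('v, 'e, 'g) pclass" where
  "hclass \<Gamma> x y c = {d. homotopic \<Gamma> x y c d}"

definition pclasses ::
  "('v, 'e, 'g, 'h) graph_of_groups \<Rightarrow> ('v, 'e) point \<Rightarrow> ('v, 'e) point \<Rightarrow> ('v, 'e, 'g) pclass set" where
  "pclasses \<Gamma> x y = {hclass \<Gamma> x y c | c. is_path \<Gamma> x c y}"

text \<open>In \<open>hmult \<Gamma> x z A B\<close>, \<open>x\<close> is the initial point of \<open>A\<close> and \<open>z\<close> the terminal point of \<open>B\<close>.\<close>

definition hmult ::
  "('v, 'e, 'g, 'h) graph_of_groups \<Rightarrow> ('v, 'e) point \<Rightarrow> ('v, 'e) point \<Rightarrow>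
     ('v, 'e, 'g) pclass \<Rightarrow> ('v, 'e, 'g) pclass \<Rightarrow> ('v, 'e, 'g) pclass" where
  "hmult \<Gamma> x z A B = {c. \<exists>a\<in>A. \<exists>b\<in>B. homotopic \<Gamma> x z (a @ b) c}"

definition fundamental_group ::
  "('v, 'e, 'g, 'h) graph_of_groups \<Rightarrow> ('v, 'e) point \<Rightarrow> ('v, 'e, 'g) pclass monoid" where
  "fundamental_group \<Gamma> p =
     \<lparr>carrier = pclasses \<Gamma> p p, monoid.mult = hmult \<Gamma> p p, one = hclass \<Gamma> p p []\<rparr>"

definition vclass ::
  "('v, 'e, 'g, 'h) graph_of_groups \<Rightarrow> 'v \<Rightarrow> 'g \<Rightarrow> ('v, 'e, 'g) pclass" where
  "vclass \<Gamma> v g = hclass \<Gamma> (Vertex v) (Vertex v) [Elt v g]"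

definition eclass ::
  "('v, 'e, 'g, 'h) graph_of_groups \<Rightarrow> 'e \<Rightarrow> ('v, 'e, 'g) pclass" where
  "eclass \<Gamma> e = hclass \<Gamma> (Vertex (src \<Gamma> e)) (Vertex (tgt \<Gamma> e)) [Seg e 0 1]"

section \<open>Morphisms and covering maps\<close>

record ('v, 'e, 'g, 'h, 'w, 'f, 'k, 'l) gmorphism =
  vmap :: "'v \<Rightarrow> 'w"
  emap :: "'e \<Rightarrow> 'f"
  vhom :: "'v \<Rightarrow> 'g \<Rightarrow> 'k"
  ehom :: "'e \<Rightarrow> 'h \<Rightarrow> 'l"
  twist :: "'e \<Rightarrow> 'k"

text \<open>Only morphisms that collapse no edge are considered: covering maps and isomorphisms are
  of this kind. \<open>twist f e\<close> is the element written \<open>\<delta>\<close> with index \<open>e\<close>.\<close>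

definition morphism ::
  "('v, 'e, 'g, 'h) graph_of_groups \<Rightarrow> ('w, 'f, 'k, 'l) graph_of_groups \<Rightarrow>
     ('v, 'e, 'g, 'h, 'w, 'f, 'k, 'l) gmorphism \<Rightarrow> bool" where
  "morphism \<Lambda> \<Gamma> f \<longleftrightarrow>
     (\<forall>v\<in>verts \<Lambda>. vmap f v \<in> verts \<Gamma> \<and> vhom f v \<in> hom (vgroup \<Lambda> v) (vgroup \<Gamma> (vmap f v))) \<and>
     (\<forall>e\<in>edges \<Lambda>.
        emap f e \<in> edges \<Gamma> \<and>
        emap f (bar \<Lambda> e) = bar \<Gamma> (emap f e) \<and>
        tgt \<Gamma> (emap f e) = vmap f (tgt \<Lambda> e) \<and>
        ehom f e \<in> hom (egroup \<Lambda> e) (egroup \<Gamma> (emap f e)) \<and>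
        twist f e \<in> carrier (vgroup \<Gamma> (tgt \<Gamma> (emap f e))) \<and>
        (\<forall>h\<in>carrier (egroup \<Lambda> e).
           ehom f (bar \<Lambda> e) h = ehom f e h \<and>
           vhom f (tgt \<Lambda> e) (einj \<Lambda> e h) =
             twist f e \<otimes>\<^bsub>vgroup \<Gamma> (tgt \<Gamma> (emap f e))\<^esub> einj \<Gamma> (emap f e) (ehom f e h)
               \<otimes>\<^bsub>vgroup \<Gamma> (tgt \<Gamma> (emap f e))\<^esub> inv\<^bsub>vgroup \<Gamma> (tgt \<Gamma> (emap f e))\<^esub> twist f e))"

definition gcompose ::
  "('v, 'e, 'g, 'h) graph_of_groups \<Rightarrow> ('x, 'y, 'm, 'n) graph_of_groups \<Rightarrow>
     ('w, 'f, 'k, 'l, 'x, 'y, 'm, 'n) gmorphism \<Rightarrow>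
     ('v, 'e, 'g, 'h, 'w, 'f, 'k, 'l) gmorphism \<Rightarrow>
     ('v, 'e, 'g, 'h, 'x, 'y, 'm, 'n) gmorphism" where
  "gcompose \<Lambda> \<Gamma> g f =
     \<lparr>vmap = vmap g \<circ> vmap f,
      emap = emap g \<circ> emap f,
      vhom = (\<lambda>v. vhom g (vmap f v) \<circ> vhom f v),
      ehom = (\<lambda>e. ehom g (emap f e) \<circ> ehom f e),
      twist = (\<lambda>e. vhom g (vmap f (tgt \<Lambda> e)) (twist f e)
        \<otimes>\<^bsub>vgroup \<Gamma> (vmap g (vmap f (tgt \<Lambda> e)))\<^esub> twist g (emap f e))\<rparr>"

text \<open>The action on paths sends \<open>e\<close> to \<open>\<delta>\<close> of the reverse edge, followed by the image edge,
  followed by the inverse of \<open>\<delta>\<close> of \<open>e\<close>; a proper segment only picks up the factors at those of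
  its ends which are vertices.\<close>

fun map_letter ::
  "('v, 'e, 'g, 'h) graph_of_groups \<Rightarrow> ('w, 'f, 'k, 'l) graph_of_groups \<Rightarrow>
     ('v, 'e, 'g, 'h, 'w, 'f, 'k, 'l) gmorphism \<Rightarrow> ('v, 'e, 'g) letter \<Rightarrow> ('w, 'f, 'k) letter list" where
  "map_letter \<Lambda> \<Gamma> f (Elt v g) = [Elt (vmap f v) (vhom f v g)]"
| "map_letter \<Lambda> \<Gamma> f (Seg e s t) =
     (if s = 0 then [Elt (src \<Gamma> (emap f e)) (twist f (bar \<Lambda> e))] else [])
     @ [Seg (emap f e) s t]
     @ (if t = 1 then [Elt (tgt \<Gamma> (emap f e)) (inv\<^bsub>vgroup \<Gamma> (tgt \<Gamma> (emap f e))\<^esub> twist f e)] else [])"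

definition map_path ::
  "('v, 'e, 'g, 'h) graph_of_groups \<Rightarrow> ('w, 'f, 'k, 'l) graph_of_groups \<Rightarrow>
     ('v, 'e, 'g, 'h, 'w, 'f, 'k, 'l) gmorphism \<Rightarrow> ('v, 'e, 'g) letter list \<Rightarrow> ('w, 'f, 'k) letter list" where
  "map_path \<Lambda> \<Gamma> f c = concat (map (map_letter \<Lambda> \<Gamma> f) c)"

definition induced_hom ::
  "('v, 'e, 'g, 'h) graph_of_groups \<Rightarrow> ('v, 'e) point \<Rightarrow> ('w, 'f, 'k, 'l) graph_of_groups \<Rightarrow>
     ('w, 'f) point \<Rightarrow> ('v, 'e, 'g, 'h, 'w, 'f, 'k, 'l) gmorphism \<Rightarrow>
     ('v, 'e, 'g) pclass \<Rightarrow> ('w, 'f, 'k) pclass" where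
  "induced_hom \<Lambda> q \<Gamma> p f A = {d. \<exists>c\<in>A. homotopic \<Gamma> p p (map_path \<Lambda> \<Gamma> f c) d}"

definition star :: "('v, 'e, 'g, 'h) graph_of_groups \<Rightarrow> 'v \<Rightarrow> ('g set \<times> 'e) set" where
  "star \<Gamma> v = {(C, e). e \<in> edges \<Gamma> \<and> tgt \<Gamma> e = v \<and>
     C \<in> lcosets\<^bsub>vgroup \<Gamma> v\<^esub> (einj \<Gamma> e ` carrier (egroup \<Gamma> e))}"

text \<open>All cosets in the union below coincide.\<close>

definition star_map ::
  "('w, 'f, 'k, 'l) graph_of_groups \<Rightarrow> ('v, 'e, 'g, 'h, 'w, 'f, 'k, 'l) gmorphism \<Rightarrow> 'v \<Rightarrow>
     'g set \<times> 'e \<Rightarrow> 'k set \<times> 'f" where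
  "star_map \<Gamma> f v = (\<lambda>(C, e).
     (\<Union>g\<in>C. (vhom f v g \<otimes>\<^bsub>vgroup \<Gamma> (vmap f v)\<^esub> twist f e) <#\<^bsub>vgroup \<Gamma> (vmap f v)\<^esub>
               (einj \<Gamma> (emap f e) ` carrier (egroup \<Gamma> (emap f e))),
      emap f e))"

definition covering ::
  "('v, 'e, 'g, 'h) graph_of_groups \<Rightarrow> ('w, 'f, 'k, 'l) graph_of_groups \<Rightarrow>
     ('v, 'e, 'g, 'h, 'w, 'f, 'k, 'l) gmorphism \<Rightarrow> bool" where
  "covering \<Lambda> \<Gamma> f \<longleftrightarrow>
     morphism \<Lambda> \<Gamma> f \<and>
     vmap f ` verts \<Lambda> = verts \<Gamma> \<and> emap f ` edges \<Lambda> = edges \<Gamma> \<and>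
     (\<forall>v\<in>verts \<Lambda>. vhom f v \<in> mon (vgroup \<Lambda> v) (vgroup \<Gamma> (vmap f v)) \<and>
        bij_betw (star_map \<Gamma> f v) (star \<Lambda> v) (star \<Gamma> (vmap f v))) \<and>
     (\<forall>e\<in>edges \<Lambda>. ehom f e \<in> mon (egroup \<Lambda> e) (egroup \<Gamma> (emap f e)))"

definition isomorphism ::
  "('v, 'e, 'g, 'h) graph_of_groups \<Rightarrow> ('w, 'f, 'k, 'l) graph_of_groups \<Rightarrow>
     ('v, 'e, 'g, 'h, 'w, 'f, 'k, 'l) gmorphism \<Rightarrow> bool" where
  "isomorphism \<Lambda> \<Gamma> f \<longleftrightarrow>
     morphism \<Lambda> \<Gamma> f \<and>
     bij_betw (vmap f) (verts \<Lambda>) (verts \<Gamma>) \<and> bij_betw (emap f) (edges \<Lambda>) (edges \<Gamma>) \<and>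
     (\<forall>v\<in>verts \<Lambda>. vhom f v \<in> iso (vgroup \<Lambda> v) (vgroup \<Gamma> (vmap f v))) \<and>
     (\<forall>e\<in>edges \<Lambda>. ehom f e \<in> iso (egroup \<Lambda> e) (egroup \<Gamma> (emap f e)))"

definition pointed_covering ::
  "('v, 'e, 'g, 'h) graph_of_groups \<Rightarrow> ('v, 'e) point \<Rightarrow> ('w, 'f, 'k, 'l) graph_of_groups \<Rightarrow>
     ('w, 'f) point \<Rightarrow> ('v, 'e, 'g, 'h, 'w, 'f, 'k, 'l) gmorphism \<Rightarrow> bool" where
  "pointed_covering \<Lambda> q \<Gamma> p f \<longleftrightarrow>
     graph_of_groups \<Lambda> \<and> graph_of_groups \<Gamma> \<and> q \<in> points \<Lambda> \<and>
     covering \<Lambda> \<Gamma> f \<and> map_point (vmap f) (emap f) q = p"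

text \<open>Equality of pointed morphisms is understood up to changing the representatives of the local
  data, i.e. conjugating by elements \<open>a v\<close> of the vertex groups and \<open>b e\<close> of the edge groups of
  the target that are trivial at the base point. Such a change does not affect the graph map
  or the induced map on path classes starting and ending at the base point. Literal equality would
  be too fine: already the natural projection from the Bass--Serre tree is only defined up to this
  choice, and over one edge with trivial edge group and vertex groups \<open>1\<close>, \<open>G\<close>, replacing all \<open>\<delta>\<close>
  at the centre of the universal covering tree by \<open>k \<delta>\<close> with \<open>k \<noteq> 1\<close> gives, for the same base
  leaf, a covering with the same subgroup but not related to the first by an isomorphism that
  commutes literally.\<close>

definition same_pointed ::
  "('v, 'e, 'g, 'h) graph_of_groups \<Rightarrow> ('v, 'e) point \<Rightarrow> ('w, 'f, 'k, 'l) graph_of_groups \<Rightarrow>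
     ('v, 'e, 'g, 'h, 'w, 'f, 'k, 'l) gmorphism \<Rightarrow>
     ('v, 'e, 'g, 'h, 'w, 'f, 'k, 'l) gmorphism \<Rightarrow> bool" where
  "same_pointed \<Lambda> q \<Gamma> f f' \<longleftrightarrow>
     (\<exists>a b.
        (\<forall>v\<in>verts \<Lambda>.
           vmap f' v = vmap f v \<and>
           a v \<in> carrier (vgroup \<Gamma> (vmap f v)) \<and>
           (q = Vertex v \<longrightarrow> a v = \<one>\<^bsub>vgroup \<Gamma> (vmap f v)\<^esub>) \<and>
           (\<forall>g\<in>carrier (vgroup \<Lambda> v).
              vhom f' v g = a v \<otimes>\<^bsub>vgroup \<Gamma> (vmap f v)\<^esub> vhom f v g
                \<otimes>\<^bsub>vgroup \<Gamma> (vmap f v)\<^esub> inv\<^bsub>vgroup \<Gamma> (vmap f v)\<^esub> a v)) \<and>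
        (\<forall>e\<in>edges \<Lambda>.
           emap f' e = emap f e \<and>
           b e \<in> carrier (egroup \<Gamma> (emap f e)) \<and>
           b (bar \<Lambda> e) = b e \<and>
           (\<forall>S t. q = Interior S \<and> (e, t) \<in> S \<longrightarrow> b e = \<one>\<^bsub>egroup \<Gamma> (emap f e)\<^esub>) \<and>
           (\<forall>h\<in>carrier (egroup \<Lambda> e).
              ehom f' e h = b e \<otimes>\<^bsub>egroup \<Gamma> (emap f e)\<^esub> ehom f e h
                \<otimes>\<^bsub>egroup \<Gamma> (emap f e)\<^esub> inv\<^bsub>egroup \<Gamma> (emap f e)\<^esub> b e) \<and>
           twist f' e =
             a (tgt \<Lambda> e) \<otimes>\<^bsub>vgroup \<Gamma> (tgt \<Gamma> (emap f e))\<^esub> twist f e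
               \<otimes>\<^bsub>vgroup \<Gamma> (tgt \<Gamma> (emap f e))\<^esub>
                 einj \<Gamma> (emap f e) (inv\<^bsub>egroup \<Gamma> (emap f e)\<^esub> b e)))"

definition covering_iso ::
  "('w, 'f, 'k, 'l) graph_of_groups \<Rightarrow>
     ('v, 'e, 'g, 'h) graph_of_groups \<Rightarrow> ('v, 'e) point \<Rightarrow>
     ('v, 'e, 'g, 'h, 'w, 'f, 'k, 'l) gmorphism \<Rightarrow>
     ('x, 'y, 'm, 'n) graph_of_groups \<Rightarrow> ('x, 'y) point \<Rightarrow>
     ('x, 'y, 'm, 'n, 'w, 'f, 'k, 'l) gmorphism \<Rightarrow> bool" where
  "covering_iso \<Gamma> \<Lambda>1 q1 \<rho>1 \<Lambda>2 q2 \<rho>2 \<longleftrightarrow>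
     (\<exists>f. isomorphism \<Lambda>1 \<Lambda>2 f \<and> map_point (vmap f) (emap f) q1 = q2 \<and>
          same_pointed \<Lambda>1 q1 \<Gamma> (gcompose \<Lambda>1 \<Gamma> \<rho>2 f) \<rho>1)"

definition factors_through ::
  "('w, 'f, 'k, 'l) graph_of_groups \<Rightarrow>
     ('v, 'e, 'g, 'h) graph_of_groups \<Rightarrow> ('v, 'e) point \<Rightarrow>
     ('v, 'e, 'g, 'h, 'w, 'f, 'k, 'l) gmorphism \<Rightarrow>
     ('x, 'y, 'm, 'n) graph_of_groups \<Rightarrow> ('x, 'y) point \<Rightarrow>
     ('x, 'y, 'm, 'n, 'w, 'f, 'k, 'l) gmorphism \<Rightarrow> bool" where
  "factors_through \<Gamma> \<Lambda>1 q1 \<rho>1 \<Lambda>2 q2 \<rho>2 \<longleftrightarrow>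
     (\<exists>f. pointed_covering \<Lambda>1 q1 \<Lambda>2 q2 f \<and>
          same_pointed \<Lambda>1 q1 \<Gamma> (gcompose \<Lambda>1 \<Gamma> \<rho>2 f) \<rho>1)"

definition covering_subgroup ::
  "('v, 'e, 'g, 'h) graph_of_groups \<Rightarrow> ('v, 'e) point \<Rightarrow> ('w, 'f, 'k, 'l) graph_of_groups \<Rightarrow>
     ('w, 'f) point \<Rightarrow> ('v, 'e, 'g, 'h, 'w, 'f, 'k, 'l) gmorphism \<Rightarrow> ('w, 'f, 'k) pclass set" where
  "covering_subgroup \<Lambda> q \<Gamma> p \<rho> = induced_hom \<Lambda> q \<Gamma> p \<rho> ` carrier (fundamental_group \<Lambda> q)"

section \<open>The Bass--Serre tree\<close>

text \<open>A vertex over \<open>v\<close> is a class of paths from \<open>p\<close> to \<open>v\<close> modulo right multiplication by the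
  vertex group. An edge over \<open>e\<close> is a class of paths from \<open>p\<close> to \<open>src e\<close> modulo right
  multiplication by the image of the edge group; following such a path by \<open>e\<close> gives the
  terminal vertex.\<close>

type_synonym ('v, 'e, 'g) bs_v = "'v \<times> ('v, 'e, 'g) pclass set"
type_synonym ('v, 'e, 'g) bs_e = "'e \<times> ('v, 'e, 'g) pclass set"

definition bs_vertex ::
  "('v, 'e, 'g, 'h) graph_of_groups \<Rightarrow> ('v, 'e) point \<Rightarrow> 'v \<Rightarrow> ('v, 'e, 'g) pclass \<Rightarrow>
     ('v, 'e, 'g) bs_v" where
  "bs_vertex \<Gamma> p v A =
     (v, (\<lambda>g. hmult \<Gamma> p (Vertex v) A (vclass \<Gamma> v g)) ` carrier (vgroup \<Gamma> v))"

definition bs_edge ::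
  "('v, 'e, 'g, 'h) graph_of_groups \<Rightarrow> ('v, 'e) point \<Rightarrow> 'e \<Rightarrow> ('v, 'e, 'g) pclass \<Rightarrow>
     ('v, 'e, 'g) bs_e" where
  "bs_edge \<Gamma> p e A =
     (e, (\<lambda>h. hmult \<Gamma> p (Vertex (src \<Gamma> e)) A (vclass \<Gamma> (src \<Gamma> e) (einj \<Gamma> (bar \<Gamma> e) h)))
           ` carrier (egroup \<Gamma> e))"

definition extend ::
  "('v, 'e, 'g, 'h) graph_of_groups \<Rightarrow> ('v, 'e) point \<Rightarrow> 'e \<Rightarrow>
     ('v, 'e, 'g) pclass \<Rightarrow> ('v, 'e, 'g) pclass" where
  "extend \<Gamma> p e A = hmult \<Gamma> p (Vertex (tgt \<Gamma> e)) A (eclass \<Gamma> e)"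

definition bs_tree ::
  "('v, 'e, 'g, 'h) graph_of_groups \<Rightarrow> ('v, 'e) point \<Rightarrow>
     (('v, 'e, 'g) bs_v, ('v, 'e, 'g) bs_e, unit, unit) graph_of_groups" where
  "bs_tree \<Gamma> p =
     \<lparr>verts = {bs_vertex \<Gamma> p v A | v A. v \<in> verts \<Gamma> \<and> A \<in> pclasses \<Gamma> p (Vertex v)},
      edges = {bs_edge \<Gamma> p e A | e A. e \<in> edges \<Gamma> \<and> A \<in> pclasses \<Gamma> p (Vertex (src \<Gamma> e))},
      bar = (\<lambda>(e, X). (bar \<Gamma> e, extend \<Gamma> p e ` X)),
      tgt = (\<lambda>(e, X). (tgt \<Gamma> e, \<Union>A\<in>X. snd (bs_vertex \<Gamma> p (tgt \<Gamma> e) (extend \<Gamma> p e A)))),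
      vgroup = (\<lambda>_. singleton_group ()),
      egroup = (\<lambda>_. singleton_group ()),
      einj = (\<lambda>_ _. ())\<rparr>"

text \<open>\<open>initial_seg \<Gamma> p e t\<close> is the class of the segment from the point at parameter \<open>t\<close> of \<open>e\<close> back
  to \<open>src e\<close>. The distinguished lift of that point is at parameter \<open>t\<close> of the edge of the
  tree given by this class.\<close>

definition initial_seg ::
  "('v, 'e, 'g, 'h) graph_of_groups \<Rightarrow> ('v, 'e) point \<Rightarrow> 'e \<Rightarrow> real \<Rightarrow> ('v, 'e, 'g) pclass" where
  "initial_seg \<Gamma> p e t = hclass \<Gamma> p (Vertex (src \<Gamma> e)) [Seg (bar \<Gamma> e) (1 - t) 1]"

definition bs_base ::
  "('v, 'e, 'g, 'h) graph_of_groups \<Rightarrow> ('v, 'e) point \<Rightarrow>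
     (('v, 'e, 'g) bs_v, ('v, 'e, 'g) bs_e) point" where
  "bs_base \<Gamma> p =
     (case p of
        Vertex v \<Rightarrow> Vertex (bs_vertex \<Gamma> p v (hclass \<Gamma> p p []))
      | Interior S \<Rightarrow> Interior ((\<lambda>(e, t). (bs_edge \<Gamma> p e (initial_seg \<Gamma> p e t), t)) ` S))"

definition bs_vact ::
  "('v, 'e, 'g, 'h) graph_of_groups \<Rightarrow> ('v, 'e) point \<Rightarrow> ('v, 'e, 'g) pclass \<Rightarrow>
     ('v, 'e, 'g) bs_v \<Rightarrow> ('v, 'e, 'g) bs_v" where
  "bs_vact \<Gamma> p h x = (fst x, hmult \<Gamma> p (Vertex (fst x)) h ` snd x)"

definition bs_eact ::
  "('v, 'e, 'g, 'h) graph_of_groups \<Rightarrow> ('v, 'e) point \<Rightarrow> ('v, 'e, 'g) pclass \<Rightarrow>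
     ('v, 'e, 'g) bs_e \<Rightarrow> ('v, 'e, 'g) bs_e" where
  "bs_eact \<Gamma> p h y = (fst y, hmult \<Gamma> p (Vertex (src \<Gamma> (fst y))) h ` snd y)"

text \<open>A choice of representing path classes for the vertices and edges of the tree, compatible with
  reversal and with the base point, and the natural projection in terms of this choice.\<close>

definition path_section ::
  "('v, 'e, 'g, 'h) graph_of_groups \<Rightarrow> ('v, 'e) point \<Rightarrow>
     (('v, 'e, 'g) bs_v \<Rightarrow> ('v, 'e, 'g) pclass) \<Rightarrow>
     (('v, 'e, 'g) bs_e \<Rightarrow> ('v, 'e, 'g) pclass) \<Rightarrow> bool" where
  "path_section \<Gamma> p vs es \<longleftrightarrow>
     (\<forall>x\<in>verts (bs_tree \<Gamma> p). vs x \<in> snd x) \<and>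
     (\<forall>y\<in>edges (bs_tree \<Gamma> p).
        es y \<in> snd y \<and> es (bar (bs_tree \<Gamma> p) y) = extend \<Gamma> p (fst y) (es y)) \<and>
     (\<forall>x. bs_base \<Gamma> p = Vertex x \<longrightarrow> vs x = hclass \<Gamma> p p []) \<and>
     (\<forall>S y t. bs_base \<Gamma> p = Interior S \<and> (y, t) \<in> S \<longrightarrow> es y = initial_seg \<Gamma> p (fst y) t)"

definition bs_projection ::
  "('v, 'e, 'g, 'h) graph_of_groups \<Rightarrow> ('v, 'e) point \<Rightarrow>
     (('v, 'e, 'g) bs_v \<Rightarrow> ('v, 'e, 'g) pclass) \<Rightarrow>
     (('v, 'e, 'g) bs_e \<Rightarrow> ('v, 'e, 'g) pclass) \<Rightarrow>
     (('v, 'e, 'g) bs_v, ('v, 'e, 'g) bs_e, unit, unit, 'v, 'e, 'g, 'h) gmorphism" where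
  "bs_projection \<Gamma> p vs es =
     \<lparr>vmap = fst,
      emap = fst,
      vhom = (\<lambda>x _. \<one>\<^bsub>vgroup \<Gamma> (fst x)\<^esub>),
      ehom = (\<lambda>y _. \<one>\<^bsub>egroup \<Gamma> (fst y)\<^esub>),
      twist = (\<lambda>y. THE g. g \<in> carrier (vgroup \<Gamma> (tgt \<Gamma> (fst y))) \<and>
        hmult \<Gamma> p (Vertex (tgt \<Gamma> (fst y))) (vs (tgt (bs_tree \<Gamma> p) y)) (vclass \<Gamma> (tgt \<Gamma> (fst y)) g)
          = es (bar (bs_tree \<Gamma> p) y))\<rparr>"

section \<open>The quotient of the tree by a subgroup\<close>

definition vorbit ::
  "('v, 'e, 'g, 'h) graph_of_groups \<Rightarrow> ('v, 'e) point \<Rightarrow> ('v, 'e, 'g) pclass set \<Rightarrow>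
     ('v, 'e, 'g) bs_v \<Rightarrow> ('v, 'e, 'g) bs_v set" where
  "vorbit \<Gamma> p H x = (\<lambda>h. bs_vact \<Gamma> p h x) ` H"

definition eorbit ::
  "('v, 'e, 'g, 'h) graph_of_groups \<Rightarrow> ('v, 'e) point \<Rightarrow> ('v, 'e, 'g) pclass set \<Rightarrow>
     ('v, 'e, 'g) bs_e \<Rightarrow> ('v, 'e, 'g) bs_e set" where
  "eorbit \<Gamma> p H y = (\<lambda>h. bs_eact \<Gamma> p h y) ` H"

text \<open>The structure of a graph of groups on the quotient (and the morphisms from and to it)
  depends on choices: representatives \<open>vlift W\<close>, \<open>elift E\<close> of the orbits, elements
  \<open>shift E\<close> of \<open>H\<close> taking the representative of the terminal vertex of \<open>E\<close> to the terminal vertex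
  of the representative of \<open>E\<close>, and elements \<open>vtrans x\<close>, \<open>etrans y\<close> of \<open>H\<close> taking the representative
  of the orbit of \<open>x\<close>, \<open>y\<close> to \<open>x\<close>, \<open>y\<close>.\<close>

record ('v, 'e, 'g) lifting =
  vlift :: "('v, 'e, 'g) bs_v set \<Rightarrow> ('v, 'e, 'g) bs_v"
  elift :: "('v, 'e, 'g) bs_e set \<Rightarrow> ('v, 'e, 'g) bs_e"
  shift :: "('v, 'e, 'g) bs_e set \<Rightarrow> ('v, 'e, 'g) pclass"
  vtrans :: "('v, 'e, 'g) bs_v \<Rightarrow> ('v, 'e, 'g) pclass"
  etrans :: "('v, 'e, 'g) bs_e \<Rightarrow> ('v, 'e, 'g) pclass"

definition is_lifting ::
  "('v, 'e, 'g, 'h) graph_of_groups \<Rightarrow> ('v, 'e) point \<Rightarrow> ('v, 'e, 'g) pclass set \<Rightarrow>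
     ('v, 'e, 'g) lifting \<Rightarrow> bool" where
  "is_lifting \<Gamma> p H D \<longleftrightarrow>
     (\<forall>x\<in>verts (bs_tree \<Gamma> p).
        vlift D (vorbit \<Gamma> p H x) \<in> vorbit \<Gamma> p H x \<and>
        vtrans D x \<in> H \<and> bs_vact \<Gamma> p (vtrans D x) (vlift D (vorbit \<Gamma> p H x)) = x) \<and>
     (\<forall>y\<in>edges (bs_tree \<Gamma> p).
        elift D (eorbit \<Gamma> p H y) \<in> eorbit \<Gamma> p H y \<and>
        elift D (eorbit \<Gamma> p H (bar (bs_tree \<Gamma> p) y)) = bar (bs_tree \<Gamma> p) (elift D (eorbit \<Gamma> p H y)) \<and>
        shift D (eorbit \<Gamma> p H y) \<in> H \<and>
        bs_vact \<Gamma> p (shift D (eorbit \<Gamma> p H y)) (vlift D (vorbit \<Gamma> p H (tgt (bs_tree \<Gamma> p) y)))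
          = tgt (bs_tree \<Gamma> p) (elift D (eorbit \<Gamma> p H y)) \<and>
        etrans D y \<in> H \<and> etrans D (bar (bs_tree \<Gamma> p) y) = etrans D y \<and>
        bs_eact \<Gamma> p (etrans D y) (elift D (eorbit \<Gamma> p H y)) = y) \<and>
     (\<forall>x. bs_base \<Gamma> p = Vertex x \<longrightarrow>
        vlift D (vorbit \<Gamma> p H x) = x \<and> vtrans D x = \<one>\<^bsub>fundamental_group \<Gamma> p\<^esub>) \<and>
     (\<forall>S y t. bs_base \<Gamma> p = Interior S \<and> (y, t) \<in> S \<longrightarrow>
        elift D (eorbit \<Gamma> p H y) = y \<and> etrans D y = \<one>\<^bsub>fundamental_group \<Gamma> p\<^esub>)"

definition quotient_gog ::
  "('v, 'e, 'g, 'h) graph_of_groups \<Rightarrow> ('v, 'e) point \<Rightarrow> ('v, 'e, 'g) pclass set \<Rightarrow>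
     ('v, 'e, 'g) lifting \<Rightarrow>
     (('v, 'e, 'g) bs_v set, ('v, 'e, 'g) bs_e set,
      ('v, 'e, 'g) pclass, ('v, 'e, 'g) pclass) graph_of_groups" where
  "quotient_gog \<Gamma> p H D =
     \<lparr>verts = vorbit \<Gamma> p H ` verts (bs_tree \<Gamma> p),
      edges = eorbit \<Gamma> p H ` edges (bs_tree \<Gamma> p),
      bar = (\<lambda>E. bar (bs_tree \<Gamma> p) ` E),
      tgt = (\<lambda>E. tgt (bs_tree \<Gamma> p) ` E),
      vgroup = (\<lambda>W. (fundamental_group \<Gamma> p)
        \<lparr>carrier := {h \<in> H. bs_vact \<Gamma> p h (vlift D W) = vlift D W}\<rparr>),
      egroup = (\<lambda>E. (fundamental_group \<Gamma> p)
        \<lparr>carrier := {h \<in> H. bs_eact \<Gamma> p h (elift D E) = elift D E}\<rparr>),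
      einj = (\<lambda>E h. inv\<^bsub>fundamental_group \<Gamma> p\<^esub> shift D E
        \<otimes>\<^bsub>fundamental_group \<Gamma> p\<^esub> h \<otimes>\<^bsub>fundamental_group \<Gamma> p\<^esub> shift D E)\<rparr>"

definition orbit_projection ::
  "('v, 'e, 'g, 'h) graph_of_groups \<Rightarrow> ('v, 'e) point \<Rightarrow> ('v, 'e, 'g) pclass set \<Rightarrow>
     ('v, 'e, 'g) lifting \<Rightarrow>
     (('v, 'e, 'g) bs_v, ('v, 'e, 'g) bs_e, unit, unit,
      ('v, 'e, 'g) bs_v set, ('v, 'e, 'g) bs_e set,
      ('v, 'e, 'g) pclass, ('v, 'e, 'g) pclass) gmorphism" where
  "orbit_projection \<Gamma> p H D =
     \<lparr>vmap = vorbit \<Gamma> p H,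
      emap = eorbit \<Gamma> p H,
      vhom = (\<lambda>_ _. \<one>\<^bsub>fundamental_group \<Gamma> p\<^esub>),
      ehom = (\<lambda>_ _. \<one>\<^bsub>fundamental_group \<Gamma> p\<^esub>),
      twist = (\<lambda>y. inv\<^bsub>fundamental_group \<Gamma> p\<^esub> vtrans D (tgt (bs_tree \<Gamma> p) y)
        \<otimes>\<^bsub>fundamental_group \<Gamma> p\<^esub> etrans D y
        \<otimes>\<^bsub>fundamental_group \<Gamma> p\<^esub> shift D (eorbit \<Gamma> p H y))\<rparr>"

definition quotient_base ::
  "('v, 'e, 'g, 'h) graph_of_groups \<Rightarrow> ('v, 'e) point \<Rightarrow> ('v, 'e, 'g) pclass set \<Rightarrow>
     ('v, 'e, 'g) lifting \<Rightarrow> (('v, 'e, 'g) bs_v set, ('v, 'e, 'g) bs_e set) point" where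
  "quotient_base \<Gamma> p H D =
     map_point (vmap (orbit_projection \<Gamma> p H D)) (emap (orbit_projection \<Gamma> p H D)) (bs_base \<Gamma> p)"

text \<open>The covering map from the quotient to \<open>\<Gamma>\<close>. If \<open>c\<close> is the path class chosen for the
  representative of \<open>W\<close>, then \<open>h\<close> in the stabiliser of that representative is sent to the unique
  element \<open>g\<close> of the vertex group with \<open>h c = c g\<close>, and similarly for edges; so on path classes
  based at \<open>p\<close> the inclusion of \<open>H\<close> is induced. The twist at \<open>E\<close> compares the path class chosen for
  the reverse of the representative of \<open>E\<close> with the translate by \<open>shift E\<close> of the one chosen for
  its terminal vertex.\<close>

definition quotient_covering ::
  "('v, 'e, 'g, 'h) graph_of_groups \<Rightarrow> ('v, 'e) point \<Rightarrow>
     (('v, 'e, 'g) bs_v \<Rightarrow> ('v, 'e, 'g) pclass) \<Rightarrow>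
     (('v, 'e, 'g) bs_e \<Rightarrow> ('v, 'e, 'g) pclass) \<Rightarrow>
     ('v, 'e, 'g) lifting \<Rightarrow>
     (('v, 'e, 'g) bs_v set, ('v, 'e, 'g) bs_e set, ('v, 'e, 'g) pclass, ('v, 'e, 'g) pclass,
      'v, 'e, 'g, 'h) gmorphism" where
  "quotient_covering \<Gamma> p vs es D =
     \<lparr>vmap = (\<lambda>W. fst (vlift D W)),
      emap = (\<lambda>E. fst (elift D E)),
      vhom = (\<lambda>W h. let v = fst (vlift D W); c = vs (vlift D W) in
        THE g. g \<in> carrier (vgroup \<Gamma> v) \<and>
          hmult \<Gamma> p (Vertex v) h c = hmult \<Gamma> p (Vertex v) c (vclass \<Gamma> v g)),
      ehom = (\<lambda>E h. let e = fst (elift D E); u = src \<Gamma> e; c = es (elift D E) in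
        THE k. k \<in> carrier (egroup \<Gamma> e) \<and>
          hmult \<Gamma> p (Vertex u) h c = hmult \<Gamma> p (Vertex u) c (vclass \<Gamma> u (einj \<Gamma> (bar \<Gamma> e) k))),
      twist = (\<lambda>E. let v = tgt \<Gamma> (fst (elift D E)); W = tgt (bs_tree \<Gamma> p) ` E in
        THE g. g \<in> carrier (vgroup \<Gamma> v) \<and>
          hmult \<Gamma> p (Vertex v) (shift D E) (hmult \<Gamma> p (Vertex v) (vs (vlift D W)) (vclass \<Gamma> v g))
            = es (bar (bs_tree \<Gamma> p) (elift D E)))\<rparr>"

end

theory Submission
  imports Defs
begin

text \<open>
  Let \<open>P v\<close> be the set of homotopy classes of paths from \<open>p\<close> to \<open>v\<close>. The fundamental group acts
  on it from the left, simply transitively, and the vertex group at \<open>v\<close> from the right, freely;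
  an edge \<open>e\<close> gives a bijection from \<open>P (src e)\<close> to \<open>P (tgt e)\<close> that is equivariant for the
  edge group. A covering map lifts these classes uniquely up to its local groups, so a pointed
  covering with subgroup \<open>H\<close> is encoded by a chart: representatives of the double cosets of \<open>H\<close>
  and the vertex (edge) groups in \<open>P\<close>, whose stabilisers are the local groups of the covering.
  Conversely, a morphism with such a chart is a covering with subgroup \<open>H\<close>. If
  \<open>H1 \<subseteq> H2\<close>, each double coset of \<open>H1\<close> lies in one of \<open>H2\<close>; comparing
  representatives gives a covering between the two sources, which is an isomorphism if
  \<open>H1 = H2\<close>. The projection from the tree has a chart for the trivial subgroup and the covering
  from the quotient one for \<open>H\<close>, and the projection from the tree to the quotient is a comparison
  of the two.
\<close>

text \<open>Two facts carry the weight, and both are usually read off from normal forms: the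
  freeness of the right action of a vertex group, and the uniqueness of lifts. Here both come from
  one universal property. The sets \<open>P v\<close>, with right multiplication and extension along
  edges, are generated by a single element and map to every other family of sets whose operations
  obey the same laws. An identity between path classes must then hold in every such family, and a
  well-chosen family rules out the unwanted ones. Three obstacles shape the rest. The base point may
  lie inside an edge, so the generating element may be a proper segment, and its two descriptions
  have to be kept consistent. Every choice made on edges must respect reversal, which forces choices
  along an orientation. Finally, representatives agree only up to \<open>H\<close> on the left and
  local groups on the right; equations are therefore stated between \<open>H\<close>-orbits, which
  leaves only the right-hand factors to be followed.\<close>

hide_const (open) lifting.extend
hide_fact (open) lifting.extend_def

section \<open>Path classes\<close>

lemma homotopic_paths:
  "homotopic \<Gamma> x y c d \<Longrightarrow> is_path \<Gamma> x c y \<and> is_path \<Gamma> x d y"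
  by (induction rule: homotopic.induct) auto

lemma pclassesE:
  assumes "A \<in> pclasses \<Gamma> x y"
  obtains c where "is_path \<Gamma> x c y" "A = hclass \<Gamma> x y c"
  using assms by (auto simp: pclasses_def)

lemma hclass_in [intro]: "is_path \<Gamma> x c y \<Longrightarrow> hclass \<Gamma> x y c \<in> pclasses \<Gamma> x y"
  by (auto simp: pclasses_def)

lemma hclass_eq_iff:
  assumes "is_path \<Gamma> x c y"
  shows "hclass \<Gamma> x y c = hclass \<Gamma> x y d \<longleftrightarrow> homotopic \<Gamma> x y c d"
proof
  assume "hclass \<Gamma> x y c = hclass \<Gamma> x y d"
  then have "homotopic \<Gamma> x y d c"
    using homotopic.refl[OF assms] by (auto simp: hclass_def)
  then show "homotopic \<Gamma> x y c d" by (rule homotopic.sym)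
next
  assume "homotopic \<Gamma> x y c d"
  then show "hclass \<Gamma> x y c = hclass \<Gamma> x y d"
    unfolding hclass_def using homotopic.sym homotopic.trans by blast
qed

lemma hclass_eqI: "homotopic \<Gamma> x y c d \<Longrightarrow> hclass \<Gamma> x y c = hclass \<Gamma> x y d"
  using hclass_eq_iff homotopic_paths by blast

lemma pclass_memE:
  assumes "A \<in> pclasses \<Gamma> x y" "c \<in> A"
  shows "is_path \<Gamma> x c y" "A = hclass \<Gamma> x y c"
proof -
  obtain d where d: "is_path \<Gamma> x d y" "A = hclass \<Gamma> x y d" using pclassesE[OF assms(1)] by blast
  then have h: "homotopic \<Gamma> x y d c" using assms(2) by (auto simp: hclass_def)
  show "is_path \<Gamma> x c y" using homotopic_paths[OF h] by simp
  show "A = hclass \<Gamma> x y c" using d hclass_eqI[OF h] by simp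
qed

section \<open>Reversed paths and the groupoid of path classes\<close>

fun inv_letter ::
  "('v, 'e, 'g, 'h) graph_of_groups \<Rightarrow> ('v, 'e, 'g) letter \<Rightarrow> ('v, 'e, 'g) letter" where
  "inv_letter \<Gamma> (Elt v g) = Elt v (inv\<^bsub>vgroup \<Gamma> v\<^esub> g)"
| "inv_letter \<Gamma> (Seg e s t) = Seg (bar \<Gamma> e) (1 - t) (1 - s)"

definition inv_path ::
  "('v, 'e, 'g, 'h) graph_of_groups \<Rightarrow> ('v, 'e, 'g) letter list \<Rightarrow> ('v, 'e, 'g) letter list" where
  "inv_path \<Gamma> c = rev (map (inv_letter \<Gamma>) c)"

locale gog =
  fixes \<Gamma> :: "('v, 'e, 'g, 'h) graph_of_groups"
  assumes gog: "graph_of_groups \<Gamma>"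
begin

lemma bar_in [simp]: "e \<in> edges \<Gamma> \<Longrightarrow> bar \<Gamma> e \<in> edges \<Gamma>"
  and bar_bar [simp]: "e \<in> edges \<Gamma> \<Longrightarrow> bar \<Gamma> (bar \<Gamma> e) = e"
  and bar_neq [simp]: "e \<in> edges \<Gamma> \<Longrightarrow> bar \<Gamma> e \<noteq> e"
  and tgt_in [simp]: "e \<in> edges \<Gamma> \<Longrightarrow> tgt \<Gamma> e \<in> verts \<Gamma>"
  and vgroup_group: "v \<in> verts \<Gamma> \<Longrightarrow> group (vgroup \<Gamma> v)"
  and egroup_group: "e \<in> edges \<Gamma> \<Longrightarrow> group (egroup \<Gamma> e)"
  and egroup_bar [simp]: "e \<in> edges \<Gamma> \<Longrightarrow> egroup \<Gamma> (bar \<Gamma> e) = egroup \<Gamma> e"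
  and einj_mon: "e \<in> edges \<Gamma> \<Longrightarrow> einj \<Gamma> e \<in> mon (egroup \<Gamma> e) (vgroup \<Gamma> (tgt \<Gamma> e))"
  using gog by (auto simp: graph_of_groups_def)

lemma src_in [simp]: "e \<in> edges \<Gamma> \<Longrightarrow> src \<Gamma> e \<in> verts \<Gamma>"
  and tgt_bar [simp]: "tgt \<Gamma> (bar \<Gamma> e) = src \<Gamma> e"
  and src_bar [simp]: "e \<in> edges \<Gamma> \<Longrightarrow> src \<Gamma> (bar \<Gamma> e) = tgt \<Gamma> e"
  by (simp_all add: src_def)

lemma vone_in [simp]: "v \<in> verts \<Gamma> \<Longrightarrow> \<one>\<^bsub>vgroup \<Gamma> v\<^esub> \<in> carrier (vgroup \<Gamma> v)"
  and vmult_in [simp]: "\<lbrakk>v \<in> verts \<Gamma>; g \<in> carrier (vgroup \<Gamma> v); g' \<in> carrier (vgroup \<Gamma> v)\<rbrakk>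
      \<Longrightarrow> g \<otimes>\<^bsub>vgroup \<Gamma> v\<^esub> g' \<in> carrier (vgroup \<Gamma> v)"
  and vinv_in [simp]: "\<lbrakk>v \<in> verts \<Gamma>; g \<in> carrier (vgroup \<Gamma> v)\<rbrakk>
      \<Longrightarrow> inv\<^bsub>vgroup \<Gamma> v\<^esub> g \<in> carrier (vgroup \<Gamma> v)"
  using vgroup_group[of v] by (simp_all add: group.is_monoid monoid.m_closed)

lemma eone_in [simp]: "e \<in> edges \<Gamma> \<Longrightarrow> \<one>\<^bsub>egroup \<Gamma> e\<^esub> \<in> carrier (egroup \<Gamma> e)"
  and emult_in [simp]: "\<lbrakk>e \<in> edges \<Gamma>; g \<in> carrier (egroup \<Gamma> e); g' \<in> carrier (egroup \<Gamma> e)\<rbrakk>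
      \<Longrightarrow> g \<otimes>\<^bsub>egroup \<Gamma> e\<^esub> g' \<in> carrier (egroup \<Gamma> e)"
  and einv_in [simp]: "\<lbrakk>e \<in> edges \<Gamma>; g \<in> carrier (egroup \<Gamma> e)\<rbrakk>
      \<Longrightarrow> inv\<^bsub>egroup \<Gamma> e\<^esub> g \<in> carrier (egroup \<Gamma> e)"
  using egroup_group[of e] by (simp_all add: group.is_monoid monoid.m_closed)

lemma einj_hom: "e \<in> edges \<Gamma> \<Longrightarrow> einj \<Gamma> e \<in> hom (egroup \<Gamma> e) (vgroup \<Gamma> (tgt \<Gamma> e))"
  and einj_inj_on: "e \<in> edges \<Gamma> \<Longrightarrow> inj_on (einj \<Gamma> e) (carrier (egroup \<Gamma> e))"
  using einj_mon[of e] by (auto simp: mon_def)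

lemma einj_in [simp]: "\<lbrakk>e \<in> edges \<Gamma>; k \<in> carrier (egroup \<Gamma> e)\<rbrakk>
    \<Longrightarrow> einj \<Gamma> e k \<in> carrier (vgroup \<Gamma> (tgt \<Gamma> e))"
  using einj_hom[of e] by (auto simp: hom_def)

lemma einj_bar_in [simp]: "\<lbrakk>e \<in> edges \<Gamma>; k \<in> carrier (egroup \<Gamma> e)\<rbrakk>
    \<Longrightarrow> einj \<Gamma> (bar \<Gamma> e) k \<in> carrier (vgroup \<Gamma> (src \<Gamma> e))"
  using einj_in[of "bar \<Gamma> e" k] by simp

lemma einj_mult: "\<lbrakk>e \<in> edges \<Gamma>; k \<in> carrier (egroup \<Gamma> e); k' \<in> carrier (egroup \<Gamma> e)\<rbrakk>
    \<Longrightarrow> einj \<Gamma> e (k \<otimes>\<^bsub>egroup \<Gamma> e\<^esub> k') = einj \<Gamma> e k \<otimes>\<^bsub>vgroup \<Gamma> (tgt \<Gamma> e)\<^esub> einj \<Gamma> e k'"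
  using einj_hom[of e] by (auto simp: hom_def)

lemma einj_bar_mult: "\<lbrakk>e \<in> edges \<Gamma>; k \<in> carrier (egroup \<Gamma> e); k' \<in> carrier (egroup \<Gamma> e)\<rbrakk>
    \<Longrightarrow> einj \<Gamma> (bar \<Gamma> e) (k \<otimes>\<^bsub>egroup \<Gamma> e\<^esub> k')
      = einj \<Gamma> (bar \<Gamma> e) k \<otimes>\<^bsub>vgroup \<Gamma> (src \<Gamma> e)\<^esub> einj \<Gamma> (bar \<Gamma> e) k'"
  using einj_mult[of "bar \<Gamma> e" k k'] by simp

lemma einj_one [simp]: "e \<in> edges \<Gamma> \<Longrightarrow> einj \<Gamma> e \<one>\<^bsub>egroup \<Gamma> e\<^esub> = \<one>\<^bsub>vgroup \<Gamma> (tgt \<Gamma> e)\<^esub>"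
  using einj_hom[of e] egroup_group[of e] vgroup_group[of "tgt \<Gamma> e"]
  by (simp add: hom_one)

lemma einj_bar_one [simp]: "e \<in> edges \<Gamma> \<Longrightarrow> einj \<Gamma> (bar \<Gamma> e) \<one>\<^bsub>egroup \<Gamma> e\<^esub> = \<one>\<^bsub>vgroup \<Gamma> (src \<Gamma> e)\<^esub>"
  using einj_one[of "bar \<Gamma> e"] by simp

lemma einj_inv: "\<lbrakk>e \<in> edges \<Gamma>; k \<in> carrier (egroup \<Gamma> e)\<rbrakk>
    \<Longrightarrow> einj \<Gamma> e (inv\<^bsub>egroup \<Gamma> e\<^esub> k) = inv\<^bsub>vgroup \<Gamma> (tgt \<Gamma> e)\<^esub> einj \<Gamma> e k"
  by (meson einj_hom egroup_group vgroup_group tgt_in group_hom.hom_inv group_hom.intro group_hom_axioms.intro)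

lemma einj_eq: "\<lbrakk>e \<in> edges \<Gamma>; k \<in> carrier (egroup \<Gamma> e); k' \<in> carrier (egroup \<Gamma> e);
    einj \<Gamma> e k = einj \<Gamma> e k'\<rbrakk> \<Longrightarrow> k = k'"
  using einj_inj_on[of e] by (auto simp: inj_on_def)

lemma einj_bar_eq: "\<lbrakk>e \<in> edges \<Gamma>; k \<in> carrier (egroup \<Gamma> e); k' \<in> carrier (egroup \<Gamma> e);
    einj \<Gamma> (bar \<Gamma> e) k = einj \<Gamma> (bar \<Gamma> e) k'\<rbrakk> \<Longrightarrow> k = k'"
  using einj_eq[of "bar \<Gamma> e"] by simp

lemma edge_point_bar [simp]: "e \<in> edges \<Gamma> \<Longrightarrow> edge_point \<Gamma> (bar \<Gamma> e) (1 - t) = edge_point \<Gamma> e t"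
  by (auto simp: edge_point_def)

lemma edge_point_0 [simp]: "edge_point \<Gamma> e 0 = Vertex (src \<Gamma> e)"
  and edge_point_1 [simp]: "edge_point \<Gamma> e 1 = Vertex (tgt \<Gamma> e)"
  by (simp_all add: edge_point_def)

lemma edge_point_eqD:
  assumes "edge_point \<Gamma> e t = edge_point \<Gamma> e' t'" "0 < t" "t < 1" "e \<in> edges \<Gamma>"
  shows "(e', t') = (e, t) \<or> (e', t') = (bar \<Gamma> e, 1 - t)"
  using assms by (auto simp: edge_point_def split: if_splits)

lemma edge_point_in: "\<lbrakk>e \<in> edges \<Gamma>; 0 \<le> t; t \<le> 1\<rbrakk> \<Longrightarrow> edge_point \<Gamma> e t \<in> points \<Gamma>"
  by (auto simp: points_def)

lemma vertex_in_points [simp]: "Vertex v \<in> points \<Gamma> \<longleftrightarrow> v \<in> verts \<Gamma>"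
  by (auto simp: points_def edge_point_def split: if_splits)

lemma pointsE:
  assumes "x \<in> points \<Gamma>"
  obtains (Vertex) v where "v \<in> verts \<Gamma>" "x = Vertex v"
  | (Edge) e t where "e \<in> edges \<Gamma>" "0 < t" "t < 1" "x = edge_point \<Gamma> e t"
proof (cases "\<exists>v \<in> verts \<Gamma>. x = Vertex v")
  case True
  then show ?thesis using Vertex by blast
next
  case False
  then obtain e t where e: "x = edge_point \<Gamma> e t" "e \<in> edges \<Gamma>" "0 \<le> t" "t \<le> 1"
    using assms by (auto simp: points_def)
  moreover have "t \<noteq> 0" "t \<noteq> 1" using False e by auto
  ultimately show ?thesis using Edge[of e t] by auto
qed

lemma letter_points: "is_letter \<Gamma> l \<Longrightarrow> start_pt \<Gamma> l \<in> points \<Gamma> \<and> end_pt \<Gamma> l \<in> points \<Gamma>"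
  by (cases l) (auto intro: edge_point_in)

lemma is_path_points: "is_path \<Gamma> x c y \<Longrightarrow> x \<in> points \<Gamma> \<and> y \<in> points \<Gamma>"
  by (induction c arbitrary: x) (use letter_points in fastforce)+

lemma is_path_append: "is_path \<Gamma> x (c @ d) z \<longleftrightarrow> (\<exists>y. is_path \<Gamma> x c y \<and> is_path \<Gamma> y d z)"
  by (induction c arbitrary: x) (use is_path_points in auto)

lemma is_path_end: "is_path \<Gamma> x c y \<Longrightarrow> is_path \<Gamma> x c y' \<Longrightarrow> y = y'"
  by (induction c arbitrary: x) auto

lemma is_path_appI: "is_path \<Gamma> x c y \<Longrightarrow> is_path \<Gamma> y d z \<Longrightarrow> is_path \<Gamma> x (c @ d) z"
  using is_path_append by blast

lemma homotopic_cong: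
  assumes "homotopic \<Gamma> x y c d" "is_path \<Gamma> w a x" "is_path \<Gamma> y b z"
  shows "homotopic \<Gamma> w z (a @ c @ b) (a @ d @ b)"
  using assms
proof (induction rule: homotopic.induct)
  case (step a' b' c' d')
  have "homotopic \<Gamma> w z ((a @ c') @ a' @ (d' @ b)) ((a @ c') @ b' @ (d' @ b))"
    by (rule homotopic.step) (use step is_path_append in \<open>auto; blast\<close>)+
  then show ?case by simp
next
  case (refl c)
  then show ?case by (meson homotopic.refl is_path_append)
qed (blast intro: homotopic.sym homotopic.trans)+

lemma homotopic_append:
  assumes "homotopic \<Gamma> x y c d" "homotopic \<Gamma> y z c' d'"
  shows "homotopic \<Gamma> x z (c @ c') (d @ d')"
proof -
  have p: "is_path \<Gamma> x c y" "is_path \<Gamma> x d y" "is_path \<Gamma> y c' z" "is_path \<Gamma> y d' z"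
    using homotopic_paths assms by blast+
  have "homotopic \<Gamma> x z ([] @ c @ c') ([] @ d @ c')"
    by (rule homotopic_cong[OF assms(1) _ p(3)]) (use is_path_points[OF p(1)] in simp)
  moreover have "homotopic \<Gamma> x z (d @ c' @ []) (d @ d' @ [])"
    by (rule homotopic_cong[OF assms(2) p(2)]) (use is_path_points[OF p(3)] in simp)
  ultimately show ?thesis by (auto intro: homotopic.trans)
qed

lemma homotopic_move:
  assumes "move \<Gamma> a b" "is_path \<Gamma> x a y" "is_path \<Gamma> x b y"
  shows "homotopic \<Gamma> x y a b"
  using homotopic.step[OF assms(1), of x "[]" "[]" y] assms by simp

lemma is_path_inv_path:
  "is_path \<Gamma> x c y \<Longrightarrow> is_path \<Gamma> y (inv_path \<Gamma> c) x"
proof (induction c arbitrary: x)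
  case Nil
  then show ?case by (auto simp: inv_path_def)
next
  case (Cons l c)
  have "is_path \<Gamma> (end_pt \<Gamma> l) [inv_letter \<Gamma> l] (start_pt \<Gamma> l)"
    using Cons.prems by (cases l) (auto simp: edge_point_in)
  moreover have "is_path \<Gamma> y (inv_path \<Gamma> c) (end_pt \<Gamma> l)" using Cons by simp
  ultimately have "is_path \<Gamma> y (inv_path \<Gamma> c @ [inv_letter \<Gamma> l]) (start_pt \<Gamma> l)"
    by (rule is_path_appI[rotated])
  then show ?case using Cons.prems by (simp add: inv_path_def)
qed

lemma inv_letter_cancel:
  assumes "is_letter \<Gamma> l"
  shows "homotopic \<Gamma> (start_pt \<Gamma> l) (start_pt \<Gamma> l) [l, inv_letter \<Gamma> l] []"
proof (cases l)
  case (Elt v g)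
  then have v: "v \<in> verts \<Gamma>" "g \<in> carrier (vgroup \<Gamma> v)" using assms by auto
  have "homotopic \<Gamma> (Vertex v) (Vertex v) [Elt v g, Elt v (inv\<^bsub>vgroup \<Gamma> v\<^esub> g)] [Elt v \<one>\<^bsub>vgroup \<Gamma> v\<^esub>]"
    using homotopic_move[OF move.mult[of \<Gamma> v g "inv\<^bsub>vgroup \<Gamma> v\<^esub> g"]] v group.r_inv[OF vgroup_group[OF v(1)] v(2)]
    by simp
  moreover have "homotopic \<Gamma> (Vertex v) (Vertex v) [Elt v \<one>\<^bsub>vgroup \<Gamma> v\<^esub>] []"
    using homotopic_move[OF move.unit[of \<Gamma> v]] v by simp
  ultimately show ?thesis using Elt by (auto intro: homotopic.trans)
next
  case (Seg e s t)
  then show ?thesis using homotopic_move[OF move.cancel[of \<Gamma> e s t]] assms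
    by (auto simp: edge_point_in)
qed

lemma homotopic_inv_path:
  assumes "is_path \<Gamma> x c y"
  shows "homotopic \<Gamma> x x (c @ inv_path \<Gamma> c) []"
  using assms
proof (induction c arbitrary: x)
  case Nil
  then show ?case by (auto simp: inv_path_def intro: homotopic.refl)
next
  case (Cons l c)
  have p: "is_letter \<Gamma> l" "start_pt \<Gamma> l = x" "is_path \<Gamma> (end_pt \<Gamma> l) c y" using Cons.prems by auto
  have "homotopic \<Gamma> x x ([l] @ (c @ inv_path \<Gamma> c) @ [inv_letter \<Gamma> l]) ([l] @ [] @ [inv_letter \<Gamma> l])"
  proof (rule homotopic_cong[OF Cons.IH[OF p(3)]])
    show "is_path \<Gamma> x [l] (end_pt \<Gamma> l)" using p letter_points by simp
    then show "is_path \<Gamma> (end_pt \<Gamma> l) [inv_letter \<Gamma> l] x"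
      using is_path_inv_path by (fastforce simp: inv_path_def)
  qed
  then show ?case using inv_letter_cancel[OF p(1)] p
    by (auto simp: inv_path_def intro: homotopic.trans)
qed

text \<open>This makes \<open>homotopic_inv_path\<close>, applied to the reversed path, yield the
  inverse on the other side as well.\<close>

lemma inv_path_inv_path:
  "is_path \<Gamma> x c y \<Longrightarrow> inv_path \<Gamma> (inv_path \<Gamma> c) = c"
proof (induction c arbitrary: x)
  case (Cons l c)
  have "inv_letter \<Gamma> (inv_letter \<Gamma> l) = l"
    using Cons.prems by (cases l) (auto simp: group.inv_inv vgroup_group)
  then show ?case using Cons by (auto simp: inv_path_def rev_map)
qed (simp add: inv_path_def)

lemma hmult_hclass:
  assumes "is_path \<Gamma> x a y" "is_path \<Gamma> y b z"
  shows "hmult \<Gamma> x z (hclass \<Gamma> x y a) (hclass \<Gamma> y z b) = hclass \<Gamma> x z (a @ b)"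
proof (intro Set.set_eqI iffI)
  fix c assume "c \<in> hmult \<Gamma> x z (hclass \<Gamma> x y a) (hclass \<Gamma> y z b)"
  then obtain a' b' where h: "homotopic \<Gamma> x y a a'" "homotopic \<Gamma> y z b b'" "homotopic \<Gamma> x z (a' @ b') c"
    by (auto simp: hmult_def hclass_def)
  show "c \<in> hclass \<Gamma> x z (a @ b)"
    using homotopic_append[OF h(1,2)] h(3) by (auto simp: hclass_def intro: homotopic.trans)
next
  fix c assume "c \<in> hclass \<Gamma> x z (a @ b)"
  then show "c \<in> hmult \<Gamma> x z (hclass \<Gamma> x y a) (hclass \<Gamma> y z b)"
    using assms by (auto simp: hmult_def hclass_def intro: homotopic.refl)
qed

lemma hmult_closed:
  assumes "A \<in> pclasses \<Gamma> x y" "B \<in> pclasses \<Gamma> y z"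
  shows "hmult \<Gamma> x z A B \<in> pclasses \<Gamma> x z"
  using assms by (elim pclassesE) (auto simp: hmult_hclass intro: is_path_appI)

lemma hmult_assoc:
  assumes "A \<in> pclasses \<Gamma> x y" "B \<in> pclasses \<Gamma> y z" "C \<in> pclasses \<Gamma> z w"
  shows "hmult \<Gamma> x w (hmult \<Gamma> x z A B) C = hmult \<Gamma> x w A (hmult \<Gamma> y w B C)"
  using assms by (elim pclassesE) (simp add: hmult_hclass[OF is_path_appI] hmult_hclass[OF _ is_path_appI] hmult_hclass)

lemma hmult_one:
  assumes "A \<in> pclasses \<Gamma> x y"
  shows "hmult \<Gamma> x y (hclass \<Gamma> x x []) A = A" "hmult \<Gamma> x y A (hclass \<Gamma> y y []) = A"
proof -
  obtain a where a: "is_path \<Gamma> x a y" "A = hclass \<Gamma> x y a" using pclassesE[OF assms] .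
  have "is_path \<Gamma> x [] x" "is_path \<Gamma> y [] y" using is_path_points[OF a(1)] by auto
  then show "hmult \<Gamma> x y (hclass \<Gamma> x x []) A = A" "hmult \<Gamma> x y A (hclass \<Gamma> y y []) = A"
    using a by (simp_all add: hmult_hclass)
qed

lemma hmult_inv:
  assumes "A \<in> pclasses \<Gamma> x y"
  obtains B where "B \<in> pclasses \<Gamma> y x" "hmult \<Gamma> x x A B = hclass \<Gamma> x x []"
    "hmult \<Gamma> y y B A = hclass \<Gamma> y y []"
proof -
  obtain a where a: "is_path \<Gamma> x a y" "A = hclass \<Gamma> x y a" using pclassesE[OF assms] .
  have i: "is_path \<Gamma> y (inv_path \<Gamma> a) x" using is_path_inv_path[OF a(1)] .
  have "hmult \<Gamma> x x A (hclass \<Gamma> y x (inv_path \<Gamma> a)) = hclass \<Gamma> x x []"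
    using a i homotopic_inv_path[OF a(1)] by (simp add: hmult_hclass hclass_eqI)
  moreover have "hmult \<Gamma> y y (hclass \<Gamma> y x (inv_path \<Gamma> a)) A = hclass \<Gamma> y y []"
    using a i homotopic_inv_path[OF i] inv_path_inv_path[OF a(1)] by (simp add: hmult_hclass hclass_eqI)
  ultimately show ?thesis using that i by blast
qed

lemma fundamental_group_group:
  assumes "p \<in> points \<Gamma>"
  shows "group (fundamental_group \<Gamma> p)"
proof (rule groupI)
  show "\<one>\<^bsub>fundamental_group \<Gamma> p\<^esub> \<in> carrier (fundamental_group \<Gamma> p)"
    using assms by (auto simp: fundamental_group_def)
  fix A assume "A \<in> carrier (fundamental_group \<Gamma> p)"
  then have A: "A \<in> pclasses \<Gamma> p p" by (simp add: fundamental_group_def)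
  obtain B where "B \<in> pclasses \<Gamma> p p" "hmult \<Gamma> p p B A = hclass \<Gamma> p p []" using hmult_inv[OF A] by blast
  then show "\<exists>B\<in>carrier (fundamental_group \<Gamma> p). B \<otimes>\<^bsub>fundamental_group \<Gamma> p\<^esub> A = \<one>\<^bsub>fundamental_group \<Gamma> p\<^esub>"
    by (auto simp: fundamental_group_def)
qed (auto simp: fundamental_group_def hmult_closed hmult_assoc hmult_one)

section \<open>Group elements and edges as path classes\<close>

lemma vclass_in: "\<lbrakk>v \<in> verts \<Gamma>; g \<in> carrier (vgroup \<Gamma> v)\<rbrakk> \<Longrightarrow> vclass \<Gamma> v g \<in> pclasses \<Gamma> (Vertex v) (Vertex v)"
  unfolding vclass_def by (rule hclass_in) auto

lemma vclass_mult:
  assumes "v \<in> verts \<Gamma>" "g \<in> carrier (vgroup \<Gamma> v)" "g' \<in> carrier (vgroup \<Gamma> v)"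
  shows "hmult \<Gamma> (Vertex v) (Vertex v) (vclass \<Gamma> v g) (vclass \<Gamma> v g') = vclass \<Gamma> v (g \<otimes>\<^bsub>vgroup \<Gamma> v\<^esub> g')"
  using assms homotopic_move[OF move.mult[of \<Gamma> v g g']]
  by (simp add: vclass_def hmult_hclass hclass_eqI)

lemma vclass_one:
  assumes "v \<in> verts \<Gamma>"
  shows "vclass \<Gamma> v \<one>\<^bsub>vgroup \<Gamma> v\<^esub> = hclass \<Gamma> (Vertex v) (Vertex v) []"
  using assms homotopic_move[OF move.unit[of \<Gamma> v]] by (simp add: vclass_def hclass_eqI)

lemma eclass_in: "e \<in> edges \<Gamma> \<Longrightarrow> eclass \<Gamma> e \<in> pclasses \<Gamma> (Vertex (src \<Gamma> e)) (Vertex (tgt \<Gamma> e))"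
  unfolding eclass_def by (rule hclass_in) auto

lemma eclass_bar:
  assumes "e \<in> edges \<Gamma>"
  shows "hmult \<Gamma> (Vertex (src \<Gamma> e)) (Vertex (src \<Gamma> e)) (eclass \<Gamma> e) (eclass \<Gamma> (bar \<Gamma> e))
    = hclass \<Gamma> (Vertex (src \<Gamma> e)) (Vertex (src \<Gamma> e)) []"
  using assms homotopic_move[OF move.cancel[of \<Gamma> e 0 1]]
  by (simp add: eclass_def hmult_hclass hclass_eqI)

lemma eclass_vclass:
  assumes "e \<in> edges \<Gamma>" "k \<in> carrier (egroup \<Gamma> e)"
  shows "hmult \<Gamma> (Vertex (src \<Gamma> e)) (Vertex (tgt \<Gamma> e)) (eclass \<Gamma> e) (vclass \<Gamma> (tgt \<Gamma> e) (einj \<Gamma> e k))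
    = hmult \<Gamma> (Vertex (src \<Gamma> e)) (Vertex (tgt \<Gamma> e)) (vclass \<Gamma> (src \<Gamma> e) (einj \<Gamma> (bar \<Gamma> e) k)) (eclass \<Gamma> e)"
  using assms homotopic_move[OF move.edge[of k \<Gamma> e]]
  by (simp add: eclass_def vclass_def hmult_hclass hclass_eqI)

end

section \<open>The action on path classes ending at vertices\<close>

definition vpaths ::
  "('v, 'e, 'g, 'h) graph_of_groups \<Rightarrow> ('v, 'e) point \<Rightarrow> 'v \<Rightarrow> ('v, 'e, 'g) pclass set" where
  "vpaths \<Gamma> p v = pclasses \<Gamma> p (Vertex v)"

definition lact ::
  "('v, 'e, 'g, 'h) graph_of_groups \<Rightarrow> ('v, 'e) point \<Rightarrow> 'v \<Rightarrow>
     ('v, 'e, 'g) pclass \<Rightarrow> ('v, 'e, 'g) pclass \<Rightarrow> ('v, 'e, 'g) pclass" where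
  "lact \<Gamma> p v h A = hmult \<Gamma> p (Vertex v) h A"

definition ract ::
  "('v, 'e, 'g, 'h) graph_of_groups \<Rightarrow> ('v, 'e) point \<Rightarrow> 'v \<Rightarrow>
     ('v, 'e, 'g) pclass \<Rightarrow> 'g \<Rightarrow> ('v, 'e, 'g) pclass" where
  "ract \<Gamma> p v A g = hmult \<Gamma> p (Vertex v) A (vclass \<Gamma> v g)"

definition root_path ::
  "('v, 'e, 'g, 'h) graph_of_groups \<Rightarrow> ('v, 'e) point \<Rightarrow> 'v \<Rightarrow> ('v, 'e, 'g) pclass \<Rightarrow> bool" where
  "root_path \<Gamma> p u \<beta> \<longleftrightarrow> (p = Vertex u \<and> \<beta> = hclass \<Gamma> p p []) \<or>
    (\<exists>e t. e \<in> edges \<Gamma> \<and> 0 < t \<and> t < 1 \<and> p = edge_point \<Gamma> e t \<and> u = src \<Gamma> e \<and>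
       \<beta> = initial_seg \<Gamma> p e t)"

locale pgog = gog \<Gamma> for \<Gamma> :: "('v, 'e, 'g, 'h) graph_of_groups" +
  fixes p :: "('v, 'e) point"
  assumes p_in: "p \<in> points \<Gamma>"
begin

abbreviation P where "P \<equiv> vpaths \<Gamma> p"
abbreviation L where "L \<equiv> lact \<Gamma> p"
abbreviation R where "R \<equiv> ract \<Gamma> p"
abbreviation X where "X \<equiv> extend \<Gamma> p"
abbreviation \<pi> where "\<pi> \<equiv> fundamental_group \<Gamma> p"

sublocale pi: group \<pi>
  using p_in by (rule fundamental_group_group)

lemma pi_carrier: "carrier \<pi> = pclasses \<Gamma> p p"
  and pi_one: "\<one>\<^bsub>\<pi>\<^esub> = hclass \<Gamma> p p []"
  and pi_mult: "h \<otimes>\<^bsub>\<pi>\<^esub> h' = hmult \<Gamma> p p h h'"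
  by (simp_all add: fundamental_group_def)

lemma vpaths_vert: "A \<in> P v \<Longrightarrow> v \<in> verts \<Gamma>"
  unfolding vpaths_def by (metis pclassesE is_path_points vertex_in_points)

lemma lact_closed [simp]: "h \<in> carrier \<pi> \<Longrightarrow> A \<in> P v \<Longrightarrow> L v h A \<in> P v"
  by (auto simp: vpaths_def lact_def pi_carrier intro: hmult_closed)

lemma lact_one [simp]: "A \<in> P v \<Longrightarrow> L v \<one>\<^bsub>\<pi>\<^esub> A = A"
  by (simp add: vpaths_def lact_def pi_one hmult_one)

lemma lact_mult: "\<lbrakk>h \<in> carrier \<pi>; h' \<in> carrier \<pi>; A \<in> P v\<rbrakk> \<Longrightarrow> L v (h \<otimes>\<^bsub>\<pi>\<^esub> h') A = L v h (L v h' A)"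
  by (simp add: vpaths_def lact_def pi_carrier pi_mult hmult_assoc)

lemma lact_inv [simp]:
  assumes "h \<in> carrier \<pi>" "A \<in> P v"
  shows "L v (inv\<^bsub>\<pi>\<^esub> h) (L v h A) = A" "L v h (L v (inv\<^bsub>\<pi>\<^esub> h) A) = A"
  using assms by (simp_all flip: lact_mult)

text \<open>\<open>B\<close> followed by the inverse of \<open>A\<close> is the loop that carries
  \<open>A\<close> to \<open>B\<close>.\<close>

lemma lact_trans:
  assumes "A \<in> P v" "B \<in> P v"
  shows "\<exists>h\<in>carrier \<pi>. L v h A = B"
proof -
  obtain A' where A': "A' \<in> pclasses \<Gamma> (Vertex v) p"
    "hmult \<Gamma> (Vertex v) (Vertex v) A' A = hclass \<Gamma> (Vertex v) (Vertex v) []"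
    using hmult_inv assms(1) unfolding vpaths_def by blast
  have "L v (hmult \<Gamma> p p B A') A = B"
    using A' assms by (simp add: lact_def vpaths_def hmult_assoc hmult_one)
  moreover have "hmult \<Gamma> p p B A' \<in> carrier \<pi>"
    using A' assms unfolding pi_carrier vpaths_def by (blast intro: hmult_closed)
  ultimately show ?thesis by blast
qed

text \<open>The inverse class of \<open>A\<close>, multiplied on the right, recovers the loop from
  its effect on \<open>A\<close>.\<close>

lemma lact_free:
  assumes "h \<in> carrier \<pi>" "h' \<in> carrier \<pi>" "A \<in> P v" "L v h A = L v h' A"
  shows "h = h'"
proof -
  obtain A' where A': "A' \<in> pclasses \<Gamma> (Vertex v) p" "hmult \<Gamma> p p A A' = hclass \<Gamma> p p []"
    using hmult_inv assms(3) unfolding vpaths_def by blast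
  have "hmult \<Gamma> p p (L v k A) A' = k" if "k \<in> carrier \<pi>" for k
    using that A' assms(3) by (simp add: lact_def vpaths_def hmult_assoc hmult_one pi_carrier)
  then show ?thesis using assms by metis
qed

lemma ract_closed [simp]: "A \<in> P v \<Longrightarrow> g \<in> carrier (vgroup \<Gamma> v) \<Longrightarrow> R v A g \<in> P v"
  using vpaths_vert[of A v] by (auto simp: vpaths_def ract_def intro: hmult_closed vclass_in)

lemma ract_one [simp]: "A \<in> P v \<Longrightarrow> R v A \<one>\<^bsub>vgroup \<Gamma> v\<^esub> = A"
  using vpaths_vert[of A v] by (simp add: vpaths_def ract_def vclass_one hmult_one)

lemma ract_mult: "\<lbrakk>A \<in> P v; g \<in> carrier (vgroup \<Gamma> v); g' \<in> carrier (vgroup \<Gamma> v)\<rbrakk>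
    \<Longrightarrow> R v A (g \<otimes>\<^bsub>vgroup \<Gamma> v\<^esub> g') = R v (R v A g) g'"
  using vpaths_vert[of A v] by (simp add: vpaths_def ract_def hmult_assoc vclass_in vclass_mult)

lemma ract_inv [simp]:
  assumes "A \<in> P v" "g \<in> carrier (vgroup \<Gamma> v)"
  shows "R v (R v A g) (inv\<^bsub>vgroup \<Gamma> v\<^esub> g) = A" "R v (R v A (inv\<^bsub>vgroup \<Gamma> v\<^esub> g)) g = A"
  using assms vpaths_vert[OF assms(1)] vgroup_group[of v]
  by (simp_all add: group.r_inv group.l_inv flip: ract_mult)

lemma lact_ract: "\<lbrakk>h \<in> carrier \<pi>; A \<in> P v; g \<in> carrier (vgroup \<Gamma> v)\<rbrakk>
    \<Longrightarrow> L v h (R v A g) = R v (L v h A) g"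
  using vpaths_vert[of A v] by (simp add: lact_def ract_def vpaths_def pi_carrier hmult_assoc vclass_in)

lemma extend_closed [simp]: "e \<in> edges \<Gamma> \<Longrightarrow> A \<in> P (src \<Gamma> e) \<Longrightarrow> X e A \<in> P (tgt \<Gamma> e)"
  by (auto simp: extend_def vpaths_def intro: hmult_closed eclass_in)

lemma extend_bar [simp]:
  assumes "e \<in> edges \<Gamma>" "A \<in> P (src \<Gamma> e)"
  shows "X (bar \<Gamma> e) (X e A) = A"
proof -
  have "hmult \<Gamma> p (Vertex (src \<Gamma> e)) (hmult \<Gamma> p (Vertex (tgt \<Gamma> e)) A (eclass \<Gamma> e)) (eclass \<Gamma> (bar \<Gamma> e)) = A"
    using assms eclass_in[of e] eclass_in[of "bar \<Gamma> e"]
    by (simp add: vpaths_def hmult_assoc eclass_bar hmult_one)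
  then show ?thesis by (simp add: extend_def)
qed

lemma extend_lact: "\<lbrakk>e \<in> edges \<Gamma>; h \<in> carrier \<pi>; A \<in> P (src \<Gamma> e)\<rbrakk>
    \<Longrightarrow> X e (L (src \<Gamma> e) h A) = L (tgt \<Gamma> e) h (X e A)"
  using eclass_in[of e] by (simp add: extend_def lact_def vpaths_def pi_carrier hmult_assoc)

lemma extend_ract: "\<lbrakk>e \<in> edges \<Gamma>; k \<in> carrier (egroup \<Gamma> e); A \<in> P (src \<Gamma> e)\<rbrakk>
    \<Longrightarrow> X e (R (src \<Gamma> e) A (einj \<Gamma> (bar \<Gamma> e) k)) = R (tgt \<Gamma> e) (X e A) (einj \<Gamma> e k)"
  using eclass_in[of e] vclass_in[of "src \<Gamma> e" "einj \<Gamma> (bar \<Gamma> e) k"] vclass_in[of "tgt \<Gamma> e" "einj \<Gamma> e k"]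
  by (simp add: extend_def ract_def vpaths_def hmult_assoc eclass_vclass)

lemma initial_seg_path:
  assumes "e \<in> edges \<Gamma>" "0 < t" "t < 1" "p = edge_point \<Gamma> e t"
  shows "is_path \<Gamma> p [Seg (bar \<Gamma> e) (1 - t) 1] (Vertex (src \<Gamma> e))"
  using assms by simp

lemma hclass_extend:
  assumes "is_path \<Gamma> p c (Vertex (src \<Gamma> e))" "e \<in> edges \<Gamma>"
  shows "X e (hclass \<Gamma> p (Vertex (src \<Gamma> e)) c) = hclass \<Gamma> p (Vertex (tgt \<Gamma> e)) (c @ [Seg e 0 1])"
  using assms by (simp add: extend_def eclass_def hmult_hclass)

lemma hclass_ract:
  assumes "is_path \<Gamma> p c (Vertex v)" "g \<in> carrier (vgroup \<Gamma> v)"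
  shows "R v (hclass \<Gamma> p (Vertex v) c) g = hclass \<Gamma> p (Vertex v) (c @ [Elt v g])"
  using assms is_path_points[OF assms(1)] by (simp add: ract_def vclass_def hmult_hclass)

text \<open>Going back to the source and then along all of \<open>e\<close> amounts to going
  straight on: subdividing the edge at the point exposes a backtrack that cancels. This links the
  two ways of completing a path that ends inside an edge.\<close>

lemma extend_half_edge:
  assumes "e \<in> edges \<Gamma>" "0 < t" "t < 1" "is_path \<Gamma> p c (edge_point \<Gamma> e t)"
  shows "X e (hclass \<Gamma> p (Vertex (src \<Gamma> e)) (c @ [Seg (bar \<Gamma> e) (1 - t) 1]))
    = hclass \<Gamma> p (Vertex (tgt \<Gamma> e)) (c @ [Seg e t 1])"
proof -
  let ?x = "edge_point \<Gamma> e t" let ?z = "Vertex (tgt \<Gamma> e)"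
  have pth: "is_path \<Gamma> p (c @ [Seg (bar \<Gamma> e) (1 - t) 1]) (Vertex (src \<Gamma> e))"
    using assms by (auto simp: is_path_append)
  have "homotopic \<Gamma> ?x ?z ([Seg (bar \<Gamma> e) (1 - t) 1] @ [Seg e 0 t, Seg e t 1] @ [])
     ([Seg (bar \<Gamma> e) (1 - t) 1] @ [Seg e 0 1] @ [])"
    by (rule homotopic.step[OF move.subdivide]) (use assms in auto)
  moreover have "homotopic \<Gamma> ?x ?z ([] @ [Seg (bar \<Gamma> e) (1 - t) 1, Seg (bar \<Gamma> (bar \<Gamma> e)) (1 - 1) (1 - (1 - t))] @ [Seg e t 1])
     ([] @ [] @ [Seg e t 1])"
    by (rule homotopic.step[OF move.cancel]) (use assms in auto)
  ultimately have "homotopic \<Gamma> ?x ?z [Seg (bar \<Gamma> e) (1 - t) 1, Seg e 0 1] [Seg e t 1]"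
    using assms by (auto intro: homotopic.sym homotopic.trans)
  from homotopic_append[OF homotopic.refl[OF assms(4)] this]
  show ?thesis using hclass_extend[OF pth assms(1)] by (simp add: hclass_eqI)
qed

lemma initial_seg_bar:
  assumes "e \<in> edges \<Gamma>" "0 < t" "t < 1" "p = edge_point \<Gamma> e t"
  shows "X e (initial_seg \<Gamma> p e t) = initial_seg \<Gamma> p (bar \<Gamma> e) (1 - t)"
  using extend_half_edge[of e t "[]"] assms p_in by (simp add: initial_seg_def)

lemma initial_seg_in:
  assumes "e \<in> edges \<Gamma>" "0 < t" "t < 1" "p = edge_point \<Gamma> e t"
  shows "initial_seg \<Gamma> p e t \<in> P (src \<Gamma> e)"
  unfolding vpaths_def initial_seg_def by (rule hclass_in[OF initial_seg_path[OF assms]])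

section \<open>Generation of the path classes by the root\<close>

lemma root_in: "root_path \<Gamma> p u \<beta> \<Longrightarrow> \<beta> \<in> P u"
  unfolding root_path_def using p_in initial_seg_in by (auto simp: vpaths_def)

lemma root_exists: "\<exists>u \<beta>. root_path \<Gamma> p u \<beta>"
  using p_in by (cases rule: pointsE) (auto simp: root_path_def)

text \<open>Whole edges suffice although paths may stop and turn inside an edge. The induction over
  letter lists carries the invariant \<open>?C\<close> about paths with arbitrary end: at a vertex
  it speaks of the class itself, inside an edge of the class completed back to the source, for each
  description of the end point.\<close>

lemma vpaths_induct:
  assumes root: "root_path \<Gamma> p u \<beta>" "S u \<beta>"
    and R: "\<And>v A g. \<lbrakk>A \<in> P v; g \<in> carrier (vgroup \<Gamma> v); S v A\<rbrakk> \<Longrightarrow> S v (R v A g)"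
    and X: "\<And>e A. \<lbrakk>e \<in> edges \<Gamma>; A \<in> P (src \<Gamma> e); S (src \<Gamma> e) A\<rbrakk> \<Longrightarrow> S (tgt \<Gamma> e) (X e A)"
    and "A \<in> P v"
  shows "S v A"
proof -
  let ?H = "\<lambda>e t c. S (src \<Gamma> e) (hclass \<Gamma> p (Vertex (src \<Gamma> e)) (c @ [Seg (bar \<Gamma> e) (1 - t) 1]))"
  \<comment> \<open>Completing towards the other end is an extension along the whole edge, by
    \<open>extend_half_edge\<close>; so the invariant for one description of the point gives it for
    the other.\<close>
  have other: "?H (bar \<Gamma> e) (1 - t) c"
    if "?H e t c" "e \<in> edges \<Gamma>" "0 < t" "t < 1" "is_path \<Gamma> p c (edge_point \<Gamma> e t)" for e t c
  proof -
    have "is_path \<Gamma> p (c @ [Seg (bar \<Gamma> e) (1 - t) 1]) (Vertex (src \<Gamma> e))"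
      using that by (auto simp: is_path_append)
    then show ?thesis using X[OF that(2) _ that(1)] extend_half_edge[OF that(2-5)] that(2)
      by (auto simp: vpaths_def)
  qed
  let ?C = "\<lambda>y c. (\<forall>v. y = Vertex v \<longrightarrow> S v (hclass \<Gamma> p y c)) \<and>
     (\<forall>e t. e \<in> edges \<Gamma> \<longrightarrow> 0 < t \<longrightarrow> t < 1 \<longrightarrow> y = edge_point \<Gamma> e t \<longrightarrow> ?H e t c)"
  have C: "?C (edge_point \<Gamma> e t) c"
    if *: "?H e t c" "e \<in> edges \<Gamma>" "0 < t" "t < 1" "is_path \<Gamma> p c (edge_point \<Gamma> e t)" for e t c
  proof (intro conjI allI impI)
    show "S v (hclass \<Gamma> p (edge_point \<Gamma> e t) c)" if "edge_point \<Gamma> e t = Vertex v" for v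
      using that * by (simp add: edge_point_def)
    show "?H e' t' c" if "edge_point \<Gamma> e t = edge_point \<Gamma> e' t'" for e' t'
      using edge_point_eqD[OF that *(3,4,2)] other[OF *] *(1) by auto
  qed
  have CV: "?C (Vertex v) c" if "S v (hclass \<Gamma> p (Vertex v) c)" for v c
    using that by (auto simp: edge_point_def)
  have main: "?C y c" if "is_path \<Gamma> p c y" for c y
    using that
  proof (induction c arbitrary: y rule: rev_induct)
    case Nil
    then have y: "y = p" by simp
    from root(1) show ?case unfolding root_path_def
    proof (elim disjE exE conjE)
      assume "p = Vertex u" "\<beta> = hclass \<Gamma> p p []"
      then show ?thesis using CV[of u "[]"] root(2) y by simp
    next
      fix e t assume *: "e \<in> edges \<Gamma>" "0 < t" "t < 1" "p = edge_point \<Gamma> e t" "u = src \<Gamma> e"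
        "\<beta> = initial_seg \<Gamma> p e t"
      have "?H e t []" using * root(2) by (simp add: initial_seg_def)
      from C[OF this *(1-3)] show ?thesis using y *(4) p_in by simp
    qed
  next
    case (snoc l c)
    obtain y0 where c: "is_path \<Gamma> p c y0" "is_letter \<Gamma> l" "start_pt \<Gamma> l = y0" "y = end_pt \<Gamma> l"
      using snoc.prems by (auto simp: is_path_append)
    note IH = snoc.IH[OF c(1)]
    show ?case
    proof (cases l)
      case (Elt v g)
      then have "S v (hclass \<Gamma> p (Vertex v) c)" "g \<in> carrier (vgroup \<Gamma> v)" "is_path \<Gamma> p c (Vertex v)"
        using IH c by auto
      then have "S v (hclass \<Gamma> p (Vertex v) (c @ [Elt v g]))"
        using R[of "hclass \<Gamma> p (Vertex v) c" v g] by (auto simp: vpaths_def hclass_ract)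
      then have S: "S v (hclass \<Gamma> p (Vertex v) (c @ [l]))" using Elt by simp
      have y: "y = Vertex v" using Elt c by simp
      show ?thesis unfolding y using CV[OF S] .
    next
      case (Seg e s t)
      then have e: "e \<in> edges \<Gamma>" "0 \<le> s" "s < t" "t \<le> 1" "is_path \<Gamma> p c (edge_point \<Gamma> e s)" using c by auto
      have full: "y = edge_point \<Gamma> e t" using c Seg by simp
      consider "s = 0" "t = 1" | "s = 0" "t < 1" | "0 < s" "t = 1" | "0 < s" "t < 1" using e by linarith
      then show ?thesis
      proof cases
        case 1
        then have "S (src \<Gamma> e) (hclass \<Gamma> p (Vertex (src \<Gamma> e)) c)" using IH Seg c by auto
        then have "S (tgt \<Gamma> e) (hclass \<Gamma> p (Vertex (tgt \<Gamma> e)) (c @ [Seg e 0 1]))"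
          using X[of e "hclass \<Gamma> p (Vertex (src \<Gamma> e)) c"] e 1 by (auto simp: vpaths_def hclass_extend)
        then have S: "S (tgt \<Gamma> e) (hclass \<Gamma> p (Vertex (tgt \<Gamma> e)) (c @ [l]))" using Seg 1 by simp
        have y: "y = Vertex (tgt \<Gamma> e)" using full 1 by simp
        show ?thesis unfolding y using CV[OF S] .
      next
        case 2
        \<comment> \<open>The completion back to the source retraces exactly the segment just
          added.\<close>
        have "homotopic \<Gamma> (Vertex (src \<Gamma> e)) (Vertex (src \<Gamma> e)) [Seg e 0 t, Seg (bar \<Gamma> e) (1 - t) (1 - 0)] []"
          by (rule homotopic_move[OF move.cancel]) (use e 2 in auto)
        from homotopic_append[OF homotopic.refl[of \<Gamma> p c] this] e 2
        have "homotopic \<Gamma> p (Vertex (src \<Gamma> e)) ((c @ [l]) @ [Seg (bar \<Gamma> e) (1 - t) 1]) c" using Seg by simp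
        moreover have "S (src \<Gamma> e) (hclass \<Gamma> p (Vertex (src \<Gamma> e)) c)" using IH Seg c 2 by auto
        ultimately have S: "?H e t (c @ [l])" by (simp add: hclass_eqI)
        have t: "0 < t" "t < 1" using e 2 by auto
        show ?thesis unfolding full using C[OF S e(1) t] snoc.prems unfolding full .
      next
        case 3
        \<comment> \<open>Running on to the target is the completion of the old end in its other
          description.\<close>
        then have "?H e s c" using IH c Seg e by auto
        from other[OF this e(1)] have "S (tgt \<Gamma> e) (hclass \<Gamma> p (Vertex (tgt \<Gamma> e)) (c @ [Seg e s 1]))" using e 3 by simp
        then have S: "S (tgt \<Gamma> e) (hclass \<Gamma> p (Vertex (tgt \<Gamma> e)) (c @ [l]))" using Seg 3 by simp
        have y: "y = Vertex (tgt \<Gamma> e)" using full 3 by simp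
        show ?thesis unfolding y using CV[OF S] .
      next
        case 4
        let ?b = "bar \<Gamma> e"
        let ?x = "edge_point \<Gamma> e s"
        \<comment> \<open>Both ends are interior: the stretch from \<open>s\<close> to
          \<open>t\<close> is traversed and retraced, which leaves the completion of the old
          end.\<close>
        have "homotopic \<Gamma> ?x (Vertex (src \<Gamma> e)) ([Seg e s t] @ [Seg ?b (1 - t) (1 - s), Seg ?b (1 - s) 1] @ [])
          ([Seg e s t] @ [Seg ?b (1 - t) 1] @ [])"
          by (rule homotopic.step[OF move.subdivide]) (use e 4 in auto)
        moreover have "homotopic \<Gamma> ?x (Vertex (src \<Gamma> e)) ([] @ [Seg e s t, Seg ?b (1 - t) (1 - s)] @ [Seg ?b (1 - s) 1])
          ([] @ [] @ [Seg ?b (1 - s) 1])"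
          by (rule homotopic.step[OF move.cancel]) (use e 4 in auto)
        ultimately have "homotopic \<Gamma> ?x (Vertex (src \<Gamma> e)) [Seg e s t, Seg ?b (1 - t) 1] [Seg ?b (1 - s) 1]"
          by (auto intro: homotopic.sym homotopic.trans)
        from homotopic_append[OF homotopic.refl[OF e(5)] this]
        have "homotopic \<Gamma> p (Vertex (src \<Gamma> e)) ((c @ [l]) @ [Seg ?b (1 - t) 1]) (c @ [Seg ?b (1 - s) 1])"
          using Seg by simp
        moreover have "?H e s c" using IH c Seg e 4 by auto
        ultimately have S: "?H e t (c @ [l])" by (simp add: hclass_eqI)
        have t: "0 < t" "t < 1" using e 4 by auto
        show ?thesis unfolding full using C[OF S e(1) t] snoc.prems unfolding full .
      qed
    qed
  qed
  obtain c where "is_path \<Gamma> p c (Vertex v)" "A = hclass \<Gamma> p (Vertex v) c"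
    using \<open>A \<in> P v\<close> unfolding vpaths_def by (rule pclassesE)
  then show ?thesis using main by blast
qed

end

section \<open>Choices compatible with reversal\<close>

definition positive :: "('e \<Rightarrow> 'e) \<Rightarrow> 'e \<Rightarrow> bool" where
  "positive \<beta> e \<longleftrightarrow> (SOME x. x \<in> {e, \<beta> e}) = e"

text \<open>The choice operator is applied to the unordered pair, which is the same for an edge and
  its reverse, so it selects one and only one of the two.\<close>

lemma positive_flip:
  assumes "\<beta> (\<beta> e) = e" "\<beta> e \<noteq> e"
  shows "positive \<beta> (\<beta> e) \<longleftrightarrow> \<not> positive \<beta> e"
proof -
  have "(SOME x. x \<in> {e, \<beta> e}) \<in> {e, \<beta> e}" by (rule someI[of _ e]) simp
  then show ?thesis using assms by (auto simp: positive_def insert_commute)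
qed

text \<open>Choose freely on positive elements and transport by \<open>\<sigma>\<close> to their
  partners. Because \<open>\<sigma>\<close> undoes itself along \<open>\<beta>\<close>, the equation
  also holds when read from a non-positive element.\<close>

lemma equivariant_choice:
  assumes inv: "\<And>e. e \<in> E \<Longrightarrow> \<beta> e \<in> E \<and> \<beta> (\<beta> e) = e \<and> \<beta> e \<noteq> e"
    and ex: "\<And>e. e \<in> E \<Longrightarrow> \<exists>z. Q e z"
    and flip: "\<And>e z. e \<in> E \<Longrightarrow> Q e z \<Longrightarrow> Q (\<beta> e) (\<sigma> e z) \<and> \<sigma> (\<beta> e) (\<sigma> e z) = z"
  obtains s where "\<And>e. e \<in> E \<Longrightarrow> Q e (s e)" "\<And>e. e \<in> E \<Longrightarrow> s (\<beta> e) = \<sigma> e (s e)"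
proof
  let ?c = "\<lambda>e. SOME z. Q e z"
  let ?s = "\<lambda>e. if positive \<beta> e then ?c e else \<sigma> (\<beta> e) (?c (\<beta> e))"
  fix e assume e: "e \<in> E"
  have c: "Q e (?c e)" if "e \<in> E" for e using someI_ex[OF ex[OF that]] .
  have i: "\<beta> e \<in> E" "\<beta> (\<beta> e) = e" "\<beta> e \<noteq> e" using inv[OF e] by auto
  show "Q e (?s e)" using c[OF e] flip[OF i(1) c[OF i(1)]] i(2) by auto
  show "?s (\<beta> e) = \<sigma> e (?s e)"
    using positive_flip[OF i(2,3)] flip[OF i(1) c[OF i(1)]] i(2) by auto
qed

lemma (in gog) positive_bar: "e \<in> edges \<Gamma> \<Longrightarrow> positive (bar \<Gamma>) (bar \<Gamma> e) \<longleftrightarrow> \<not> positive (bar \<Gamma>) e"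
  by (rule positive_flip) simp_all

lemma (in gog) bar_equivariant_choice:
  assumes ex: "\<And>e. e \<in> edges \<Gamma> \<Longrightarrow> \<exists>z. Q e z"
    and flip: "\<And>e z. e \<in> edges \<Gamma> \<Longrightarrow> Q e z \<Longrightarrow> Q (bar \<Gamma> e) (\<sigma> e z) \<and> \<sigma> (bar \<Gamma> e) (\<sigma> e z) = z"
  obtains s where "\<And>e. e \<in> edges \<Gamma> \<Longrightarrow> Q e (s e)" "\<And>e. e \<in> edges \<Gamma> \<Longrightarrow> s (bar \<Gamma> e) = \<sigma> e (s e)"
proof -
  note result = that
  show thesis
  proof (rule equivariant_choice[of "edges \<Gamma>" "bar \<Gamma>" Q \<sigma>])
    show thesis if "\<And>e. e \<in> edges \<Gamma> \<Longrightarrow> Q e (s e)" "\<And>e. e \<in> edges \<Gamma> \<Longrightarrow> s (bar \<Gamma> e) = \<sigma> e (s e)" for s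
      using that by (rule result)
  qed (use ex flip in simp_all)
qed

section \<open>The universal property of the path classes\<close>

context pgog
begin

text \<open>The laws demanded of \<open>rv\<close> and \<open>ex\<close> are those that the unit,
  multiplication, cancellation and edge moves impose on paths, so that the effect of a path on a
  state depends on its homotopy class only. The map \<open>\<Phi>\<close> is the tool for separating
  path classes: whatever differs after \<open>\<Phi>\<close> differs before.\<close>

lemma vpaths_rec:
  fixes Y :: "'v \<Rightarrow> 's set"
  assumes root: "root_path \<Gamma> p u \<beta>" "y0 \<in> Y u"
    and rv_in: "\<And>v y g. \<lbrakk>v \<in> verts \<Gamma>; y \<in> Y v; g \<in> carrier (vgroup \<Gamma> v)\<rbrakk> \<Longrightarrow> rv v y g \<in> Y v"
    and rv_one: "\<And>v y. \<lbrakk>v \<in> verts \<Gamma>; y \<in> Y v\<rbrakk> \<Longrightarrow> rv v y \<one>\<^bsub>vgroup \<Gamma> v\<^esub> = y"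
    and rv_mult: "\<And>v y g g'. \<lbrakk>v \<in> verts \<Gamma>; y \<in> Y v; g \<in> carrier (vgroup \<Gamma> v); g' \<in> carrier (vgroup \<Gamma> v)\<rbrakk>
      \<Longrightarrow> rv v y (g \<otimes>\<^bsub>vgroup \<Gamma> v\<^esub> g') = rv v (rv v y g) g'"
    and ex_in: "\<And>e y. \<lbrakk>e \<in> edges \<Gamma>; y \<in> Y (src \<Gamma> e)\<rbrakk> \<Longrightarrow> ex e y \<in> Y (tgt \<Gamma> e)"
    and ex_bar: "\<And>e y. \<lbrakk>e \<in> edges \<Gamma>; y \<in> Y (src \<Gamma> e)\<rbrakk> \<Longrightarrow> ex (bar \<Gamma> e) (ex e y) = y"
    and ex_rv: "\<And>e y k. \<lbrakk>e \<in> edges \<Gamma>; y \<in> Y (src \<Gamma> e); k \<in> carrier (egroup \<Gamma> e)\<rbrakk>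
      \<Longrightarrow> ex e (rv (src \<Gamma> e) y (einj \<Gamma> (bar \<Gamma> e) k)) = rv (tgt \<Gamma> e) (ex e y) (einj \<Gamma> e k)"
  obtains \<Phi> :: "('v, 'e, 'g) pclass \<Rightarrow> 's" where
    "\<Phi> \<beta> = y0"
    "\<And>v A. A \<in> P v \<Longrightarrow> \<Phi> A \<in> Y v"
    "\<And>v A g. \<lbrakk>A \<in> P v; g \<in> carrier (vgroup \<Gamma> v)\<rbrakk> \<Longrightarrow> \<Phi> (R v A g) = rv v (\<Phi> A) g"
    "\<And>e A. \<lbrakk>e \<in> edges \<Gamma>; A \<in> P (src \<Gamma> e)\<rbrakk> \<Longrightarrow> \<Phi> (X e A) = ex e (\<Phi> A)"
proof -
  \<comment> \<open>Paths act on the union of the \<open>Y v\<close>, a positive edge acting when its end is reached and a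
    negative one when its start is left; then interior points carry the state of the source
    of the positive edge through them.\<close>
  define act :: "('v, 'e, 'g) letter \<Rightarrow> 's \<Rightarrow> 's" where
    "act l y = (case l of Elt v g \<Rightarrow> rv v y g
      | Seg e s t \<Rightarrow> if (if positive (bar \<Gamma>) e then t = 1 else s = 0) then ex e y else y)" for l y
  define acts where "acts c y = fold act c y" for c y
  define rt :: "('v, 'e) point \<Rightarrow> 'v" where
    "rt x = (case x of Vertex v \<Rightarrow> v | Interior S \<Rightarrow> src \<Gamma> (SOME e. \<exists>t. (e, t) \<in> S \<and> positive (bar \<Gamma>) e))" for x
  have rt_V [simp]: "rt (Vertex v) = v" for v by (simp add: rt_def)
  have rt_pos: "rt (edge_point \<Gamma> e t) = src \<Gamma> e"
    if "e \<in> edges \<Gamma>" "positive (bar \<Gamma>) e" "0 \<le> t" "t < 1" for e t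
  proof (cases "t = 0")
    case False
    have "(SOME e'. \<exists>t'. (e', t') \<in> {(e, t), (bar \<Gamma> e, 1 - t)} \<and> positive (bar \<Gamma>) e') = e"
      by (rule some_equality) (use that positive_bar[of e] in auto)
    then show ?thesis using that False by (simp add: rt_def edge_point_def)
  qed simp
  have rt_neg: "rt (edge_point \<Gamma> e t) = tgt \<Gamma> e"
    if "e \<in> edges \<Gamma>" "\<not> positive (bar \<Gamma>) e" "0 < t" "t \<le> 1" for e t
    using rt_pos[of "bar \<Gamma> e" "1 - t"] that positive_bar[of e] by simp
  have act_in: "act l y \<in> Y (rt (end_pt \<Gamma> l))" if "is_letter \<Gamma> l" "y \<in> Y (rt (start_pt \<Gamma> l))" for l y
  proof (cases l)
    case (Elt v g)
    then show ?thesis using that rv_in by (simp add: act_def)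
  next
    case (Seg e s t)
    then show ?thesis
      using that rt_pos[of e s] rt_pos[of e t] rt_neg[of e s] rt_neg[of e t] ex_in[of e y]
      by (cases "positive (bar \<Gamma>) e"; cases "s = 0"; cases "t = 1") (auto simp: act_def)
  qed
  have acts_in: "acts c y \<in> Y (rt z)" if "is_path \<Gamma> x c z" "y \<in> Y (rt x)" for x c z y
    using that by (induction c arbitrary: x y) (auto simp: acts_def intro: act_in)
  have move: "acts a y = acts b y"
    if "move \<Gamma> a b" "is_path \<Gamma> x a z" "is_path \<Gamma> x b z" "y \<in> Y (rt x)" for a b x z y
    using that
  proof (induction rule: move.induct)
    case (mult v g g')
    then show ?case using rv_mult by (auto simp: acts_def act_def)
  next
    case (unit v)
    then show ?case using rv_one by (auto simp: acts_def act_def)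
  next
    \<comment> \<open>The dividing parameter is interior, so the crossing of the edge is charged to
      one piece only, and to one precisely if the undivided segment carries it.\<close>
    case (subdivide e s t u)
    then show ?case by (auto simp: acts_def act_def)
  next
    case (cancel e s t)
    then have e: "e \<in> edges \<Gamma>" "0 \<le> s" "s < t" "t \<le> 1" "x = edge_point \<Gamma> e s" by auto
    \<comment> \<open>A segment that crosses the edge starts with a state over the source, which is
      what \<open>ex_bar\<close> needs.\<close>
    have "y \<in> Y (src \<Gamma> e)" if "if positive (bar \<Gamma>) e then t = 1 else s = 0"
      using cancel.prems(3) e rt_pos[of e s] that by (auto split: if_splits)
    then show ?case using positive_bar[OF e(1)] ex_bar[OF e(1), of y] e by (auto simp: acts_def act_def)
  next
    case (edge h e)
    then show ?case using ex_rv by (auto simp: acts_def act_def)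
  qed
  have hom: "acts c y = acts d y" if "homotopic \<Gamma> x z c d" "y \<in> Y (rt x)" for x z c d y
    using that
  proof (induction rule: homotopic.induct)
    case (step a b c d)
    obtain x1 z1 where 1: "is_path \<Gamma> x c x1" "is_path \<Gamma> x1 a z1" "is_path \<Gamma> z1 d z"
      using step by (auto simp: is_path_append)
    obtain x2 z2 where 2: "is_path \<Gamma> x c x2" "is_path \<Gamma> x2 b z2"
      using step by (auto simp: is_path_append)
    have x2: "x2 = x1" using is_path_end 1 2 by blast
    have "z1 = z2 \<or> a = b"
      using step.hyps(1) 1(2) 2(2) unfolding x2 by (cases rule: move.cases) auto
    then have "acts a (acts c y) = acts b (acts c y)"
      using move[OF step.hyps(1) 1(2) _ acts_in[OF 1(1) step.prems]] 2 x2 by auto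
    then show ?case by (simp add: acts_def)
  qed auto
  have core: "acts c y = acts d y" if "A \<in> P v" "c \<in> A" "d \<in> A" "y \<in> Y (rt p)" for v A c d y
    using hom[of p "Vertex v" c d y] pclass_memE[of A \<Gamma> p "Vertex v"] that
    unfolding vpaths_def by (metis hclass_eq_iff)
  \<comment> \<open>The state at the base point must lead to \<open>y0\<close> along the root path.
    Inside an edge, states belong to the source of the positive edge; if \<open>e\<close> is
    negative that is the target of \<open>e\<close>, and \<open>y0\<close> is first moved
    across.\<close>
  obtain y1 c1 where y1: "y1 \<in> Y (rt p)"
    and c1: "is_path \<Gamma> p c1 (Vertex u)" "\<beta> = hclass \<Gamma> p (Vertex u) c1" "acts c1 y1 = y0"
  proof -
    from root(1) show ?thesis unfolding root_path_def
    proof (elim disjE exE conjE)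
      assume "p = Vertex u" "\<beta> = hclass \<Gamma> p p []"
      then show ?thesis using that[of y0 "[]"] root(2) p_in by (simp add: acts_def)
    next
      fix e t assume *: "e \<in> edges \<Gamma>" "0 < t" "t < 1" "p = edge_point \<Gamma> e t" "u = src \<Gamma> e"
        "\<beta> = initial_seg \<Gamma> p e t"
      let ?y1 = "if positive (bar \<Gamma>) e then y0 else ex e y0"
      have "acts [Seg (bar \<Gamma> e) (1 - t) 1] ?y1 = y0"
        using * root(2) ex_bar[OF *(1)] positive_bar[OF *(1)] by (auto simp: acts_def act_def)
      moreover have "?y1 \<in> Y (rt p)" using * root(2) ex_in[OF *(1)] rt_pos[of e t] rt_neg[of e t] by auto
      ultimately show ?thesis
        by (intro that) (use initial_seg_path[OF *(1-4)] *(5,6) in \<open>auto simp only: initial_seg_def\<close>)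
    qed
  qed
  \<comment> \<open>By \<open>core\<close> all representatives of a class yield the same state, so
    an arbitrary one may be evaluated.\<close>
  define \<Phi> where "\<Phi> A = acts (SOME c. c \<in> A) y1" for A
  have \<Phi>: "\<Phi> A = acts c y1" if "A \<in> P v" "c \<in> A" for A v c
    unfolding \<Phi>_def by (rule core[OF that(1) _ that(2) y1]) (use that in \<open>metis someI_ex\<close>)
  have \<Phi>h: "\<Phi> (hclass \<Gamma> p (Vertex v) c) = acts c y1" if "is_path \<Gamma> p c (Vertex v)" for v c
    by (rule \<Phi>[of _ v]) (use that hclass_in[OF that] in \<open>auto simp: vpaths_def hclass_def intro: homotopic.refl\<close>)
  show ?thesis
  proof (rule that[of \<Phi>])
    show "\<Phi> \<beta> = y0" using \<Phi>h[OF c1(1)] c1 by simp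
    show "\<Phi> A \<in> Y v" if A: "A \<in> P v" for v A
    proof -
      obtain c where "is_path \<Gamma> p c (Vertex v)" "A = hclass \<Gamma> p (Vertex v) c"
        using A unfolding vpaths_def by (rule pclassesE)
      then show ?thesis using \<Phi>h[of c v] acts_in[of p c "Vertex v" y1] y1 by simp
    qed
    show "\<Phi> (R v A g) = rv v (\<Phi> A) g" if A: "A \<in> P v" and g: "g \<in> carrier (vgroup \<Gamma> v)" for v A g
    proof -
      obtain c where c: "is_path \<Gamma> p c (Vertex v)" "A = hclass \<Gamma> p (Vertex v) c"
        using A unfolding vpaths_def by (rule pclassesE)
      have "is_path \<Gamma> p (c @ [Elt v g]) (Vertex v)"
        using c g vpaths_vert[OF A] by (auto simp: is_path_append)
      then show ?thesis using c g by (simp add: hclass_ract \<Phi>h) (simp add: acts_def act_def)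
    qed
    show "\<Phi> (X e A) = ex e (\<Phi> A)" if e: "e \<in> edges \<Gamma>" and A: "A \<in> P (src \<Gamma> e)" for e A
    proof -
      obtain c where c: "is_path \<Gamma> p c (Vertex (src \<Gamma> e))" "A = hclass \<Gamma> p (Vertex (src \<Gamma> e)) c"
        using A unfolding vpaths_def by (rule pclassesE)
      have "is_path \<Gamma> p (c @ [Seg e 0 1]) (Vertex (tgt \<Gamma> e))"
        using c e by (auto simp: is_path_append)
      then show ?thesis using c e by (simp add: hclass_extend \<Phi>h) (simp add: acts_def act_def)
    qed
  qed
qed

end

section \<open>Vertex groups embed\<close>

text \<open>With \<open>Z\<close> infinite and large, the free right \<open>E\<close>-set \<open>G \<times> Z\<close> has as many orbits as \<open>Z\<close>.\<close>

lemma free_action_trivialisation: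
  fixes i :: "'h \<Rightarrow> 'g"
  assumes "group E" "group G" "i \<in> mon E G"
  obtains \<delta> :: "'g \<times> ('g \<times> nat) \<Rightarrow> ('g \<times> nat) \<times> 'h"
  where "bij_betw \<delta> (carrier G \<times> UNIV) (UNIV \<times> carrier E)"
    "\<And>x z k. \<lbrakk>x \<in> carrier G; k \<in> carrier E\<rbrakk>
      \<Longrightarrow> \<delta> (x \<otimes>\<^bsub>G\<^esub> i k, z) = (fst (\<delta> (x, z)), snd (\<delta> (x, z)) \<otimes>\<^bsub>E\<^esub> k)"
proof -
  interpret E: group E by fact
  interpret G: group G by fact
  interpret i: group_hom E G i using assms by unfold_locales (auto simp: mon_def)
  have inj: "k = k'" if "i k = i k'" "k \<in> carrier E" "k' \<in> carrier E" for k k'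
    using assms(3) that by (auto simp: mon_def inj_on_def)
  \<comment> \<open>\<open>C x\<close> is the coset of \<open>x\<close> by the image of
    \<open>i\<close>, \<open>c x\<close> a representative that depends on the coset alone, and
    \<open>j x\<close> the element of \<open>E\<close> leading from it to \<open>x\<close>.\<close>
  define C where "C x = (\<lambda>k. x \<otimes>\<^bsub>G\<^esub> i k) ` carrier E" for x
  define c where "c x = (SOME y. y \<in> C x)" for x
  define j where "j x = (SOME k. k \<in> carrier E \<and> x = c x \<otimes>\<^bsub>G\<^esub> i k)" for x
  define T where "T = c ` carrier G"
  have C: "C (x \<otimes>\<^bsub>G\<^esub> i k) = C x" if "x \<in> carrier G" "k \<in> carrier E" for x k
  proof
    show "C (x \<otimes>\<^bsub>G\<^esub> i k) \<subseteq> C x"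
      using that by (auto simp: C_def G.m_assoc simp flip: i.hom_mult)
    show "C x \<subseteq> C (x \<otimes>\<^bsub>G\<^esub> i k)"
    proof
      fix y assume "y \<in> C x"
      then obtain k' where k': "k' \<in> carrier E" "y = x \<otimes>\<^bsub>G\<^esub> i k'" by (auto simp: C_def)
      have "k' = k \<otimes>\<^bsub>E\<^esub> (inv\<^bsub>E\<^esub> k \<otimes>\<^bsub>E\<^esub> k')" using k' that by (simp flip: E.m_assoc)
      then have "y = x \<otimes>\<^bsub>G\<^esub> i (k \<otimes>\<^bsub>E\<^esub> (inv\<^bsub>E\<^esub> k \<otimes>\<^bsub>E\<^esub> k'))" using k' by simp
      also have "\<dots> = x \<otimes>\<^bsub>G\<^esub> i k \<otimes>\<^bsub>G\<^esub> i (inv\<^bsub>E\<^esub> k \<otimes>\<^bsub>E\<^esub> k')"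
        using k' that by (simp add: G.m_assoc del: i.hom_inv)
      finally show "y \<in> C (x \<otimes>\<^bsub>G\<^esub> i k)" unfolding C_def using k' that by blast
    qed
  qed
  have cx: "\<exists>k\<in>carrier E. c x = x \<otimes>\<^bsub>G\<^esub> i k" if "x \<in> carrier G" for x
  proof -
    have "x \<otimes>\<^bsub>G\<^esub> i \<one>\<^bsub>E\<^esub> \<in> C x" unfolding C_def by blast
    then have "c x \<in> C x" unfolding c_def by (rule someI)
    then show ?thesis by (auto simp: C_def)
  qed
  have c_in: "c x \<in> carrier G" if "x \<in> carrier G" for x using cx[OF that] that by auto
  have c_mult: "c (x \<otimes>\<^bsub>G\<^esub> i k) = c x" if "x \<in> carrier G" "k \<in> carrier E" for x k
    using C[OF that] by (simp add: c_def)
  have c_c: "c (c x) = c x" if "x \<in> carrier G" for x using cx[OF that] c_mult[OF that] by auto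
  have jx: "j x \<in> carrier E" "c x \<otimes>\<^bsub>G\<^esub> i (j x) = x" if x: "x \<in> carrier G" for x
  proof -
    obtain k where k: "k \<in> carrier E" "c x = x \<otimes>\<^bsub>G\<^esub> i k" using cx[OF x] by blast
    have "x = c x \<otimes>\<^bsub>G\<^esub> i (inv\<^bsub>E\<^esub> k)" using k(1) x by (simp add: k(2) G.m_assoc)
    then have "\<exists>k. k \<in> carrier E \<and> x = c x \<otimes>\<^bsub>G\<^esub> i k" using k(1) by blast
    from someI_ex[OF this, folded j_def]
    show "j x \<in> carrier E" "c x \<otimes>\<^bsub>G\<^esub> i (j x) = x" by simp_all
  qed
  have j_uniq: "j (t \<otimes>\<^bsub>G\<^esub> i k) = k" if "t \<in> T" "k \<in> carrier E" for t k
  proof -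
    have t: "t \<in> carrier G" "c t = t" using that c_in c_c by (auto simp: T_def)
    then have tk: "t \<otimes>\<^bsub>G\<^esub> i k \<in> carrier G" using that by simp
    have "t \<otimes>\<^bsub>G\<^esub> i (j (t \<otimes>\<^bsub>G\<^esub> i k)) = t \<otimes>\<^bsub>G\<^esub> i k"
      using jx(2)[OF tk] c_mult[OF t(1) that(2)] t(2) by simp
    then have "i (j (t \<otimes>\<^bsub>G\<^esub> i k)) = i k" using t(1) that(2) jx(1)[OF tk] by simp
    then show ?thesis using that(2) jx(1)[OF tk] inj by blast
  qed
  \<comment> \<open>The transversal \<open>T\<close> is nonempty and no larger than the infinite set
    of all pairs in \<open>'g \<times> nat\<close>, so its product with that set has the size of the
    set.\<close>
  have "\<exists>\<beta> :: 'g \<times> ('g \<times> nat) \<Rightarrow> 'g \<times> nat. bij_betw \<beta> (T \<times> UNIV) UNIV"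
  proof -
    include cardinal_syntax
    have "T \<noteq> {}" using G.one_closed by (auto simp: T_def)
    moreover have "|T| \<le>o |UNIV :: ('g \<times> nat) set|"
      by (rule card_of_ordLeqI[of "\<lambda>x. (x, 0)"]) (auto simp: inj_on_def)
    moreover have "infinite (UNIV :: ('g \<times> nat) set)" by (simp add: finite_prod)
    ultimately have "|T \<times> (UNIV :: ('g \<times> nat) set)| =o |UNIV :: ('g \<times> nat) set|"
      by (intro card_of_Times_infinite[THEN conjunct2])
    then show ?thesis by (simp add: card_of_ordIso)
  qed
  then obtain \<beta> :: "'g \<times> ('g \<times> nat) \<Rightarrow> 'g \<times> nat" where \<beta>: "bij_betw \<beta> (T \<times> UNIV) UNIV" by blast
  \<comment> \<open>The first component names the orbit of \<open>(x, z)\<close>, by an element of a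
    set that does not depend on \<open>E\<close>, \<open>G\<close> or \<open>i\<close>; the second
    is the coordinate inside the orbit.\<close>
  define \<delta> where "\<delta> = (\<lambda>(x, z). (\<beta> (c x, z), j x))"
  have "bij_betw \<delta> (carrier G \<times> UNIV) (UNIV \<times> carrier E)"
    unfolding bij_betw_def
  proof
    show "inj_on \<delta> (carrier G \<times> UNIV)"
    proof (rule inj_onI, clarsimp simp: \<delta>_def)
      fix x a b x' a' b'
      assume x: "x \<in> carrier G" "x' \<in> carrier G" and eq: "\<beta> (c x, a, b) = \<beta> (c x', a', b')" "j x = j x'"
      have *: "c x = c x'" "a = a'" "b = b'"
        using inj_onD[OF bij_betw_imp_inj_on[OF \<beta>] eq(1)] x by (auto simp: T_def)
      have "x = c x' \<otimes>\<^bsub>G\<^esub> i (j x')" unfolding *(1)[symmetric] eq(2)[symmetric] by (rule jx(2)[OF x(1), symmetric])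
      then have "x = x'" using jx(2)[OF x(2)] by metis
      then show "x = x' \<and> a = a' \<and> b = b'" using * by blast
    qed
    have "(w, k) \<in> \<delta> ` (carrier G \<times> UNIV)" if k: "k \<in> carrier E" for w k
    proof -
      obtain t z where t: "t \<in> T" "w = \<beta> (t, z)" using bij_betw_imp_surj_on[OF \<beta>] by blast
      then have "t \<in> carrier G" "c t = t" using c_in c_c by (auto simp: T_def)
      then have "\<delta> (t \<otimes>\<^bsub>G\<^esub> i k, z) = (w, k)" "t \<otimes>\<^bsub>G\<^esub> i k \<in> carrier G"
        using t k c_mult j_uniq by (auto simp: \<delta>_def)
      then show ?thesis by (metis SigmaI UNIV_I image_eqI)
    qed
    then show "\<delta> ` (carrier G \<times> UNIV) = UNIV \<times> carrier E" using jx(1) by (auto simp: \<delta>_def)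
  qed
  moreover have "\<delta> (x \<otimes>\<^bsub>G\<^esub> i k, z) = (fst (\<delta> (x, z)), snd (\<delta> (x, z)) \<otimes>\<^bsub>E\<^esub> k)"
    if "x \<in> carrier G" "k \<in> carrier E" for x z k
  proof -
    have "x \<otimes>\<^bsub>G\<^esub> i k = c x \<otimes>\<^bsub>G\<^esub> i (j x) \<otimes>\<^bsub>G\<^esub> i k" using jx(2)[OF that(1)] by simp
    also have "\<dots> = c x \<otimes>\<^bsub>G\<^esub> i (j x \<otimes>\<^bsub>E\<^esub> k)"
      using jx(1)[OF that(1)] that c_in[OF that(1)] by (simp add: G.m_assoc)
    finally have "j (x \<otimes>\<^bsub>G\<^esub> i k) = j (c x \<otimes>\<^bsub>G\<^esub> i (j x \<otimes>\<^bsub>E\<^esub> k))" by (rule arg_cong)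
    also have "\<dots> = j x \<otimes>\<^bsub>E\<^esub> k"
      by (rule j_uniq) (use jx(1)[OF that(1)] that in \<open>auto simp: T_def\<close>)
    finally show ?thesis using c_mult that by (simp add: \<delta>_def)
  qed
  ultimately show ?thesis using that by blast
qed

text \<open>Each vertex carries copies of its group, indexed by one set common to all vertices. Seen
  as free sets for an edge group, the two ends of an edge then have orbits indexed by the same set,
  so they are equivariantly in bijection and the edges can be made to act. In this family right
  multiplication is free, and \<open>\<Phi>\<close> carries the given equation there. In effect the
  vertex groups embed in the groupoid of path classes.\<close>

lemma (in pgog) ract_free:
  assumes A: "A \<in> P v" and g: "g \<in> carrier (vgroup \<Gamma> v)" "g' \<in> carrier (vgroup \<Gamma> v)"
    and eq: "R v A g = R v A g'"
  shows "g = g'"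
proof -
  let ?G = "\<lambda>v. carrier (vgroup \<Gamma> v)"
  define Y :: "'v \<Rightarrow> ('g \<times> ('g \<times> nat)) set" where "Y v = ?G v \<times> UNIV" for v
  define rv where "rv v y g = (fst y \<otimes>\<^bsub>vgroup \<Gamma> v\<^esub> g, snd y)" for v and y :: "'g \<times> ('g \<times> nat)" and g
  have "\<exists>\<delta> :: 'g \<times> ('g \<times> nat) \<Rightarrow> ('g \<times> nat) \<times> 'h. bij_betw \<delta> (?G (tgt \<Gamma> e) \<times> UNIV) (UNIV \<times> carrier (egroup \<Gamma> e)) \<and>
    (\<forall>x\<in>?G (tgt \<Gamma> e). \<forall>z. \<forall>k\<in>carrier (egroup \<Gamma> e). \<delta> (x \<otimes>\<^bsub>vgroup \<Gamma> (tgt \<Gamma> e)\<^esub> einj \<Gamma> e k, z)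
        = (fst (\<delta> (x, z)), snd (\<delta> (x, z)) \<otimes>\<^bsub>egroup \<Gamma> e\<^esub> k))"
    if "e \<in> edges \<Gamma>" for e
    by (rule free_action_trivialisation[OF egroup_group[OF that] vgroup_group[OF tgt_in[OF that]] einj_mon[OF that]])
      blast
  then obtain \<delta> :: "'e \<Rightarrow> 'g \<times> ('g \<times> nat) \<Rightarrow> ('g \<times> nat) \<times> 'h" where
    \<delta>_bij: "\<And>e. e \<in> edges \<Gamma> \<Longrightarrow> bij_betw (\<delta> e) (Y (tgt \<Gamma> e)) (UNIV \<times> carrier (egroup \<Gamma> e))"
    and \<delta>_mult: "\<And>e y k. \<lbrakk>e \<in> edges \<Gamma>; y \<in> Y (tgt \<Gamma> e); k \<in> carrier (egroup \<Gamma> e)\<rbrakk> \<Longrightarrow>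
      \<delta> e (rv (tgt \<Gamma> e) y (einj \<Gamma> e k)) = (fst (\<delta> e y), snd (\<delta> e y) \<otimes>\<^bsub>egroup \<Gamma> e\<^esub> k)"
    unfolding Y_def rv_def by (auto simp: Bex_def) metis
  \<comment> \<open>Both ends are identified with orbits times edge group, by
    \<open>\<delta>\<close> of the edge and of its reverse. Reversing the edge exchanges these two
    bijections and so inverts the map.\<close>
  define ex where "ex e y = inv_into (Y (tgt \<Gamma> e)) (\<delta> e) (\<delta> (bar \<Gamma> e) y)" for e y
  have \<delta>_in: "\<delta> e y \<in> UNIV \<times> carrier (egroup \<Gamma> e)" if "e \<in> edges \<Gamma>" "y \<in> Y (tgt \<Gamma> e)" for e y
    using \<delta>_bij[OF that(1)] that(2) by (auto simp: bij_betw_def)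
  have \<delta>_bar_in: "\<delta> (bar \<Gamma> e) y \<in> UNIV \<times> carrier (egroup \<Gamma> e)" if "e \<in> edges \<Gamma>" "y \<in> Y (src \<Gamma> e)" for e y
    using \<delta>_in[of "bar \<Gamma> e" y] that by simp
  have ex_in: "ex e y \<in> Y (tgt \<Gamma> e)" and \<delta>_ex: "\<delta> e (ex e y) = \<delta> (bar \<Gamma> e) y"
    if "e \<in> edges \<Gamma>" "y \<in> Y (src \<Gamma> e)" for e y
  proof -
    have i: "\<delta> (bar \<Gamma> e) y \<in> \<delta> e ` Y (tgt \<Gamma> e)"
      using \<delta>_bar_in[OF that] bij_betw_imp_surj_on[OF \<delta>_bij[OF that(1)]] by simp
    show "ex e y \<in> Y (tgt \<Gamma> e)" "\<delta> e (ex e y) = \<delta> (bar \<Gamma> e) y"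
      unfolding ex_def using inv_into_into[OF i] f_inv_into_f[OF i] by auto
  qed
  have \<delta>_inj: "y = y'" if "e \<in> edges \<Gamma>" "y \<in> Y (tgt \<Gamma> e)" "y' \<in> Y (tgt \<Gamma> e)" "\<delta> e y = \<delta> e y'" for e y y'
    using \<delta>_bij[OF that(1)] that by (auto simp: bij_betw_def inj_on_def)
  have rv_in: "rv v y g \<in> Y v" if "v \<in> verts \<Gamma>" "y \<in> Y v" "g \<in> ?G v" for v y g
    using that by (auto simp: Y_def rv_def)
  obtain u \<beta> where root: "root_path \<Gamma> p u \<beta>" using root_exists by blast
  have u: "u \<in> verts \<Gamma>" using root_in[OF root] vpaths_vert by blast
  have y0: "(\<one>\<^bsub>vgroup \<Gamma> u\<^esub>, undefined) \<in> Y u" using u by (simp add: Y_def)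
  obtain \<Phi> where \<Phi>: "\<And>v A. A \<in> P v \<Longrightarrow> \<Phi> A \<in> Y v"
    "\<And>v A g. \<lbrakk>A \<in> P v; g \<in> ?G v\<rbrakk> \<Longrightarrow> \<Phi> (R v A g) = rv v (\<Phi> A) g"
  proof (rule vpaths_rec[where Y = Y and rv = rv and ex = ex, OF root y0])
    show "rv v y \<one>\<^bsub>vgroup \<Gamma> v\<^esub> = y" if "v \<in> verts \<Gamma>" "y \<in> Y v" for v y
      using that vgroup_group[of v] by (auto simp: Y_def rv_def group.is_monoid monoid.r_one)
    show "rv v y (g \<otimes>\<^bsub>vgroup \<Gamma> v\<^esub> g') = rv v (rv v y g) g'"
      if "v \<in> verts \<Gamma>" "y \<in> Y v" "g \<in> ?G v" "g' \<in> ?G v" for v y g g'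
      using that vgroup_group[of v] by (auto simp: Y_def rv_def group.is_monoid monoid.m_assoc)
    show "ex (bar \<Gamma> e) (ex e y) = y" if e: "e \<in> edges \<Gamma>" and y: "y \<in> Y (src \<Gamma> e)" for e y
    proof (rule \<delta>_inj[of "bar \<Gamma> e"])
      show "ex (bar \<Gamma> e) (ex e y) \<in> Y (tgt \<Gamma> (bar \<Gamma> e))" "\<delta> (bar \<Gamma> e) (ex (bar \<Gamma> e) (ex e y)) = \<delta> (bar \<Gamma> e) y"
        using ex_in[of "bar \<Gamma> e" "ex e y"] \<delta>_ex[of "bar \<Gamma> e" "ex e y"] ex_in[OF e y] \<delta>_ex[OF e y] e by auto
    qed (use e y in auto)
    show "ex e (rv (src \<Gamma> e) y (einj \<Gamma> (bar \<Gamma> e) k)) = rv (tgt \<Gamma> e) (ex e y) (einj \<Gamma> e k)"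
      if e: "e \<in> edges \<Gamma>" and y: "y \<in> Y (src \<Gamma> e)" and k: "k \<in> carrier (egroup \<Gamma> e)" for e y k
    proof (rule \<delta>_inj[of e])
      have i: "rv (src \<Gamma> e) y (einj \<Gamma> (bar \<Gamma> e) k) \<in> Y (src \<Gamma> e)" using rv_in e y k by simp
      show "ex e (rv (src \<Gamma> e) y (einj \<Gamma> (bar \<Gamma> e) k)) \<in> Y (tgt \<Gamma> e)" by (rule ex_in[OF e i])
      show "\<delta> e (ex e (rv (src \<Gamma> e) y (einj \<Gamma> (bar \<Gamma> e) k))) = \<delta> e (rv (tgt \<Gamma> e) (ex e y) (einj \<Gamma> e k))"
        using \<delta>_ex[OF e i] \<delta>_mult[OF e ex_in[OF e y] k] \<delta>_ex[OF e y] \<delta>_mult[of "bar \<Gamma> e" y k] e y k by simp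
    qed (use e y k rv_in ex_in in auto)
  qed (use rv_in ex_in in auto)
  interpret G: group "vgroup \<Gamma> v" using A by (intro vgroup_group vpaths_vert)
  have "fst (\<Phi> A) \<in> ?G v" "fst (\<Phi> A) \<otimes>\<^bsub>vgroup \<Gamma> v\<^esub> g = fst (\<Phi> A) \<otimes>\<^bsub>vgroup \<Gamma> v\<^esub> g'"
    using \<Phi>(1)[OF A] \<Phi>(2)[OF A g(1)] \<Phi>(2)[OF A g(2)] eq by (auto simp: Y_def rv_def)
  then show ?thesis using g by simp
qed

section \<open>Morphisms and path classes\<close>

text \<open>\<open>induced_hom\<close> for arbitrary end points in the target: the arguments run on
  classes of paths to vertices, of which the loops are only the operators.\<close>

definition pmap ::
  "('v, 'e, 'g, 'h) graph_of_groups \<Rightarrow> ('w, 'f, 'k, 'l) graph_of_groups \<Rightarrow>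
     ('v, 'e, 'g, 'h, 'w, 'f, 'k, 'l) gmorphism \<Rightarrow> ('w, 'f) point \<Rightarrow> ('w, 'f) point \<Rightarrow>
     ('v, 'e, 'g) pclass \<Rightarrow> ('w, 'f, 'k) pclass" where
  "pmap \<Lambda> \<Gamma> f x y A = {d. \<exists>c\<in>A. homotopic \<Gamma> x y (map_path \<Lambda> \<Gamma> f c) d}"

lemma induced_hom_pmap: "induced_hom \<Lambda> q \<Gamma> p f = pmap \<Lambda> \<Gamma> f p p"
  by (simp add: fun_eq_iff induced_hom_def pmap_def)

lemma is_path_start: "is_path \<Gamma> x c y \<Longrightarrow> is_path \<Gamma> x' c y \<Longrightarrow> x = x'"
  by (cases c) auto

locale gog_morphism = L: gog \<Lambda> + G: gog \<Gamma>
  for \<Lambda> :: "('v, 'e, 'g, 'h) graph_of_groups" and \<Gamma> :: "('w, 'f, 'k, 'l) graph_of_groups" +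
  fixes f :: "('v, 'e, 'g, 'h, 'w, 'f, 'k, 'l) gmorphism"
  assumes mor: "morphism \<Lambda> \<Gamma> f"
begin

abbreviation mp where "mp \<equiv> map_point (vmap f) (emap f)"

lemma vmap_in [simp]: "v \<in> verts \<Lambda> \<Longrightarrow> vmap f v \<in> verts \<Gamma>"
  and vhom_hom: "v \<in> verts \<Lambda> \<Longrightarrow> vhom f v \<in> hom (vgroup \<Lambda> v) (vgroup \<Gamma> (vmap f v))"
  and emap_in [simp]: "e \<in> edges \<Lambda> \<Longrightarrow> emap f e \<in> edges \<Gamma>"
  and emap_bar [simp]: "e \<in> edges \<Lambda> \<Longrightarrow> emap f (bar \<Lambda> e) = bar \<Gamma> (emap f e)"
  and tgt_emap [simp]: "e \<in> edges \<Lambda> \<Longrightarrow> tgt \<Gamma> (emap f e) = vmap f (tgt \<Lambda> e)"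
  and ehom_hom: "e \<in> edges \<Lambda> \<Longrightarrow> ehom f e \<in> hom (egroup \<Lambda> e) (egroup \<Gamma> (emap f e))"
  and ehom_bar [simp]: "e \<in> edges \<Lambda> \<Longrightarrow> k \<in> carrier (egroup \<Lambda> e) \<Longrightarrow> ehom f (bar \<Lambda> e) k = ehom f e k"
  using mor by (auto simp: morphism_def)

lemma twist_in [simp]: "e \<in> edges \<Lambda> \<Longrightarrow> twist f e \<in> carrier (vgroup \<Gamma> (vmap f (tgt \<Lambda> e)))"
  using mor tgt_emap unfolding morphism_def by metis

lemma src_emap [simp]: "e \<in> edges \<Lambda> \<Longrightarrow> src \<Gamma> (emap f e) = vmap f (src \<Lambda> e)"
  using tgt_emap[of "bar \<Lambda> e"] by simp

lemma twist_bar_in [simp]: "e \<in> edges \<Lambda> \<Longrightarrow> twist f (bar \<Lambda> e) \<in> carrier (vgroup \<Gamma> (vmap f (src \<Lambda> e)))"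
  using twist_in[of "bar \<Lambda> e"] by simp

lemma vhom_in [simp]: "v \<in> verts \<Lambda> \<Longrightarrow> g \<in> carrier (vgroup \<Lambda> v) \<Longrightarrow> vhom f v g \<in> carrier (vgroup \<Gamma> (vmap f v))"
  using vhom_hom[of v] by (auto simp: hom_def)

lemma vhom_mult: "\<lbrakk>v \<in> verts \<Lambda>; g \<in> carrier (vgroup \<Lambda> v); g' \<in> carrier (vgroup \<Lambda> v)\<rbrakk>
   \<Longrightarrow> vhom f v (g \<otimes>\<^bsub>vgroup \<Lambda> v\<^esub> g') = vhom f v g \<otimes>\<^bsub>vgroup \<Gamma> (vmap f v)\<^esub> vhom f v g'"
  using vhom_hom[of v] by (auto simp: hom_def)

lemma vhom_one [simp]: "v \<in> verts \<Lambda> \<Longrightarrow> vhom f v \<one>\<^bsub>vgroup \<Lambda> v\<^esub> = \<one>\<^bsub>vgroup \<Gamma> (vmap f v)\<^esub>"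
  using vhom_hom[of v] L.vgroup_group[of v] G.vgroup_group[of "vmap f v"] by (simp add: hom_one)

lemma vhom_inv: "\<lbrakk>v \<in> verts \<Lambda>; g \<in> carrier (vgroup \<Lambda> v)\<rbrakk>
    \<Longrightarrow> vhom f v (inv\<^bsub>vgroup \<Lambda> v\<^esub> g) = inv\<^bsub>vgroup \<Gamma> (vmap f v)\<^esub> vhom f v g"
  by (meson vhom_hom L.vgroup_group G.vgroup_group vmap_in group_hom.hom_inv group_hom.intro
      group_hom_axioms.intro)

lemma ehom_in [simp]: "e \<in> edges \<Lambda> \<Longrightarrow> k \<in> carrier (egroup \<Lambda> e) \<Longrightarrow> ehom f e k \<in> carrier (egroup \<Gamma> (emap f e))"
  using ehom_hom[of e] by (auto simp: hom_def)

lemma vhom_einj: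
  assumes "e \<in> edges \<Lambda>" "k \<in> carrier (egroup \<Lambda> e)"
  shows "vhom f (tgt \<Lambda> e) (einj \<Lambda> e k) \<otimes>\<^bsub>vgroup \<Gamma> (vmap f (tgt \<Lambda> e))\<^esub> twist f e
    = twist f e \<otimes>\<^bsub>vgroup \<Gamma> (vmap f (tgt \<Lambda> e))\<^esub> einj \<Gamma> (emap f e) (ehom f e k)"
proof -
  interpret V: group "vgroup \<Gamma> (vmap f (tgt \<Lambda> e))" using assms by (intro G.vgroup_group) simp
  have "einj \<Gamma> (emap f e) (ehom f e k) \<in> carrier (vgroup \<Gamma> (vmap f (tgt \<Lambda> e)))"
    using G.einj_in[of "emap f e" "ehom f e k"] assms by simp
  moreover have "vhom f (tgt \<Lambda> e) (einj \<Lambda> e k) =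
             twist f e \<otimes>\<^bsub>vgroup \<Gamma> (vmap f (tgt \<Lambda> e))\<^esub> einj \<Gamma> (emap f e) (ehom f e k)
               \<otimes>\<^bsub>vgroup \<Gamma> (vmap f (tgt \<Lambda> e))\<^esub> inv\<^bsub>vgroup \<Gamma> (vmap f (tgt \<Lambda> e))\<^esub> twist f e"
    using mor assms tgt_emap unfolding morphism_def by metis
  ultimately show ?thesis using assms by (simp add: V.m_assoc)
qed

lemma vhom_einj_bar:
  assumes "e \<in> edges \<Lambda>" "k \<in> carrier (egroup \<Lambda> e)"
  shows "vhom f (src \<Lambda> e) (einj \<Lambda> (bar \<Lambda> e) k) \<otimes>\<^bsub>vgroup \<Gamma> (vmap f (src \<Lambda> e))\<^esub> twist f (bar \<Lambda> e)
    = twist f (bar \<Lambda> e) \<otimes>\<^bsub>vgroup \<Gamma> (vmap f (src \<Lambda> e))\<^esub> einj \<Gamma> (bar \<Gamma> (emap f e)) (ehom f e k)"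
  using vhom_einj[of "bar \<Lambda> e" k] assms by simp

lemma einj_ehom_in [simp]:
  assumes "e \<in> edges \<Lambda>" "k \<in> carrier (egroup \<Gamma> (emap f e))"
  shows "einj \<Gamma> (emap f e) k \<in> carrier (vgroup \<Gamma> (vmap f (tgt \<Lambda> e)))"
    "einj \<Gamma> (bar \<Gamma> (emap f e)) k \<in> carrier (vgroup \<Gamma> (vmap f (src \<Lambda> e)))"
  using G.einj_in[of "emap f e" k] G.einj_bar_in[of "emap f e" k] assms by simp_all

lemma map_edge_point [simp]:
  assumes "e \<in> edges \<Lambda>"
  shows "mp (edge_point \<Lambda> e t) = edge_point \<Gamma> (emap f e) t"
  using assms by (simp add: edge_point_def)

lemma map_path_append [simp]: "map_path \<Lambda> \<Gamma> f (c @ d) = map_path \<Lambda> \<Gamma> f c @ map_path \<Lambda> \<Gamma> f d"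
  by (simp add: map_path_def)

lemma map_letter_path:
  assumes "is_letter \<Lambda> l"
  shows "is_path \<Gamma> (mp (start_pt \<Lambda> l)) (map_letter \<Lambda> \<Gamma> f l) (mp (end_pt \<Lambda> l))"
proof (cases l)
  case (Seg e s t)
  then have "e \<in> edges \<Lambda>" "0 \<le> s" "s < t" "t \<le> 1" using assms by auto
  then show ?thesis using Seg G.edge_point_in[of "emap f e"] by (auto simp: G.vinv_in[of "vmap f (tgt \<Lambda> e)"])
qed (use assms in auto)

lemma map_is_path: "is_path \<Lambda> x c y \<Longrightarrow> is_path \<Gamma> (mp x) (map_path \<Lambda> \<Gamma> f c) (mp y)"
proof (induction c arbitrary: x)
  case Nil
  then have y: "y \<in> points \<Lambda>" "x = y" by auto
  from y(1) have "mp y \<in> points \<Gamma>"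
    by (cases rule: L.pointsE) (auto intro: G.edge_point_in)
  then show ?case using y by (simp add: map_path_def)
next
  case (Cons l c)
  then show ?case using map_letter_path[of l]
    by (auto simp: map_path_def intro: G.is_path_appI)
qed

lemma map_point_in: "x \<in> points \<Lambda> \<Longrightarrow> mp x \<in> points \<Gamma>"
  using map_is_path[of x "[]" x] by (simp add: map_path_def)

lemma elt_cancel:
  assumes "v \<in> verts \<Gamma>" "g \<in> carrier (vgroup \<Gamma> v)"
  shows "homotopic \<Gamma> (Vertex v) (Vertex v) [Elt v g, Elt v (inv\<^bsub>vgroup \<Gamma> v\<^esub> g)] []"
    "homotopic \<Gamma> (Vertex v) (Vertex v) [Elt v (inv\<^bsub>vgroup \<Gamma> v\<^esub> g), Elt v g] []"
  using G.inv_letter_cancel[of "Elt v g"] G.inv_letter_cancel[of "Elt v (inv\<^bsub>vgroup \<Gamma> v\<^esub> g)"] assms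
    group.inv_inv[OF G.vgroup_group[OF assms(1)] assms(2)] by simp_all

text \<open>Twists are inserted only where a segment meets a vertex. So a subdivision point receives
  none, the twists at the turning point of a backtrack cancel, and an edge move is absorbed by the
  relations \<open>vhom_einj\<close> and \<open>vhom_einj_bar\<close> at the two ends.\<close>

lemma map_move:
  assumes "move \<Lambda> a b" "is_path \<Lambda> x a y" "is_path \<Lambda> x b y"
  shows "homotopic \<Gamma> (mp x) (mp y) (map_path \<Lambda> \<Gamma> f a) (map_path \<Lambda> \<Gamma> f b)"
  using assms(1)
proof cases
  case (mult v g g')
  then show ?thesis using assms vhom_mult[of v g g'] G.homotopic_move[OF move.mult[of \<Gamma> "vmap f v" "vhom f v g" "vhom f v g'"]]
    by (auto simp: map_path_def)
next
  case (unit v)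
  then show ?thesis using assms G.homotopic_move[OF move.unit[of \<Gamma> "vmap f v"]]
    by (auto simp: map_path_def)
next
  case (subdivide e s t u)
  let ?A = "if s = 0 then [Elt (src \<Gamma> (emap f e)) (twist f (bar \<Lambda> e))] else []"
  let ?B = "if u = 1 then [Elt (tgt \<Gamma> (emap f e)) (inv\<^bsub>vgroup \<Gamma> (tgt \<Gamma> (emap f e))\<^esub> twist f e)] else []"
  have e: "e \<in> edges \<Lambda>" "0 \<le> s" "s < t" "t < u" "u \<le> 1" "x = edge_point \<Lambda> e s" "y = edge_point \<Lambda> e u"
    using assms subdivide by auto
  have "homotopic \<Gamma> (mp x) (mp y) (?A @ [Seg (emap f e) s t, Seg (emap f e) t u] @ ?B)
    (?A @ [Seg (emap f e) s u] @ ?B)"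
    by (rule homotopic.step[OF move.subdivide])
      (use e G.edge_point_in[of "emap f e"] in \<open>auto simp: G.vinv_in[of "vmap f (tgt \<Lambda> e)"]\<close>)
  then show ?thesis using subdivide e by (auto simp: map_path_def)
next
  case (cancel e s t)
  have e: "e \<in> edges \<Lambda>" "0 \<le> s" "s < t" "t \<le> 1" "x = edge_point \<Lambda> e s" "y = edge_point \<Lambda> e s"
    using assms cancel by auto
  let ?e = "emap f e" and ?v = "vmap f (tgt \<Lambda> e)" and ?u = "vmap f (src \<Lambda> e)"
  let ?A = "if s = 0 then [Elt ?u (twist f (bar \<Lambda> e))] else []"
  let ?A' = "if s = 0 then [Elt ?u (inv\<^bsub>vgroup \<Gamma> ?u\<^esub> twist f (bar \<Lambda> e))] else []"
  let ?B = "if t = 1 then [Elt ?v (inv\<^bsub>vgroup \<Gamma> ?v\<^esub> twist f e), Elt ?v (twist f e)] else []"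
  let ?S = "[Seg ?e s t]" and ?S' = "[Seg (bar \<Gamma> ?e) (1 - t) (1 - s)]"
  let ?x = "edge_point \<Gamma> ?e s" and ?z = "edge_point \<Gamma> ?e t"
  have pts: "?x \<in> points \<Gamma>" "?z \<in> points \<Gamma>" using e by (auto intro!: G.edge_point_in)
  have B: "homotopic \<Gamma> ?z ?z ?B []"
    using e elt_cancel(2)[of ?v "twist f e"] pts by (auto intro: homotopic.refl)
  have A: "homotopic \<Gamma> ?x ?x (?A @ ?A') []"
    using e elt_cancel(1)[of ?u "twist f (bar \<Lambda> e)"] pts by (auto intro: homotopic.refl)
  have Ap: "is_path \<Gamma> ?x ?A ?x" "is_path \<Gamma> ?x ?A' ?x"
    using e pts by auto
  have Sp: "is_path \<Gamma> ?x ?S ?z" "is_path \<Gamma> ?z ?S' ?x" using e pts by auto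
  have "homotopic \<Gamma> ?x ?x ((?A @ ?S) @ ?B @ (?S' @ ?A')) ((?A @ ?S) @ [] @ (?S' @ ?A'))"
    by (rule G.homotopic_cong[OF B]) (use Ap Sp in \<open>blast intro: G.is_path_appI\<close>)+
  then have 1: "homotopic \<Gamma> ?x ?x (?A @ ?S @ ?B @ ?S' @ ?A') (?A @ (?S @ ?S') @ ?A')"
    by (simp only: append_assoc append_Nil)
  have "homotopic \<Gamma> ?x ?x (?S @ ?S') []"
    by (rule G.homotopic_move) (use move.cancel[of \<Gamma> ?e s t] G.is_path_appI[OF Sp] pts in auto)
  from G.homotopic_cong[OF this Ap]
  have 2: "homotopic \<Gamma> ?x ?x (?A @ (?S @ ?S') @ ?A') (?A @ ?A')" by (simp only: append_Nil)
  have "homotopic \<Gamma> ?x ?x (?A @ ?S @ ?B @ ?S' @ ?A') []"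
    by (rule homotopic.trans[OF 1 homotopic.trans[OF 2 A]])
  moreover have "map_path \<Lambda> \<Gamma> f a = ?A @ ?S @ ?B @ ?S' @ ?A'"
    using cancel e by (auto simp: map_path_def)
  ultimately show ?thesis using cancel e by (simp add: map_path_def)
next
  case (edge h e)
  have e: "e \<in> edges \<Lambda>" "x = Vertex (src \<Lambda> e)" "y = Vertex (tgt \<Lambda> e)" "h \<in> carrier (egroup \<Lambda> e)"
    using assms edge by auto
  let ?e = "emap f e" and ?v = "vmap f (tgt \<Lambda> e)" and ?u = "vmap f (src \<Lambda> e)"
  let ?k = "ehom f e h"
  \<comment> \<open>With the base point at the source of the image edge, the paths on both sides of
    the move become iterated right multiplications and one extension of the constant class.\<close>
  interpret B: pgog \<Gamma> "Vertex ?u" using e by unfold_locales simp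
  interpret V: group "vgroup \<Gamma> ?v" using e by (intro G.vgroup_group) simp
  let ?one = "hclass \<Gamma> (Vertex ?u) (Vertex ?u) []"
  have one: "?one \<in> B.P ?u" using e by (auto simp: vpaths_def)
  have k: "?k \<in> carrier (egroup \<Gamma> ?e)" using e by simp
  have *: "inv\<^bsub>vgroup \<Gamma> ?v\<^esub> twist f e \<otimes>\<^bsub>vgroup \<Gamma> ?v\<^esub> vhom f (tgt \<Lambda> e) (einj \<Lambda> e h)
      = einj \<Gamma> ?e ?k \<otimes>\<^bsub>vgroup \<Gamma> ?v\<^esub> inv\<^bsub>vgroup \<Gamma> ?v\<^esub> twist f e"
  proof -
    have "einj \<Gamma> ?e ?k = inv\<^bsub>vgroup \<Gamma> ?v\<^esub> twist f e \<otimes>\<^bsub>vgroup \<Gamma> ?v\<^esub>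
       (vhom f (tgt \<Lambda> e) (einj \<Lambda> e h) \<otimes>\<^bsub>vgroup \<Gamma> ?v\<^esub> twist f e)"
      unfolding vhom_einj[OF e(1,4)] using e k by (simp flip: V.m_assoc)
    then show ?thesis using e by (simp add: V.m_assoc)
  qed
  have cl: "hclass \<Gamma> (Vertex ?u) (Vertex ?v)
      [Elt ?u a, Seg ?e 0 1, Elt ?v b] = B.R ?v (B.X ?e (B.R ?u ?one a)) b"
    if "a \<in> carrier (vgroup \<Gamma> ?u)" "b \<in> carrier (vgroup \<Gamma> ?v)" for a b
    using e that B.hclass_ract[of "[]" ?u a] B.hclass_extend[of "[Elt ?u a]" ?e]
      B.hclass_ract[of "[Elt ?u a, Seg ?e 0 1]" ?v b] by simp
  have "hclass \<Gamma> (Vertex ?u) (Vertex ?v) (map_path \<Lambda> \<Gamma> f a)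
     = B.R ?v (B.R ?v (B.X ?e (B.R ?u ?one (twist f (bar \<Lambda> e)))) (inv\<^bsub>vgroup \<Gamma> ?v\<^esub> twist f e)) (vhom f (tgt \<Lambda> e) (einj \<Lambda> e h))"
    using e edge cl[of "twist f (bar \<Lambda> e)" "inv\<^bsub>vgroup \<Gamma> ?v\<^esub> twist f e"]
      B.hclass_ract[of "[Elt ?u (twist f (bar \<Lambda> e)), Seg ?e 0 1, Elt ?v (inv\<^bsub>vgroup \<Gamma> ?v\<^esub> twist f e)]" ?v]
    by (simp add: map_path_def)
  also have "\<dots> = B.R ?v (B.R ?v (B.X ?e (B.R ?u ?one (twist f (bar \<Lambda> e)))) (einj \<Gamma> ?e ?k)) (inv\<^bsub>vgroup \<Gamma> ?v\<^esub> twist f e)"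
  proof -
    have "B.X ?e (B.R ?u ?one (twist f (bar \<Lambda> e))) \<in> B.P ?v"
      using e one B.extend_closed[of ?e "B.R ?u ?one (twist f (bar \<Lambda> e))"] by simp
    then show ?thesis using * e k by (simp flip: B.ract_mult)
  qed
  also have "B.R ?v (B.X ?e (B.R ?u ?one (twist f (bar \<Lambda> e)))) (einj \<Gamma> ?e ?k)
      = B.X ?e (B.R ?u (B.R ?u ?one (twist f (bar \<Lambda> e))) (einj \<Gamma> (bar \<Gamma> ?e) ?k))"
    using B.extend_ract[of ?e ?k "B.R ?u ?one (twist f (bar \<Lambda> e))"] e k one by simp
  also have "B.R ?u (B.R ?u ?one (twist f (bar \<Lambda> e))) (einj \<Gamma> (bar \<Gamma> ?e) ?k)
     = B.R ?u (B.R ?u ?one (vhom f (src \<Lambda> e) (einj \<Lambda> (bar \<Lambda> e) h))) (twist f (bar \<Lambda> e))"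
    using vhom_einj_bar[OF e(1,4)] e one k by (simp flip: B.ract_mult)
  also have "B.R ?v (B.X ?e \<dots>) (inv\<^bsub>vgroup \<Gamma> ?v\<^esub> twist f e) = hclass \<Gamma> (Vertex ?u) (Vertex ?v) (map_path \<Lambda> \<Gamma> f b)"
    using e edge B.hclass_ract[of "[]" ?u "vhom f (src \<Lambda> e) (einj \<Lambda> (bar \<Lambda> e) h)"]
      B.hclass_ract[of "[Elt ?u (vhom f (src \<Lambda> e) (einj \<Lambda> (bar \<Lambda> e) h))]" ?u "twist f (bar \<Lambda> e)"]
      B.hclass_extend[of "[Elt ?u (vhom f (src \<Lambda> e) (einj \<Lambda> (bar \<Lambda> e) h)), Elt ?u (twist f (bar \<Lambda> e))]" ?e]
      B.hclass_ract[of "[Elt ?u (vhom f (src \<Lambda> e) (einj \<Lambda> (bar \<Lambda> e) h)), Elt ?u (twist f (bar \<Lambda> e)), Seg ?e 0 1]" ?v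
         "inv\<^bsub>vgroup \<Gamma> ?v\<^esub> twist f e"]
    by (simp add: map_path_def)
  finally have eq: "hclass \<Gamma> (Vertex ?u) (Vertex ?v) (map_path \<Lambda> \<Gamma> f a)
    = hclass \<Gamma> (Vertex ?u) (Vertex ?v) (map_path \<Lambda> \<Gamma> f b)" .
  have "is_path \<Gamma> (Vertex ?u) (map_path \<Lambda> \<Gamma> f a) (Vertex ?v)" using map_is_path[OF assms(2)] e by simp
  from iffD1[OF hclass_eq_iff[OF this] eq] show ?thesis using e by simp
qed

lemma map_homotopic:
  "homotopic \<Lambda> x y c d \<Longrightarrow> homotopic \<Gamma> (mp x) (mp y) (map_path \<Lambda> \<Gamma> f c) (map_path \<Lambda> \<Gamma> f d)"
proof (induction rule: homotopic.induct)
  case (step a b c d)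
  obtain x1 z1 where 1: "is_path \<Lambda> x c x1" "is_path \<Lambda> x1 a z1" "is_path \<Lambda> z1 d y"
    using step by (auto simp: L.is_path_append)
  obtain x2 z2 where 2: "is_path \<Lambda> x c x2" "is_path \<Lambda> x2 b z2" "is_path \<Lambda> z2 d y"
    using step by (auto simp: L.is_path_append)
  have "is_path \<Lambda> x1 b z1" using L.is_path_end[OF 1(1) 2(1)] is_path_start[OF 1(3) 2(3)] 2(2) by simp
  from G.homotopic_cong[OF map_move[OF step.hyps(1) 1(2) this]] map_is_path[OF 1(1)] map_is_path[OF 1(3)]
  show ?case by simp
qed (auto intro: homotopic.refl homotopic.sym homotopic.trans map_is_path)

lemma pmap_hclass:
  assumes "is_path \<Lambda> x c y"
  shows "pmap \<Lambda> \<Gamma> f (mp x) (mp y) (hclass \<Lambda> x y c) = hclass \<Gamma> (mp x) (mp y) (map_path \<Lambda> \<Gamma> f c)"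
proof (intro Set.set_eqI iffI)
  fix d assume "d \<in> pmap \<Lambda> \<Gamma> f (mp x) (mp y) (hclass \<Lambda> x y c)"
  then obtain c' where "homotopic \<Lambda> x y c c'" "homotopic \<Gamma> (mp x) (mp y) (map_path \<Lambda> \<Gamma> f c') d"
    by (auto simp: pmap_def hclass_def)
  then show "d \<in> hclass \<Gamma> (mp x) (mp y) (map_path \<Lambda> \<Gamma> f c)"
    unfolding hclass_def using map_homotopic homotopic.trans by blast
next
  fix d assume "d \<in> hclass \<Gamma> (mp x) (mp y) (map_path \<Lambda> \<Gamma> f c)"
  then show "d \<in> pmap \<Lambda> \<Gamma> f (mp x) (mp y) (hclass \<Lambda> x y c)"
    using homotopic.refl[OF assms] by (auto simp: hclass_def pmap_def)
qed

lemma pmap_in: "A \<in> pclasses \<Lambda> x y \<Longrightarrow> pmap \<Lambda> \<Gamma> f (mp x) (mp y) A \<in> pclasses \<Gamma> (mp x) (mp y)"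
  by (elim pclassesE) (auto simp: pmap_hclass intro: map_is_path)

lemma pmap_hmult:
  assumes "A \<in> pclasses \<Lambda> x y" "B \<in> pclasses \<Lambda> y z"
  shows "pmap \<Lambda> \<Gamma> f (mp x) (mp z) (hmult \<Lambda> x z A B)
    = hmult \<Gamma> (mp x) (mp z) (pmap \<Lambda> \<Gamma> f (mp x) (mp y) A) (pmap \<Lambda> \<Gamma> f (mp y) (mp z) B)"
proof -
  obtain a b where ab: "is_path \<Lambda> x a y" "A = hclass \<Lambda> x y a" "is_path \<Lambda> y b z" "B = hclass \<Lambda> y z b"
    using assms by (elim pclassesE)
  have "hmult \<Lambda> x z A B = hclass \<Lambda> x z (a @ b)" using ab by (simp add: L.hmult_hclass)
  then show ?thesis using pmap_hclass[OF ab(1)] pmap_hclass[OF ab(3)] pmap_hclass[OF L.is_path_appI[OF ab(1,3)]]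
      G.hmult_hclass[OF map_is_path[OF ab(1)] map_is_path[OF ab(3)]] ab by simp
qed

end

locale pointed_morphism = gog_morphism \<Lambda> \<Gamma> f + L: pgog \<Lambda> q + G: pgog \<Gamma> p
  for \<Lambda> :: "('v, 'e, 'g, 'h) graph_of_groups" and \<Gamma> :: "('w, 'f, 'k, 'l) graph_of_groups"
    and f :: "('v, 'e, 'g, 'h, 'w, 'f, 'k, 'l) gmorphism" and q p +
  assumes base: "map_point (vmap f) (emap f) q = p"
begin

abbreviation F where "F w \<equiv> pmap \<Lambda> \<Gamma> f p (Vertex (vmap f w))"
abbreviation f_sharp where "f_sharp \<equiv> induced_hom \<Lambda> q \<Gamma> p f"

lemma pmap_vpaths [simp]: "B \<in> L.P w \<Longrightarrow> F w B \<in> G.P (vmap f w)"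
  using pmap_in[of B q "Vertex w"] base by (simp add: vpaths_def)

lemma induced_hom_in [simp]: "h \<in> carrier L.\<pi> \<Longrightarrow> f_sharp h \<in> carrier G.\<pi>"
  using pmap_in[of h q q] base by (simp add: induced_hom_pmap L.pi_carrier G.pi_carrier)

lemma induced_hom_hom: "f_sharp \<in> hom L.\<pi> G.\<pi>"
  using pmap_hmult[of _ q q _ q] base
  by (auto simp: hom_def L.pi_mult G.pi_mult L.pi_carrier G.pi_carrier induced_hom_pmap dest: pmap_in)

lemma covering_subgroup_subgroup: "subgroup (covering_subgroup \<Lambda> q \<Gamma> p f) G.\<pi>"
proof -
  interpret group_hom L.\<pi> G.\<pi> "f_sharp" by unfold_locales (rule induced_hom_hom)
  show ?thesis unfolding covering_subgroup_def by (rule img_is_subgroup)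
qed

lemma pmap_lact: "\<lbrakk>h \<in> carrier L.\<pi>; B \<in> L.P w\<rbrakk> \<Longrightarrow> F w (L.L w h B) = G.L (vmap f w) (f_sharp h) (F w B)"
  using pmap_hmult[of h q q B "Vertex w"] base
  by (simp add: lact_def vpaths_def induced_hom_pmap L.pi_carrier)

lemma pmap_ract:
  assumes "B \<in> L.P w" "g \<in> carrier (vgroup \<Lambda> w)"
  shows "F w (L.R w B g) = G.R (vmap f w) (F w B) (vhom f w g)"
proof -
  have w: "w \<in> verts \<Lambda>" using assms L.vpaths_vert by blast
  have "pmap \<Lambda> \<Gamma> f (Vertex (vmap f w)) (Vertex (vmap f w)) (vclass \<Lambda> w g) = vclass \<Gamma> (vmap f w) (vhom f w g)"
    using pmap_hclass[of "Vertex w" "[Elt w g]" "Vertex w"] w assms by (simp add: vclass_def map_path_def)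
  then show ?thesis using pmap_hmult[of B q "Vertex w" "vclass \<Lambda> w g" "Vertex w"] base assms L.vclass_in[OF w]
    by (simp add: ract_def vpaths_def)
qed

text \<open>The image of an edge ends with the inverse of its twist. With that factor moved to the
  left-hand side, the formula treats the two ends of the edge alike, and no inverse has to be
  carried along.\<close>

lemma pmap_extend:
  assumes "e \<in> edges \<Lambda>" "B \<in> L.P (src \<Lambda> e)"
  shows "G.R (vmap f (tgt \<Lambda> e)) (F (tgt \<Lambda> e) (L.X e B)) (twist f e)
    = G.X (emap f e) (G.R (vmap f (src \<Lambda> e)) (F (src \<Lambda> e) B) (twist f (bar \<Lambda> e)))"
proof -
  let ?v = "vmap f (tgt \<Lambda> e)" and ?u = "vmap f (src \<Lambda> e)" and ?e = "emap f e"
  obtain c where c: "is_path \<Lambda> q c (Vertex (src \<Lambda> e))" "B = hclass \<Lambda> q (Vertex (src \<Lambda> e)) c"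
    using assms(2) unfolding vpaths_def by (rule pclassesE)
  have c': "is_path \<Lambda> q (c @ [Seg e 0 1]) (Vertex (tgt \<Lambda> e))" using c assms by (auto simp: L.is_path_append)
  let ?c = "map_path \<Lambda> \<Gamma> f c"
  have m: "is_path \<Gamma> p ?c (Vertex ?u)" using map_is_path[OF c(1)] base by simp
  have p1: "is_path \<Gamma> p (?c @ [Elt ?u (twist f (bar \<Lambda> e))]) (Vertex ?u)"
    using m assms by (auto simp: G.is_path_append)
  have p2: "is_path \<Gamma> p (?c @ [Elt ?u (twist f (bar \<Lambda> e)), Seg ?e 0 1]) (Vertex ?v)"
    using m assms by (auto simp: G.is_path_append)
  have "F (tgt \<Lambda> e) (L.X e B) = hclass \<Gamma> p (Vertex ?v) (map_path \<Lambda> \<Gamma> f (c @ [Seg e 0 1]))"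
    using pmap_hclass[OF c'] base c assms by (simp add: L.hclass_extend)
  also have "\<dots> = G.R ?v (hclass \<Gamma> p (Vertex ?v) (?c @ [Elt ?u (twist f (bar \<Lambda> e)), Seg ?e 0 1])) (inv\<^bsub>vgroup \<Gamma> ?v\<^esub> twist f e)"
    using G.hclass_ract[OF p2, of "inv\<^bsub>vgroup \<Gamma> ?v\<^esub> twist f e"] assms by (simp add: map_path_def)
  also have "hclass \<Gamma> p (Vertex ?v) (?c @ [Elt ?u (twist f (bar \<Lambda> e)), Seg ?e 0 1])
     = G.X ?e (G.R ?u (F (src \<Lambda> e) B) (twist f (bar \<Lambda> e)))"
    using G.hclass_extend[of "?c @ [Elt ?u (twist f (bar \<Lambda> e))]" ?e] p1 assms
      G.hclass_ract[OF m, of "twist f (bar \<Lambda> e)"] pmap_hclass[OF c(1)] c base by simp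
  finally show ?thesis using assms
      G.extend_closed[of ?e "G.R ?u (F (src \<Lambda> e) B) (twist f (bar \<Lambda> e))"] by simp
qed

lemma pmap_one: "q = Vertex w \<Longrightarrow> F w (hclass \<Lambda> q q []) = hclass \<Gamma> p p []"
  using pmap_hclass[of q "[]" q] base L.p_in by (auto simp: map_path_def)

text \<open>The initial segment arrives at the source along the reverse edge, so its image picks up
  the inverse of that edge's twist and nothing at its interior end.\<close>

lemma pmap_initial_seg:
  assumes "e \<in> edges \<Lambda>" "0 < t" "t < 1" "q = edge_point \<Lambda> e t"
  shows "G.R (vmap f (src \<Lambda> e)) (F (src \<Lambda> e) (initial_seg \<Lambda> q e t)) (twist f (bar \<Lambda> e))
    = initial_seg \<Gamma> p (emap f e) t"
proof -
  let ?u = "vmap f (src \<Lambda> e)" and ?e = "emap f e"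
  have p: "p = edge_point \<Gamma> ?e t" using base assms by auto
  have i: "initial_seg \<Gamma> p ?e t \<in> G.P ?u" using G.initial_seg_in[of ?e t] assms p by simp
  have "F (src \<Lambda> e) (initial_seg \<Lambda> q e t) =
     hclass \<Gamma> p (Vertex ?u) [Seg (bar \<Gamma> ?e) (1 - t) 1, Elt ?u (inv\<^bsub>vgroup \<Gamma> ?u\<^esub> twist f (bar \<Lambda> e))]"
    using pmap_hclass[OF L.initial_seg_path[OF assms]] assms(1-3) base
    by (simp add: initial_seg_def map_path_def)
  also have "\<dots> = G.R ?u (initial_seg \<Gamma> p ?e t) (inv\<^bsub>vgroup \<Gamma> ?u\<^esub> twist f (bar \<Lambda> e))"
    using G.hclass_ract[of "[Seg (bar \<Gamma> ?e) (1 - t) 1]" ?u "inv\<^bsub>vgroup \<Gamma> ?u\<^esub> twist f (bar \<Lambda> e)"]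
      G.initial_seg_path[of ?e t] assms(1-3) p by (simp add: initial_seg_def)
  finally show ?thesis using i assms by simp
qed

text \<open>The two cases need different corrections: none for a constant path, the twist of the
  reverse edge for an initial segment. Later arguments use only that some vertex group element
  corrects the image.\<close>

lemma pmap_root:
  assumes "root_path \<Lambda> q w B"
  shows "\<exists>\<beta>. root_path \<Gamma> p (vmap f w) \<beta> \<and> (\<exists>g\<in>carrier (vgroup \<Gamma> (vmap f w)). G.R (vmap f w) (F w B) g = \<beta>)"
  using assms[unfolded root_path_def]
proof (elim disjE exE conjE)
  assume *: "q = Vertex w" "B = hclass \<Lambda> q q []"
  then have w: "w \<in> verts \<Lambda>" using L.p_in by simp
  have "F w B = hclass \<Gamma> p p []" "p = Vertex (vmap f w)" using pmap_one * base by auto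
  moreover have "F w B \<in> G.P (vmap f w)" using L.root_in[OF assms] by simp
  ultimately show ?thesis using G.vone_in[OF vmap_in[OF w]] G.ract_one unfolding root_path_def by metis
next
  fix e t assume *: "e \<in> edges \<Lambda>" "0 < t" "t < 1" "q = edge_point \<Lambda> e t" "w = src \<Lambda> e"
    "B = initial_seg \<Lambda> q e t"
  have "root_path \<Gamma> p (vmap f w) (initial_seg \<Gamma> p (emap f e) t)"
    unfolding root_path_def using * base by (intro disjI2 exI[of _ "emap f e"] exI[of _ t]) auto
  then show ?thesis using pmap_initial_seg[OF *(1-4)] *(5,6) twist_bar_in[OF *(1)] by blast
qed

end

section \<open>Stars and coverings\<close>

context gog
begin

lemma einj_subgroup: "e \<in> edges \<Gamma> \<Longrightarrow> subgroup (einj \<Gamma> e ` carrier (egroup \<Gamma> e)) (vgroup \<Gamma> (tgt \<Gamma> e))"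
  by (intro group_hom.img_is_subgroup group_hom.intro group_hom_axioms.intro egroup_group
      vgroup_group einj_hom tgt_in)

lemma einj_coset_eq_iff:
  assumes e: "e \<in> edges \<Gamma>" and a: "a \<in> carrier (vgroup \<Gamma> (tgt \<Gamma> e))" and b: "b \<in> carrier (vgroup \<Gamma> (tgt \<Gamma> e))"
  shows "a <#\<^bsub>vgroup \<Gamma> (tgt \<Gamma> e)\<^esub> (einj \<Gamma> e ` carrier (egroup \<Gamma> e))
      = b <#\<^bsub>vgroup \<Gamma> (tgt \<Gamma> e)\<^esub> (einj \<Gamma> e ` carrier (egroup \<Gamma> e))
    \<longleftrightarrow> (\<exists>k\<in>carrier (egroup \<Gamma> e). a \<otimes>\<^bsub>vgroup \<Gamma> (tgt \<Gamma> e)\<^esub> einj \<Gamma> e k = b)" (is "?L \<longleftrightarrow> ?R")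
proof -
  interpret V: group "vgroup \<Gamma> (tgt \<Gamma> e)" using e by (intro vgroup_group) simp
  note sub = einj_subgroup[OF e]
  show ?thesis
  proof
    assume ?L
    then have "b \<in> a <#\<^bsub>vgroup \<Gamma> (tgt \<Gamma> e)\<^esub> (einj \<Gamma> e ` carrier (egroup \<Gamma> e))"
      using V.lcos_self[OF b sub] by simp
    then show ?R by (auto simp: l_coset_def)
  next
    assume ?R
    then have "b \<in> a <#\<^bsub>vgroup \<Gamma> (tgt \<Gamma> e)\<^esub> (einj \<Gamma> e ` carrier (egroup \<Gamma> e))"
      by (auto simp: l_coset_def)
    then show ?L using V.l_repr_independence[OF _ a sub] by simp
  qed
qed

end

section \<open>The maps of stars in terms of elements\<close>

context gog_morphism
begin

text \<open>Injectivity and, in \<open>locally_surj\<close>, surjectivity of the map of stars at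
  \<open>v\<close>, with cosets replaced by representatives and equality of cosets by a factor from
  the edge group.\<close>

definition locally_inj :: "'v \<Rightarrow> bool" where
  "locally_inj v \<longleftrightarrow> (\<forall>e\<in>edges \<Lambda>. \<forall>e'\<in>edges \<Lambda>. \<forall>l\<in>carrier (vgroup \<Lambda> v). \<forall>l'\<in>carrier (vgroup \<Lambda> v).
     \<forall>k\<in>carrier (egroup \<Gamma> (emap f e)). tgt \<Lambda> e = v \<longrightarrow> tgt \<Lambda> e' = v \<longrightarrow> emap f e = emap f e' \<longrightarrow>
     vhom f v l \<otimes>\<^bsub>vgroup \<Gamma> (vmap f v)\<^esub> twist f e \<otimes>\<^bsub>vgroup \<Gamma> (vmap f v)\<^esub> einj \<Gamma> (emap f e) k
       = vhom f v l' \<otimes>\<^bsub>vgroup \<Gamma> (vmap f v)\<^esub> twist f e' \<longrightarrow>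
     e = e' \<and> (\<exists>j\<in>carrier (egroup \<Lambda> e). l \<otimes>\<^bsub>vgroup \<Lambda> v\<^esub> einj \<Lambda> e j = l'))"

definition locally_surj :: "'v \<Rightarrow> bool" where
  "locally_surj v \<longleftrightarrow> (\<forall>e'\<in>edges \<Gamma>. \<forall>g\<in>carrier (vgroup \<Gamma> (vmap f v)). tgt \<Gamma> e' = vmap f v \<longrightarrow>
     (\<exists>e\<in>edges \<Lambda>. \<exists>l\<in>carrier (vgroup \<Lambda> v). \<exists>k\<in>carrier (egroup \<Gamma> e'). tgt \<Lambda> e = v \<and> emap f e = e' \<and>
        g = vhom f v l \<otimes>\<^bsub>vgroup \<Gamma> (vmap f v)\<^esub> twist f e \<otimes>\<^bsub>vgroup \<Gamma> (vmap f v)\<^esub> einj \<Gamma> e' k))"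

text \<open>Changing the representative \<open>l\<close> by an element of the edge group passes
  through the twist by \<open>vhom_einj\<close> and comes out as an element of the image edge group,
  so all members of the union are the same coset.\<close>

lemma star_map_coset:
  assumes e: "e \<in> edges \<Lambda>" and l: "l \<in> carrier (vgroup \<Lambda> (tgt \<Lambda> e))"
  shows "star_map \<Gamma> f (tgt \<Lambda> e) (l <#\<^bsub>vgroup \<Lambda> (tgt \<Lambda> e)\<^esub> (einj \<Lambda> e ` carrier (egroup \<Lambda> e)), e)
    = ((vhom f (tgt \<Lambda> e) l \<otimes>\<^bsub>vgroup \<Gamma> (vmap f (tgt \<Lambda> e))\<^esub> twist f e) <#\<^bsub>vgroup \<Gamma> (vmap f (tgt \<Lambda> e))\<^esub>
        (einj \<Gamma> (emap f e) ` carrier (egroup \<Gamma> (emap f e))), emap f e)"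
proof -
  let ?v = "tgt \<Lambda> e" and ?G = "vgroup \<Gamma> (vmap f (tgt \<Lambda> e))"
  interpret V: group ?G using e by (intro G.vgroup_group) simp
  let ?K = "einj \<Gamma> (emap f e) ` carrier (egroup \<Gamma> (emap f e))"
  let ?C = "l <#\<^bsub>vgroup \<Lambda> ?v\<^esub> (einj \<Lambda> e ` carrier (egroup \<Lambda> e))"
  have eq: "(vhom f ?v g \<otimes>\<^bsub>?G\<^esub> twist f e) <#\<^bsub>?G\<^esub> ?K = (vhom f ?v l \<otimes>\<^bsub>?G\<^esub> twist f e) <#\<^bsub>?G\<^esub> ?K"
    if "g \<in> ?C" for g
  proof -
    obtain j where j: "j \<in> carrier (egroup \<Lambda> e)" "g = l \<otimes>\<^bsub>vgroup \<Lambda> ?v\<^esub> einj \<Lambda> e j"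
      using \<open>g \<in> ?C\<close> by (auto simp: l_coset_def)
    have "vhom f ?v l \<otimes>\<^bsub>?G\<^esub> twist f e \<otimes>\<^bsub>?G\<^esub> einj \<Gamma> (emap f e) (ehom f e j) = vhom f ?v g \<otimes>\<^bsub>?G\<^esub> twist f e"
      using e l j vhom_einj[OF e j(1)] by (simp add: V.m_assoc vhom_mult)
    then show ?thesis
      using G.einj_coset_eq_iff[of "emap f e" "vhom f ?v l \<otimes>\<^bsub>?G\<^esub> twist f e" "vhom f ?v g \<otimes>\<^bsub>?G\<^esub> twist f e"] e l j
      by (metis G.vmult_in L.einj_in L.vmult_in L.tgt_in ehom_in emap_in tgt_emap twist_in vhom_in vmap_in)
  qed
  have "l \<in> ?C" using group.lcos_self[OF L.vgroup_group l L.einj_subgroup[OF e]] e by simp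
  then show ?thesis unfolding star_map_def prod.case
    by (intro arg_cong2[of _ _ _ _ Pair] HOL.refl UN_constant_eq ballI eq)
qed

lemma star_bij_iff:
  assumes v: "v \<in> verts \<Lambda>"
  shows "bij_betw (star_map \<Gamma> f v) (star \<Lambda> v) (star \<Gamma> (vmap f v)) \<longleftrightarrow> locally_inj v \<and> locally_surj v"
proof -
  let ?G = "vgroup \<Gamma> (vmap f v)" and ?L = "vgroup \<Lambda> v"
  interpret V: group ?G using v by (intro G.vgroup_group) simp
  let ?C = "\<lambda>l e. l <#\<^bsub>?L\<^esub> (einj \<Lambda> e ` carrier (egroup \<Lambda> e))"
  let ?D = "\<lambda>g e. g <#\<^bsub>?G\<^esub> (einj \<Gamma> e ` carrier (egroup \<Gamma> e))"
  have starL: "star \<Lambda> v = {(?C l e, e) | l e. e \<in> edges \<Lambda> \<and> tgt \<Lambda> e = v \<and> l \<in> carrier ?L}"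
    by (auto simp: star_def LCOSETS_def)
  have starG: "star \<Gamma> (vmap f v) = {(?D g e, e) | g e. e \<in> edges \<Gamma> \<and> tgt \<Gamma> e = vmap f v \<and> g \<in> carrier ?G}"
    by (auto simp: star_def LCOSETS_def)
  have sm: "star_map \<Gamma> f v (?C l e, e) = (?D (vhom f v l \<otimes>\<^bsub>?G\<^esub> twist f e) (emap f e), emap f e)"
    if "e \<in> edges \<Lambda>" "tgt \<Lambda> e = v" "l \<in> carrier ?L" for l e
    using star_map_coset[of e l] that by simp
  have D: "?D a e = ?D b e \<longleftrightarrow> (\<exists>k\<in>carrier (egroup \<Gamma> e). a \<otimes>\<^bsub>?G\<^esub> einj \<Gamma> e k = b)"
    if "e \<in> edges \<Gamma>" "tgt \<Gamma> e = vmap f v" "a \<in> carrier ?G" "b \<in> carrier ?G" for a b e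
    using G.einj_coset_eq_iff[of e a b] that by simp
  have C: "?C a e = ?C b e \<longleftrightarrow> (\<exists>k\<in>carrier (egroup \<Lambda> e). a \<otimes>\<^bsub>?L\<^esub> einj \<Lambda> e k = b)"
    if "e \<in> edges \<Lambda>" "tgt \<Lambda> e = v" "a \<in> carrier ?L" "b \<in> carrier ?L" for a b e
    using L.einj_coset_eq_iff[of e a b] that by simp
  have cl: "vhom f v l \<otimes>\<^bsub>?G\<^esub> twist f e \<in> carrier ?G" if "e \<in> edges \<Lambda>" "tgt \<Lambda> e = v" "l \<in> carrier ?L" for l e
    using that v twist_in[of e] by auto
  have te: "tgt \<Gamma> (emap f e) = vmap f v" if "e \<in> edges \<Lambda>" "tgt \<Lambda> e = v" for e
    using that by simp
  have inj: "inj_on (star_map \<Gamma> f v) (star \<Lambda> v) \<longleftrightarrow> locally_inj v"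
  proof
    assume i: "inj_on (star_map \<Gamma> f v) (star \<Lambda> v)"
    show "locally_inj v"
      unfolding locally_inj_def
    proof (intro ballI impI)
      fix e e' l l' k
      assume *: "e \<in> edges \<Lambda>" "e' \<in> edges \<Lambda>" "l \<in> carrier ?L" "l' \<in> carrier ?L"
        "k \<in> carrier (egroup \<Gamma> (emap f e))" "tgt \<Lambda> e = v" "tgt \<Lambda> e' = v" "emap f e = emap f e'"
        "vhom f v l \<otimes>\<^bsub>?G\<^esub> twist f e \<otimes>\<^bsub>?G\<^esub> einj \<Gamma> (emap f e) k = vhom f v l' \<otimes>\<^bsub>?G\<^esub> twist f e'"
      have "?D (vhom f v l \<otimes>\<^bsub>?G\<^esub> twist f e) (emap f e) = ?D (vhom f v l' \<otimes>\<^bsub>?G\<^esub> twist f e') (emap f e)"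
        using D[OF emap_in[OF *(1)] te[OF *(1,6)] cl[OF *(1,6,3)] cl[OF *(2,7,4)]] *(5,9) by blast
      then have "star_map \<Gamma> f v (?C l e, e) = star_map \<Gamma> f v (?C l' e', e')"
        using sm[OF *(1,6,3)] sm[OF *(2,7,4)] *(8) by simp
      then have "(?C l e, e) = (?C l' e', e')"
        by (rule inj_onD[OF i]) (use * starL in auto)
      then show "e = e' \<and> (\<exists>j\<in>carrier (egroup \<Lambda> e). l \<otimes>\<^bsub>?L\<^esub> einj \<Lambda> e j = l')"
        using C[OF *(1,6,3,4)] by auto
    qed
  next
    assume i: "locally_inj v"
    show "inj_on (star_map \<Gamma> f v) (star \<Lambda> v)"
    proof (rule inj_onI)
      fix x y assume "x \<in> star \<Lambda> v" "y \<in> star \<Lambda> v" and eq: "star_map \<Gamma> f v x = star_map \<Gamma> f v y"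
      then obtain l e l' e' where *: "e \<in> edges \<Lambda>" "tgt \<Lambda> e = v" "l \<in> carrier ?L"
        "e' \<in> edges \<Lambda>" "tgt \<Lambda> e' = v" "l' \<in> carrier ?L" and xy: "x = (?C l e, e)" "y = (?C l' e', e')"
        unfolding starL by blast
      have pair: "(?D (vhom f v l \<otimes>\<^bsub>?G\<^esub> twist f e) (emap f e), emap f e)
          = (?D (vhom f v l' \<otimes>\<^bsub>?G\<^esub> twist f e') (emap f e'), emap f e')"
        using eq unfolding xy sm[OF *(1-3)] sm[OF *(4-6)] .
      then have ee: "emap f e = emap f e'" by (rule Pair_inject)
      from pair have "?D (vhom f v l \<otimes>\<^bsub>?G\<^esub> twist f e) (emap f e) = ?D (vhom f v l' \<otimes>\<^bsub>?G\<^esub> twist f e') (emap f e)"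
        unfolding ee by (rule Pair_inject)
      then obtain k where "k \<in> carrier (egroup \<Gamma> (emap f e))"
        "vhom f v l \<otimes>\<^bsub>?G\<^esub> twist f e \<otimes>\<^bsub>?G\<^esub> einj \<Gamma> (emap f e) k = vhom f v l' \<otimes>\<^bsub>?G\<^esub> twist f e'"
        using D[OF emap_in[OF *(1)] te[OF *(1,2)] cl[OF *(1-3)] cl[OF *(4-6)]] by blast
      then have "e = e' \<and> (\<exists>j\<in>carrier (egroup \<Lambda> e). l \<otimes>\<^bsub>?L\<^esub> einj \<Lambda> e j = l')"
        using i * ee unfolding locally_inj_def by blast
      then show "x = y" using C[OF *(1-3,6)] xy by auto
    qed
  qed
  have surj: "star_map \<Gamma> f v ` star \<Lambda> v = star \<Gamma> (vmap f v) \<longleftrightarrow> locally_surj v"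
  proof
    assume s: "star_map \<Gamma> f v ` star \<Lambda> v = star \<Gamma> (vmap f v)"
    show "locally_surj v" unfolding locally_surj_def
    proof (intro ballI impI)
      fix e' g assume *: "e' \<in> edges \<Gamma>" "g \<in> carrier ?G" "tgt \<Gamma> e' = vmap f v"
      then have "(?D g e', e') \<in> star_map \<Gamma> f v ` star \<Lambda> v" unfolding s starG by blast
      then obtain l e where le: "e \<in> edges \<Lambda>" "tgt \<Lambda> e = v" "l \<in> carrier ?L"
        "(?D g e', e') = star_map \<Gamma> f v (?C l e, e)" unfolding starL by blast
      then have e': "emap f e = e'" and "?D (vhom f v l \<otimes>\<^bsub>?G\<^esub> twist f e) e' = ?D g e'"
        using sm[OF le(1-3)] by auto
      then obtain k where "k \<in> carrier (egroup \<Gamma> e')" "vhom f v l \<otimes>\<^bsub>?G\<^esub> twist f e \<otimes>\<^bsub>?G\<^esub> einj \<Gamma> e' k = g"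
        using D[OF *(1,3) cl[OF le(1-3)] *(2)] by blast
      then show "\<exists>e\<in>edges \<Lambda>. \<exists>l\<in>carrier ?L. \<exists>k\<in>carrier (egroup \<Gamma> e'). tgt \<Lambda> e = v \<and> emap f e = e' \<and>
        g = vhom f v l \<otimes>\<^bsub>?G\<^esub> twist f e \<otimes>\<^bsub>?G\<^esub> einj \<Gamma> e' k" using le e' by blast
    qed
  next
    assume s: "locally_surj v"
    show "star_map \<Gamma> f v ` star \<Lambda> v = star \<Gamma> (vmap f v)"
    proof
      show "star_map \<Gamma> f v ` star \<Lambda> v \<subseteq> star \<Gamma> (vmap f v)"
        unfolding starL starG using sm cl te emap_in by blast
      show "star \<Gamma> (vmap f v) \<subseteq> star_map \<Gamma> f v ` star \<Lambda> v"
      proof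
        fix x assume "x \<in> star \<Gamma> (vmap f v)"
        then obtain g e' where *: "e' \<in> edges \<Gamma>" "tgt \<Gamma> e' = vmap f v" "g \<in> carrier ?G" "x = (?D g e', e')"
          unfolding starG by blast
        then obtain e l k where le: "e \<in> edges \<Lambda>" "l \<in> carrier ?L" "k \<in> carrier (egroup \<Gamma> e')" "tgt \<Lambda> e = v" "emap f e = e'"
          "g = vhom f v l \<otimes>\<^bsub>?G\<^esub> twist f e \<otimes>\<^bsub>?G\<^esub> einj \<Gamma> e' k"
          using s unfolding locally_surj_def by blast
        then have "?D (vhom f v l \<otimes>\<^bsub>?G\<^esub> twist f e) e' = ?D g e'"
          using D[OF *(1,2) cl[OF le(1,4,2)] *(3)] by blast
        then have "x = star_map \<Gamma> f v (?C l e, e)" using sm[OF le(1,4,2)] le(5) *(4) by simp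
        then show "x \<in> star_map \<Gamma> f v ` star \<Lambda> v" unfolding starL using le by blast
      qed
    qed
  qed
  show ?thesis unfolding bij_betw_def inj surj ..
qed

end

section \<open>Lifting path classes through a covering\<close>

locale covering_morphism = gog_morphism +
  assumes cov: "covering \<Lambda> \<Gamma> f"
begin

lemma locally: "v \<in> verts \<Lambda> \<Longrightarrow> locally_inj v" "v \<in> verts \<Lambda> \<Longrightarrow> locally_surj v"
  using cov star_bij_iff unfolding covering_def by blast+

lemma vhom_inj: "v \<in> verts \<Lambda> \<Longrightarrow> inj_on (vhom f v) (carrier (vgroup \<Lambda> v))"
  and ehom_inj: "e \<in> edges \<Lambda> \<Longrightarrow> inj_on (ehom f e) (carrier (egroup \<Lambda> e))"
  using cov by (auto simp: covering_def mon_def)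

text \<open>Local injectivity, turned to outgoing edges, with one addition: the element
  \<open>j\<close> found in the edge group also accounts for \<open>k\<close>. Substituting
  \<open>l'\<close> into the equation and cancelling leaves an equality of \<open>einj\<close>
  values, and \<open>einj\<close> is injective.\<close>

lemma star_injD:
  assumes e: "e \<in> edges \<Lambda>" "e' \<in> edges \<Lambda>" "src \<Lambda> e' = src \<Lambda> e" "emap f e' = emap f e"
    and l: "l \<in> carrier (vgroup \<Lambda> (src \<Lambda> e))" "l' \<in> carrier (vgroup \<Lambda> (src \<Lambda> e))"
    and k: "k \<in> carrier (egroup \<Gamma> (emap f e))"
    and eq: "vhom f (src \<Lambda> e) l \<otimes>\<^bsub>vgroup \<Gamma> (vmap f (src \<Lambda> e))\<^esub> twist f (bar \<Lambda> e)
        \<otimes>\<^bsub>vgroup \<Gamma> (vmap f (src \<Lambda> e))\<^esub> einj \<Gamma> (bar \<Gamma> (emap f e)) k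
      = vhom f (src \<Lambda> e) l' \<otimes>\<^bsub>vgroup \<Gamma> (vmap f (src \<Lambda> e))\<^esub> twist f (bar \<Lambda> e')"
  shows "e = e' \<and> (\<exists>j\<in>carrier (egroup \<Lambda> e). l' = l \<otimes>\<^bsub>vgroup \<Lambda> (src \<Lambda> e)\<^esub> einj \<Lambda> (bar \<Lambda> e) j \<and> k = ehom f e j)"
proof -
  let ?v = "src \<Lambda> e"
  interpret V: group "vgroup \<Gamma> (vmap f ?v)" using e by (intro G.vgroup_group) simp
  have "bar \<Lambda> e = bar \<Lambda> e' \<and> (\<exists>j\<in>carrier (egroup \<Lambda> (bar \<Lambda> e)). l \<otimes>\<^bsub>vgroup \<Lambda> ?v\<^esub> einj \<Lambda> (bar \<Lambda> e) j = l')"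
  proof (rule locally(1)[of ?v, unfolded locally_inj_def, rule_format])
    show "vhom f ?v l \<otimes>\<^bsub>vgroup \<Gamma> (vmap f ?v)\<^esub> twist f (bar \<Lambda> e) \<otimes>\<^bsub>vgroup \<Gamma> (vmap f ?v)\<^esub> einj \<Gamma> (emap f (bar \<Lambda> e)) k
      = vhom f ?v l' \<otimes>\<^bsub>vgroup \<Gamma> (vmap f ?v)\<^esub> twist f (bar \<Lambda> e')" using eq e by simp
  qed (use e l k in auto)
  then obtain j where ee: "bar \<Lambda> e = bar \<Lambda> e'" and j: "j \<in> carrier (egroup \<Lambda> e)"
    "l' = l \<otimes>\<^bsub>vgroup \<Lambda> ?v\<^esub> einj \<Lambda> (bar \<Lambda> e) j" using e by auto
  have e': "e = e'" using arg_cong[OF ee, of "bar \<Lambda>"] e by simp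
  have jc: "ehom f e j \<in> carrier (egroup \<Gamma> (emap f e))" using e j by simp
  let ?G = "vgroup \<Gamma> (vmap f ?v)"
  have cl: "vhom f ?v l \<in> carrier ?G" "twist f (bar \<Lambda> e) \<in> carrier ?G"
    "einj \<Gamma> (bar \<Gamma> (emap f e)) (ehom f e j) \<in> carrier ?G" "vhom f ?v (einj \<Lambda> (bar \<Lambda> e) j) \<in> carrier ?G"
    using e l jc j by simp_all
  have "vhom f ?v l' = vhom f ?v l \<otimes>\<^bsub>?G\<^esub> vhom f ?v (einj \<Lambda> (bar \<Lambda> e) j)"
    unfolding j(2) by (rule vhom_mult) (use e l j in auto)
  then have "vhom f ?v l' \<otimes>\<^bsub>?G\<^esub> twist f (bar \<Lambda> e)
      = vhom f ?v l \<otimes>\<^bsub>?G\<^esub> twist f (bar \<Lambda> e) \<otimes>\<^bsub>?G\<^esub> einj \<Gamma> (bar \<Gamma> (emap f e)) (ehom f e j)"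
    using cl by (simp only: V.m_assoc V.m_closed vhom_einj_bar[OF e(1) j(1)])
  with eq have "vhom f ?v l \<otimes>\<^bsub>?G\<^esub> twist f (bar \<Lambda> e) \<otimes>\<^bsub>?G\<^esub> einj \<Gamma> (bar \<Gamma> (emap f e)) k
     = vhom f ?v l \<otimes>\<^bsub>?G\<^esub> twist f (bar \<Lambda> e) \<otimes>\<^bsub>?G\<^esub> einj \<Gamma> (bar \<Gamma> (emap f e)) (ehom f e j)"
    using ee by simp
  then have "einj \<Gamma> (bar \<Gamma> (emap f e)) k = einj \<Gamma> (bar \<Gamma> (emap f e)) (ehom f e j)"
    using e k cl by simp
  then have "k = ehom f e j" using G.einj_bar_eq[OF emap_in[OF e(1)] k jc] by simp
  then show ?thesis using e' j by blast
qed

lemma star_surjD: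
  assumes "w \<in> verts \<Lambda>" "e' \<in> edges \<Gamma>" "src \<Gamma> e' = vmap f w" "g \<in> carrier (vgroup \<Gamma> (vmap f w))"
  obtains e l k where "e \<in> edges \<Lambda>" "src \<Lambda> e = w" "emap f e = e'" "l \<in> carrier (vgroup \<Lambda> w)"
    "k \<in> carrier (egroup \<Gamma> e')"
    "g = vhom f w l \<otimes>\<^bsub>vgroup \<Gamma> (vmap f w)\<^esub> twist f (bar \<Lambda> e) \<otimes>\<^bsub>vgroup \<Gamma> (vmap f w)\<^esub> einj \<Gamma> (bar \<Gamma> e') k"
proof -
  obtain e l k where *: "e \<in> edges \<Lambda>" "l \<in> carrier (vgroup \<Lambda> w)" "k \<in> carrier (egroup \<Gamma> (bar \<Gamma> e'))"
    "tgt \<Lambda> e = w" "emap f e = bar \<Gamma> e'"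
    "g = vhom f w l \<otimes>\<^bsub>vgroup \<Gamma> (vmap f w)\<^esub> twist f e \<otimes>\<^bsub>vgroup \<Gamma> (vmap f w)\<^esub> einj \<Gamma> (bar \<Gamma> e') k"
    using locally(2)[OF assms(1)] assms G.bar_in[OF assms(2)] G.tgt_bar[of e'] unfolding locally_surj_def by metis
  show ?thesis by (rule that[of "bar \<Lambda> e" l k]) (use * assms in auto)
qed

end

locale pointed_covering_morphism = pointed_morphism \<Lambda> \<Gamma> f q p + covering_morphism \<Lambda> \<Gamma> f
  for \<Lambda> :: "('v, 'e, 'g, 'h) graph_of_groups" and \<Gamma> :: "('w, 'f, 'k, 'l) graph_of_groups"
    and f :: "('v, 'e, 'g, 'h, 'w, 'f, 'k, 'l) gmorphism" and q p
begin

text \<open>Induction over path classes in \<open>\<Gamma>\<close>. The remainder \<open>g\<close>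
  absorbs right multiplication; at an edge, surjectivity on stars rewrites it so that the path
  upstairs can follow an edge.\<close>

lemma lift_exists:
  assumes "A \<in> G.P v"
  shows "\<exists>w\<in>verts \<Lambda>. \<exists>B\<in>L.P w. \<exists>g\<in>carrier (vgroup \<Gamma> v). vmap f w = v \<and> A = G.R v (F w B) g"
proof -
  obtain w0 B0 where r: "root_path \<Lambda> q w0 B0" using L.root_exists by blast
  obtain \<beta> g0 where r': "root_path \<Gamma> p (vmap f w0) \<beta>" "g0 \<in> carrier (vgroup \<Gamma> (vmap f w0))"
    "G.R (vmap f w0) (F w0 B0) g0 = \<beta>" using pmap_root[OF r] by blast
  show ?thesis
    using r'(1) _ _ _ assms
  proof (rule G.vpaths_induct)
    show "\<exists>w\<in>verts \<Lambda>. \<exists>B\<in>L.P w. \<exists>g\<in>carrier (vgroup \<Gamma> (vmap f w0)).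
        vmap f w = vmap f w0 \<and> \<beta> = G.R (vmap f w0) (F w B) g"
      using L.root_in[OF r] L.vpaths_vert r' by blast
  next
    fix v A g
    assume A: "A \<in> G.P v" and g: "g \<in> carrier (vgroup \<Gamma> v)"
      and "\<exists>w\<in>verts \<Lambda>. \<exists>B\<in>L.P w. \<exists>g\<in>carrier (vgroup \<Gamma> v). vmap f w = v \<and> A = G.R v (F w B) g"
    then obtain w B g' where *: "w \<in> verts \<Lambda>" "B \<in> L.P w" "g' \<in> carrier (vgroup \<Gamma> v)" "vmap f w = v"
      "A = G.R v (F w B) g'" by blast
    have "G.R v A g = G.R v (F w B) (g' \<otimes>\<^bsub>vgroup \<Gamma> v\<^esub> g)"
      using * g pmap_vpaths[OF *(2)] by (simp add: G.ract_mult)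
    moreover have "g' \<otimes>\<^bsub>vgroup \<Gamma> v\<^esub> g \<in> carrier (vgroup \<Gamma> v)" using * g G.vpaths_vert[OF A] by simp
    ultimately show "\<exists>w\<in>verts \<Lambda>. \<exists>B\<in>L.P w. \<exists>h\<in>carrier (vgroup \<Gamma> v). vmap f w = v \<and> G.R v A g = G.R v (F w B) h"
      using * by blast
  next
    fix e' A
    assume e': "e' \<in> edges \<Gamma>" and A: "A \<in> G.P (src \<Gamma> e')"
      and "\<exists>w\<in>verts \<Lambda>. \<exists>B\<in>L.P w. \<exists>g\<in>carrier (vgroup \<Gamma> (src \<Gamma> e')). vmap f w = src \<Gamma> e' \<and> A = G.R (src \<Gamma> e') (F w B) g"
    then obtain w B g where *: "w \<in> verts \<Lambda>" "B \<in> L.P w" "src \<Gamma> e' = vmap f w" "g \<in> carrier (vgroup \<Gamma> (vmap f w))"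
      "A = G.R (vmap f w) (F w B) g" by metis
    \<comment> \<open>The factor \<open>l\<close> corrects the lift before it leaves along
      \<open>e\<close>, the twist is what the image of \<open>e\<close> begins with, and
      \<open>k\<close> is pushed across the edge into the new remainder.\<close>
    obtain e l k where e: "e \<in> edges \<Lambda>" "src \<Lambda> e = w" "emap f e = e'" "l \<in> carrier (vgroup \<Lambda> w)"
      "k \<in> carrier (egroup \<Gamma> e')"
      "g = vhom f w l \<otimes>\<^bsub>vgroup \<Gamma> (vmap f w)\<^esub> twist f (bar \<Lambda> e) \<otimes>\<^bsub>vgroup \<Gamma> (vmap f w)\<^esub> einj \<Gamma> (bar \<Gamma> e') k"
      using star_surjD[OF *(1) e' *(3,4)] by blast
    let ?B = "L.R w B l" and ?v = "vmap f (tgt \<Lambda> e)"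
    have B: "?B \<in> L.P w" "F w B \<in> G.P (vmap f w)" "F w ?B \<in> G.P (vmap f w)" using * e by simp_all
    have t: "twist f (bar \<Lambda> e) \<in> carrier (vgroup \<Gamma> (vmap f w))" using twist_bar_in[OF e(1)] e(2) by simp
    have i: "einj \<Gamma> (bar \<Gamma> e') k \<in> carrier (vgroup \<Gamma> (vmap f w))" using e by auto
    have te: "tgt \<Gamma> e' = ?v" using tgt_emap[OF e(1)] e(3) by simp
    have A': "A = G.R (vmap f w) (G.R (vmap f w) (F w ?B) (twist f (bar \<Lambda> e))) (einj \<Gamma> (bar \<Gamma> e') k)"
      unfolding *(5) e(6) using *(1,2) e(4) B t i by (simp add: pmap_ract G.ract_mult)
    have "G.X e' A = G.R ?v (G.X e' (G.R (vmap f w) (F w ?B) (twist f (bar \<Lambda> e)))) (einj \<Gamma> e' k)"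
      unfolding A' te[symmetric] *(3)[symmetric]
      by (rule G.extend_ract[OF e' e(5)]) (use B(3) t *(3) in simp)
    also have "\<dots> = G.R ?v (G.R ?v (F (tgt \<Lambda> e) (L.X e ?B)) (twist f e)) (einj \<Gamma> e' k)"
      using pmap_extend[OF e(1), of ?B] e(2,3) B(1) by simp
    also have "\<dots> = G.R ?v (F (tgt \<Lambda> e) (L.X e ?B)) (twist f e \<otimes>\<^bsub>vgroup \<Gamma> ?v\<^esub> einj \<Gamma> e' k)"
      by (rule G.ract_mult[symmetric]) (use e(1,2,3,5) B in \<open>auto intro!: pmap_vpaths\<close>)
    finally have "G.X e' A = G.R ?v (F (tgt \<Lambda> e) (L.X e ?B)) (twist f e \<otimes>\<^bsub>vgroup \<Gamma> ?v\<^esub> einj \<Gamma> e' k)" .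
    moreover have "twist f e \<otimes>\<^bsub>vgroup \<Gamma> ?v\<^esub> einj \<Gamma> e' k \<in> carrier (vgroup \<Gamma> ?v)"
      using e(1,3,5) by auto
    moreover have "tgt \<Lambda> e \<in> verts \<Lambda>" "L.X e ?B \<in> L.P (tgt \<Lambda> e)" using e(1,2) B(1) by auto
    ultimately show "\<exists>w\<in>verts \<Lambda>. \<exists>B\<in>L.P w. \<exists>g\<in>carrier (vgroup \<Gamma> (tgt \<Gamma> e')). vmap f w = tgt \<Gamma> e' \<and> G.X e' A = G.R (tgt \<Gamma> e') (F w B) g"
      unfolding te by blast
  qed
qed

text \<open>Uniqueness of lifts: paths in \<open>\<Gamma>\<close> act on classes of triples \<open>(w, B, g)\<close>, standing for the path
  \<open>f B g\<close>, under \<open>(w, B l, g) \<sim> (w, B, f l g)\<close>, and the triple reached by \<open>f B g\<close> is \<open>(w, B, g)\<close>.\<close>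

lemma lift_unique:
  assumes w: "w \<in> verts \<Lambda>" "w' \<in> verts \<Lambda>" "vmap f w' = vmap f w"
    and B: "B \<in> L.P w" "B' \<in> L.P w'"
    and g: "g \<in> carrier (vgroup \<Gamma> (vmap f w))" "g' \<in> carrier (vgroup \<Gamma> (vmap f w))"
    and eq: "G.R (vmap f w) (F w B) g = G.R (vmap f w) (F w' B') g'"
  shows "w' = w \<and> (\<exists>l\<in>carrier (vgroup \<Lambda> w). B' = L.R w B l \<and> g = vhom f w l \<otimes>\<^bsub>vgroup \<Gamma> (vmap f w)\<^esub> g')"
proof -
  let ?GL = "\<lambda>w. carrier (vgroup \<Lambda> w)" and ?G = "\<lambda>w. vgroup \<Gamma> (vmap f w)"
  \<comment> \<open>The orbit of a triple under the vertex group of \<open>\<Lambda>\<close>, which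
    acts on the path and inversely on the remainder.\<close>
  define cls where "cls w B g = {(w, L.R w B l, inv\<^bsub>?G w\<^esub> (vhom f w l) \<otimes>\<^bsub>?G w\<^esub> g) | l. l \<in> ?GL w}" for w B g
  define Y where "Y v = {cls w B g | w B g. w \<in> verts \<Lambda> \<and> vmap f w = v \<and> B \<in> L.P w \<and> g \<in> carrier (vgroup \<Gamma> v)}" for v
  define rv where "rv v Z g0 = (\<lambda>(w, B, g). (w, B, g \<otimes>\<^bsub>vgroup \<Gamma> v\<^esub> g0)) ` Z" for v g0 and Z :: "('v \<times> ('v, 'e, 'g) pclass \<times> 'k) set"
  \<comment> \<open>A triple is ready to leave along \<open>e'\<close> when its remainder is the
    twist of some edge over \<open>e'\<close> times an element of the edge group; then that edge is
    followed in \<open>\<Lambda>\<close>. The union ranges over all ready triples of the class and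
    is shown to be a union of equal sets.\<close>
  define ex where "ex e' Z = \<Union>{cls (tgt \<Lambda> e) (L.X e B) (twist f e \<otimes>\<^bsub>?G (tgt \<Lambda> e)\<^esub> einj \<Gamma> e' k) | e B k.
     e \<in> edges \<Lambda> \<and> emap f e = e' \<and> B \<in> L.P (src \<Lambda> e) \<and> k \<in> carrier (egroup \<Gamma> e') \<and>
     (src \<Lambda> e, B, twist f (bar \<Lambda> e) \<otimes>\<^bsub>?G (src \<Lambda> e)\<^esub> einj \<Gamma> (bar \<Gamma> e') k) \<in> Z}" for e' Z
  have YI: "cls w B g \<in> Y (vmap f w)" if "w \<in> verts \<Lambda>" "B \<in> L.P w" "g \<in> carrier (?G w)" for w B g
    using that unfolding Y_def by blast
  have self: "(w, B, g) \<in> cls w B g" if "w \<in> verts \<Lambda>" "B \<in> L.P w" "g \<in> carrier (?G w)" for w B g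
  proof -
    interpret V: group "?G w" using that by (intro G.vgroup_group) simp
    have "(w, L.R w B \<one>\<^bsub>vgroup \<Lambda> w\<^esub>, inv\<^bsub>?G w\<^esub> (vhom f w \<one>\<^bsub>vgroup \<Lambda> w\<^esub>) \<otimes>\<^bsub>?G w\<^esub> g) \<in> cls w B g"
      unfolding cls_def using L.vone_in[OF that(1)] by blast
    then show ?thesis using that by simp
  qed
  have cls_ract: "cls w (L.R w B l) g = cls w B (vhom f w l \<otimes>\<^bsub>?G w\<^esub> g)"
    if "w \<in> verts \<Lambda>" "B \<in> L.P w" "l \<in> ?GL w" "g \<in> carrier (?G w)" for w B l g
  proof -
    interpret V: group "?G w" using that by (intro G.vgroup_group) simp
    interpret W: group "vgroup \<Lambda> w" using that by (intro L.vgroup_group) simp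
    have 1: "L.R w (L.R w B l) m = L.R w B (l \<otimes>\<^bsub>vgroup \<Lambda> w\<^esub> m)"
      "inv\<^bsub>?G w\<^esub> (vhom f w m) \<otimes>\<^bsub>?G w\<^esub> g
        = inv\<^bsub>?G w\<^esub> (vhom f w (l \<otimes>\<^bsub>vgroup \<Lambda> w\<^esub> m)) \<otimes>\<^bsub>?G w\<^esub> (vhom f w l \<otimes>\<^bsub>?G w\<^esub> g)" if "m \<in> ?GL w" for m
      using \<open>w \<in> verts \<Lambda>\<close> \<open>B \<in> L.P w\<close> \<open>l \<in> ?GL w\<close> \<open>g \<in> carrier (?G w)\<close> that
      by (simp_all add: L.ract_mult vhom_mult V.inv_mult_group V.m_assoc flip: V.m_assoc[of "inv\<^bsub>?G w\<^esub> (vhom f w l)" "vhom f w l" g])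
    have "(\<exists>m\<in>?GL w. x = (w, L.R w B m, inv\<^bsub>?G w\<^esub> (vhom f w m) \<otimes>\<^bsub>?G w\<^esub> (vhom f w l \<otimes>\<^bsub>?G w\<^esub> g)))"
      if "m \<in> ?GL w" "x = (w, L.R w (L.R w B l) m, inv\<^bsub>?G w\<^esub> (vhom f w m) \<otimes>\<^bsub>?G w\<^esub> g)" for x m
      using 1[OF that(1)] that \<open>l \<in> ?GL w\<close> by (intro bexI[of _ "l \<otimes>\<^bsub>vgroup \<Lambda> w\<^esub> m"]) auto
    moreover have "(\<exists>m\<in>?GL w. x = (w, L.R w (L.R w B l) m, inv\<^bsub>?G w\<^esub> (vhom f w m) \<otimes>\<^bsub>?G w\<^esub> g))"
      if "m \<in> ?GL w" "x = (w, L.R w B m, inv\<^bsub>?G w\<^esub> (vhom f w m) \<otimes>\<^bsub>?G w\<^esub> (vhom f w l \<otimes>\<^bsub>?G w\<^esub> g))" for x m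
    proof -
      let ?m = "inv\<^bsub>vgroup \<Lambda> w\<^esub> l \<otimes>\<^bsub>vgroup \<Lambda> w\<^esub> m"
      have m: "?m \<in> ?GL w" "l \<otimes>\<^bsub>vgroup \<Lambda> w\<^esub> ?m = m"
        using that(1) \<open>l \<in> ?GL w\<close> by (simp_all flip: W.m_assoc)
      show ?thesis using 1[OF m(1)] m that(2) by (intro bexI[of _ ?m]) auto
    qed
    ultimately show ?thesis unfolding cls_def by blast
  qed
  \<comment> \<open>Injectivity on stars: two ready triples of one class use the same edge and
    differ by an element \<open>j\<close> of its edge group, which crosses to the far end and is
    absorbed there by \<open>cls_ract\<close>.\<close>
  have ex_cls: "ex (emap f e) (cls (src \<Lambda> e) B (twist f (bar \<Lambda> e) \<otimes>\<^bsub>?G (src \<Lambda> e)\<^esub> einj \<Gamma> (bar \<Gamma> (emap f e)) k))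
      = cls (tgt \<Lambda> e) (L.X e B) (twist f e \<otimes>\<^bsub>?G (tgt \<Lambda> e)\<^esub> einj \<Gamma> (emap f e) k)" (is "ex ?e' ?Z = ?R")
    if e: "e \<in> edges \<Lambda>" and B: "B \<in> L.P (src \<Lambda> e)" and k: "k \<in> carrier (egroup \<Gamma> (emap f e))" for e B k
  proof -
    interpret V: group "?G (src \<Lambda> e)" using e by (intro G.vgroup_group) simp
    interpret W: group "?G (tgt \<Lambda> e)" using e by (intro G.vgroup_group) simp
    have "cls (tgt \<Lambda> e1) (L.X e1 B1) (twist f e1 \<otimes>\<^bsub>?G (tgt \<Lambda> e1)\<^esub> einj \<Gamma> ?e' k1) = ?R"
      if e1: "e1 \<in> edges \<Lambda>" "emap f e1 = ?e'" and k1: "k1 \<in> carrier (egroup \<Gamma> ?e')"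
        and mem: "(src \<Lambda> e1, B1, twist f (bar \<Lambda> e1) \<otimes>\<^bsub>?G (src \<Lambda> e1)\<^esub> einj \<Gamma> (bar \<Gamma> ?e') k1) \<in> ?Z" for e1 B1 k1
    proof -
      obtain l where l: "src \<Lambda> e1 = src \<Lambda> e" "l \<in> ?GL (src \<Lambda> e)" "B1 = L.R (src \<Lambda> e) B l"
        "twist f (bar \<Lambda> e1) \<otimes>\<^bsub>?G (src \<Lambda> e1)\<^esub> einj \<Gamma> (bar \<Gamma> ?e') k1
         = inv\<^bsub>?G (src \<Lambda> e)\<^esub> (vhom f (src \<Lambda> e) l) \<otimes>\<^bsub>?G (src \<Lambda> e)\<^esub> (twist f (bar \<Lambda> e) \<otimes>\<^bsub>?G (src \<Lambda> e)\<^esub> einj \<Gamma> (bar \<Gamma> ?e') k)"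
        using mem unfolding cls_def by auto
      let ?I = "einj \<Gamma> (bar \<Gamma> ?e')" and ?u = "src \<Lambda> e"
      interpret E: group "egroup \<Gamma> ?e'" using e by (intro G.egroup_group) simp
      have cl: "twist f (bar \<Lambda> e) \<in> carrier (?G ?u)" "twist f (bar \<Lambda> e1) \<in> carrier (?G ?u)"
        "?I k \<in> carrier (?G ?u)" "?I k1 \<in> carrier (?G ?u)" "vhom f ?u l \<in> carrier (?G ?u)"
        using e e1 l(1,2) k k1 twist_bar_in[OF e1(1)] by auto
      have t1: "twist f (bar \<Lambda> e1) = inv\<^bsub>?G ?u\<^esub> (vhom f ?u l) \<otimes>\<^bsub>?G ?u\<^esub> (twist f (bar \<Lambda> e) \<otimes>\<^bsub>?G ?u\<^esub> ?I k) \<otimes>\<^bsub>?G ?u\<^esub> inv\<^bsub>?G ?u\<^esub> ?I k1"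
        using l(4)[symmetric] cl unfolding l(1) by (simp add: V.m_assoc)
      have Ik: "?I (k \<otimes>\<^bsub>egroup \<Gamma> ?e'\<^esub> inv\<^bsub>egroup \<Gamma> ?e'\<^esub> k1) = ?I k \<otimes>\<^bsub>?G ?u\<^esub> inv\<^bsub>?G ?u\<^esub> ?I k1"
        using G.einj_bar_mult[of ?e' k "inv\<^bsub>egroup \<Gamma> ?e'\<^esub> k1"] G.einj_inv[of "bar \<Gamma> ?e'" k1] e k k1 by simp
      have "e = e1 \<and> (\<exists>j\<in>carrier (egroup \<Lambda> e). l = \<one>\<^bsub>vgroup \<Lambda> ?u\<^esub> \<otimes>\<^bsub>vgroup \<Lambda> ?u\<^esub> einj \<Lambda> (bar \<Lambda> e) j \<and>
          k \<otimes>\<^bsub>egroup \<Gamma> ?e'\<^esub> inv\<^bsub>egroup \<Gamma> ?e'\<^esub> k1 = ehom f e j)"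
      proof (rule star_injD)
        show "vhom f ?u \<one>\<^bsub>vgroup \<Lambda> ?u\<^esub> \<otimes>\<^bsub>?G ?u\<^esub> twist f (bar \<Lambda> e) \<otimes>\<^bsub>?G ?u\<^esub> ?I (k \<otimes>\<^bsub>egroup \<Gamma> ?e'\<^esub> inv\<^bsub>egroup \<Gamma> ?e'\<^esub> k1)
          = vhom f ?u l \<otimes>\<^bsub>?G ?u\<^esub> twist f (bar \<Lambda> e1)"
          unfolding t1 Ik using cl e by (simp add: V.m_assoc flip: V.m_assoc[of "vhom f ?u l" "inv\<^bsub>?G ?u\<^esub> (vhom f ?u l)"])
      qed (use e e1 l k k1 in auto)
      then obtain j where ee: "e1 = e" and j: "j \<in> carrier (egroup \<Lambda> e)" "l = einj \<Lambda> (bar \<Lambda> e) j"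
        "k \<otimes>\<^bsub>egroup \<Gamma> ?e'\<^esub> inv\<^bsub>egroup \<Gamma> ?e'\<^esub> k1 = ehom f e j"
        using e monoid.l_one[OF group.is_monoid[OF L.vgroup_group[of ?u]]] by auto
      have kk: "ehom f e j \<otimes>\<^bsub>egroup \<Gamma> ?e'\<^esub> k1 = k" unfolding j(3)[symmetric] using k k1 by (simp add: E.m_assoc)
      have XB: "L.X e B1 = L.R (tgt \<Lambda> e) (L.X e B) (einj \<Lambda> e j)"
        unfolding l(3) j(2) using L.extend_ract[OF e j(1) B] .
      have cl': "twist f e \<in> carrier (?G (tgt \<Lambda> e))" "einj \<Gamma> ?e' k1 \<in> carrier (?G (tgt \<Lambda> e))"
        "einj \<Gamma> ?e' (ehom f e j) \<in> carrier (?G (tgt \<Lambda> e))" "vhom f (tgt \<Lambda> e) (einj \<Lambda> e j) \<in> carrier (?G (tgt \<Lambda> e))"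
        using e k1 j(1) by simp_all
      have "cls (tgt \<Lambda> e) (L.X e B1) (twist f e \<otimes>\<^bsub>?G (tgt \<Lambda> e)\<^esub> einj \<Gamma> ?e' k1)
        = cls (tgt \<Lambda> e) (L.X e B) (vhom f (tgt \<Lambda> e) (einj \<Lambda> e j) \<otimes>\<^bsub>?G (tgt \<Lambda> e)\<^esub> (twist f e \<otimes>\<^bsub>?G (tgt \<Lambda> e)\<^esub> einj \<Gamma> ?e' k1))"
        unfolding XB by (rule cls_ract) (use e j(1) B cl' in auto)
      also have "vhom f (tgt \<Lambda> e) (einj \<Lambda> e j) \<otimes>\<^bsub>?G (tgt \<Lambda> e)\<^esub> (twist f e \<otimes>\<^bsub>?G (tgt \<Lambda> e)\<^esub> einj \<Gamma> ?e' k1)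
        = twist f e \<otimes>\<^bsub>?G (tgt \<Lambda> e)\<^esub> (einj \<Gamma> ?e' (ehom f e j) \<otimes>\<^bsub>?G (tgt \<Lambda> e)\<^esub> einj \<Gamma> ?e' k1)"
        using cl' vhom_einj[OF e j(1)] by (metis W.m_assoc)
      also have "einj \<Gamma> ?e' (ehom f e j) \<otimes>\<^bsub>?G (tgt \<Lambda> e)\<^esub> einj \<Gamma> ?e' k1 = einj \<Gamma> ?e' k"
        using G.einj_mult[of ?e' "ehom f e j" k1] kk e j(1) k1 by simp
      finally show ?thesis unfolding ee .
    qed
    moreover have "(src \<Lambda> e, B, twist f (bar \<Lambda> e) \<otimes>\<^bsub>?G (src \<Lambda> e)\<^esub> einj \<Gamma> (bar \<Gamma> ?e') k) \<in> ?Z"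
      by (rule self) (use e B k in auto)
    ultimately have "{cls (tgt \<Lambda> e1) (L.X e1 B1) (twist f e1 \<otimes>\<^bsub>?G (tgt \<Lambda> e1)\<^esub> einj \<Gamma> ?e' k1) | e1 B1 k1.
       e1 \<in> edges \<Lambda> \<and> emap f e1 = ?e' \<and> B1 \<in> L.P (src \<Lambda> e1) \<and> k1 \<in> carrier (egroup \<Gamma> ?e') \<and>
       (src \<Lambda> e1, B1, twist f (bar \<Lambda> e1) \<otimes>\<^bsub>?G (src \<Lambda> e1)\<^esub> einj \<Gamma> (bar \<Gamma> ?e') k1) \<in> ?Z} = {?R}"
      using e B k by blast
    then show ?thesis unfolding ex_def by simp
  qed
  \<comment> \<open>Surjectivity on stars: every class over the source of \<open>e'\<close> contains
    a ready triple.\<close>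
  have Y_out: "\<exists>e B k. e \<in> edges \<Lambda> \<and> emap f e = e' \<and> B \<in> L.P (src \<Lambda> e) \<and> k \<in> carrier (egroup \<Gamma> e') \<and>
      Z = cls (src \<Lambda> e) B (twist f (bar \<Lambda> e) \<otimes>\<^bsub>?G (src \<Lambda> e)\<^esub> einj \<Gamma> (bar \<Gamma> e') k)"
    if e': "e' \<in> edges \<Gamma>" and "Z \<in> Y (src \<Gamma> e')" for e' Z
  proof -
    obtain w B g where *: "w \<in> verts \<Lambda>" "src \<Gamma> e' = vmap f w" "B \<in> L.P w" "g \<in> carrier (?G w)" "Z = cls w B g"
      using \<open>Z \<in> Y (src \<Gamma> e')\<close> unfolding Y_def by auto
    obtain e l k where e: "e \<in> edges \<Lambda>" "src \<Lambda> e = w" "emap f e = e'" "l \<in> ?GL w"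
      "k \<in> carrier (egroup \<Gamma> e')"
      "g = vhom f w l \<otimes>\<^bsub>?G w\<^esub> twist f (bar \<Lambda> e) \<otimes>\<^bsub>?G w\<^esub> einj \<Gamma> (bar \<Gamma> e') k"
      using star_surjD[OF *(1) e' *(2,4)] by blast
    interpret V: group "?G w" using * by (intro G.vgroup_group) simp
    have cl: "twist f (bar \<Lambda> e) \<in> carrier (?G w)" "einj \<Gamma> (bar \<Gamma> e') k \<in> carrier (?G w)" "vhom f w l \<in> carrier (?G w)"
      using e * twist_bar_in[OF e(1)] by auto
    have "Z = cls w (L.R w B l) (twist f (bar \<Lambda> e) \<otimes>\<^bsub>?G w\<^esub> einj \<Gamma> (bar \<Gamma> e') k)"
      unfolding *(5) using cls_ract[OF *(1,3) e(4), of "twist f (bar \<Lambda> e) \<otimes>\<^bsub>?G w\<^esub> einj \<Gamma> (bar \<Gamma> e') k"] cl e(6)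
      by (simp add: V.m_assoc)
    then show ?thesis using e * by (intro exI[of _ e] exI[of _ "L.R w B l"] exI[of _ k]) auto
  qed
  have rv_cls: "rv (vmap f w) (cls w B g) g0 = cls w B (g \<otimes>\<^bsub>?G w\<^esub> g0)"
    if "w \<in> verts \<Lambda>" "B \<in> L.P w" "g \<in> carrier (?G w)" "g0 \<in> carrier (?G w)" for w B g g0
  proof -
    interpret V: group "?G w" using that by (intro G.vgroup_group) simp
    have "inv\<^bsub>?G w\<^esub> (vhom f w l) \<otimes>\<^bsub>?G w\<^esub> g \<otimes>\<^bsub>?G w\<^esub> g0 = inv\<^bsub>?G w\<^esub> (vhom f w l) \<otimes>\<^bsub>?G w\<^esub> (g \<otimes>\<^bsub>?G w\<^esub> g0)"
      if "l \<in> ?GL w" for l using that \<open>w \<in> verts \<Lambda>\<close> \<open>g \<in> carrier (?G w)\<close> \<open>g0 \<in> carrier (?G w)\<close> by (simp add: V.m_assoc)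
    then show ?thesis unfolding rv_def cls_def by (force simp: image_iff)
  qed
  obtain w0 B0 where r: "root_path \<Lambda> q w0 B0" using L.root_exists by blast
  obtain \<beta> g0 where r': "root_path \<Gamma> p (vmap f w0) \<beta>" "g0 \<in> carrier (?G w0)"
    "G.R (vmap f w0) (F w0 B0) g0 = \<beta>" using pmap_root[OF r] by blast
  have r0: "B0 \<in> L.P w0" "w0 \<in> verts \<Lambda>" using L.root_in[OF r] L.vpaths_vert by auto
  have eout: "\<exists>e B k. e \<in> edges \<Lambda> \<and> emap f e = e' \<and> B \<in> L.P (src \<Lambda> e) \<and> k \<in> carrier (egroup \<Gamma> e') \<and>
      Z = cls (src \<Lambda> e) B (twist f (bar \<Lambda> e) \<otimes>\<^bsub>?G (src \<Lambda> e)\<^esub> einj \<Gamma> (bar \<Gamma> e') k) \<and>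
      ex e' Z = cls (tgt \<Lambda> e) (L.X e B) (twist f e \<otimes>\<^bsub>?G (tgt \<Lambda> e)\<^esub> einj \<Gamma> e' k)"
    if "e' \<in> edges \<Gamma>" "Z \<in> Y (src \<Gamma> e')" for e' Z
    using Y_out[OF that] ex_cls by metis
  \<comment> \<open>The root of \<open>\<Gamma>\<close> is the image of \<open>B0\<close> times
    \<open>g0\<close>, which is why the recursion starts from the triple
    \<open>(w0, B0, g0)\<close>.\<close>
  obtain \<Phi> where \<Phi>: "\<Phi> \<beta> = cls w0 B0 g0"
    "\<And>v A g. \<lbrakk>A \<in> G.P v; g \<in> carrier (vgroup \<Gamma> v)\<rbrakk> \<Longrightarrow> \<Phi> (G.R v A g) = rv v (\<Phi> A) g"
    "\<And>e A. \<lbrakk>e \<in> edges \<Gamma>; A \<in> G.P (src \<Gamma> e)\<rbrakk> \<Longrightarrow> \<Phi> (G.X e A) = ex e (\<Phi> A)"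
  proof (rule G.vpaths_rec[where Y = Y and rv = rv and ex = ex, OF r'(1) YI[OF r0(2,1) r'(2)]])
    show "rv v y g \<in> Y v" if "v \<in> verts \<Gamma>" "y \<in> Y v" "g \<in> carrier (vgroup \<Gamma> v)" for v y g
      using that rv_cls YI unfolding Y_def by auto
    show "rv v y \<one>\<^bsub>vgroup \<Gamma> v\<^esub> = y" if "v \<in> verts \<Gamma>" "y \<in> Y v" for v y
      using that rv_cls monoid.r_one[OF group.is_monoid[OF G.vgroup_group[OF that(1)]]] unfolding Y_def by auto
    show "rv v y (g \<otimes>\<^bsub>vgroup \<Gamma> v\<^esub> g') = rv v (rv v y g) g'"
      if "v \<in> verts \<Gamma>" "y \<in> Y v" "g \<in> carrier (vgroup \<Gamma> v)" "g' \<in> carrier (vgroup \<Gamma> v)" for v y g g'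
      using that rv_cls monoid.m_assoc[OF group.is_monoid[OF G.vgroup_group[OF that(1)]]] unfolding Y_def by auto
    show "ex e y \<in> Y (tgt \<Gamma> e)" if ey: "e \<in> edges \<Gamma>" "y \<in> Y (src \<Gamma> e)" for e y
    proof -
      obtain e1 B k where *: "e1 \<in> edges \<Lambda>" "emap f e1 = e" "B \<in> L.P (src \<Lambda> e1)" "k \<in> carrier (egroup \<Gamma> e)"
        "ex e y = cls (tgt \<Lambda> e1) (L.X e1 B) (twist f e1 \<otimes>\<^bsub>?G (tgt \<Lambda> e1)\<^esub> einj \<Gamma> e k)" using eout[OF ey] by blast
      then show ?thesis using YI[of "tgt \<Lambda> e1" "L.X e1 B" "twist f e1 \<otimes>\<^bsub>?G (tgt \<Lambda> e1)\<^esub> einj \<Gamma> e k"] by auto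
    qed
    show "ex (bar \<Gamma> e) (ex e y) = y" if ey: "e \<in> edges \<Gamma>" "y \<in> Y (src \<Gamma> e)" for e y
    proof -
      obtain e1 B k where *: "e1 \<in> edges \<Lambda>" "emap f e1 = e" "B \<in> L.P (src \<Lambda> e1)" "k \<in> carrier (egroup \<Gamma> e)"
        "y = cls (src \<Lambda> e1) B (twist f (bar \<Lambda> e1) \<otimes>\<^bsub>?G (src \<Lambda> e1)\<^esub> einj \<Gamma> (bar \<Gamma> e) k)"
        "ex e y = cls (tgt \<Lambda> e1) (L.X e1 B) (twist f e1 \<otimes>\<^bsub>?G (tgt \<Lambda> e1)\<^esub> einj \<Gamma> e k)" using eout[OF ey] by blast
      then show ?thesis using ex_cls[of "bar \<Lambda> e1" "L.X e1 B" k] ey(1) by simp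
    qed
    show "ex e (rv (src \<Gamma> e) y (einj \<Gamma> (bar \<Gamma> e) k)) = rv (tgt \<Gamma> e) (ex e y) (einj \<Gamma> e k)"
      if ey: "e \<in> edges \<Gamma>" "y \<in> Y (src \<Gamma> e)" and k: "k \<in> carrier (egroup \<Gamma> e)" for e y k
    proof -
      obtain e1 B k1 where *: "e1 \<in> edges \<Lambda>" "emap f e1 = e" "B \<in> L.P (src \<Lambda> e1)" "k1 \<in> carrier (egroup \<Gamma> e)"
        "y = cls (src \<Lambda> e1) B (twist f (bar \<Lambda> e1) \<otimes>\<^bsub>?G (src \<Lambda> e1)\<^esub> einj \<Gamma> (bar \<Gamma> e) k1)"
        "ex e y = cls (tgt \<Lambda> e1) (L.X e1 B) (twist f e1 \<otimes>\<^bsub>?G (tgt \<Lambda> e1)\<^esub> einj \<Gamma> e k1)" using eout[OF ey] by blast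
      interpret V: group "?G (src \<Lambda> e1)" using * by (intro G.vgroup_group) simp
      interpret W: group "?G (tgt \<Lambda> e1)" using * by (intro G.vgroup_group) simp
      have st: "src \<Gamma> e = vmap f (src \<Lambda> e1)" "tgt \<Gamma> e = vmap f (tgt \<Lambda> e1)" using * by auto
      have cl: "twist f (bar \<Lambda> e1) \<in> carrier (?G (src \<Lambda> e1))" "twist f e1 \<in> carrier (?G (tgt \<Lambda> e1))"
        "\<And>k. k \<in> carrier (egroup \<Gamma> e) \<Longrightarrow> einj \<Gamma> (bar \<Gamma> e) k \<in> carrier (?G (src \<Lambda> e1))"
        "\<And>k. k \<in> carrier (egroup \<Gamma> e) \<Longrightarrow> einj \<Gamma> e k \<in> carrier (?G (tgt \<Lambda> e1))"
        using *(1,2) by auto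
      have kk: "k1 \<otimes>\<^bsub>egroup \<Gamma> e\<^esub> k \<in> carrier (egroup \<Gamma> e)" using ey(1) k *(4) by simp
      have "rv (src \<Gamma> e) y (einj \<Gamma> (bar \<Gamma> e) k)
        = cls (src \<Lambda> e1) B (twist f (bar \<Lambda> e1) \<otimes>\<^bsub>?G (src \<Lambda> e1)\<^esub> einj \<Gamma> (bar \<Gamma> e) (k1 \<otimes>\<^bsub>egroup \<Gamma> e\<^esub> k))"
        unfolding *(5) st(1)
        using rv_cls[of "src \<Lambda> e1" B] *(1-4) k cl G.einj_bar_mult[OF ey(1) *(4) k] st by (simp add: V.m_assoc)
      then have "ex e (rv (src \<Gamma> e) y (einj \<Gamma> (bar \<Gamma> e) k))
        = cls (tgt \<Lambda> e1) (L.X e1 B) (twist f e1 \<otimes>\<^bsub>?G (tgt \<Lambda> e1)\<^esub> einj \<Gamma> e (k1 \<otimes>\<^bsub>egroup \<Gamma> e\<^esub> k))"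
        using ex_cls[OF *(1,3), of "k1 \<otimes>\<^bsub>egroup \<Gamma> e\<^esub> k"] kk *(2) by simp
      also have "\<dots> = rv (tgt \<Gamma> e) (ex e y) (einj \<Gamma> e k)"
        unfolding *(6) st(2)
        using rv_cls[of "tgt \<Lambda> e1" "L.X e1 B"] *(1-4) k cl G.einj_mult[OF ey(1) *(4) k] st by (simp add: W.m_assoc)
      finally show ?thesis .
    qed
  qed blast
  \<comment> \<open>Induction in \<open>\<Lambda>\<close>: walking along the image of
    \<open>B\<close> leads back to \<open>B\<close>, with trivial remainder.\<close>
  have key: "\<Phi> (F w B) = cls w B \<one>\<^bsub>?G w\<^esub>" if "B \<in> L.P w" for w B
    using r _ _ _ that
  proof (rule L.vpaths_induct)
    interpret V: group "?G w0" using r0 by (intro G.vgroup_group) simp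
    have "F w0 B0 = G.R (vmap f w0) \<beta> (inv\<^bsub>?G w0\<^esub> g0)"
      using r' pmap_vpaths[OF r0(1)] by auto
    then have "\<Phi> (F w0 B0) = rv (vmap f w0) (cls w0 B0 g0) (inv\<^bsub>?G w0\<^esub> g0)"
      using \<Phi>(1) \<Phi>(2)[OF G.root_in[OF r'(1)]] r'(2) by simp
    then show "\<Phi> (F w0 B0) = cls w0 B0 \<one>\<^bsub>?G w0\<^esub>"
      using rv_cls[OF r0(2,1)] r' by simp
  next
    fix w B g assume B: "B \<in> L.P w" and g: "g \<in> ?GL w" and IH: "\<Phi> (F w B) = cls w B \<one>\<^bsub>?G w\<^esub>"
    have w: "w \<in> verts \<Lambda>" using L.vpaths_vert[OF B] .
    interpret V: group "?G w" using w by (intro G.vgroup_group) simp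
    have "\<Phi> (F w (L.R w B g)) = cls w B (vhom f w g)"
      using pmap_ract[OF B g] \<Phi>(2)[OF pmap_vpaths[OF B]] rv_cls[OF w B, of "\<one>\<^bsub>?G w\<^esub>" "vhom f w g"] IH w g by simp
    then show "\<Phi> (F w (L.R w B g)) = cls w (L.R w B g) \<one>\<^bsub>?G w\<^esub>"
      using cls_ract[OF w B g, of "\<one>\<^bsub>?G w\<^esub>"] w g by simp
  next
    fix e B assume e: "e \<in> edges \<Lambda>" and B: "B \<in> L.P (src \<Lambda> e)" and IH: "\<Phi> (F (src \<Lambda> e) B) = cls (src \<Lambda> e) B \<one>\<^bsub>?G (src \<Lambda> e)\<^esub>"
    let ?u = "src \<Lambda> e" and ?v = "tgt \<Lambda> e"
    interpret V: group "?G ?u" using e by (intro G.vgroup_group) simp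
    interpret W: group "?G ?v" using e by (intro G.vgroup_group) simp
    have "F ?v (L.X e B) = G.R (vmap f ?v) (G.X (emap f e) (G.R (vmap f ?u) (F ?u B) (twist f (bar \<Lambda> e)))) (inv\<^bsub>?G ?v\<^esub> twist f e)"
      using pmap_extend[OF e B, symmetric] e B by simp
    moreover have "\<Phi> (G.R (vmap f ?u) (F ?u B) (twist f (bar \<Lambda> e))) = cls ?u B (twist f (bar \<Lambda> e))"
      using \<Phi>(2)[OF pmap_vpaths[OF B]] IH rv_cls[of ?u B "\<one>\<^bsub>?G ?u\<^esub>" "twist f (bar \<Lambda> e)"] e B by simp
    moreover have "ex (emap f e) (cls ?u B (twist f (bar \<Lambda> e))) = cls ?v (L.X e B) (twist f e)"
      using ex_cls[OF e B, of "\<one>\<^bsub>egroup \<Gamma> (emap f e)\<^esub>"] e by simp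
    moreover have "G.R (vmap f ?u) (F ?u B) (twist f (bar \<Lambda> e)) \<in> G.P (src \<Gamma> (emap f e))" using e B by simp
    ultimately have "\<Phi> (F ?v (L.X e B)) = rv (vmap f ?v) (cls ?v (L.X e B) (twist f e)) (inv\<^bsub>?G ?v\<^esub> twist f e)"
      using \<Phi>(2)[of "G.X (emap f e) (G.R (vmap f ?u) (F ?u B) (twist f (bar \<Lambda> e)))" "vmap f ?v"] \<Phi>(3)[of "emap f e"] e
        G.extend_closed[of "emap f e" "G.R (vmap f ?u) (F ?u B) (twist f (bar \<Lambda> e))"] by simp
    then show "\<Phi> (F ?v (L.X e B)) = cls ?v (L.X e B) \<one>\<^bsub>?G ?v\<^esub>"
      using rv_cls[of ?v "L.X e B" "twist f e" "inv\<^bsub>?G ?v\<^esub> twist f e"] e B by simp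
  qed
  interpret V: group "?G w" using w by (intro G.vgroup_group) simp
  \<comment> \<open>\<open>\<Phi>\<close> sends the two sides of the hypothesis \<open>eq\<close> to
    the classes of the two triples.\<close>
  have "cls w B g = cls w' B' g'"
    using \<Phi>(2)[OF pmap_vpaths[OF B(1)] g(1)] \<Phi>(2)[OF pmap_vpaths[OF B(2)], of g'] key[OF B(1)] key[OF B(2)]
      rv_cls[OF w(1) B(1) V.one_closed g(1)] rv_cls[OF w(2) B(2), of "\<one>\<^bsub>?G w\<^esub>" g'] eq w(3) g by simp
  then have "(w', B', g') \<in> cls w B g" using self[OF w(2) B(2)] g w(3) by simp
  then obtain l where l: "w' = w" "l \<in> ?GL w" "B' = L.R w B l" "g' = inv\<^bsub>?G w\<^esub> (vhom f w l) \<otimes>\<^bsub>?G w\<^esub> g"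
    unfolding cls_def by blast
  have "g = vhom f w l \<otimes>\<^bsub>?G w\<^esub> g'" unfolding l(4) using w(1) l(2) g by (simp flip: V.m_assoc)
  then show ?thesis using l by blast
qed

end

lemma (in pgog) vpaths_nonempty:
  assumes "v \<in> verts \<Gamma>"
  shows "\<exists>A. A \<in> P v"
proof -
  obtain u \<beta> where "root_path \<Gamma> p u \<beta>" using root_exists by blast
  then have u: "\<beta> \<in> P u" "u \<in> verts \<Gamma>" using root_in vpaths_vert by auto
  then have "(u, v) \<in> ((\<lambda>e. (src \<Gamma> e, tgt \<Gamma> e)) ` edges \<Gamma>)\<^sup>*"
    using gog assms by (simp add: graph_of_groups_def)
  then show ?thesis
  proof induction
    case (step v w)
    then obtain e A where "e \<in> edges \<Gamma>" "v = src \<Gamma> e" "w = tgt \<Gamma> e" "A \<in> P v" by auto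
    then show ?case using extend_closed[of e A] by blast
  qed (use u in auto)
qed

lemma (in gog) edge_point_inj:
  "edge_point \<Gamma> e t = edge_point \<Gamma> e t' \<Longrightarrow> 0 < t \<Longrightarrow> t < 1 \<Longrightarrow> e \<in> edges \<Gamma> \<Longrightarrow> t' = t"
  using edge_point_eqD[of e t e t'] bar_neq[of e] by (metis prod.inject)

section \<open>Charts\<close>

text \<open>A pointed covering corresponding to \<open>H\<close> amounts to a choice of representatives \<open>cv w\<close> and
  \<open>ce e\<close> of the double cosets of \<open>H\<close> and the local groups in the sets of path classes.\<close>

locale chart = pointed_morphism \<Lambda> \<Gamma> f q p
  for \<Lambda> :: "('v, 'e, 'g, 'h) graph_of_groups" and \<Gamma> :: "('w, 'f, 'k, 'l) graph_of_groups"
    and f :: "('v, 'e, 'g, 'h, 'w, 'f, 'k, 'l) gmorphism" and q p +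
  fixes H :: "('w, 'f, 'k) pclass set"
    and cv :: "'v \<Rightarrow> ('w, 'f, 'k) pclass" and ce :: "'e \<Rightarrow> ('w, 'f, 'k) pclass"
  assumes H: "subgroup H (fundamental_group \<Gamma> p)"
    and cv_in [simp]: "w \<in> verts \<Lambda> \<Longrightarrow> cv w \<in> vpaths \<Gamma> p (vmap f w)"
    and ce_in [simp]: "e \<in> edges \<Lambda> \<Longrightarrow> ce e \<in> vpaths \<Gamma> p (vmap f (src \<Lambda> e))"
    and ce_bar: "e \<in> edges \<Lambda> \<Longrightarrow> ce (bar \<Lambda> e) = extend \<Gamma> p (emap f e) (ce e)"
    and cv_ex: "A \<in> vpaths \<Gamma> p v \<Longrightarrow> \<exists>w\<in>verts \<Lambda>. \<exists>h\<in>H. \<exists>g\<in>carrier (vgroup \<Gamma> v).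
      vmap f w = v \<and> A = lact \<Gamma> p v h (ract \<Gamma> p v (cv w) g)"
    and cv_uniq: "\<lbrakk>w \<in> verts \<Lambda>; w' \<in> verts \<Lambda>; vmap f w' = vmap f w; h \<in> H; g \<in> carrier (vgroup \<Gamma> (vmap f w));
      cv w' = lact \<Gamma> p (vmap f w) h (ract \<Gamma> p (vmap f w) (cv w) g)\<rbrakk> \<Longrightarrow> w' = w"
    and vhom_inj_on: "w \<in> verts \<Lambda> \<Longrightarrow> inj_on (vhom f w) (carrier (vgroup \<Lambda> w))"
    and vhom_stab: "\<lbrakk>w \<in> verts \<Lambda>; l \<in> carrier (vgroup \<Lambda> w)\<rbrakk> \<Longrightarrow>
      \<exists>h\<in>H. lact \<Gamma> p (vmap f w) h (cv w) = ract \<Gamma> p (vmap f w) (cv w) (vhom f w l)"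
    and stab_vhom: "\<lbrakk>w \<in> verts \<Lambda>; h \<in> H; g \<in> carrier (vgroup \<Gamma> (vmap f w));
      lact \<Gamma> p (vmap f w) h (cv w) = ract \<Gamma> p (vmap f w) (cv w) g\<rbrakk> \<Longrightarrow> \<exists>l\<in>carrier (vgroup \<Lambda> w). g = vhom f w l"
    and ce_ex: "\<lbrakk>e' \<in> edges \<Gamma>; A \<in> vpaths \<Gamma> p (src \<Gamma> e')\<rbrakk> \<Longrightarrow> \<exists>e\<in>edges \<Lambda>. \<exists>h\<in>H. \<exists>k\<in>carrier (egroup \<Gamma> e').
      emap f e = e' \<and> A = lact \<Gamma> p (src \<Gamma> e') h (ract \<Gamma> p (src \<Gamma> e') (ce e) (einj \<Gamma> (bar \<Gamma> e') k))"
    and ce_uniq: "\<lbrakk>e \<in> edges \<Lambda>; e1 \<in> edges \<Lambda>; emap f e1 = emap f e; h \<in> H; k \<in> carrier (egroup \<Gamma> (emap f e));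
      ce e1 = lact \<Gamma> p (vmap f (src \<Lambda> e)) h
        (ract \<Gamma> p (vmap f (src \<Lambda> e)) (ce e) (einj \<Gamma> (bar \<Gamma> (emap f e)) k))\<rbrakk> \<Longrightarrow> e1 = e"
    and ehom_inj_on: "e \<in> edges \<Lambda> \<Longrightarrow> inj_on (ehom f e) (carrier (egroup \<Lambda> e))"
    and ehom_stab: "\<lbrakk>e \<in> edges \<Lambda>; j \<in> carrier (egroup \<Lambda> e)\<rbrakk> \<Longrightarrow>
      \<exists>h\<in>H. lact \<Gamma> p (vmap f (src \<Lambda> e)) h (ce e)
        = ract \<Gamma> p (vmap f (src \<Lambda> e)) (ce e) (einj \<Gamma> (bar \<Gamma> (emap f e)) (ehom f e j))"
    and stab_ehom: "\<lbrakk>e \<in> edges \<Lambda>; h \<in> H; k \<in> carrier (egroup \<Gamma> (emap f e));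
      lact \<Gamma> p (vmap f (src \<Lambda> e)) h (ce e)
        = ract \<Gamma> p (vmap f (src \<Lambda> e)) (ce e) (einj \<Gamma> (bar \<Gamma> (emap f e)) k)\<rbrakk>
      \<Longrightarrow> \<exists>j\<in>carrier (egroup \<Lambda> e). k = ehom f e j"
    and twist_cv: "e \<in> edges \<Lambda> \<Longrightarrow> \<exists>h\<in>H. lact \<Gamma> p (vmap f (tgt \<Lambda> e)) h
        (ract \<Gamma> p (vmap f (tgt \<Lambda> e)) (cv (tgt \<Lambda> e)) (twist f e)) = ce (bar \<Lambda> e)"
    and cv_base: "q = Vertex w \<Longrightarrow> cv w = hclass \<Gamma> p p []"
    and ce_base: "\<lbrakk>e \<in> edges \<Lambda>; 0 < t; t < 1; q = edge_point \<Lambda> e t\<rbrakk> \<Longrightarrow> ce e = initial_seg \<Gamma> p (emap f e) t"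

context pointed_covering_morphism
begin

text \<open>Path classes are chosen in \<open>\<Lambda>\<close>, one to each vertex and one to the
  source of each edge, and their images serve as representatives. Two classes with the same end in
  \<open>\<Lambda>\<close> differ by a loop, which becomes an element of the subgroup. The covering
  clauses of the chart are then existence and uniqueness of lifts, with the stars deciding which
  edge is met.\<close>

theorem chart_exists: "\<exists>cv ce. chart \<Lambda> \<Gamma> f q p (covering_subgroup \<Lambda> q \<Gamma> p f) cv ce"
proof -
  let ?H = "covering_subgroup \<Lambda> q \<Gamma> p f"
  have H: "h \<in> ?H \<longleftrightarrow> (\<exists>m\<in>carrier L.\<pi>. h = f_sharp m)" for h
    by (auto simp: covering_subgroup_def)
  have "\<exists>B. B \<in> L.P w \<and> (q = Vertex w \<longrightarrow> B = hclass \<Lambda> q q [])" if w: "w \<in> verts \<Lambda>" for w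
  proof (cases "q = Vertex w")
    case True
    then have "root_path \<Lambda> q w (hclass \<Lambda> q q [])" by (simp add: root_path_def)
    from L.root_in[OF this] show ?thesis by blast
  qed (use L.vpaths_nonempty[OF w] in auto)
  then obtain vb where vb: "\<And>w. w \<in> verts \<Lambda> \<Longrightarrow> vb w \<in> L.P w" "\<And>w. w \<in> verts \<Lambda> \<Longrightarrow> q = Vertex w \<Longrightarrow> vb w = hclass \<Lambda> q q []"
    by metis
  \<comment> \<open>If the base point is interior, both edges through it are bound to carry initial
    segments; \<open>initial_seg_bar\<close> makes this compatible with reversal.\<close>
  let ?Q = "\<lambda>e z. z \<in> L.P (src \<Lambda> e) \<and> (\<forall>t. 0 < t \<longrightarrow> t < 1 \<longrightarrow> q = edge_point \<Lambda> e t \<longrightarrow> z = initial_seg \<Lambda> q e t)"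
  obtain eb where eb0: "\<And>e. e \<in> edges \<Lambda> \<Longrightarrow> ?Q e (eb e)" and eb_bar: "\<And>e. e \<in> edges \<Lambda> \<Longrightarrow> eb (bar \<Lambda> e) = L.X e (eb e)"
  proof (rule L.bar_equivariant_choice[of ?Q "L.X"])
    fix e assume e: "e \<in> edges \<Lambda>"
    show "\<exists>z. ?Q e z"
    proof (cases "\<exists>t. 0 < t \<and> t < 1 \<and> q = edge_point \<Lambda> e t")
      case True
      then obtain t where t: "0 < t" "t < 1" "q = edge_point \<Lambda> e t" by blast
      have "?Q e (initial_seg \<Lambda> q e t)"
        using L.initial_seg_in[OF e t] L.edge_point_inj[of e t] t e by metis
      then show ?thesis by blast
    next
      case False
      then show ?thesis using L.vpaths_nonempty[of "src \<Lambda> e"] e by auto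
    qed
  next
    fix e z assume e: "e \<in> edges \<Lambda>" and z: "?Q e z"
    have "L.X e z = initial_seg \<Lambda> q (bar \<Lambda> e) t" if "0 < t" "t < 1" "q = edge_point \<Lambda> (bar \<Lambda> e) t" for t
    proof -
      have q': "q = edge_point \<Lambda> e (1 - t)" using that(3) L.edge_point_bar[OF e, of "1 - t"] by simp
      then have "z = initial_seg \<Lambda> q e (1 - t)" using z that(1,2) by (metis diff_gt_0_iff_gt diff_less_eq less_add_same_cancel1)
      then show ?thesis using L.initial_seg_bar[OF e _ _ q'] that(1,2) by simp
    qed
    then show "?Q (bar \<Lambda> e) (L.X e z) \<and> L.X (bar \<Lambda> e) (L.X e z) = z" using e z by simp
  qed blast
  have eb: "eb e \<in> L.P (src \<Lambda> e)" if "e \<in> edges \<Lambda>" for e using eb0[OF that] by blast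
  define cv where "cv w = F w (vb w)" for w
  \<comment> \<open>Appending the twist makes reversal exact: by \<open>pmap_extend\<close>, the
    class for the reverse edge is the extension of this one with no group element left over.\<close>
  define ce where "ce e = G.R (vmap f (src \<Lambda> e)) (F (src \<Lambda> e) (eb e)) (twist f (bar \<Lambda> e))" for e
  have cv_in: "cv w \<in> G.P (vmap f w)" if "w \<in> verts \<Lambda>" for w using vb that by (simp add: cv_def)
  have ce_in: "ce e \<in> G.P (vmap f (src \<Lambda> e))" if "e \<in> edges \<Lambda>" for e using eb that by (simp add: ce_def)
  have trans: "\<exists>m\<in>carrier L.\<pi>. B' = L.L w m B" if "B \<in> L.P w" "B' \<in> L.P w" for w B B'
    using L.lact_trans[OF that] by blast
  have cvL: "F w (L.L w m (vb w)) = G.L (vmap f w) (f_sharp m) (cv w)" if "w \<in> verts \<Lambda>" "m \<in> carrier L.\<pi>" for w m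
    using pmap_lact vb that by (simp add: cv_def)
  have ceL: "G.R (vmap f (src \<Lambda> e)) (F (src \<Lambda> e) (L.L (src \<Lambda> e) m (eb e))) (twist f (bar \<Lambda> e))
      = G.L (vmap f (src \<Lambda> e)) (f_sharp m) (ce e)" if "e \<in> edges \<Lambda>" "m \<in> carrier L.\<pi>" for e m
    using pmap_lact eb that by (simp add: ce_def G.lact_ract)
  have "chart \<Lambda> \<Gamma> f q p ?H cv ce"
  proof (intro chart.intro chart_axioms.intro)
    show "pointed_morphism \<Lambda> \<Gamma> f q p" by unfold_locales
    show "subgroup ?H G.\<pi>" by (rule covering_subgroup_subgroup)
    show "ce (bar \<Lambda> e) = G.X (emap f e) (ce e)" if "e \<in> edges \<Lambda>" for e
      using pmap_extend[OF that eb[OF that]] that by (simp add: ce_def eb_bar)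
    show "\<exists>w\<in>verts \<Lambda>. \<exists>h\<in>?H. \<exists>g\<in>carrier (vgroup \<Gamma> v). vmap f w = v \<and> A = G.L v h (G.R v (cv w) g)" if A: "A \<in> G.P v" for A v
    proof -
      obtain w B g where *: "w \<in> verts \<Lambda>" "B \<in> L.P w" "g \<in> carrier (vgroup \<Gamma> v)" "vmap f w = v" "A = G.R v (F w B) g"
        using lift_exists[OF A] by blast
      obtain m where m: "m \<in> carrier L.\<pi>" "B = L.L w m (vb w)" using trans[OF vb(1) *(2)] *(1) by blast
      have "A = G.L v (f_sharp m) (G.R v (cv w) g)"
        unfolding *(5) m(2) cvL[OF *(1) m(1)] using * m cv_in[OF *(1)] by (simp add: G.lact_ract)
      then show ?thesis using * m H by blast
    qed
    show "w' = w" if *: "w \<in> verts \<Lambda>" "w' \<in> verts \<Lambda>" "vmap f w' = vmap f w" "h \<in> ?H" "g \<in> carrier (vgroup \<Gamma> (vmap f w))"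
        "cv w' = G.L (vmap f w) h (G.R (vmap f w) (cv w) g)" for w w' h g
    proof -
      obtain m where m: "m \<in> carrier L.\<pi>" "h = f_sharp m" using *(4) H by blast
      have "cv w' = G.R (vmap f w) (F w (L.L w m (vb w))) g"
        unfolding cvL[OF *(1) m(1)] *(6) m(2) using * m cv_in by (simp add: G.lact_ract)
      then have "G.R (vmap f w) (F w (L.L w m (vb w))) g = G.R (vmap f w) (F w' (vb w')) \<one>\<^bsub>vgroup \<Gamma> (vmap f w)\<^esub>"
        using * cv_in[of w'] by (simp add: cv_def)
      from lift_unique[OF *(1,2,3) _ _ *(5) _ this] show ?thesis using vb * m(1) by simp
    qed
    show "inj_on (vhom f w) (carrier (vgroup \<Lambda> w))" if "w \<in> verts \<Lambda>" for w using vhom_inj[OF that] .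
    show "\<exists>h\<in>?H. G.L (vmap f w) h (cv w) = G.R (vmap f w) (cv w) (vhom f w l)"
      if *: "w \<in> verts \<Lambda>" "l \<in> carrier (vgroup \<Lambda> w)" for w l
    proof -
      obtain m where m: "m \<in> carrier L.\<pi>" "L.R w (vb w) l = L.L w m (vb w)" using trans[OF vb(1), of w "L.R w (vb w) l"] vb * by auto
      have "G.L (vmap f w) (f_sharp m) (cv w) = G.R (vmap f w) (cv w) (vhom f w l)"
        unfolding cvL[OF *(1) m(1), symmetric] m(2)[symmetric] using pmap_ract vb * by (simp add: cv_def)
      then show ?thesis using m H by blast
    qed
    show "\<exists>l\<in>carrier (vgroup \<Lambda> w). g = vhom f w l"
      if *: "w \<in> verts \<Lambda>" "h \<in> ?H" "g \<in> carrier (vgroup \<Gamma> (vmap f w))" "G.L (vmap f w) h (cv w) = G.R (vmap f w) (cv w) g" for w h g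
    proof -
      obtain m where m: "m \<in> carrier L.\<pi>" "h = f_sharp m" using *(2) H by blast
      have "G.R (vmap f w) (F w (vb w)) g = G.R (vmap f w) (F w (L.L w m (vb w))) \<one>\<^bsub>vgroup \<Gamma> (vmap f w)\<^esub>"
        using *(4) cvL[OF *(1) m(1)] vb m * by (simp add: cv_def)
      from lift_unique[OF *(1,1) HOL.refl _ _ *(3) _ this]
      have "\<exists>l\<in>carrier (vgroup \<Lambda> w). g = vhom f w l \<otimes>\<^bsub>vgroup \<Gamma> (vmap f w)\<^esub> \<one>\<^bsub>vgroup \<Gamma> (vmap f w)\<^esub>"
        using vb * m(1) by auto
      then show ?thesis using * monoid.r_one[OF group.is_monoid[OF G.vgroup_group[OF vmap_in[OF *(1)]]]] by auto
    qed
    show "\<exists>e\<in>edges \<Lambda>. \<exists>h\<in>?H. \<exists>k\<in>carrier (egroup \<Gamma> e').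
      emap f e = e' \<and> A = G.L (src \<Gamma> e') h (G.R (src \<Gamma> e') (ce e) (einj \<Gamma> (bar \<Gamma> e') k))"
      if e': "e' \<in> edges \<Gamma>" and A: "A \<in> G.P (src \<Gamma> e')" for e' A
    proof -
      obtain w B g where *: "w \<in> verts \<Lambda>" "B \<in> L.P w" "g \<in> carrier (vgroup \<Gamma> (src \<Gamma> e'))" "vmap f w = src \<Gamma> e'" "A = G.R (src \<Gamma> e') (F w B) g"
        using lift_exists[OF A] by blast
      obtain e l k where e: "e \<in> edges \<Lambda>" "src \<Lambda> e = w" "emap f e = e'" "l \<in> carrier (vgroup \<Lambda> w)"
        "k \<in> carrier (egroup \<Gamma> e')"
        "g = vhom f w l \<otimes>\<^bsub>vgroup \<Gamma> (vmap f w)\<^esub> twist f (bar \<Lambda> e) \<otimes>\<^bsub>vgroup \<Gamma> (vmap f w)\<^esub> einj \<Gamma> (bar \<Gamma> e') k"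
        using star_surjD[OF *(1) e' *(4)[symmetric]] *(3) unfolding *(4)[symmetric] by blast
      obtain m where m: "m \<in> carrier L.\<pi>" "L.R w B l = L.L w m (eb e)" using trans[of "eb e" w "L.R w B l"] eb e * by auto
      have i: "einj \<Gamma> (bar \<Gamma> e') k \<in> carrier (vgroup \<Gamma> (vmap f w))" using e by auto
      have t: "twist f (bar \<Lambda> e) \<in> carrier (vgroup \<Gamma> (vmap f w))" using twist_bar_in[OF e(1)] e(2) by simp
      have "A = G.R (vmap f w) (G.R (vmap f w) (F w (L.R w B l)) (twist f (bar \<Lambda> e))) (einj \<Gamma> (bar \<Gamma> e') k)"
        unfolding *(5) e(6) *(4)[symmetric] using *(1,2) e(4) i t pmap_vpaths[OF *(2)] by (simp add: pmap_ract G.ract_mult)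
      also have "\<dots> = G.L (vmap f w) (f_sharp m) (G.R (vmap f w) (ce e) (einj \<Gamma> (bar \<Gamma> e') k))"
        unfolding m(2) using ceL[OF e(1) m(1)] e(2) ce_in[OF e(1)] m(1) i by (simp add: G.lact_ract)
      finally show ?thesis using e(1,3,5) m(1) H *(4) by metis
    qed
    show "e' = e" if *: "e \<in> edges \<Lambda>" "e' \<in> edges \<Lambda>" "emap f e' = emap f e" "h \<in> ?H" "k \<in> carrier (egroup \<Gamma> (emap f e))"
      "ce e' = G.L (vmap f (src \<Lambda> e)) h (G.R (vmap f (src \<Lambda> e)) (ce e) (einj \<Gamma> (bar \<Gamma> (emap f e)) k))" for e e' h k
    proof -
      let ?u = "src \<Lambda> e" and ?i = "einj \<Gamma> (bar \<Gamma> (emap f e)) k"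
      obtain m where m: "m \<in> carrier L.\<pi>" "h = f_sharp m" using *(4) H by blast
      interpret V: group "vgroup \<Gamma> (vmap f ?u)" using * by (intro G.vgroup_group) simp
      have u: "vmap f (src \<Lambda> e') = vmap f ?u" using * src_emap by metis
      have t': "twist f (bar \<Lambda> e') \<in> carrier (vgroup \<Gamma> (vmap f ?u))" using twist_bar_in[OF *(2)] u by simp
      have "ce e' = G.R (vmap f ?u) (G.L (vmap f ?u) h (ce e)) ?i"
        unfolding *(6) using * m ce_in by (simp add: G.lact_ract)
      also have "\<dots> = G.R (vmap f ?u) (F ?u (L.L ?u m (eb e))) (twist f (bar \<Lambda> e) \<otimes>\<^bsub>vgroup \<Gamma> (vmap f ?u)\<^esub> ?i)"
        unfolding m(2) ceL[OF *(1) m(1), symmetric] using * m eb by (simp add: G.ract_mult)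
      finally have "G.R (vmap f ?u) (F ?u (L.L ?u m (eb e))) (twist f (bar \<Lambda> e) \<otimes>\<^bsub>vgroup \<Gamma> (vmap f ?u)\<^esub> ?i)
        = G.R (vmap f ?u) (F (src \<Lambda> e') (eb e')) (twist f (bar \<Lambda> e'))" using u by (simp add: ce_def)
      from lift_unique[OF _ _ u _ _ _ t' this] eb *(1,2,5) m(1)
      obtain l where l: "src \<Lambda> e' = ?u" "l \<in> carrier (vgroup \<Lambda> ?u)"
        "twist f (bar \<Lambda> e) \<otimes>\<^bsub>vgroup \<Gamma> (vmap f ?u)\<^esub> ?i = vhom f ?u l \<otimes>\<^bsub>vgroup \<Gamma> (vmap f ?u)\<^esub> twist f (bar \<Lambda> e')" by auto
      have "e = e'"
        using star_injD[OF *(1,2) l(1) *(3) _ l(2) *(5), of "\<one>\<^bsub>vgroup \<Lambda> ?u\<^esub>"] l(3) *(1) by simp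
      then show ?thesis ..
    qed
    show "inj_on (ehom f e) (carrier (egroup \<Lambda> e))" if "e \<in> edges \<Lambda>" for e using ehom_inj[OF that] .
    show "\<exists>h\<in>?H. G.L (vmap f (src \<Lambda> e)) h (ce e) = G.R (vmap f (src \<Lambda> e)) (ce e) (einj \<Gamma> (bar \<Gamma> (emap f e)) (ehom f e j))"
      if *: "e \<in> edges \<Lambda>" "j \<in> carrier (egroup \<Lambda> e)" for e j
    proof -
      let ?u = "src \<Lambda> e"
      obtain m where m: "m \<in> carrier L.\<pi>" "L.R ?u (eb e) (einj \<Lambda> (bar \<Lambda> e) j) = L.L ?u m (eb e)"
        using trans[of "eb e" ?u "L.R ?u (eb e) (einj \<Lambda> (bar \<Lambda> e) j)"] eb * by auto
      have "G.R (vmap f ?u) (ce e) (einj \<Gamma> (bar \<Gamma> (emap f e)) (ehom f e j))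
        = G.R (vmap f ?u) (F ?u (eb e)) (vhom f ?u (einj \<Lambda> (bar \<Lambda> e) j) \<otimes>\<^bsub>vgroup \<Gamma> (vmap f ?u)\<^esub> twist f (bar \<Lambda> e))"
        using vhom_einj_bar[OF *] eb * by (simp add: ce_def flip: G.ract_mult)
      also have "\<dots> = G.L (vmap f ?u) (f_sharp m) (ce e)"
        unfolding ceL[OF *(1) m(1), symmetric] m(2)[symmetric] using eb * pmap_ract by (simp add: G.ract_mult)
      finally show ?thesis using m H by metis
    qed
    show "\<exists>j\<in>carrier (egroup \<Lambda> e). k = ehom f e j"
      if *: "e \<in> edges \<Lambda>" "h \<in> ?H" "k \<in> carrier (egroup \<Gamma> (emap f e))"
        "G.L (vmap f (src \<Lambda> e)) h (ce e) = G.R (vmap f (src \<Lambda> e)) (ce e) (einj \<Gamma> (bar \<Gamma> (emap f e)) k)" for e h k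
    proof -
      let ?u = "src \<Lambda> e" and ?i = "einj \<Gamma> (bar \<Gamma> (emap f e)) k"
      obtain m where m: "m \<in> carrier L.\<pi>" "h = f_sharp m" using *(2) H by blast
      have "G.R (vmap f ?u) (F ?u (eb e)) (twist f (bar \<Lambda> e) \<otimes>\<^bsub>vgroup \<Gamma> (vmap f ?u)\<^esub> ?i)
        = G.R (vmap f ?u) (F ?u (L.L ?u m (eb e))) (twist f (bar \<Lambda> e))"
        using *(4) ceL[OF *(1) m(1)] m(2) eb * by (simp add: ce_def G.ract_mult)
      from lift_unique[OF _ _ HOL.refl _ _ _ _ this] eb *(1,3) m(1)
      obtain l where l: "l \<in> carrier (vgroup \<Lambda> ?u)"
        "twist f (bar \<Lambda> e) \<otimes>\<^bsub>vgroup \<Gamma> (vmap f ?u)\<^esub> ?i = vhom f ?u l \<otimes>\<^bsub>vgroup \<Gamma> (vmap f ?u)\<^esub> twist f (bar \<Lambda> e)" by auto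
      interpret V: group "vgroup \<Gamma> (vmap f ?u)" using * by (intro G.vgroup_group) simp
      show ?thesis
        using star_injD[OF *(1,1) HOL.refl HOL.refl _ l(1) *(3), of "\<one>\<^bsub>vgroup \<Lambda> ?u\<^esub>"] l(2) *(1) by auto
    qed
    show "\<exists>h\<in>?H. G.L (vmap f (tgt \<Lambda> e)) h (G.R (vmap f (tgt \<Lambda> e)) (cv (tgt \<Lambda> e)) (twist f e)) = ce (bar \<Lambda> e)"
      if e: "e \<in> edges \<Lambda>" for e
    proof -
      \<comment> \<open>The class chosen for the vertex \<open>tgt \<Lambda> e\<close> and the one
        chosen for the start of the reverse edge end at the same vertex, so they differ by a loop of
        \<open>\<Lambda>\<close>; its image is the element sought.\<close>
      obtain m where m: "m \<in> carrier L.\<pi>" "eb (bar \<Lambda> e) = L.L (tgt \<Lambda> e) m (vb (tgt \<Lambda> e))"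
        using trans[of "vb (tgt \<Lambda> e)" "tgt \<Lambda> e" "eb (bar \<Lambda> e)"] vb eb[of "bar \<Lambda> e"] e by auto
      have "ce (bar \<Lambda> e) = G.R (vmap f (tgt \<Lambda> e)) (G.L (vmap f (tgt \<Lambda> e)) (f_sharp m) (cv (tgt \<Lambda> e))) (twist f e)"
        using cvL[of "tgt \<Lambda> e" m] m e by (simp add: ce_def)
      then show ?thesis using m e cv_in H by (metis G.lact_ract L.tgt_in induced_hom_in twist_in)
    qed
    show "cv w = hclass \<Gamma> p p []" if "q = Vertex w" for w
      using pmap_one[OF that] vb(2)[of w] that L.p_in by (simp add: cv_def)
    show "ce e = initial_seg \<Gamma> p (emap f e) t" if "e \<in> edges \<Lambda>" "0 < t" "t < 1" "q = edge_point \<Lambda> e t" for e t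
      using pmap_initial_seg[OF that] eb0[OF that(1)] that by (auto simp: ce_def)
  qed (use cv_in ce_in in auto)
  then show ?thesis by blast
qed

end

section \<open>Computing modulo the subgroup\<close>

lemma (in group) inv_cancel_left [simp]:
  assumes "x \<in> carrier G" "y \<in> carrier G"
  shows "inv x \<otimes> (x \<otimes> y) = y" "x \<otimes> (inv x \<otimes> y) = y"
  using assms by (simp_all flip: m_assoc)

text \<open>The \<open>H\<close>-orbit of \<open>A\<close>. Since left multiplication commutes with
  right multiplication and with extension, these operations pass to orbits, and double coset
  arguments can be run as equations in which no element of \<open>H\<close> is named.\<close>

definition hcoset ::
  "('v, 'e, 'g, 'h) graph_of_groups \<Rightarrow> ('v, 'e) point \<Rightarrow> ('v, 'e, 'g) pclass set \<Rightarrow> 'v \<Rightarrow>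
     ('v, 'e, 'g) pclass \<Rightarrow> ('v, 'e, 'g) pclass set" where
  "hcoset \<Gamma> p H v A = (\<lambda>h. lact \<Gamma> p v h A) ` H"

locale pgog_subgroup = pgog \<Gamma> p for \<Gamma> :: "('v, 'e, 'g, 'h) graph_of_groups" and p +
  fixes H
  assumes H: "subgroup H (fundamental_group \<Gamma> p)"
begin

abbreviation K where "K \<equiv> hcoset \<Gamma> p H"

lemma H_in [simp]: "h \<in> H \<Longrightarrow> h \<in> carrier \<pi>"
  and H_one [simp]: "\<one>\<^bsub>\<pi>\<^esub> \<in> H"
  and H_mult [simp]: "h \<in> H \<Longrightarrow> h' \<in> H \<Longrightarrow> h \<otimes>\<^bsub>\<pi>\<^esub> h' \<in> H"
  and H_inv [simp]: "h \<in> H \<Longrightarrow> inv\<^bsub>\<pi>\<^esub> h \<in> H"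
  using H by (auto simp: subgroup.mem_carrier subgroup.one_closed subgroup.m_closed subgroup.m_inv_closed)

lemma hcoset_lact [simp]: "h \<in> H \<Longrightarrow> A \<in> P v \<Longrightarrow> K v (L v h A) = K v A"
proof -
  assume h: "h \<in> H" "A \<in> P v"
  have "L v k (L v h A) \<in> K v A" if "k \<in> H" for k
    using that h by (simp add: hcoset_def flip: lact_mult)
  moreover have "L v k A \<in> K v (L v h A)" if "k \<in> H" for k
  proof -
    have "L v k A = L v (k \<otimes>\<^bsub>\<pi>\<^esub> inv\<^bsub>\<pi>\<^esub> h) (L v h A)"
      using that h by (simp add: pi.m_assoc flip: lact_mult)
    then show ?thesis unfolding hcoset_def by (rule image_eqI) (use that h in simp)
  qed
  ultimately show "K v (L v h A) = K v A" unfolding hcoset_def by blast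
qed

lemma hcoset_eqD: "K v A = K v B \<Longrightarrow> B \<in> P v \<Longrightarrow> \<exists>h\<in>H. L v h A = B"
proof -
  assume eq: "K v A = K v B" and B: "B \<in> P v"
  have "L v \<one>\<^bsub>\<pi>\<^esub> B \<in> K v B" unfolding hcoset_def by (intro imageI H_one)
  then have "B \<in> K v A" using eq B by simp
  then show "\<exists>h\<in>H. L v h A = B" by (auto simp: hcoset_def)
qed

lemma hcoset_ract:
  assumes "K v A = K v B" "A \<in> P v" "B \<in> P v" "g \<in> carrier (vgroup \<Gamma> v)"
  shows "K v (R v A g) = K v (R v B g)"
proof -
  obtain h where h: "h \<in> H" "B = L v h A" using hcoset_eqD[OF assms(1,3)] by blast
  have "R v B g = L v h (R v A g)" unfolding h(2) using h assms by (simp add: lact_ract)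
  then show ?thesis using hcoset_lact[OF h(1)] assms by simp
qed

lemma hcoset_extend:
  assumes "K (src \<Gamma> e) A = K (src \<Gamma> e) B" "A \<in> P (src \<Gamma> e)" "B \<in> P (src \<Gamma> e)" "e \<in> edges \<Gamma>"
  shows "K (tgt \<Gamma> e) (X e A) = K (tgt \<Gamma> e) (X e B)"
proof -
  obtain h where h: "h \<in> H" "B = L (src \<Gamma> e) h A" using hcoset_eqD[OF assms(1,3)] by blast
  have "X e B = L (tgt \<Gamma> e) h (X e A)" unfolding h(2) using h assms by (simp add: extend_lact)
  then show ?thesis using hcoset_lact[OF h(1)] assms by simp
qed

lemma hcoset_ract_cancel:
  assumes "K v (R v A g) = K v (R v B g')" "A \<in> P v" "B \<in> P v" "g \<in> carrier (vgroup \<Gamma> v)" "g' \<in> carrier (vgroup \<Gamma> v)"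
  shows "K v (R v A (g \<otimes>\<^bsub>vgroup \<Gamma> v\<^esub> inv\<^bsub>vgroup \<Gamma> v\<^esub> g')) = K v B"
proof -
  have v: "v \<in> verts \<Gamma>" using vpaths_vert assms by blast
  show ?thesis using hcoset_ract[OF assms(1), of "inv\<^bsub>vgroup \<Gamma> v\<^esub> g'"] assms v by (simp add: ract_mult)
qed

end

sublocale chart \<subseteq> G: pgog_subgroup \<Gamma> p H
  by (intro pgog_subgroup.intro pgog_subgroup_axioms.intro G.pgog_axioms H)

section \<open>A morphism with a chart is a covering\<close>

context chart
begin

abbreviation K where "K \<equiv> hcoset \<Gamma> p H"

text \<open>Moving \<open>g'\<close> to the left puts \<open>cv w'\<close> in the orbit of
  \<open>cv w\<close> times \<open>g\<close> and the inverse of \<open>g'\<close>. Uniqueness of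
  representatives settles the vertex; then the factor fixes the orbit of \<open>cv w\<close>, and
  such factors come from the local group. \<open>ce_hcoset\<close> is the same argument for
  edges.\<close>

lemma cv_hcoset:
  assumes w: "w \<in> verts \<Lambda>" "w' \<in> verts \<Lambda>" "vmap f w' = vmap f w"
    and g: "g \<in> carrier (vgroup \<Gamma> (vmap f w))" "g' \<in> carrier (vgroup \<Gamma> (vmap f w))"
    and eq: "K (vmap f w) (G.R (vmap f w) (cv w) g) = K (vmap f w) (G.R (vmap f w) (cv w') g')"
  shows "w' = w \<and> (\<exists>l\<in>carrier (vgroup \<Lambda> w). g = vhom f w l \<otimes>\<^bsub>vgroup \<Gamma> (vmap f w)\<^esub> g')"
proof -
  let ?v = "vmap f w" and ?G = "vgroup \<Gamma> (vmap f w)"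
  interpret V: group ?G using w by (intro G.vgroup_group) simp
  have P: "cv w' \<in> G.P ?v" using cv_in[OF w(2)] w(3) by simp
  have gg: "g \<otimes>\<^bsub>?G\<^esub> inv\<^bsub>?G\<^esub> g' \<in> carrier ?G" using g by simp
  have K: "K ?v (G.R ?v (cv w) (g \<otimes>\<^bsub>?G\<^esub> inv\<^bsub>?G\<^esub> g')) = K ?v (cv w')"
    by (rule G.hcoset_ract_cancel[OF eq]) (use w g P in auto)
  obtain h where h: "h \<in> H" "G.L ?v h (G.R ?v (cv w) (g \<otimes>\<^bsub>?G\<^esub> inv\<^bsub>?G\<^esub> g')) = cv w'"
    using G.hcoset_eqD[OF K P] by blast
  have ww: "w' = w" using cv_uniq[OF w h(1) gg h(2)[symmetric]] .
  have "G.L ?v (inv\<^bsub>G.\<pi>\<^esub> h) (cv w) = G.R ?v (cv w) (g \<otimes>\<^bsub>?G\<^esub> inv\<^bsub>?G\<^esub> g')"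
    using arg_cong[OF h(2), of "G.L ?v (inv\<^bsub>G.\<pi>\<^esub> h)"] h(1) w gg unfolding ww by simp
  from stab_vhom[OF w(1) _ gg this] obtain l where l: "l \<in> carrier (vgroup \<Lambda> w)" "g \<otimes>\<^bsub>?G\<^esub> inv\<^bsub>?G\<^esub> g' = vhom f w l"
    using h(1) by auto
  have "g = vhom f w l \<otimes>\<^bsub>?G\<^esub> g'" unfolding l(2)[symmetric] using g by (simp add: V.m_assoc)
  then show ?thesis using ww l(1) by blast
qed

lemma ce_hcoset:
  assumes e: "e \<in> edges \<Lambda>" "e' \<in> edges \<Lambda>" "emap f e' = emap f e"
    and k: "k \<in> carrier (egroup \<Gamma> (emap f e))" "k' \<in> carrier (egroup \<Gamma> (emap f e))"
    and eq: "K (vmap f (src \<Lambda> e)) (G.R (vmap f (src \<Lambda> e)) (ce e) (einj \<Gamma> (bar \<Gamma> (emap f e)) k))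
      = K (vmap f (src \<Lambda> e)) (G.R (vmap f (src \<Lambda> e)) (ce e') (einj \<Gamma> (bar \<Gamma> (emap f e)) k'))"
  shows "e' = e \<and> (\<exists>j\<in>carrier (egroup \<Lambda> e). k = ehom f e j \<otimes>\<^bsub>egroup \<Gamma> (emap f e)\<^esub> k')"
proof -
  let ?v = "vmap f (src \<Lambda> e)" and ?e = "emap f e"
  let ?G = "vgroup \<Gamma> ?v" and ?E = "egroup \<Gamma> ?e" and ?i = "einj \<Gamma> (bar \<Gamma> (emap f e))"
  interpret E: group ?E using e by (intro G.egroup_group) simp
  have u: "vmap f (src \<Lambda> e') = ?v" using e src_emap by metis
  have P: "ce e' \<in> G.P ?v" using ce_in[OF e(2)] u by simp
  have kk: "k \<otimes>\<^bsub>?E\<^esub> inv\<^bsub>?E\<^esub> k' \<in> carrier ?E" using k by simp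
  have i: "?i (k \<otimes>\<^bsub>?E\<^esub> inv\<^bsub>?E\<^esub> k') = ?i k \<otimes>\<^bsub>?G\<^esub> inv\<^bsub>?G\<^esub> ?i k'"
    using G.einj_bar_mult[of ?e k "inv\<^bsub>?E\<^esub> k'"] G.einj_inv[of "bar \<Gamma> ?e" k'] e k by simp
  have K: "K ?v (G.R ?v (ce e) (?i (k \<otimes>\<^bsub>?E\<^esub> inv\<^bsub>?E\<^esub> k'))) = K ?v (ce e')"
    unfolding i by (rule G.hcoset_ract_cancel[OF eq]) (use e k P in auto)
  obtain h where h: "h \<in> H" "G.L ?v h (G.R ?v (ce e) (?i (k \<otimes>\<^bsub>?E\<^esub> inv\<^bsub>?E\<^esub> k'))) = ce e'"
    using G.hcoset_eqD[OF K P] by blast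
  have ee: "e' = e" using ce_uniq[OF e h(1) kk h(2)[symmetric]] .
  have "G.L ?v (inv\<^bsub>G.\<pi>\<^esub> h) (ce e) = G.R ?v (ce e) (?i (k \<otimes>\<^bsub>?E\<^esub> inv\<^bsub>?E\<^esub> k'))"
    using arg_cong[OF h(2), of "G.L ?v (inv\<^bsub>G.\<pi>\<^esub> h)"] h(1) e kk unfolding ee by simp
  from stab_ehom[OF e(1) _ kk this] obtain j where j: "j \<in> carrier (egroup \<Lambda> e)" "k \<otimes>\<^bsub>?E\<^esub> inv\<^bsub>?E\<^esub> k' = ehom f e j"
    using h(1) by auto
  have "k = ehom f e j \<otimes>\<^bsub>?E\<^esub> k'" unfolding j(2)[symmetric] using k by (simp add: E.m_assoc)
  then show ?thesis using ee j(1) by blast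
qed

lemma cv_vhom_hcoset: "\<lbrakk>w \<in> verts \<Lambda>; l \<in> carrier (vgroup \<Lambda> w)\<rbrakk>
    \<Longrightarrow> K (vmap f w) (G.R (vmap f w) (cv w) (vhom f w l)) = K (vmap f w) (cv w)"
  using vhom_stab[of w l] G.hcoset_lact cv_in by metis

lemma ce_ehom_hcoset: "\<lbrakk>e \<in> edges \<Lambda>; j \<in> carrier (egroup \<Lambda> e)\<rbrakk>
    \<Longrightarrow> K (vmap f (src \<Lambda> e)) (G.R (vmap f (src \<Lambda> e)) (ce e) (einj \<Gamma> (bar \<Gamma> (emap f e)) (ehom f e j)))
      = K (vmap f (src \<Lambda> e)) (ce e)"
  using ehom_stab[of e j] G.hcoset_lact ce_in by metis

lemma ce_bar_in [simp]: "e \<in> edges \<Lambda> \<Longrightarrow> ce (bar \<Lambda> e) \<in> G.P (vmap f (tgt \<Lambda> e))"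
  using ce_in[of "bar \<Lambda> e"] by simp

lemma cv_twist_hcoset: "e \<in> edges \<Lambda> \<Longrightarrow>
    K (vmap f (tgt \<Lambda> e)) (G.R (vmap f (tgt \<Lambda> e)) (cv (tgt \<Lambda> e)) (twist f e)) = K (vmap f (tgt \<Lambda> e)) (ce (bar \<Lambda> e))"
  using twist_cv[of e] G.hcoset_lact by (metis L.tgt_in cv_in twist_in G.ract_closed)

lemma cv_hcoset_ex: "A \<in> G.P v \<Longrightarrow> \<exists>w\<in>verts \<Lambda>. \<exists>g\<in>carrier (vgroup \<Gamma> v). vmap f w = v \<and> K v A = K v (G.R v (cv w) g)"
  using cv_ex[of A v] G.hcoset_lact by (metis cv_in G.ract_closed)

lemma ce_hcoset_ex: "\<lbrakk>e' \<in> edges \<Gamma>; A \<in> G.P (src \<Gamma> e')\<rbrakk> \<Longrightarrow> \<exists>e\<in>edges \<Lambda>. \<exists>k\<in>carrier (egroup \<Gamma> e').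
    emap f e = e' \<and> K (src \<Gamma> e') A = K (src \<Gamma> e') (G.R (src \<Gamma> e') (ce e) (einj \<Gamma> (bar \<Gamma> e') k))"
  using ce_ex[of e' A] G.hcoset_lact by (metis ce_in G.ract_closed src_emap G.einj_bar_in)

text \<open>Modulo \<open>H\<close>, the class \<open>cv v\<close> times an element from the local
  group and the twist of \<open>e\<close> is the representative of the reverse of \<open>e\<close>.
  Applied to \<open>cv v\<close>, the given equation thus compares two edge representatives, and
  \<open>ce_hcoset\<close> identifies the edges and recognises \<open>k\<close>; the vertex part
  then follows by cancellation.\<close>

lemma chart_locally_inj:
  assumes v: "v \<in> verts \<Lambda>"
  shows "locally_inj v"
  unfolding locally_inj_def
proof (intro ballI impI)
  let ?v = "vmap f v"
  let ?G = "vgroup \<Gamma> ?v"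
  interpret V: group ?G using v by (intro G.vgroup_group) simp
  fix e e' l l' k
  assume e: "e \<in> edges \<Lambda>" "e' \<in> edges \<Lambda>" and l: "l \<in> carrier (vgroup \<Lambda> v)" "l' \<in> carrier (vgroup \<Lambda> v)"
    and k: "k \<in> carrier (egroup \<Gamma> (emap f e))" and t: "tgt \<Lambda> e = v" "tgt \<Lambda> e' = v" and ee: "emap f e = emap f e'"
    and eq: "vhom f v l \<otimes>\<^bsub>?G\<^esub> twist f e \<otimes>\<^bsub>?G\<^esub> einj \<Gamma> (emap f e) k = vhom f v l' \<otimes>\<^bsub>?G\<^esub> twist f e'"
  have cl: "twist f e \<in> carrier ?G" "twist f e' \<in> carrier ?G" "einj \<Gamma> (emap f e) k \<in> carrier ?G"
    "vhom f v l \<in> carrier ?G" "vhom f v l' \<in> carrier ?G"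
    using e l k t v twist_in[OF e(1)] twist_in[OF e(2)] einj_ehom_in(1)[OF e(1) k] by auto
  have tw: "K ?v (G.R ?v (G.R ?v (cv v) (vhom f v m)) (twist f d)) = K ?v (ce (bar \<Lambda> d))"
    if "d \<in> edges \<Lambda>" "tgt \<Lambda> d = v" "m \<in> carrier (vgroup \<Lambda> v)" for d m
    using G.hcoset_ract[OF cv_vhom_hcoset[OF v that(3)], of "twist f d"] cv_twist_hcoset[OF that(1)] that v
      twist_in[OF that(1)] by simp
  have P: "ce (bar \<Lambda> e) \<in> G.P ?v" "ce (bar \<Lambda> e') \<in> G.P ?v" using ce_bar_in[OF e(1)] ce_bar_in[OF e(2)] t by auto
  have "K ?v (G.R ?v (ce (bar \<Lambda> e)) (einj \<Gamma> (emap f e) k))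
      = K ?v (G.R ?v (G.R ?v (G.R ?v (cv v) (vhom f v l)) (twist f e)) (einj \<Gamma> (emap f e) k))"
    by (rule G.hcoset_ract[OF tw[OF e(1) t(1) l(1), symmetric]]) (use cl v P in auto)
  also have "\<dots> = K ?v (G.R ?v (cv v) (vhom f v l' \<otimes>\<^bsub>?G\<^esub> twist f e'))"
    unfolding eq[symmetric] using cl v by (simp add: G.ract_mult)
  also have "\<dots> = K ?v (ce (bar \<Lambda> e'))" using tw[OF e(2) t(2) l(2)] cl v by (simp add: G.ract_mult)
  finally have K: "K ?v (G.R ?v (ce (bar \<Lambda> e)) (einj \<Gamma> (emap f e) k)) = K ?v (ce (bar \<Lambda> e'))" .
  have "bar \<Lambda> e' = bar \<Lambda> e \<and> (\<exists>j\<in>carrier (egroup \<Lambda> (bar \<Lambda> e)).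
      k = ehom f (bar \<Lambda> e) j \<otimes>\<^bsub>egroup \<Gamma> (emap f (bar \<Lambda> e))\<^esub> \<one>\<^bsub>egroup \<Gamma> (emap f (bar \<Lambda> e))\<^esub>)"
    by (rule ce_hcoset) (use e k t ee K P in auto)
  then obtain j where b: "bar \<Lambda> e' = bar \<Lambda> e" and j: "j \<in> carrier (egroup \<Lambda> e)"
    "k = ehom f e j"
    using e group.is_monoid[OF G.egroup_group[of "emap f e"]] by (auto simp: monoid.r_one)
  have e': "e' = e" using arg_cong[OF b, of "bar \<Lambda>"] e by simp
  have jc: "einj \<Lambda> e j \<in> carrier (vgroup \<Lambda> v)" using L.einj_in[OF e(1) j(1)] t by simp
  have "vhom f v (l \<otimes>\<^bsub>vgroup \<Lambda> v\<^esub> einj \<Lambda> e j) \<otimes>\<^bsub>?G\<^esub> twist f e = vhom f v l' \<otimes>\<^bsub>?G\<^esub> twist f e"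
    using eq vhom_einj[OF e(1) j(1)] cl jc v l t j unfolding e' by (simp add: vhom_mult V.m_assoc)
  then have "vhom f v (l \<otimes>\<^bsub>vgroup \<Lambda> v\<^esub> einj \<Lambda> e j) = vhom f v l'"
    using cl jc v l by simp
  then have "l \<otimes>\<^bsub>vgroup \<Lambda> v\<^esub> einj \<Lambda> e j = l'"
    using inj_onD[OF vhom_inj_on[OF v]] v l jc by simp
  then show "e = e' \<and> (\<exists>j\<in>carrier (egroup \<Lambda> e). l \<otimes>\<^bsub>vgroup \<Lambda> v\<^esub> einj \<Lambda> e j = l')" using e' j(1) by blast
qed

text \<open>The class \<open>cv v\<close> times \<open>g\<close> can be left along the reverse of
  \<open>e'\<close>, so it lies in the double coset of some edge representative. Rewriting that
  representative through the terminal vertex of the edge gives two expressions for one orbit, and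
  \<open>cv_hcoset\<close> shows that the vertex is \<open>v\<close> and produces
  \<open>l\<close>.\<close>

lemma chart_locally_surj:
  assumes v: "v \<in> verts \<Lambda>"
  shows "locally_surj v"
  unfolding locally_surj_def
proof (intro ballI impI)
  let ?v = "vmap f v"
  let ?G = "vgroup \<Gamma> ?v"
  interpret V: group ?G using v by (intro G.vgroup_group) simp
  fix e' g assume e': "e' \<in> edges \<Gamma>" and g: "g \<in> carrier ?G" and t: "tgt \<Gamma> e' = ?v"
  have "G.R ?v (cv v) g \<in> G.P (src \<Gamma> (bar \<Gamma> e'))" using e' g v t by simp
  from ce_hcoset_ex[OF _ this] obtain e1 k where e1: "e1 \<in> edges \<Lambda>" "k \<in> carrier (egroup \<Gamma> e')" "emap f e1 = bar \<Gamma> e'"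
    "K ?v (G.R ?v (cv v) g) = K ?v (G.R ?v (ce e1) (einj \<Gamma> e' k))"
    using e' t by auto
  define e where "e = bar \<Lambda> e1"
  have e: "e \<in> edges \<Lambda>" "bar \<Lambda> e = e1" "emap f e = e'" using e1 e' by (simp_all add: e_def)
  have te: "vmap f (tgt \<Lambda> e) = ?v" using tgt_emap[OF e(1)] e(3) t by simp
  have cl: "twist f e \<in> carrier ?G" "einj \<Gamma> e' k \<in> carrier ?G" using twist_in[OF e(1)] te G.einj_in[OF e' e1(2)] t by auto
  have P: "cv (tgt \<Lambda> e) \<in> G.P ?v" "ce e1 \<in> G.P ?v" using cv_in[of "tgt \<Lambda> e"] ce_bar_in[OF e(1)] e te by auto
  have "K ?v (G.R ?v (G.R ?v (cv (tgt \<Lambda> e)) (twist f e)) (einj \<Gamma> e' k)) = K ?v (G.R ?v (ce e1) (einj \<Gamma> e' k))"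
    by (rule G.hcoset_ract) (use cv_twist_hcoset[OF e(1)] te P cl e in auto)
  with e1(4) have K: "K ?v (G.R ?v (cv v) g) = K ?v (G.R ?v (cv (tgt \<Lambda> e)) (twist f e \<otimes>\<^bsub>?G\<^esub> einj \<Gamma> e' k))"
    using P cl by (simp add: G.ract_mult)
  obtain l where l: "tgt \<Lambda> e = v" "l \<in> carrier (vgroup \<Lambda> v)" "g = vhom f v l \<otimes>\<^bsub>?G\<^esub> (twist f e \<otimes>\<^bsub>?G\<^esub> einj \<Gamma> e' k)"
    using cv_hcoset[OF v _ te g _ K] e cl by auto
  then show "\<exists>e\<in>edges \<Lambda>. \<exists>l\<in>carrier (vgroup \<Lambda> v). \<exists>k\<in>carrier (egroup \<Gamma> e').
      tgt \<Lambda> e = v \<and> emap f e = e' \<and> g = vhom f v l \<otimes>\<^bsub>?G\<^esub> twist f e \<otimes>\<^bsub>?G\<^esub> einj \<Gamma> e' k"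
    using e e1(2) cl v by (intro bexI[of _ e] bexI[of _ l] bexI[of _ k]) (auto simp: V.m_assoc)
qed

lemma chart_covering: "covering \<Lambda> \<Gamma> f"
  unfolding covering_def
proof (intro conjI ballI)
  show "morphism \<Lambda> \<Gamma> f" by (rule mor)
  show "vmap f ` verts \<Lambda> = verts \<Gamma>"
  proof
    show "verts \<Gamma> \<subseteq> vmap f ` verts \<Lambda>"
    proof
      fix v assume "v \<in> verts \<Gamma>"
      then obtain A where "A \<in> G.P v" using G.vpaths_nonempty by blast
      then show "v \<in> vmap f ` verts \<Lambda>" using cv_ex by blast
    qed
  qed auto
  show "emap f ` edges \<Lambda> = edges \<Gamma>"
  proof
    show "edges \<Gamma> \<subseteq> emap f ` edges \<Lambda>"
    proof
      fix e assume e: "e \<in> edges \<Gamma>"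
      then obtain A where "A \<in> G.P (src \<Gamma> e)" using G.vpaths_nonempty G.src_in by blast
      then show "e \<in> emap f ` edges \<Lambda>" using ce_ex[OF e] by blast
    qed
  qed auto
  show "vhom f v \<in> mon (vgroup \<Lambda> v) (vgroup \<Gamma> (vmap f v))" if "v \<in> verts \<Lambda>" for v
    using vhom_hom[OF that] vhom_inj_on[OF that] by (simp add: mon_def)
  show "bij_betw (star_map \<Gamma> f v) (star \<Lambda> v) (star \<Gamma> (vmap f v))" if "v \<in> verts \<Lambda>" for v
    using star_bij_iff[OF that] chart_locally_inj[OF that] chart_locally_surj[OF that] by simp
  show "ehom f e \<in> mon (egroup \<Lambda> e) (egroup \<Gamma> (emap f e))" if "e \<in> edges \<Lambda>" for e
    using ehom_hom[OF that] ehom_inj_on[OF that] by (simp add: mon_def)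
qed

end

sublocale chart \<subseteq> pointed_covering_morphism \<Lambda> \<Gamma> f q p
  by unfold_locales (rule chart_covering)

section \<open>The subgroup determined by a chart\<close>

context chart
begin

lemma chart_pointed_covering: "pointed_covering \<Lambda> q \<Gamma> p f"
  using L.gog G.gog L.p_in chart_covering base by (simp add: pointed_covering_def)

text \<open>Along a path in \<open>\<Lambda>\<close> the image never leaves the orbit of the
  representative of the vertex reached: each generating step is one of the chart equations. The
  normalisation of the chart at the base point enters at the root.\<close>

lemma pmap_hcoset:
  assumes "B \<in> L.P w"
  shows "K (vmap f w) (F w B) = K (vmap f w) (cv w)"
proof -
  obtain u \<beta> where root: "root_path \<Lambda> q u \<beta>" using L.root_exists by blast
  have tw: "K (vmap f (src \<Lambda> e)) (ce e) = K (vmap f (src \<Lambda> e)) (G.R (vmap f (src \<Lambda> e)) (cv (src \<Lambda> e)) (twist f (bar \<Lambda> e)))"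
    if "e \<in> edges \<Lambda>" for e using cv_twist_hcoset[of "bar \<Lambda> e"] that by simp
  show ?thesis using root _ _ _ assms
  proof (rule L.vpaths_induct)
    show "K (vmap f u) (F u \<beta>) = K (vmap f u) (cv u)"
      using root[unfolded root_path_def]
    proof (elim disjE exE conjE)
      assume "q = Vertex u" "\<beta> = hclass \<Lambda> q q []"
      then show ?thesis using pmap_one[of u] cv_base[of u] by simp
    next
      fix e t assume *: "e \<in> edges \<Lambda>" "0 < t" "t < 1" "q = edge_point \<Lambda> e t" "u = src \<Lambda> e"
        "\<beta> = initial_seg \<Lambda> q e t"
      have \<beta>: "\<beta> \<in> L.P u" using L.root_in[OF root] .
      \<comment> \<open>Both sides are the initial segment of \<open>p\<close> modulo
        \<open>H\<close>, one as the image of the root of \<open>\<Lambda>\<close>, one as the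
        representative of the edge; the common twist is then cancelled.\<close>
      have "K (vmap f u) (G.R (vmap f u) (F u \<beta>) (twist f (bar \<Lambda> e))) = K (vmap f u) (G.R (vmap f u) (cv u) (twist f (bar \<Lambda> e)))"
        using pmap_initial_seg[OF *(1-4)] ce_base[OF *(1-4)] *(5,6) tw[OF *(1)] by simp
      from G.hcoset_ract_cancel[OF this] show ?thesis
        using * \<beta> pmap_vpaths[OF \<beta>] twist_bar_in[OF *(1)] group.r_inv[OF G.vgroup_group[of "vmap f u"]] by simp
    qed
  next
    fix w B g assume B: "B \<in> L.P w" and g: "g \<in> carrier (vgroup \<Lambda> w)" and IH: "K (vmap f w) (F w B) = K (vmap f w) (cv w)"
    have w: "w \<in> verts \<Lambda>" using L.vpaths_vert[OF B] .
    show "K (vmap f w) (F w (L.R w B g)) = K (vmap f w) (cv w)"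
      using G.hcoset_ract[OF IH, of "vhom f w g"] pmap_ract[OF B g] cv_vhom_hcoset[OF w g] w g B by simp
  next
    fix e B assume e: "e \<in> edges \<Lambda>" and B: "B \<in> L.P (src \<Lambda> e)" and IH: "K (vmap f (src \<Lambda> e)) (F (src \<Lambda> e) B) = K (vmap f (src \<Lambda> e)) (cv (src \<Lambda> e))"
    let ?u = "vmap f (src \<Lambda> e)" and ?v = "vmap f (tgt \<Lambda> e)"
    have P: "F (src \<Lambda> e) B \<in> G.P ?u" "F (tgt \<Lambda> e) (L.X e B) \<in> G.P ?v" using e B by simp_all
    have "K ?u (G.R ?u (F (src \<Lambda> e) B) (twist f (bar \<Lambda> e))) = K ?u (G.R ?u (cv (src \<Lambda> e)) (twist f (bar \<Lambda> e)))"
      by (rule G.hcoset_ract[OF IH]) (use e P in auto)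
    also have "\<dots> = K ?u (ce e)" using tw[OF e] by simp
    finally have "K ?v (G.X (emap f e) (G.R ?u (F (src \<Lambda> e) B) (twist f (bar \<Lambda> e)))) = K ?v (G.X (emap f e) (ce e))"
      using G.hcoset_extend[of "emap f e" "G.R ?u (F (src \<Lambda> e) B) (twist f (bar \<Lambda> e))" "ce e"] e P by simp
    also have "\<dots> = K ?v (G.R ?v (cv (tgt \<Lambda> e)) (twist f e))" using cv_twist_hcoset[OF e] ce_bar[OF e] by simp
    finally have "K ?v (G.R ?v (F (tgt \<Lambda> e) (L.X e B)) (twist f e)) = K ?v (G.R ?v (cv (tgt \<Lambda> e)) (twist f e))"
      using pmap_extend[OF e B] by simp
    from G.hcoset_ract_cancel[OF this] show "K ?v (F (tgt \<Lambda> e) (L.X e B)) = K ?v (cv (tgt \<Lambda> e))"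
      using e P twist_in[OF e] group.r_inv[OF G.vgroup_group[of ?v]] by simp
  qed
qed

text \<open>Loops are tested on one class \<open>F w B\<close>. A loop of \<open>\<Lambda>\<close>
  keeps the image in its \<open>H\<close>-orbit, so by freeness it acts as an element of
  \<open>H\<close>. Conversely the translate by \<open>h\<close> in \<open>H\<close> lifts; being in
  the same orbit, the lift ends at \<open>w\<close> with a remainder from the local group of
  \<open>w\<close>, so the translate is itself the image of a path to \<open>w\<close>, and the two
  paths to \<open>w\<close> differ by a loop.\<close>

theorem chart_subgroup: "covering_subgroup \<Lambda> q \<Gamma> p f = H"
proof -
  obtain w B where "root_path \<Lambda> q w B" using L.root_exists by blast
  then have B: "B \<in> L.P w" and w: "w \<in> verts \<Lambda>" using L.root_in L.vpaths_vert by auto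
  let ?v = "vmap f w"
  have FB: "F w B \<in> G.P ?v" using B by simp
  have 1: "f_sharp m \<in> H" if m: "m \<in> carrier L.\<pi>" for m
  proof -
    have "K ?v (F w B) = K ?v (F w (L.L w m B))" using pmap_hcoset B m by simp
    then have "K ?v (F w B) = K ?v (G.L ?v (f_sharp m) (F w B))" using pmap_lact[OF m B] by simp
    then obtain h where "h \<in> H" "G.L ?v h (F w B) = G.L ?v (f_sharp m) (F w B)"
      using G.hcoset_eqD FB m by (metis G.lact_closed induced_hom_in)
    then show ?thesis using G.lact_free[OF _ _ FB, of h "f_sharp m"] m by simp
  qed
  have 2: "\<exists>m\<in>carrier L.\<pi>. h = f_sharp m" if h: "h \<in> H" for h
  proof -
    have "G.L ?v h (F w B) \<in> G.P ?v" using h FB by simp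
    from lift_exists[OF this] obtain w' B' g where *: "w' \<in> verts \<Lambda>" "B' \<in> L.P w'" "g \<in> carrier (vgroup \<Gamma> ?v)"
      "vmap f w' = ?v" "G.L ?v h (F w B) = G.R ?v (F w' B') g" by blast
    interpret V: group "vgroup \<Gamma> ?v" using w by (intro G.vgroup_group) simp
    have P: "F w' B' \<in> G.P ?v" "cv w' \<in> G.P ?v" using pmap_vpaths[OF *(2)] cv_in[OF *(1)] *(4) by auto
    have "K ?v (G.R ?v (cv w) \<one>\<^bsub>vgroup \<Gamma> ?v\<^esub>) = K ?v (G.L ?v h (F w B))" using pmap_hcoset[OF B] h w FB by simp
    also have "\<dots> = K ?v (G.R ?v (cv w') g)" unfolding *(5)
      by (rule G.hcoset_ract) (use pmap_hcoset[OF *(2)] P * in auto)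
    finally have K: "K ?v (G.R ?v (cv w) \<one>\<^bsub>vgroup \<Gamma> ?v\<^esub>) = K ?v (G.R ?v (cv w') g)" .
    from cv_hcoset[OF w *(1,4) V.one_closed *(3) K] obtain l where l: "w' = w" "l \<in> carrier (vgroup \<Lambda> w)"
      "\<one>\<^bsub>vgroup \<Gamma> ?v\<^esub> = vhom f w l \<otimes>\<^bsub>vgroup \<Gamma> ?v\<^esub> g" by blast
    have g: "g = vhom f w (inv\<^bsub>vgroup \<Lambda> w\<^esub> l)"
      using V.inv_unique'[of "vhom f w l" g] l *(3) w V.inv_equality V.inv_comm by (metis vhom_in vhom_inv)
    let ?B = "L.R w B' (inv\<^bsub>vgroup \<Lambda> w\<^esub> l)"
    have B'': "?B \<in> L.P w" using *(2) l w by simp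
    obtain m where m: "m \<in> carrier L.\<pi>" "L.L w m B = ?B" using L.lact_trans[OF B B''] by blast
    have "G.L ?v (f_sharp m) (F w B) = G.L ?v h (F w B)"
      unfolding *(5) pmap_lact[OF m(1) B, symmetric] m(2) using pmap_ract[of B' w] *(2) l w g by simp
    then have "h = f_sharp m" using G.lact_free[OF _ _ FB, of h "f_sharp m"] m h by simp
    then show ?thesis using m(1) by blast
  qed
  show ?thesis unfolding covering_subgroup_def using 1 2 by blast
qed

end

section \<open>Comparing charts\<close>

lemma hcoset_mono:
  assumes "pgog_subgroup \<Gamma> p H" "pgog_subgroup \<Gamma> p H'" "H \<subseteq> H'" "hcoset \<Gamma> p H v A = hcoset \<Gamma> p H v B"
    and "A \<in> vpaths \<Gamma> p v" "B \<in> vpaths \<Gamma> p v"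
  shows "hcoset \<Gamma> p H' v A = hcoset \<Gamma> p H' v B"
  using pgog_subgroup.hcoset_eqD[OF assms(1,4,6)] pgog_subgroup.hcoset_lact[OF assms(2) _ assms(5)] assms(3) by auto

text \<open>A map of the underlying graphs sending each place to the double coset of
  \<open>H2\<close> that contains its representative; \<open>a\<close> and \<open>b\<close> record
  the local factors by which the two systems of representatives differ. The equations hold modulo
  \<open>H2\<close> because only there is the position in a double coset forgotten.\<close>

locale comparison = C1: chart \<Lambda>1 \<Gamma> f1 q1 p H1 cv1 ce1 + C2: chart \<Lambda>2 \<Gamma> f2 q2 p H2 cv2 ce2
  for \<Lambda>1 :: "('v1, 'e1, 'g1, 'h1) graph_of_groups" and \<Lambda>2 :: "('v2, 'e2, 'g2, 'h2) graph_of_groups"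
    and \<Gamma> :: "('w, 'f, 'k, 'l) graph_of_groups"
    and f1 f2 q1 q2 p H1 cv1 ce1 H2 cv2 ce2 +
  fixes \<phi>v :: "'v1 \<Rightarrow> 'v2" and \<phi>e :: "'e1 \<Rightarrow> 'e2" and a :: "'v1 \<Rightarrow> 'k" and b :: "'e1 \<Rightarrow> 'l"
  assumes H_le: "H1 \<subseteq> H2"
    and phi_v [simp]: "w \<in> verts \<Lambda>1 \<Longrightarrow> \<phi>v w \<in> verts \<Lambda>2" "w \<in> verts \<Lambda>1 \<Longrightarrow> vmap f2 (\<phi>v w) = vmap f1 w"
    and a_in [simp]: "w \<in> verts \<Lambda>1 \<Longrightarrow> a w \<in> carrier (vgroup \<Gamma> (vmap f1 w))"
    and cv_phi: "w \<in> verts \<Lambda>1 \<Longrightarrow> hcoset \<Gamma> p H2 (vmap f1 w) (cv1 w)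
      = hcoset \<Gamma> p H2 (vmap f1 w) (ract \<Gamma> p (vmap f1 w) (cv2 (\<phi>v w)) (a w))"
    and phi_e [simp]: "e \<in> edges \<Lambda>1 \<Longrightarrow> \<phi>e e \<in> edges \<Lambda>2" "e \<in> edges \<Lambda>1 \<Longrightarrow> emap f2 (\<phi>e e) = emap f1 e"
      "e \<in> edges \<Lambda>1 \<Longrightarrow> \<phi>e (bar \<Lambda>1 e) = bar \<Lambda>2 (\<phi>e e)"
    and b_in [simp]: "e \<in> edges \<Lambda>1 \<Longrightarrow> b e \<in> carrier (egroup \<Gamma> (emap f1 e))"
      "e \<in> edges \<Lambda>1 \<Longrightarrow> b (bar \<Lambda>1 e) = b e"
    and ce_phi: "e \<in> edges \<Lambda>1 \<Longrightarrow> hcoset \<Gamma> p H2 (vmap f1 (src \<Lambda>1 e)) (ce1 e)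
      = hcoset \<Gamma> p H2 (vmap f1 (src \<Lambda>1 e))
          (ract \<Gamma> p (vmap f1 (src \<Lambda>1 e)) (ce2 (\<phi>e e)) (einj \<Gamma> (bar \<Gamma> (emap f1 e)) (b e)))"
begin

abbreviation K where "K \<equiv> hcoset \<Gamma> p H2"

lemma H1_hcoset:
  "hcoset \<Gamma> p H1 v A = hcoset \<Gamma> p H1 v B \<Longrightarrow> A \<in> C1.G.P v \<Longrightarrow> B \<in> C1.G.P v \<Longrightarrow> K v A = K v B"
  by (rule hcoset_mono[OF C1.G.pgog_subgroup_axioms C2.G.pgog_subgroup_axioms H_le])

lemma cv2_in [simp]: "w \<in> verts \<Lambda>1 \<Longrightarrow> cv2 (\<phi>v w) \<in> C1.G.P (vmap f1 w)"
  using C2.cv_in[of "\<phi>v w"] by simp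

lemma src_phi: "e \<in> edges \<Lambda>1 \<Longrightarrow> vmap f2 (src \<Lambda>2 (\<phi>e e)) = vmap f1 (src \<Lambda>1 e)"
  and vmap_tgt_phi: "e \<in> edges \<Lambda>1 \<Longrightarrow> vmap f2 (tgt \<Lambda>2 (\<phi>e e)) = vmap f1 (tgt \<Lambda>1 e)"
  using C2.src_emap[of "\<phi>e e"] C1.src_emap[of e] C2.tgt_emap[of "\<phi>e e"] C1.tgt_emap[of e] by auto

lemma ce2_in [simp]: "e \<in> edges \<Lambda>1 \<Longrightarrow> ce2 (\<phi>e e) \<in> C1.G.P (vmap f1 (src \<Lambda>1 e))"
  using C2.ce_in[of "\<phi>e e"] src_phi[of e] by simp

text \<open>The orbit of \<open>ce1 (bar \<Lambda>1 e)\<close> is reached from the second chart in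
  two ways: through the vertex assigned to the target of \<open>e\<close>, and through the target of
  the edge assigned to \<open>e\<close>. Uniqueness of representatives makes these vertices equal,
  so that the assignment is a graph map, and the leftover element becomes the twist of the
  comparison.\<close>

lemma twist_ex:
  assumes e: "e \<in> edges \<Lambda>1"
  shows "tgt \<Lambda>2 (\<phi>e e) = \<phi>v (tgt \<Lambda>1 e) \<and>
    (\<exists>l\<in>carrier (vgroup \<Lambda>2 (\<phi>v (tgt \<Lambda>1 e))).
       a (tgt \<Lambda>1 e) \<otimes>\<^bsub>vgroup \<Gamma> (vmap f1 (tgt \<Lambda>1 e))\<^esub> twist f1 e
       = vhom f2 (\<phi>v (tgt \<Lambda>1 e)) l \<otimes>\<^bsub>vgroup \<Gamma> (vmap f1 (tgt \<Lambda>1 e))\<^esub>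
          (twist f2 (\<phi>e e) \<otimes>\<^bsub>vgroup \<Gamma> (vmap f1 (tgt \<Lambda>1 e))\<^esub> einj \<Gamma> (emap f1 e) (b e)))"
proof -
  let ?t = "tgt \<Lambda>1 e" and ?t2 = "tgt \<Lambda>2 (\<phi>e e)"
  let ?v = "vmap f1 ?t"
  let ?G = "vgroup \<Gamma> ?v"
  interpret V: group ?G using e by (intro C1.G.vgroup_group) simp
  have v2: "vmap f2 ?t2 = ?v" "vmap f2 (\<phi>v ?t) = ?v" using vmap_tgt_phi e by auto
  have cl: "twist f2 (\<phi>e e) \<in> carrier ?G" "einj \<Gamma> (emap f1 e) (b e) \<in> carrier ?G" "twist f1 e \<in> carrier ?G" "a ?t \<in> carrier ?G"
    using C2.twist_in[of "\<phi>e e"] v2 e by auto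
  have P: "cv1 ?t \<in> C1.G.P ?v" "cv2 (\<phi>v ?t) \<in> C1.G.P ?v" "cv2 ?t2 \<in> C1.G.P ?v" "ce1 (bar \<Lambda>1 e) \<in> C1.G.P ?v"
    "ce2 (bar \<Lambda>2 (\<phi>e e)) \<in> C1.G.P ?v"
    using e C2.cv_in[of ?t2] v2 C2.ce_bar_in[of "\<phi>e e"] by auto
  have "K ?v (C1.G.R ?v (cv2 (\<phi>v ?t)) (a ?t \<otimes>\<^bsub>?G\<^esub> twist f1 e)) = K ?v (C1.G.R ?v (cv1 ?t) (twist f1 e))"
    using C2.G.hcoset_ract[OF cv_phi[of ?t, symmetric], of "twist f1 e"] P cl e by (simp add: C1.G.ract_mult)
  also have "\<dots> = K ?v (ce1 (bar \<Lambda>1 e))"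
    by (rule H1_hcoset[OF C1.cv_twist_hcoset[OF e]]) (use P cl in auto)
  also have "\<dots> = K ?v (C1.G.R ?v (ce2 (bar \<Lambda>2 (\<phi>e e))) (einj \<Gamma> (emap f1 e) (b e)))"
    using ce_phi[of "bar \<Lambda>1 e"] e by simp
  also have "\<dots> = K ?v (C1.G.R ?v (C1.G.R ?v (cv2 ?t2) (twist f2 (\<phi>e e))) (einj \<Gamma> (emap f1 e) (b e)))"
    by (rule C2.G.hcoset_ract) (use C2.cv_twist_hcoset[of "\<phi>e e"] v2 e P cl in auto)
  also have "\<dots> = K ?v (C1.G.R ?v (cv2 ?t2) (twist f2 (\<phi>e e) \<otimes>\<^bsub>?G\<^esub> einj \<Gamma> (emap f1 e) (b e)))"
    using P cl by (simp add: C1.G.ract_mult)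
  finally have "K ?v (C1.G.R ?v (cv2 (\<phi>v ?t)) (a ?t \<otimes>\<^bsub>?G\<^esub> twist f1 e))
    = K ?v (C1.G.R ?v (cv2 ?t2) (twist f2 (\<phi>e e) \<otimes>\<^bsub>?G\<^esub> einj \<Gamma> (emap f1 e) (b e)))" .
  then show ?thesis using C2.cv_hcoset[of "\<phi>v ?t" ?t2 "a ?t \<otimes>\<^bsub>?G\<^esub> twist f1 e" "twist f2 (\<phi>e e) \<otimes>\<^bsub>?G\<^esub> einj \<Gamma> (emap f1 e) (b e)"] v2 cl e by simp
qed

text \<open>Elements of the local group of \<open>w\<close> fix the orbit of \<open>cv1 w\<close>
  under \<open>H1\<close>, hence under \<open>H2\<close>; expressed from \<open>cv2\<close>, this is
  a stabilising factor conjugated by \<open>a w\<close>.\<close>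

lemma vhom_ex:
  assumes w: "w \<in> verts \<Lambda>1" and l: "l \<in> carrier (vgroup \<Lambda>1 w)"
  shows "\<exists>l2\<in>carrier (vgroup \<Lambda>2 (\<phi>v w)). vhom f2 (\<phi>v w) l2
    = a w \<otimes>\<^bsub>vgroup \<Gamma> (vmap f1 w)\<^esub> vhom f1 w l \<otimes>\<^bsub>vgroup \<Gamma> (vmap f1 w)\<^esub> inv\<^bsub>vgroup \<Gamma> (vmap f1 w)\<^esub> a w"
proof -
  let ?v = "vmap f1 w"
  let ?G = "vgroup \<Gamma> ?v"
  interpret V: group ?G using w by (intro C1.G.vgroup_group) simp
  have P: "cv1 w \<in> C1.G.P ?v" "cv2 (\<phi>v w) \<in> C1.G.P ?v" using w by auto
  have cl: "a w \<in> carrier ?G" "vhom f1 w l \<in> carrier ?G" using w l by auto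
  have "K ?v (C1.G.R ?v (cv2 (\<phi>v w)) (a w \<otimes>\<^bsub>?G\<^esub> vhom f1 w l)) = K ?v (C1.G.R ?v (cv1 w) (vhom f1 w l))"
    using C2.G.hcoset_ract[OF cv_phi[OF w, symmetric], of "vhom f1 w l"] P cl by (simp add: C1.G.ract_mult)
  also have "\<dots> = K ?v (cv1 w)" by (rule H1_hcoset[OF C1.cv_vhom_hcoset[OF w l]]) (use P cl in auto)
  also have "\<dots> = K ?v (C1.G.R ?v (cv2 (\<phi>v w)) (a w))" by (rule cv_phi[OF w])
  finally have "\<exists>l2\<in>carrier (vgroup \<Lambda>2 (\<phi>v w)). a w \<otimes>\<^bsub>?G\<^esub> vhom f1 w l = vhom f2 (\<phi>v w) l2 \<otimes>\<^bsub>?G\<^esub> a w"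
    using C2.cv_hcoset[of "\<phi>v w" "\<phi>v w" "a w \<otimes>\<^bsub>?G\<^esub> vhom f1 w l" "a w"] w cl by simp
  then obtain l2 where l2: "l2 \<in> carrier (vgroup \<Lambda>2 (\<phi>v w))" "a w \<otimes>\<^bsub>?G\<^esub> vhom f1 w l = vhom f2 (\<phi>v w) l2 \<otimes>\<^bsub>?G\<^esub> a w" by blast
  have "vhom f2 (\<phi>v w) l2 \<in> carrier ?G" using C2.vhom_in[of "\<phi>v w" l2] w l2(1) by simp
  then have "a w \<otimes>\<^bsub>?G\<^esub> vhom f1 w l \<otimes>\<^bsub>?G\<^esub> inv\<^bsub>?G\<^esub> a w = vhom f2 (\<phi>v w) l2"
    unfolding l2(2) using cl by (simp add: V.m_assoc)
  then show ?thesis using l2(1) by metis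
qed

lemma ehom_ex:
  assumes e: "e \<in> edges \<Lambda>1" and j: "j \<in> carrier (egroup \<Lambda>1 e)"
  shows "\<exists>j2\<in>carrier (egroup \<Lambda>2 (\<phi>e e)). ehom f2 (\<phi>e e) j2
    = b e \<otimes>\<^bsub>egroup \<Gamma> (emap f1 e)\<^esub> ehom f1 e j \<otimes>\<^bsub>egroup \<Gamma> (emap f1 e)\<^esub> inv\<^bsub>egroup \<Gamma> (emap f1 e)\<^esub> b e"
proof -
  let ?v = "vmap f1 (src \<Lambda>1 e)" and ?E = "egroup \<Gamma> (emap f1 e)" and ?i = "einj \<Gamma> (bar \<Gamma> (emap f1 e))"
  interpret E: group ?E using e by (intro C1.G.egroup_group) simp
  have P: "ce1 e \<in> C1.G.P ?v" "ce2 (\<phi>e e) \<in> C1.G.P ?v" using e by auto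
  have cl: "b e \<in> carrier ?E" "ehom f1 e j \<in> carrier ?E" using e j by auto
  have i: "?i (b e) \<in> carrier (vgroup \<Gamma> ?v)" "?i (ehom f1 e j) \<in> carrier (vgroup \<Gamma> ?v)"
    "?i (b e \<otimes>\<^bsub>?E\<^esub> ehom f1 e j) = ?i (b e) \<otimes>\<^bsub>vgroup \<Gamma> ?v\<^esub> ?i (ehom f1 e j)"
    using C1.G.einj_bar_mult[of "emap f1 e" "b e" "ehom f1 e j"] e cl by auto
  have "K ?v (C1.G.R ?v (ce2 (\<phi>e e)) (?i (b e \<otimes>\<^bsub>?E\<^esub> ehom f1 e j))) = K ?v (C1.G.R ?v (ce1 e) (?i (ehom f1 e j)))"
    unfolding i(3) using C2.G.hcoset_ract[OF ce_phi[OF e, symmetric], of "?i (ehom f1 e j)"] P i by (simp add: C1.G.ract_mult)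
  also have "\<dots> = K ?v (ce1 e)" by (rule H1_hcoset[OF C1.ce_ehom_hcoset[OF e j]]) (use P i in auto)
  also have "\<dots> = K ?v (C1.G.R ?v (ce2 (\<phi>e e)) (?i (b e)))" by (rule ce_phi[OF e])
  finally have "\<exists>j2\<in>carrier (egroup \<Lambda>2 (\<phi>e e)). b e \<otimes>\<^bsub>?E\<^esub> ehom f1 e j = ehom f2 (\<phi>e e) j2 \<otimes>\<^bsub>?E\<^esub> b e"
    using C2.ce_hcoset[of "\<phi>e e" "\<phi>e e" "b e \<otimes>\<^bsub>?E\<^esub> ehom f1 e j" "b e"] src_phi e cl by simp
  then obtain j2 where j2: "j2 \<in> carrier (egroup \<Lambda>2 (\<phi>e e))" "b e \<otimes>\<^bsub>?E\<^esub> ehom f1 e j = ehom f2 (\<phi>e e) j2 \<otimes>\<^bsub>?E\<^esub> b e" by blast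
  have "ehom f2 (\<phi>e e) j2 \<in> carrier ?E" using C2.ehom_in[of "\<phi>e e" j2] e j2(1) by simp
  then have "b e \<otimes>\<^bsub>?E\<^esub> ehom f1 e j \<otimes>\<^bsub>?E\<^esub> inv\<^bsub>?E\<^esub> b e = ehom f2 (\<phi>e e) j2"
    unfolding j2(2) using cl by (simp add: E.m_assoc)
  then show ?thesis using j2(1) by metis
qed

end

text \<open>A comparison together with local data solving the equations of \<open>vhom_ex\<close>,
  \<open>ehom_ex\<close> and \<open>twist_ex\<close>. Keeping the morphism as a parameter, instead
  of constructing it, lets the projection from the tree to its quotient be recognised as an
  instance.\<close>

locale comparison_morphism = comparison \<Lambda>1 \<Lambda>2 \<Gamma> f1 f2 q1 q2 p H1 cv1 ce1 H2 cv2 ce2 "vmap \<phi>" "emap \<phi>" a b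
  for \<Lambda>1 :: "('v1, 'e1, 'g1, 'h1) graph_of_groups" and \<Lambda>2 :: "('v2, 'e2, 'g2, 'h2) graph_of_groups"
    and \<Gamma> :: "('w, 'f, 'k, 'l) graph_of_groups"
    and f1 f2 q1 q2 p H1 cv1 ce1 H2 cv2 ce2 and \<phi> :: "('v1, 'e1, 'g1, 'h1, 'v2, 'e2, 'g2, 'h2) gmorphism" and a b +
  assumes vhom_phi_in [simp]: "\<lbrakk>w \<in> verts \<Lambda>1; l \<in> carrier (vgroup \<Lambda>1 w)\<rbrakk> \<Longrightarrow> vhom \<phi> w l \<in> carrier (vgroup \<Lambda>2 (vmap \<phi> w))"
    and vhom_phi: "\<lbrakk>w \<in> verts \<Lambda>1; l \<in> carrier (vgroup \<Lambda>1 w)\<rbrakk> \<Longrightarrow> vhom f2 (vmap \<phi> w) (vhom \<phi> w l)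
      = a w \<otimes>\<^bsub>vgroup \<Gamma> (vmap f1 w)\<^esub> vhom f1 w l \<otimes>\<^bsub>vgroup \<Gamma> (vmap f1 w)\<^esub> inv\<^bsub>vgroup \<Gamma> (vmap f1 w)\<^esub> a w"
    and ehom_phi_in [simp]: "\<lbrakk>e \<in> edges \<Lambda>1; j \<in> carrier (egroup \<Lambda>1 e)\<rbrakk> \<Longrightarrow> ehom \<phi> e j \<in> carrier (egroup \<Lambda>2 (emap \<phi> e))"
    and ehom_phi: "\<lbrakk>e \<in> edges \<Lambda>1; j \<in> carrier (egroup \<Lambda>1 e)\<rbrakk> \<Longrightarrow> ehom f2 (emap \<phi> e) (ehom \<phi> e j)
      = b e \<otimes>\<^bsub>egroup \<Gamma> (emap f1 e)\<^esub> ehom f1 e j \<otimes>\<^bsub>egroup \<Gamma> (emap f1 e)\<^esub> inv\<^bsub>egroup \<Gamma> (emap f1 e)\<^esub> b e"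
    and twist_phi_in [simp]: "e \<in> edges \<Lambda>1 \<Longrightarrow> twist \<phi> e \<in> carrier (vgroup \<Lambda>2 (vmap \<phi> (tgt \<Lambda>1 e)))"
    and twist_phi: "e \<in> edges \<Lambda>1 \<Longrightarrow> a (tgt \<Lambda>1 e) \<otimes>\<^bsub>vgroup \<Gamma> (vmap f1 (tgt \<Lambda>1 e))\<^esub> twist f1 e
       = vhom f2 (vmap \<phi> (tgt \<Lambda>1 e)) (twist \<phi> e) \<otimes>\<^bsub>vgroup \<Gamma> (vmap f1 (tgt \<Lambda>1 e))\<^esub>
          (twist f2 (emap \<phi> e) \<otimes>\<^bsub>vgroup \<Gamma> (vmap f1 (tgt \<Lambda>1 e))\<^esub> einj \<Gamma> (emap f1 e) (b e))"
    and base_phi: "map_point (vmap \<phi>) (emap \<phi>) q1 = q2"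
    and a_base: "q1 = Vertex w \<Longrightarrow> a w = \<one>\<^bsub>vgroup \<Gamma> (vmap f1 w)\<^esub>"
    and b_base: "q1 = Interior S \<Longrightarrow> (e, t) \<in> S \<Longrightarrow> b e = \<one>\<^bsub>egroup \<Gamma> (emap f1 e)\<^esub>"
begin

lemma tgt_phi [simp]: "e \<in> edges \<Lambda>1 \<Longrightarrow> tgt \<Lambda>2 (emap \<phi> e) = vmap \<phi> (tgt \<Lambda>1 e)"
  using twist_ex by blast

lemma vhom2_in [simp]: "\<lbrakk>w \<in> verts \<Lambda>1; l \<in> carrier (vgroup \<Lambda>2 (vmap \<phi> w))\<rbrakk>
    \<Longrightarrow> vhom f2 (vmap \<phi> w) l \<in> carrier (vgroup \<Gamma> (vmap f1 w))"
  using C2.vhom_in[of "vmap \<phi> w" l] by simp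

lemma vhom2_eq: "\<lbrakk>w \<in> verts \<Lambda>1; l \<in> carrier (vgroup \<Lambda>2 (vmap \<phi> w)); l' \<in> carrier (vgroup \<Lambda>2 (vmap \<phi> w));
    vhom f2 (vmap \<phi> w) l = vhom f2 (vmap \<phi> w) l'\<rbrakk> \<Longrightarrow> l = l'"
  using inj_onD[OF C2.vhom_inj_on[of "vmap \<phi> w"]] by simp

lemma ehom2_eq: "\<lbrakk>e \<in> edges \<Lambda>1; j \<in> carrier (egroup \<Lambda>2 (emap \<phi> e)); j' \<in> carrier (egroup \<Lambda>2 (emap \<phi> e));
    ehom f2 (emap \<phi> e) j = ehom f2 (emap \<phi> e) j'\<rbrakk> \<Longrightarrow> j = j'"
  using inj_onD[OF C2.ehom_inj_on[of "emap \<phi> e"]] by simp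

lemma twist2_in [simp]: "e \<in> edges \<Lambda>1 \<Longrightarrow> twist f2 (emap \<phi> e) \<in> carrier (vgroup \<Gamma> (vmap f1 (tgt \<Lambda>1 e)))"
  using C2.twist_in[of "emap \<phi> e"] by simp

text \<open>All conditions are equations in local groups of \<open>\<Lambda>2\<close>. They are
  verified after applying the injective local maps of \<open>f2\<close>, where the maps of
  \<open>\<phi>\<close> turn into conjugates of those of \<open>f1\<close>.\<close>

lemma morphism_phi: "morphism \<Lambda>1 \<Lambda>2 \<phi>"
  unfolding morphism_def
proof (intro conjI ballI)
  fix w assume w: "w \<in> verts \<Lambda>1"
  interpret V: group "vgroup \<Gamma> (vmap f1 w)" using w by (intro C1.G.vgroup_group) simp
  show "vmap \<phi> w \<in> verts \<Lambda>2" using w by simp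
  show "vhom \<phi> w \<in> hom (vgroup \<Lambda>1 w) (vgroup \<Lambda>2 (vmap \<phi> w))"
  proof (rule homI)
    fix l l' assume l: "l \<in> carrier (vgroup \<Lambda>1 w)" "l' \<in> carrier (vgroup \<Lambda>1 w)"
    show "vhom \<phi> w (l \<otimes>\<^bsub>vgroup \<Lambda>1 w\<^esub> l') = vhom \<phi> w l \<otimes>\<^bsub>vgroup \<Lambda>2 (vmap \<phi> w)\<^esub> vhom \<phi> w l'"
      by (rule vhom2_eq[OF w]) (use w l in \<open>simp_all add: C2.vhom_mult vhom_phi C1.vhom_mult V.m_assoc\<close>)
  qed (use w in simp)
next
  fix e assume e: "e \<in> edges \<Lambda>1"
  let ?v = "vmap f1 (tgt \<Lambda>1 e)"
  let ?G = "vgroup \<Gamma> ?v" and ?E = "egroup \<Gamma> (emap f1 e)"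
  interpret V: group ?G using e by (intro C1.G.vgroup_group) simp
  interpret V2: group "vgroup \<Lambda>2 (vmap \<phi> (tgt \<Lambda>1 e))" using e by (intro C2.L.vgroup_group) simp
  interpret E: group ?E using e by (intro C1.G.egroup_group) simp
  show "emap \<phi> e \<in> edges \<Lambda>2" "emap \<phi> (bar \<Lambda>1 e) = bar \<Lambda>2 (emap \<phi> e)"
    "tgt \<Lambda>2 (emap \<phi> e) = vmap \<phi> (tgt \<Lambda>1 e)" "twist \<phi> e \<in> carrier (vgroup \<Lambda>2 (tgt \<Lambda>2 (emap \<phi> e)))"
    using e by simp_all
  show "ehom \<phi> e \<in> hom (egroup \<Lambda>1 e) (egroup \<Lambda>2 (emap \<phi> e))"
  proof (rule homI)
    fix j j' assume j: "j \<in> carrier (egroup \<Lambda>1 e)" "j' \<in> carrier (egroup \<Lambda>1 e)"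
    have h2: "ehom f2 (emap \<phi> e) (x \<otimes>\<^bsub>egroup \<Lambda>2 (emap \<phi> e)\<^esub> y) = ehom f2 (emap \<phi> e) x \<otimes>\<^bsub>?E\<^esub> ehom f2 (emap \<phi> e) y"
      if "x \<in> carrier (egroup \<Lambda>2 (emap \<phi> e))" "y \<in> carrier (egroup \<Lambda>2 (emap \<phi> e))" for x y
      using C2.ehom_hom[of "emap \<phi> e"] that e by (simp add: hom_def)
    have h1: "ehom f1 e (j \<otimes>\<^bsub>egroup \<Lambda>1 e\<^esub> j') = ehom f1 e j \<otimes>\<^bsub>?E\<^esub> ehom f1 e j'"
      using C1.ehom_hom[OF e] j by (simp add: hom_def)
    show "ehom \<phi> e (j \<otimes>\<^bsub>egroup \<Lambda>1 e\<^esub> j') = ehom \<phi> e j \<otimes>\<^bsub>egroup \<Lambda>2 (emap \<phi> e)\<^esub> ehom \<phi> e j'"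
      by (rule ehom2_eq[OF e]) (use e j in \<open>simp_all add: h1 h2 ehom_phi E.m_assoc\<close>)
  qed (use e in simp)
  fix j assume j: "j \<in> carrier (egroup \<Lambda>1 e)"
  show "ehom \<phi> (bar \<Lambda>1 e) j = ehom \<phi> e j"
    by (rule ehom2_eq[OF e]) (use e j ehom_phi[OF e j] ehom_phi[of "bar \<Lambda>1 e" j] ehom_phi_in[of "bar \<Lambda>1 e" j]
        C2.ehom_bar[of "emap \<phi> e" "ehom \<phi> (bar \<Lambda>1 e) j"] in simp_all)
  let ?V2 = "vgroup \<Lambda>2 (vmap \<phi> (tgt \<Lambda>1 e))" and ?f2 = "vhom f2 (vmap \<phi> (tgt \<Lambda>1 e))"
  let ?i = "einj \<Lambda>2 (emap \<phi> e) (ehom \<phi> e j)" and ?I = "einj \<Gamma> (emap f1 e)"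
  have i: "?i \<in> carrier ?V2" using C2.L.einj_in[of "emap \<phi> e" "ehom \<phi> e j"] e j by simp
  have fj: "ehom f1 e j \<in> carrier ?E" using e j by simp
  have cl: "?f2 (twist \<phi> e) \<in> carrier ?G" "twist f2 (emap \<phi> e) \<in> carrier ?G" "a (tgt \<Lambda>1 e) \<in> carrier ?G"
    "twist f1 e \<in> carrier ?G" "?f2 ?i \<in> carrier ?G" "?I (b e) \<in> carrier ?G" "?I (ehom f1 e j) \<in> carrier ?G"
    "vhom f1 (tgt \<Lambda>1 e) (einj \<Lambda>1 e j) \<in> carrier ?G" using e j i by simp_all
  have e2: "?f2 ?i \<otimes>\<^bsub>?G\<^esub> twist f2 (emap \<phi> e) = twist f2 (emap \<phi> e) \<otimes>\<^bsub>?G\<^esub> (?I (b e) \<otimes>\<^bsub>?G\<^esub> ?I (ehom f1 e j) \<otimes>\<^bsub>?G\<^esub> inv\<^bsub>?G\<^esub> ?I (b e))"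
    using C2.vhom_einj[of "emap \<phi> e" "ehom \<phi> e j"] e j ehom_phi[OF e j] fj
      C1.G.einj_mult[of "emap f1 e" "b e \<otimes>\<^bsub>?E\<^esub> ehom f1 e j" "inv\<^bsub>?E\<^esub> b e"] C1.G.einj_mult[of "emap f1 e" "b e" "ehom f1 e j"]
      C1.G.einj_inv[of "emap f1 e" "b e"] by simp
  \<comment> \<open>With the factor \<open>a (tgt \<Lambda>1 e)\<close> times
    \<open>twist f1 e\<close> on the right, the element can be carried through the twist relation of
    \<open>f1\<close> and then, by \<open>twist_phi\<close>, through that of \<open>f2\<close>; the
    factor is cancelled afterwards.\<close>
  have "?f2 (vhom \<phi> (tgt \<Lambda>1 e) (einj \<Lambda>1 e j)) \<otimes>\<^bsub>?G\<^esub> (a (tgt \<Lambda>1 e) \<otimes>\<^bsub>?G\<^esub> twist f1 e)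
     = a (tgt \<Lambda>1 e) \<otimes>\<^bsub>?G\<^esub> (vhom f1 (tgt \<Lambda>1 e) (einj \<Lambda>1 e j) \<otimes>\<^bsub>?G\<^esub> twist f1 e)"
    using vhom_phi[of "tgt \<Lambda>1 e" "einj \<Lambda>1 e j"] e j cl by (simp add: V.m_assoc)
  also have "\<dots> = a (tgt \<Lambda>1 e) \<otimes>\<^bsub>?G\<^esub> twist f1 e \<otimes>\<^bsub>?G\<^esub> ?I (ehom f1 e j)"
    unfolding C1.vhom_einj[OF e j] using cl by (simp add: V.m_assoc)
  also have "\<dots> = ?f2 (twist \<phi> e) \<otimes>\<^bsub>?G\<^esub> (twist f2 (emap \<phi> e) \<otimes>\<^bsub>?G\<^esub> (?I (b e) \<otimes>\<^bsub>?G\<^esub> ?I (ehom f1 e j) \<otimes>\<^bsub>?G\<^esub> inv\<^bsub>?G\<^esub> ?I (b e))) \<otimes>\<^bsub>?G\<^esub> ?I (b e)"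
    unfolding twist_phi[OF e] using cl by (simp add: V.m_assoc)
  also have "\<dots> = ?f2 (twist \<phi> e) \<otimes>\<^bsub>?G\<^esub> ?f2 ?i \<otimes>\<^bsub>?G\<^esub> inv\<^bsub>?G\<^esub> ?f2 (twist \<phi> e) \<otimes>\<^bsub>?G\<^esub> (a (tgt \<Lambda>1 e) \<otimes>\<^bsub>?G\<^esub> twist f1 e)"
    unfolding e2[symmetric] twist_phi[OF e] using cl by (simp add: V.m_assoc)
  finally have "?f2 (vhom \<phi> (tgt \<Lambda>1 e) (einj \<Lambda>1 e j)) = ?f2 (twist \<phi> e) \<otimes>\<^bsub>?G\<^esub> ?f2 ?i \<otimes>\<^bsub>?G\<^esub> inv\<^bsub>?G\<^esub> ?f2 (twist \<phi> e)"
    by (rule V.right_cancel[THEN iffD1, rotated -1]) (use cl e j in simp_all)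
  then have "?f2 (vhom \<phi> (tgt \<Lambda>1 e) (einj \<Lambda>1 e j)) = ?f2 (twist \<phi> e \<otimes>\<^bsub>?V2\<^esub> ?i \<otimes>\<^bsub>?V2\<^esub> inv\<^bsub>?V2\<^esub> twist \<phi> e)"
    using e i C2.vhom_mult[of "vmap \<phi> (tgt \<Lambda>1 e)"] C2.vhom_inv[of "vmap \<phi> (tgt \<Lambda>1 e)"] by simp
  then have "vhom \<phi> (tgt \<Lambda>1 e) (einj \<Lambda>1 e j) = twist \<phi> e \<otimes>\<^bsub>?V2\<^esub> ?i \<otimes>\<^bsub>?V2\<^esub> inv\<^bsub>?V2\<^esub> twist \<phi> e"
    by (rule vhom2_eq[rotated 3]) (use e j i in simp_all)
  then show "vhom \<phi> (tgt \<Lambda>1 e) (einj \<Lambda>1 e j) = twist \<phi> e \<otimes>\<^bsub>vgroup \<Lambda>2 (tgt \<Lambda>2 (emap \<phi> e))\<^esub> ?i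
      \<otimes>\<^bsub>vgroup \<Lambda>2 (tgt \<Lambda>2 (emap \<phi> e))\<^esub> inv\<^bsub>vgroup \<Lambda>2 (tgt \<Lambda>2 (emap \<phi> e))\<^esub> twist \<phi> e" using e by simp
qed

sublocale phi: pointed_morphism \<Lambda>1 \<Lambda>2 \<phi> q1 q2
  by (intro pointed_morphism.intro pointed_morphism_axioms.intro gog_morphism.intro gog_morphism_axioms.intro
      C1.L.gog_axioms C2.L.gog_axioms C1.L.pgog_axioms C2.L.pgog_axioms morphism_phi base_phi)

lemma same_pointed_phi: "same_pointed \<Lambda>1 q1 \<Gamma> (gcompose \<Lambda>1 \<Gamma> f2 \<phi>) f1"
  unfolding same_pointed_def
proof (intro exI conjI ballI allI impI)
  \<comment> \<open>The relation leads from the composite to \<open>f1\<close>, against the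
    direction in which \<open>a\<close> and \<open>b\<close> were chosen; hence the
    inverses.\<close>
  let ?a = "\<lambda>w. inv\<^bsub>vgroup \<Gamma> (vmap f1 w)\<^esub> a w" and ?b = "\<lambda>e. inv\<^bsub>egroup \<Gamma> (emap f1 e)\<^esub> b e"
  let ?f = "gcompose \<Lambda>1 \<Gamma> f2 \<phi>"
  fix w assume w: "w \<in> verts \<Lambda>1"
  interpret V: group "vgroup \<Gamma> (vmap f1 w)" using w by (intro C1.G.vgroup_group) simp
  show "vmap f1 w = vmap ?f w" "?a w \<in> carrier (vgroup \<Gamma> (vmap ?f w))"
    using w by (simp_all add: gcompose_def)
  show "?a w = \<one>\<^bsub>vgroup \<Gamma> (vmap ?f w)\<^esub>" if "q1 = Vertex w"
    using w a_base[OF that] by (simp add: gcompose_def)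
  show "vhom f1 w g = ?a w \<otimes>\<^bsub>vgroup \<Gamma> (vmap ?f w)\<^esub> vhom ?f w g \<otimes>\<^bsub>vgroup \<Gamma> (vmap ?f w)\<^esub> inv\<^bsub>vgroup \<Gamma> (vmap ?f w)\<^esub> ?a w"
    if "g \<in> carrier (vgroup \<Lambda>1 w)" for g
    using w that vhom_phi[OF w that] by (simp add: gcompose_def V.m_assoc)
next
  let ?a = "\<lambda>w. inv\<^bsub>vgroup \<Gamma> (vmap f1 w)\<^esub> a w" and ?b = "\<lambda>e. inv\<^bsub>egroup \<Gamma> (emap f1 e)\<^esub> b e"
  let ?f = "gcompose \<Lambda>1 \<Gamma> f2 \<phi>"
  fix e assume e: "e \<in> edges \<Lambda>1"
  let ?v = "vmap f1 (tgt \<Lambda>1 e)"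
  interpret V: group "vgroup \<Gamma> ?v" using e by (intro C1.G.vgroup_group) simp
  interpret E: group "egroup \<Gamma> (emap f1 e)" using e by (intro C1.G.egroup_group) simp
  show "emap f1 e = emap ?f e" "?b e \<in> carrier (egroup \<Gamma> (emap ?f e))" "?b (bar \<Lambda>1 e) = ?b e"
    using e by (simp_all add: gcompose_def)
  show "?b e = \<one>\<^bsub>egroup \<Gamma> (emap ?f e)\<^esub>" if "q1 = Interior S \<and> (e, t) \<in> S" for S t
    using e b_base[of S e t] that by (simp add: gcompose_def)
  show "ehom f1 e h = ?b e \<otimes>\<^bsub>egroup \<Gamma> (emap ?f e)\<^esub> ehom ?f e h \<otimes>\<^bsub>egroup \<Gamma> (emap ?f e)\<^esub> inv\<^bsub>egroup \<Gamma> (emap ?f e)\<^esub> ?b e"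
    if "h \<in> carrier (egroup \<Lambda>1 e)" for h
    using e that ehom_phi[OF e that] by (simp add: gcompose_def E.m_assoc)
  have "twist f1 e = ?a (tgt \<Lambda>1 e) \<otimes>\<^bsub>vgroup \<Gamma> ?v\<^esub> (a (tgt \<Lambda>1 e) \<otimes>\<^bsub>vgroup \<Gamma> ?v\<^esub> twist f1 e)" using e by simp
  also have "\<dots> = ?a (tgt \<Lambda>1 e) \<otimes>\<^bsub>vgroup \<Gamma> ?v\<^esub> (vhom f2 (vmap \<phi> (tgt \<Lambda>1 e)) (twist \<phi> e) \<otimes>\<^bsub>vgroup \<Gamma> ?v\<^esub> twist f2 (emap \<phi> e))
     \<otimes>\<^bsub>vgroup \<Gamma> ?v\<^esub> einj \<Gamma> (emap f1 e) (b e)"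
    unfolding twist_phi[OF e] using e by (simp add: V.m_assoc)
  finally show "twist f1 e = ?a (tgt \<Lambda>1 e) \<otimes>\<^bsub>vgroup \<Gamma> (tgt \<Gamma> (emap ?f e))\<^esub> twist ?f e
     \<otimes>\<^bsub>vgroup \<Gamma> (tgt \<Gamma> (emap ?f e))\<^esub> einj \<Gamma> (emap ?f e) (inv\<^bsub>egroup \<Gamma> (emap ?f e)\<^esub> ?b e)"
    using e by (simp add: gcompose_def)
qed

text \<open>A coincidence for \<open>\<phi>\<close> is sent by \<open>f2\<close> to one between
  elements of the form occurring for \<open>f1\<close>: the twist equation replaces the twists of
  \<open>\<phi>\<close> and \<open>f2\<close> by that of \<open>f1\<close>, and the common factor
  \<open>a v\<close> cancels.\<close>

lemma phi_locally_inj: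
  assumes v: "v \<in> verts \<Lambda>1"
  shows "phi.locally_inj v"
  unfolding phi.locally_inj_def
proof (intro ballI impI)
  let ?v = "vmap f1 v" and ?V2 = "vgroup \<Lambda>2 (vmap \<phi> v)" and ?f2 = "vhom f2 (vmap \<phi> v)"
  let ?G = "vgroup \<Gamma> ?v"
  interpret V: group ?G using v by (intro C1.G.vgroup_group) simp
  fix e e' l l' k
  assume e: "e \<in> edges \<Lambda>1" "e' \<in> edges \<Lambda>1" and l: "l \<in> carrier (vgroup \<Lambda>1 v)" "l' \<in> carrier (vgroup \<Lambda>1 v)"
    and k: "k \<in> carrier (egroup \<Lambda>2 (emap \<phi> e))" and t: "tgt \<Lambda>1 e = v" "tgt \<Lambda>1 e' = v" and ee: "emap \<phi> e = emap \<phi> e'"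
    and eq: "vhom \<phi> v l \<otimes>\<^bsub>?V2\<^esub> twist \<phi> e \<otimes>\<^bsub>?V2\<^esub> einj \<Lambda>2 (emap \<phi> e) k = vhom \<phi> v l' \<otimes>\<^bsub>?V2\<^esub> twist \<phi> e'"
  have ee1: "emap f1 e' = emap f1 e" using ee e phi_e(2) by metis
  let ?E = "egroup \<Gamma> (emap f1 e)" and ?I = "einj \<Gamma> (emap f1 e)"
  interpret E: group ?E using e by (intro C1.G.egroup_group) simp
  let ?k = "ehom f2 (emap \<phi> e) k"
  have kk: "?k \<in> carrier ?E" "b e \<in> carrier ?E" "b e' \<in> carrier ?E"
    using C2.ehom_in[of "emap \<phi> e" k] e k b_in(1)[OF e(2)] ee1 by simp_all
  have ik: "einj \<Lambda>2 (emap \<phi> e) k \<in> carrier ?V2" using C2.L.einj_in[of "emap \<phi> e" k] e k t by simp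
  have i: "?I x \<in> carrier ?G" if "x \<in> carrier ?E" for x using C1.G.einj_in[of "emap f1 e" x] that e t by simp
  have cl: "vhom f1 v l \<in> carrier ?G" "vhom f1 v l' \<in> carrier ?G" "twist f1 e \<in> carrier ?G" "twist f1 e' \<in> carrier ?G"
    "twist f2 (emap \<phi> e) \<in> carrier ?G" "a v \<in> carrier ?G" "?f2 (twist \<phi> e) \<in> carrier ?G" "?f2 (twist \<phi> e') \<in> carrier ?G"
    "?f2 (vhom \<phi> v l) \<in> carrier ?G" "?f2 (vhom \<phi> v l') \<in> carrier ?G" "?f2 (einj \<Lambda>2 (emap \<phi> e) k) \<in> carrier ?G"
    using v l e t ik C1.twist_in[OF e(1)] C1.twist_in[OF e(2)] twist2_in[OF e(1)] twist_phi_in[OF e(1)] twist_phi_in[OF e(2)]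
    by auto
  have tw: "twist \<phi> e \<in> carrier ?V2" "twist \<phi> e' \<in> carrier ?V2" using twist_phi_in[OF e(1)] twist_phi_in[OF e(2)] t by auto
  interpret V2: group ?V2 using v by (intro C2.L.vgroup_group) simp
  have "?f2 (vhom \<phi> v l) \<otimes>\<^bsub>?G\<^esub> ?f2 (twist \<phi> e) \<otimes>\<^bsub>?G\<^esub> ?f2 (einj \<Lambda>2 (emap \<phi> e) k) = ?f2 (vhom \<phi> v l') \<otimes>\<^bsub>?G\<^esub> ?f2 (twist \<phi> e')"
    using arg_cong[OF eq, of ?f2] C2.vhom_mult[of "vmap \<phi> v"] v l tw ik by simp
  then have 1: "?f2 (vhom \<phi> v l) \<otimes>\<^bsub>?G\<^esub> ?f2 (twist \<phi> e) \<otimes>\<^bsub>?G\<^esub> (?f2 (einj \<Lambda>2 (emap \<phi> e) k) \<otimes>\<^bsub>?G\<^esub> twist f2 (emap \<phi> e))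
    = ?f2 (vhom \<phi> v l') \<otimes>\<^bsub>?G\<^esub> ?f2 (twist \<phi> e') \<otimes>\<^bsub>?G\<^esub> twist f2 (emap \<phi> e)"
    using cl by (simp flip: V.m_assoc)
  have 2: "?f2 (einj \<Lambda>2 (emap \<phi> e) k) \<otimes>\<^bsub>?G\<^esub> twist f2 (emap \<phi> e) = twist f2 (emap \<phi> e) \<otimes>\<^bsub>?G\<^esub> ?I ?k"
    using C2.vhom_einj[of "emap \<phi> e" k] e k t v by simp
  have tws: "?f2 (twist \<phi> d) \<otimes>\<^bsub>?G\<^esub> twist f2 (emap \<phi> d) = a v \<otimes>\<^bsub>?G\<^esub> twist f1 d \<otimes>\<^bsub>?G\<^esub> inv\<^bsub>?G\<^esub> einj \<Gamma> (emap f1 d) (b d)"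
    if "d \<in> edges \<Lambda>1" "tgt \<Lambda>1 d = v" for d
    using twist_phi[OF that(1)] that v twist2_in[OF that(1)] twist_phi_in[OF that(1)] vhom2_in[OF v, of "twist \<phi> d"]
      C1.einj_ehom_in(1)[OF that(1), of "b d"] by (simp add: V.m_assoc)
  have "a v \<otimes>\<^bsub>?G\<^esub> (vhom f1 v l \<otimes>\<^bsub>?G\<^esub> twist f1 e \<otimes>\<^bsub>?G\<^esub> inv\<^bsub>?G\<^esub> ?I (b e) \<otimes>\<^bsub>?G\<^esub> ?I ?k)
      = ?f2 (vhom \<phi> v l) \<otimes>\<^bsub>?G\<^esub> (?f2 (twist \<phi> e) \<otimes>\<^bsub>?G\<^esub> twist f2 (emap \<phi> e)) \<otimes>\<^bsub>?G\<^esub> ?I ?k"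
    unfolding tws[OF e(1) t(1)] vhom_phi[OF v l(1)] using cl i kk by (simp add: V.m_assoc)
  also have "\<dots> = ?f2 (vhom \<phi> v l') \<otimes>\<^bsub>?G\<^esub> (?f2 (twist \<phi> e') \<otimes>\<^bsub>?G\<^esub> twist f2 (emap \<phi> e))"
    using 1[unfolded 2] cl i kk by (simp add: V.m_assoc)
  also have "\<dots> = a v \<otimes>\<^bsub>?G\<^esub> (vhom f1 v l' \<otimes>\<^bsub>?G\<^esub> twist f1 e' \<otimes>\<^bsub>?G\<^esub> inv\<^bsub>?G\<^esub> ?I (b e'))"
    unfolding ee tws[OF e(2) t(2)] vhom_phi[OF v l(2)] ee1 using cl i kk ee1 by (simp add: V.m_assoc)
  finally have 3: "vhom f1 v l \<otimes>\<^bsub>?G\<^esub> twist f1 e \<otimes>\<^bsub>?G\<^esub> inv\<^bsub>?G\<^esub> ?I (b e) \<otimes>\<^bsub>?G\<^esub> ?I ?k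
      = vhom f1 v l' \<otimes>\<^bsub>?G\<^esub> twist f1 e' \<otimes>\<^bsub>?G\<^esub> inv\<^bsub>?G\<^esub> ?I (b e')" using cl i kk by simp
  \<comment> \<open>The edge group element left over after the corrections \<open>b e\<close> and
    \<open>b e'\<close> at the two edges are collected on one side.\<close>
  let ?m = "inv\<^bsub>?E\<^esub> b e \<otimes>\<^bsub>?E\<^esub> ?k \<otimes>\<^bsub>?E\<^esub> b e'"
  have Im: "?I ?m = inv\<^bsub>?G\<^esub> ?I (b e) \<otimes>\<^bsub>?G\<^esub> ?I ?k \<otimes>\<^bsub>?G\<^esub> ?I (b e')"
    using C1.G.einj_mult[of "emap f1 e" "inv\<^bsub>?E\<^esub> b e \<otimes>\<^bsub>?E\<^esub> ?k" "b e'"] C1.G.einj_mult[of "emap f1 e" "inv\<^bsub>?E\<^esub> b e" ?k]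
      C1.G.einj_inv[of "emap f1 e" "b e"] e kk t by simp
  have "vhom f1 v l \<otimes>\<^bsub>?G\<^esub> twist f1 e \<otimes>\<^bsub>?G\<^esub> ?I ?m
     = vhom f1 v l \<otimes>\<^bsub>?G\<^esub> twist f1 e \<otimes>\<^bsub>?G\<^esub> inv\<^bsub>?G\<^esub> ?I (b e) \<otimes>\<^bsub>?G\<^esub> ?I ?k \<otimes>\<^bsub>?G\<^esub> ?I (b e')"
    unfolding Im using cl i kk by (simp add: V.m_assoc)
  also have "\<dots> = vhom f1 v l' \<otimes>\<^bsub>?G\<^esub> twist f1 e'" unfolding 3 using cl i kk by (simp add: V.m_assoc)
  finally have "vhom f1 v l \<otimes>\<^bsub>?G\<^esub> twist f1 e \<otimes>\<^bsub>?G\<^esub> ?I ?m = vhom f1 v l' \<otimes>\<^bsub>?G\<^esub> twist f1 e'" .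
  moreover have "?m \<in> carrier ?E" using kk by simp
  ultimately have "e = e' \<and> (\<exists>j\<in>carrier (egroup \<Lambda>1 e). l \<otimes>\<^bsub>vgroup \<Lambda>1 v\<^esub> einj \<Lambda>1 e j = l')"
    using C1.locally(1)[OF v, unfolded C1.locally_inj_def, rule_format, OF e l _ t ee1[symmetric]] by blast
  then show "e = e' \<and> (\<exists>j\<in>carrier (egroup \<Lambda>1 e). l \<otimes>\<^bsub>vgroup \<Lambda>1 v\<^esub> einj \<Lambda>1 e j = l')" .
qed

text \<open>The element is pushed down by \<open>f2\<close> and corrected by \<open>a v\<close>;
  surjectivity of \<open>f1\<close> on stars gives an edge and elements in
  \<open>\<Lambda>1\<close>. Their images under \<open>\<phi>\<close> have the right image in
  \<open>\<Gamma>\<close>, and injectivity of \<open>f2\<close> on stars identifies them with the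
  given element.\<close>

lemma phi_locally_surj:
  assumes v: "v \<in> verts \<Lambda>1"
  shows "phi.locally_surj v"
  unfolding phi.locally_surj_def
proof (intro ballI impI)
  let ?v = "vmap f1 v" and ?V2 = "vgroup \<Lambda>2 (vmap \<phi> v)" and ?f2 = "vhom f2 (vmap \<phi> v)"
  let ?G = "vgroup \<Gamma> ?v"
  interpret V: group ?G using v by (intro C1.G.vgroup_group) simp
  interpret V2: group ?V2 using v by (intro C2.L.vgroup_group) simp
  fix e2 g assume e2: "e2 \<in> edges \<Lambda>2" and g: "g \<in> carrier ?V2" and t: "tgt \<Lambda>2 e2 = vmap \<phi> v"
  have t2: "tgt \<Gamma> (emap f2 e2) = ?v" using e2 t v by simp
  have cl2: "twist f2 e2 \<in> carrier ?G" "?f2 g \<in> carrier ?G" "a v \<in> carrier ?G" using C2.twist_in[OF e2] t v g by auto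
  have "inv\<^bsub>?G\<^esub> a v \<otimes>\<^bsub>?G\<^esub> (?f2 g \<otimes>\<^bsub>?G\<^esub> twist f2 e2) \<in> carrier ?G" using cl2 by simp
  from C1.locally(2)[OF v, unfolded C1.locally_surj_def, rule_format, OF C2.emap_in[OF e2] this t2]
  obtain e l k where e: "e \<in> edges \<Lambda>1" "l \<in> carrier (vgroup \<Lambda>1 v)" "k \<in> carrier (egroup \<Gamma> (emap f2 e2))"
    "tgt \<Lambda>1 e = v" "emap f1 e = emap f2 e2"
    "inv\<^bsub>?G\<^esub> a v \<otimes>\<^bsub>?G\<^esub> (?f2 g \<otimes>\<^bsub>?G\<^esub> twist f2 e2) = vhom f1 v l \<otimes>\<^bsub>?G\<^esub> twist f1 e \<otimes>\<^bsub>?G\<^esub> einj \<Gamma> (emap f2 e2) k" by blast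
  let ?E = "egroup \<Gamma> (emap f1 e)" and ?I = "einj \<Gamma> (emap f1 e)"
  have k: "k \<in> carrier ?E" "b e \<in> carrier ?E" using e(3) e(5)[symmetric] b_in(1)[OF e(1)] by simp_all
  have i: "?I x \<in> carrier ?G" if "x \<in> carrier ?E" for x using C1.G.einj_in[of "emap f1 e" x] that e(1,4) by simp
  have cl: "vhom f1 v l \<in> carrier ?G" "twist f1 e \<in> carrier ?G" "?f2 (vhom \<phi> v l) \<in> carrier ?G" "?f2 (twist \<phi> e) \<in> carrier ?G"
    "twist f2 (emap \<phi> e) \<in> carrier ?G"
    using v e(1,2,4) C1.twist_in[OF e(1)] twist_phi_in[OF e(1)] twist2_in[OF e(1)] by auto
  have tw: "twist \<phi> e \<in> carrier ?V2" using twist_phi_in[OF e(1)] e(4) by simp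
  have "?f2 g \<otimes>\<^bsub>?G\<^esub> twist f2 e2 = a v \<otimes>\<^bsub>?G\<^esub> (inv\<^bsub>?G\<^esub> a v \<otimes>\<^bsub>?G\<^esub> (?f2 g \<otimes>\<^bsub>?G\<^esub> twist f2 e2))" using cl2 by simp
  also have "\<dots> = a v \<otimes>\<^bsub>?G\<^esub> (vhom f1 v l \<otimes>\<^bsub>?G\<^esub> twist f1 e \<otimes>\<^bsub>?G\<^esub> ?I k)" unfolding e(6) e(5) ..
  also have "\<dots> = ?f2 (vhom \<phi> v l) \<otimes>\<^bsub>?G\<^esub> (a v \<otimes>\<^bsub>?G\<^esub> twist f1 e) \<otimes>\<^bsub>?G\<^esub> ?I k"
    unfolding vhom_phi[OF v e(2)] using cl cl2 i k by (simp add: V.m_assoc)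
  also have "a v \<otimes>\<^bsub>?G\<^esub> twist f1 e = ?f2 (twist \<phi> e) \<otimes>\<^bsub>?G\<^esub> (twist f2 (emap \<phi> e) \<otimes>\<^bsub>?G\<^esub> ?I (b e))"
    using twist_phi[OF e(1)] e(4) by simp
  also have "?f2 (vhom \<phi> v l) \<otimes>\<^bsub>?G\<^esub> \<dots> \<otimes>\<^bsub>?G\<^esub> ?I k
     = ?f2 (vhom \<phi> v l \<otimes>\<^bsub>?V2\<^esub> twist \<phi> e) \<otimes>\<^bsub>?G\<^esub> twist f2 (emap \<phi> e) \<otimes>\<^bsub>?G\<^esub> ?I (b e \<otimes>\<^bsub>?E\<^esub> k)"
    using C1.G.einj_mult[of "emap f1 e" "b e" k] C2.vhom_mult[of "vmap \<phi> v" "vhom \<phi> v l" "twist \<phi> e"] v e(1,2,4) tw cl i k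
    by (simp add: V.m_assoc)
  finally have eq: "?f2 (vhom \<phi> v l \<otimes>\<^bsub>?V2\<^esub> twist \<phi> e) \<otimes>\<^bsub>?G\<^esub> twist f2 (emap \<phi> e) \<otimes>\<^bsub>?G\<^esub> ?I (b e \<otimes>\<^bsub>?E\<^esub> k)
    = ?f2 g \<otimes>\<^bsub>?G\<^esub> twist f2 e2" ..
  have "emap \<phi> e = e2 \<and> (\<exists>j\<in>carrier (egroup \<Lambda>2 (emap \<phi> e)).
      (vhom \<phi> v l \<otimes>\<^bsub>?V2\<^esub> twist \<phi> e) \<otimes>\<^bsub>?V2\<^esub> einj \<Lambda>2 (emap \<phi> e) j = g)"
    by (rule C2.locally(1)[of "vmap \<phi> v", unfolded C2.locally_inj_def, rule_format, where k = "b e \<otimes>\<^bsub>?E\<^esub> k"])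
      (use eq e(1,2,4) e(5)[symmetric] e2 v g t tw k in simp_all)
  then show "\<exists>e\<in>edges \<Lambda>1. \<exists>l\<in>carrier (vgroup \<Lambda>1 v). \<exists>k\<in>carrier (egroup \<Lambda>2 e2). tgt \<Lambda>1 e = v \<and> emap \<phi> e = e2 \<and>
      g = vhom \<phi> v l \<otimes>\<^bsub>?V2\<^esub> twist \<phi> e \<otimes>\<^bsub>?V2\<^esub> einj \<Lambda>2 e2 k"
    using e(1,2,4) by blast
qed

text \<open>The representative of \<open>w2\<close> lies in the double coset of \<open>H1\<close>
  belonging to some \<open>w1\<close>; modulo \<open>H2\<close> this is the double coset assigned to
  \<open>w1\<close>, and it already has \<open>w2\<close> as its vertex.\<close>

lemma vmap_phi_surj: "vmap \<phi> ` verts \<Lambda>1 = verts \<Lambda>2"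
proof
  show "verts \<Lambda>2 \<subseteq> vmap \<phi> ` verts \<Lambda>1"
  proof
    fix w2 assume w2: "w2 \<in> verts \<Lambda>2"
    let ?v = "vmap f2 w2"
    interpret V: group "vgroup \<Gamma> ?v" using w2 by (intro C1.G.vgroup_group) simp
    obtain w1 g where w1: "w1 \<in> verts \<Lambda>1" "g \<in> carrier (vgroup \<Gamma> ?v)" "vmap f1 w1 = ?v"
      "hcoset \<Gamma> p H1 ?v (cv2 w2) = hcoset \<Gamma> p H1 ?v (C1.G.R ?v (cv1 w1) g)"
      using C1.cv_hcoset_ex[OF C2.cv_in[OF w2]] by blast
    have P: "cv1 w1 \<in> C1.G.P ?v" "cv2 (vmap \<phi> w1) \<in> C1.G.P ?v" "a w1 \<in> carrier (vgroup \<Gamma> ?v)"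
      using C1.cv_in[OF w1(1)] cv2_in[OF w1(1)] a_in[OF w1(1)] w1(3) by auto
    have "K ?v (C1.G.R ?v (cv2 w2) \<one>\<^bsub>vgroup \<Gamma> ?v\<^esub>) = K ?v (C1.G.R ?v (cv1 w1) g)"
      using H1_hcoset[OF w1(4)] w1 P C2.cv_in[OF w2] by simp
    also have "\<dots> = K ?v (C1.G.R ?v (C1.G.R ?v (cv2 (vmap \<phi> w1)) (a w1)) g)"
      by (rule C2.G.hcoset_ract) (use cv_phi[OF w1(1)] w1 P in auto)
    also have "\<dots> = K ?v (C1.G.R ?v (cv2 (vmap \<phi> w1)) (a w1 \<otimes>\<^bsub>vgroup \<Gamma> ?v\<^esub> g))" using P w1 by (simp add: C1.G.ract_mult)
    finally have "vmap \<phi> w1 = w2"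
      using C2.cv_hcoset[OF w2, of "vmap \<phi> w1" "\<one>\<^bsub>vgroup \<Gamma> ?v\<^esub>" "a w1 \<otimes>\<^bsub>vgroup \<Gamma> ?v\<^esub> g"] w1 P by simp
    then show "w2 \<in> vmap \<phi> ` verts \<Lambda>1" using w1(1) by blast
  qed
qed auto

text \<open>The terminal vertex of a given edge is hit, and there the edge is found in the image of
  the star.\<close>

lemma emap_phi_surj: "emap \<phi> ` edges \<Lambda>1 = edges \<Lambda>2"
proof
  show "edges \<Lambda>2 \<subseteq> emap \<phi> ` edges \<Lambda>1"
  proof
    fix e2 assume e2: "e2 \<in> edges \<Lambda>2"
    then obtain w1 where w1: "w1 \<in> verts \<Lambda>1" "vmap \<phi> w1 = tgt \<Lambda>2 e2"
      using vmap_phi_surj C2.L.tgt_in[OF e2] by (metis imageE)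
    from phi_locally_surj[OF w1(1), unfolded phi.locally_surj_def, rule_format, OF e2 _ w1(2)[symmetric]]
    show "e2 \<in> emap \<phi> ` edges \<Lambda>1" using C2.L.vone_in w1 phi_v(1) by blast
  qed
qed auto

lemma pointed_covering_phi: "pointed_covering \<Lambda>1 q1 \<Lambda>2 q2 \<phi>"
proof -
  have "covering \<Lambda>1 \<Lambda>2 \<phi>"
    unfolding covering_def
  proof (intro conjI ballI)
    show "vhom \<phi> v \<in> mon (vgroup \<Lambda>1 v) (vgroup \<Lambda>2 (vmap \<phi> v))" if v: "v \<in> verts \<Lambda>1" for v
    proof -
      interpret V: group "vgroup \<Gamma> (vmap f1 v)" using v by (intro C1.G.vgroup_group) simp
      have "inj_on (vhom \<phi> v) (carrier (vgroup \<Lambda>1 v))"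
      proof (rule inj_onI)
        fix x y assume xy: "x \<in> carrier (vgroup \<Lambda>1 v)" "y \<in> carrier (vgroup \<Lambda>1 v)" "vhom \<phi> v x = vhom \<phi> v y"
        then have "vhom f1 v x = vhom f1 v y" using vhom_phi[OF v, of x] vhom_phi[OF v, of y] v by simp
        then show "x = y" using inj_onD[OF C1.vhom_inj_on[OF v]] xy by blast
      qed
      then show ?thesis using phi.vhom_hom[OF v] by (simp add: mon_def)
    qed
    show "ehom \<phi> e \<in> mon (egroup \<Lambda>1 e) (egroup \<Lambda>2 (emap \<phi> e))" if e: "e \<in> edges \<Lambda>1" for e
    proof -
      interpret E: group "egroup \<Gamma> (emap f1 e)" using e by (intro C1.G.egroup_group) simp
      have "inj_on (ehom \<phi> e) (carrier (egroup \<Lambda>1 e))"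
      proof (rule inj_onI)
        fix x y assume xy: "x \<in> carrier (egroup \<Lambda>1 e)" "y \<in> carrier (egroup \<Lambda>1 e)" "ehom \<phi> e x = ehom \<phi> e y"
        then have "ehom f1 e x = ehom f1 e y" using ehom_phi[OF e, of x] ehom_phi[OF e, of y] e by simp
        then show "x = y" using inj_onD[OF C1.ehom_inj_on[OF e]] xy by blast
      qed
      then show ?thesis using phi.ehom_hom[OF e] by (simp add: mon_def)
    qed
    show "bij_betw (star_map \<Lambda>2 \<phi> v) (star \<Lambda>1 v) (star \<Lambda>2 (vmap \<phi> v))" if "v \<in> verts \<Lambda>1" for v
      using phi.star_bij_iff[OF that] phi_locally_inj[OF that] phi_locally_surj[OF that] by simp
  qed (rule morphism_phi vmap_phi_surj emap_phi_surj)+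
  then show ?thesis
    using C1.L.gog C2.L.gog C1.L.p_in base_phi by (simp add: pointed_covering_def)
qed

text \<open>When the subgroups agree, an equation modulo \<open>H2\<close> can be read back in the
  first chart. So two places with the same image lie in one double coset of the first chart, and
  every element of a local group of \<open>\<Lambda>2\<close>, conjugated back by \<open>a\<close>
  or \<open>b\<close>, stabilises a representative there.\<close>

lemma isomorphism_phi:
  assumes H: "H1 = H2"
  shows "isomorphism \<Lambda>1 \<Lambda>2 \<phi>"
  unfolding isomorphism_def
proof (intro conjI ballI)
  show "morphism \<Lambda>1 \<Lambda>2 \<phi>" by (rule morphism_phi)
  have "inj_on (vmap \<phi>) (verts \<Lambda>1)"
  proof (rule inj_onI)
    fix w w' assume w: "w \<in> verts \<Lambda>1" "w' \<in> verts \<Lambda>1" "vmap \<phi> w = vmap \<phi> w'"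
    let ?v = "vmap f1 w"
    interpret V: group "vgroup \<Gamma> ?v" using w by (intro C1.G.vgroup_group) simp
    have v: "vmap f1 w' = ?v" using w phi_v(2) by metis
    have P: "cv1 w' \<in> C1.G.P ?v" "cv2 (vmap \<phi> w) \<in> C1.G.P ?v" "a w' \<in> carrier (vgroup \<Gamma> ?v)" "cv1 w \<in> C1.G.P ?v"
      using C1.cv_in[OF w(2)] cv2_in[OF w(1)] a_in[OF w(2)] C1.cv_in[OF w(1)] v by auto
    have "K ?v (C1.G.R ?v (cv1 w) (inv\<^bsub>vgroup \<Gamma> ?v\<^esub> a w)) = K ?v (cv2 (vmap \<phi> w))"
      using C2.G.hcoset_ract[OF cv_phi[OF w(1)], of "inv\<^bsub>vgroup \<Gamma> ?v\<^esub> a w"] P w by simp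
    also have "\<dots> = K ?v (C1.G.R ?v (cv1 w') (inv\<^bsub>vgroup \<Gamma> ?v\<^esub> a w'))"
      using C2.G.hcoset_ract[OF cv_phi[OF w(2)], of "inv\<^bsub>vgroup \<Gamma> ?v\<^esub> a w'"] P w v by simp
    finally have eq: "K ?v (C1.G.R ?v (cv1 w) (inv\<^bsub>vgroup \<Gamma> ?v\<^esub> a w)) = K ?v (C1.G.R ?v (cv1 w') (inv\<^bsub>vgroup \<Gamma> ?v\<^esub> a w'))" .
    have "w' = w" using C1.cv_hcoset[OF w(1,2) v _ _ eq[folded H]] P w(1) by simp
    then show "w = w'" ..
  qed
  then show "bij_betw (vmap \<phi>) (verts \<Lambda>1) (verts \<Lambda>2)" using vmap_phi_surj by (simp add: bij_betw_def)
  have "inj_on (emap \<phi>) (edges \<Lambda>1)"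
  proof (rule inj_onI)
    fix e e' assume e: "e \<in> edges \<Lambda>1" "e' \<in> edges \<Lambda>1" "emap \<phi> e = emap \<phi> e'"
    let ?v = "vmap f1 (src \<Lambda>1 e)" and ?E = "egroup \<Gamma> (emap f1 e)" and ?I = "einj \<Gamma> (bar \<Gamma> (emap f1 e))"
    interpret E: group ?E using e by (intro C1.G.egroup_group) simp
    have ee: "emap f1 e' = emap f1 e" using e phi_e(2) by metis
    have v: "vmap f1 (src \<Lambda>1 e') = ?v" using C1.src_emap e ee by metis
    have b: "b e \<in> carrier ?E" "b e' \<in> carrier ?E" using b_in(1)[OF e(1)] b_in(1)[OF e(2)] ee by auto
    have i: "?I x \<in> carrier (vgroup \<Gamma> ?v)" if "x \<in> carrier ?E" for x using e that by simp
    have ii: "?I (inv\<^bsub>?E\<^esub> x) = inv\<^bsub>vgroup \<Gamma> ?v\<^esub> ?I x" if "x \<in> carrier ?E" for x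
      using C1.G.einj_inv[of "bar \<Gamma> (emap f1 e)" x] e that by simp
    have P: "ce1 e' \<in> C1.G.P ?v" "ce2 (emap \<phi> e) \<in> C1.G.P ?v" "ce1 e \<in> C1.G.P ?v"
      using C1.ce_in[OF e(2)] ce2_in[OF e(1)] C1.ce_in[OF e(1)] v by auto
    have "K ?v (C1.G.R ?v (ce1 e) (?I (inv\<^bsub>?E\<^esub> b e))) = K ?v (ce2 (emap \<phi> e))"
      using C2.G.hcoset_ract[OF ce_phi[OF e(1)], of "?I (inv\<^bsub>?E\<^esub> b e)"] P i b ii e(1) by simp
    also have "\<dots> = K ?v (C1.G.R ?v (ce1 e') (?I (inv\<^bsub>?E\<^esub> b e')))"
      using C2.G.hcoset_ract[OF ce_phi[OF e(2)], of "?I (inv\<^bsub>?E\<^esub> b e')"] P i b ii v ee e(1) e(3)[symmetric] by simp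
    finally have eq: "K ?v (C1.G.R ?v (ce1 e) (?I (inv\<^bsub>?E\<^esub> b e))) = K ?v (C1.G.R ?v (ce1 e') (?I (inv\<^bsub>?E\<^esub> b e')))" .
    have "e' = e" using C1.ce_hcoset[OF e(1,2) ee _ _ eq[folded H]] b by simp
    then show "e = e'" ..
  qed
  then show "bij_betw (emap \<phi>) (edges \<Lambda>1) (edges \<Lambda>2)" using emap_phi_surj by (simp add: bij_betw_def)
  have mon: "\<And>v. v \<in> verts \<Lambda>1 \<Longrightarrow> vhom \<phi> v \<in> mon (vgroup \<Lambda>1 v) (vgroup \<Lambda>2 (vmap \<phi> v))"
    "\<And>e. e \<in> edges \<Lambda>1 \<Longrightarrow> ehom \<phi> e \<in> mon (egroup \<Lambda>1 e) (egroup \<Lambda>2 (emap \<phi> e))"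
    using pointed_covering_phi by (auto simp: pointed_covering_def covering_def)
  show "vhom \<phi> w \<in> iso (vgroup \<Lambda>1 w) (vgroup \<Lambda>2 (vmap \<phi> w))" if w: "w \<in> verts \<Lambda>1" for w
  proof -
    let ?v = "vmap f1 w" and ?f2 = "vhom f2 (vmap \<phi> w)"
    let ?G = "vgroup \<Gamma> ?v"
    interpret V: group ?G using w by (intro C1.G.vgroup_group) simp
    have P: "cv2 (vmap \<phi> w) \<in> C1.G.P ?v" "cv1 w \<in> C1.G.P ?v" using w by auto
    have "\<exists>l\<in>carrier (vgroup \<Lambda>1 w). vhom \<phi> w l = l2" if l2: "l2 \<in> carrier (vgroup \<Lambda>2 (vmap \<phi> w))" for l2
    proof -
      have cl: "?f2 l2 \<in> carrier ?G" "a w \<in> carrier ?G" using w l2 by auto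
      have "K ?v (C1.G.R ?v (cv1 w) (inv\<^bsub>?G\<^esub> a w \<otimes>\<^bsub>?G\<^esub> (?f2 l2 \<otimes>\<^bsub>?G\<^esub> a w))) = K ?v (C1.G.R ?v (C1.G.R ?v (cv2 (vmap \<phi> w)) (?f2 l2)) (a w))"
        using C2.G.hcoset_ract[OF cv_phi[OF w], of "inv\<^bsub>?G\<^esub> a w \<otimes>\<^bsub>?G\<^esub> (?f2 l2 \<otimes>\<^bsub>?G\<^esub> a w)"] P cl by (simp flip: C1.G.ract_mult)
      also have "\<dots> = K ?v (C1.G.R ?v (cv2 (vmap \<phi> w)) (a w))"
        by (rule C2.G.hcoset_ract) (use C2.cv_vhom_hcoset[of "vmap \<phi> w" l2] w l2 P cl in auto)
      also have "\<dots> = K ?v (C1.G.R ?v (cv1 w) \<one>\<^bsub>?G\<^esub>)" using cv_phi[OF w] P by simp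
      finally have eq: "K ?v (C1.G.R ?v (cv1 w) (inv\<^bsub>?G\<^esub> a w \<otimes>\<^bsub>?G\<^esub> (?f2 l2 \<otimes>\<^bsub>?G\<^esub> a w))) = K ?v (C1.G.R ?v (cv1 w) \<one>\<^bsub>?G\<^esub>)" .
      have "\<exists>l\<in>carrier (vgroup \<Lambda>1 w). inv\<^bsub>?G\<^esub> a w \<otimes>\<^bsub>?G\<^esub> (?f2 l2 \<otimes>\<^bsub>?G\<^esub> a w) = vhom f1 w l \<otimes>\<^bsub>?G\<^esub> \<one>\<^bsub>?G\<^esub>"
        using C1.cv_hcoset[OF w w HOL.refl _ _ eq[folded H]] cl by simp
      then obtain l where l: "l \<in> carrier (vgroup \<Lambda>1 w)" "inv\<^bsub>?G\<^esub> a w \<otimes>\<^bsub>?G\<^esub> (?f2 l2 \<otimes>\<^bsub>?G\<^esub> a w) = vhom f1 w l" using w by auto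
      have "?f2 (vhom \<phi> w l) = ?f2 l2" unfolding vhom_phi[OF w l(1)] l(2)[symmetric] using cl by (simp add: V.m_assoc)
      then show ?thesis using vhom2_eq[OF w _ l2, of "vhom \<phi> w l"] w l(1) by auto
    qed
    then show ?thesis using mon(1)[OF w] unfolding mon_def iso_def bij_betw_def hom_def by blast
  qed
  show "ehom \<phi> e \<in> iso (egroup \<Lambda>1 e) (egroup \<Lambda>2 (emap \<phi> e))" if e: "e \<in> edges \<Lambda>1" for e
  proof -
    let ?v = "vmap f1 (src \<Lambda>1 e)" and ?f2 = "ehom f2 (emap \<phi> e)"
    let ?G = "vgroup \<Gamma> ?v" and ?E = "egroup \<Gamma> (emap f1 e)" and ?I = "einj \<Gamma> (bar \<Gamma> (emap f1 e))"
    interpret V: group ?G using e by (intro C1.G.vgroup_group) simp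
    interpret E: group ?E using e by (intro C1.G.egroup_group) simp
    have P: "ce2 (emap \<phi> e) \<in> C1.G.P ?v" "ce1 e \<in> C1.G.P ?v" using e by auto
    have "\<exists>j\<in>carrier (egroup \<Lambda>1 e). ehom \<phi> e j = j2" if j2: "j2 \<in> carrier (egroup \<Lambda>2 (emap \<phi> e))" for j2
    proof -
      have cl: "?f2 j2 \<in> carrier ?E" "b e \<in> carrier ?E" using C2.ehom_in[of "emap \<phi> e" j2] e j2 by auto
      let ?m = "inv\<^bsub>?E\<^esub> b e \<otimes>\<^bsub>?E\<^esub> (?f2 j2 \<otimes>\<^bsub>?E\<^esub> b e)"
      have m: "?m \<in> carrier ?E" using cl by simp
      have i: "?I (?f2 j2) \<in> carrier ?G" "?I (b e) \<in> carrier ?G" "?I ?m \<in> carrier ?G" using e cl m by auto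
      have Im: "?I (b e) \<otimes>\<^bsub>?G\<^esub> ?I ?m = ?I (?f2 j2) \<otimes>\<^bsub>?G\<^esub> ?I (b e)"
        using C1.G.einj_bar_mult[of "emap f1 e" "b e" ?m] C1.G.einj_bar_mult[of "emap f1 e" "?f2 j2" "b e"] e cl m by simp
      have "K ?v (C1.G.R ?v (ce1 e) (?I ?m)) = K ?v (C1.G.R ?v (C1.G.R ?v (ce2 (emap \<phi> e)) (?I (?f2 j2))) (?I (b e)))"
        using C2.G.hcoset_ract[OF ce_phi[OF e], of "?I ?m"] P i Im by (simp flip: C1.G.ract_mult)
      also have "\<dots> = K ?v (C1.G.R ?v (ce2 (emap \<phi> e)) (?I (b e)))"
        by (rule C2.G.hcoset_ract) (use C2.ce_ehom_hcoset[of "emap \<phi> e" j2] src_phi[OF e] e j2 P i in auto)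
      also have "\<dots> = K ?v (C1.G.R ?v (ce1 e) (?I \<one>\<^bsub>?E\<^esub>))" using ce_phi[OF e] P e by simp
      finally have eq: "K ?v (C1.G.R ?v (ce1 e) (?I ?m)) = K ?v (C1.G.R ?v (ce1 e) (?I \<one>\<^bsub>?E\<^esub>))" .
      have "\<exists>j\<in>carrier (egroup \<Lambda>1 e). ?m = ehom f1 e j \<otimes>\<^bsub>?E\<^esub> \<one>\<^bsub>?E\<^esub>"
        using C1.ce_hcoset[OF e e HOL.refl m _ eq[folded H]] e by simp
      then obtain j where j: "j \<in> carrier (egroup \<Lambda>1 e)" "?m = ehom f1 e j" using e by auto
      have "?f2 (ehom \<phi> e j) = ?f2 j2" unfolding ehom_phi[OF e j(1)] j(2)[symmetric] using cl by (simp add: E.m_assoc)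
      then show ?thesis using ehom2_eq[OF e _ j2, of "ehom \<phi> e j"] e j(1) by auto
    qed
    then show ?thesis using mon(2)[OF e] unfolding mon_def iso_def bij_betw_def hom_def by blast
  qed
qed

end

section \<open>Existence of comparisons\<close>

lemma (in pgog) ract_solve:
  assumes "R v A g = R v B g'" "A \<in> P v" "B \<in> P v" "g \<in> carrier (vgroup \<Gamma> v)" "g' \<in> carrier (vgroup \<Gamma> v)"
  shows "A = R v B (g' \<otimes>\<^bsub>vgroup \<Gamma> v\<^esub> inv\<^bsub>vgroup \<Gamma> v\<^esub> g)"
proof -
  have v: "v \<in> verts \<Gamma>" using assms vpaths_vert by blast
  have "A = R v (R v A g) (inv\<^bsub>vgroup \<Gamma> v\<^esub> g)" using assms(2,4) by simp
  also have "\<dots> = R v B (g' \<otimes>\<^bsub>vgroup \<Gamma> v\<^esub> inv\<^bsub>vgroup \<Gamma> v\<^esub> g)"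
    unfolding assms(1) using assms v by (simp add: ract_mult)
  finally show ?thesis .
qed

lemma (in gog) interior_pointD:
  assumes "x \<in> points \<Gamma>" "x = Interior S" "(e, t) \<in> S"
  shows "e \<in> edges \<Gamma>" "0 < t" "t < 1" "x = edge_point \<Gamma> e t"
proof -
  have "e \<in> edges \<Gamma> \<and> 0 < t \<and> t < 1 \<and> x = edge_point \<Gamma> e t"
    using assms(1)
  proof (cases rule: pointsE)
    case (Edge e0 t0)
    then have S: "S = {(e0, t0), (bar \<Gamma> e0, 1 - t0)}" using assms(2) by (simp add: edge_point_def)
    then have "(e, t) = (e0, t0) \<or> (e, t) = (bar \<Gamma> e0, 1 - t0)" using assms(3) by blast
    then show ?thesis using Edge by auto
  qed (use assms in auto)
  then show "e \<in> edges \<Gamma>" "0 < t" "t < 1" "x = edge_point \<Gamma> e t" by blast+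
qed

text \<open>The places, \<open>a\<close> and \<open>b\<close> are chosen from the statement that
  every class lies in some double coset of \<open>H2\<close>. At the base point the choice is
  forced: the representatives agree, the factor is trivial and the place is the one containing
  \<open>q2\<close>. On edges the choice must moreover respect reversal.\<close>

theorem comparison_exists:
  assumes c1: "chart \<Lambda>1 \<Gamma> f1 q1 p H1 cv1 ce1" and c2: "chart \<Lambda>2 \<Gamma> f2 q2 p H2 cv2 ce2" and le: "H1 \<subseteq> H2"
  shows "\<exists>\<phi> a b. comparison_morphism \<Lambda>1 \<Lambda>2 \<Gamma> f1 f2 q1 q2 p H1 cv1 ce1 H2 cv2 ce2 \<phi> a b"
proof -
  interpret C1: chart \<Lambda>1 \<Gamma> f1 q1 p H1 cv1 ce1 by fact
  interpret C2: chart \<Lambda>2 \<Gamma> f2 q2 p H2 cv2 ce2 by fact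
  let ?K = "hcoset \<Gamma> p H2"
  let ?QV = "\<lambda>w z. fst z \<in> verts \<Lambda>2 \<and> vmap f2 (fst z) = vmap f1 w \<and> snd z \<in> carrier (vgroup \<Gamma> (vmap f1 w)) \<and>
    ?K (vmap f1 w) (cv1 w) = ?K (vmap f1 w) (C1.G.R (vmap f1 w) (cv2 (fst z)) (snd z)) \<and>
    (q1 = Vertex w \<longrightarrow> snd z = \<one>\<^bsub>vgroup \<Gamma> (vmap f1 w)\<^esub> \<and> q2 = Vertex (fst z))"
  have "\<exists>z. ?QV w z" if w: "w \<in> verts \<Lambda>1" for w
  proof (cases "q1 = Vertex w")
    case True
    then have p: "p = Vertex (vmap f1 w)" using C1.base by simp
    then obtain w2 where w2: "q2 = Vertex w2" "vmap f2 w2 = vmap f1 w" using C2.base by (cases q2) auto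
    then have "w2 \<in> verts \<Lambda>2" using C2.L.p_in by simp
    moreover have "cv1 w = hclass \<Gamma> p p []" "cv2 w2 = hclass \<Gamma> p p []" using C1.cv_base[OF True] C2.cv_base[OF w2(1)] .
    ultimately have "?QV w (w2, \<one>\<^bsub>vgroup \<Gamma> (vmap f1 w)\<^esub>)" using w2 w C2.cv_in[of w2] by simp
    then show ?thesis by blast
  next
    case False
    obtain w2 g where "w2 \<in> verts \<Lambda>2" "g \<in> carrier (vgroup \<Gamma> (vmap f1 w))" "vmap f2 w2 = vmap f1 w"
      "?K (vmap f1 w) (cv1 w) = ?K (vmap f1 w) (C1.G.R (vmap f1 w) (cv2 w2) g)"
      using C2.cv_hcoset_ex[OF C1.cv_in[OF w]] by blast
    then have "?QV w (w2, g)" using False by simp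
    then show ?thesis by blast
  qed
  then obtain va where va: "\<And>w. w \<in> verts \<Lambda>1 \<Longrightarrow> ?QV w (va w)" by metis
  let ?QE = "\<lambda>e z. fst z \<in> edges \<Lambda>2 \<and> emap f2 (fst z) = emap f1 e \<and> snd z \<in> carrier (egroup \<Gamma> (emap f1 e)) \<and>
    ?K (vmap f1 (src \<Lambda>1 e)) (ce1 e)
      = ?K (vmap f1 (src \<Lambda>1 e)) (C1.G.R (vmap f1 (src \<Lambda>1 e)) (ce2 (fst z)) (einj \<Gamma> (bar \<Gamma> (emap f1 e)) (snd z))) \<and>
    (\<forall>t. 0 < t \<longrightarrow> t < 1 \<longrightarrow> q1 = edge_point \<Lambda>1 e t \<longrightarrow> snd z = \<one>\<^bsub>egroup \<Gamma> (emap f1 e)\<^esub> \<and> q2 = edge_point \<Lambda>2 (fst z) t)"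
  have src2: "vmap f2 (src \<Lambda>2 e2) = vmap f1 (src \<Lambda>1 e)" "vmap f2 (tgt \<Lambda>2 e2) = vmap f1 (tgt \<Lambda>1 e)"
    if "e \<in> edges \<Lambda>1" "e2 \<in> edges \<Lambda>2" "emap f2 e2 = emap f1 e" for e e2
    using C2.src_emap[of e2] C1.src_emap[of e] C2.tgt_emap[of e2] C1.tgt_emap[of e] that by auto
  obtain eb where eb: "\<And>e. e \<in> edges \<Lambda>1 \<Longrightarrow> ?QE e (eb e)"
    and eb_bar: "\<And>e. e \<in> edges \<Lambda>1 \<Longrightarrow> eb (bar \<Lambda>1 e) = (bar \<Lambda>2 (fst (eb e)), snd (eb e))"
  proof (rule C1.L.bar_equivariant_choice[of ?QE "\<lambda>e z. (bar \<Lambda>2 (fst z), snd z)"])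
    fix e assume e: "e \<in> edges \<Lambda>1"
    let ?v = "vmap f1 (src \<Lambda>1 e)"
    show "\<exists>z. ?QE e z"
    proof (cases "\<exists>t. 0 < t \<and> t < 1 \<and> q1 = edge_point \<Lambda>1 e t")
      case True
      then obtain t where t: "0 < t" "t < 1" "q1 = edge_point \<Lambda>1 e t" by blast
      have p: "p = edge_point \<Gamma> (emap f1 e) t" using C1.base t(3) e by auto
      \<comment> \<open>The point \<open>q2\<close> lies over the interior point \<open>p\<close>,
        so it is interior; of its two descriptions one lies over \<open>emap f1 e\<close> with
        parameter \<open>t\<close>, by \<open>edge_point_eqD\<close>.\<close>
      have "\<exists>e2\<in>edges \<Lambda>2. emap f2 e2 = emap f1 e \<and> q2 = edge_point \<Lambda>2 e2 t"
        using C2.L.p_in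
      proof (cases rule: C2.L.pointsE)
        case (Vertex v)
        then show ?thesis using C2.base p t by (simp add: edge_point_def)
      next
        case (Edge e2 t2)
        then have p2: "edge_point \<Gamma> (emap f1 e) t = edge_point \<Gamma> (emap f2 e2) t2" using C2.base p by simp
        from C1.G.edge_point_eqD[OF p2 t(1,2) C1.emap_in[OF e]] show ?thesis
        proof
          assume "(emap f2 e2, t2) = (emap f1 e, t)"
          then show ?thesis using Edge by auto
        next
          assume *: "(emap f2 e2, t2) = (bar \<Gamma> (emap f1 e), 1 - t)"
          then have "q2 = edge_point \<Lambda>2 (bar \<Lambda>2 e2) t" using C2.L.edge_point_bar[OF Edge(1), of t2] Edge(4) by simp
          then show ?thesis using * Edge(1) e by (intro bexI[of _ "bar \<Lambda>2 e2"]) auto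
        qed
      qed
      then obtain e2 where e2: "e2 \<in> edges \<Lambda>2" "emap f2 e2 = emap f1 e" "q2 = edge_point \<Lambda>2 e2 t" by blast
      have ce: "ce1 e = ce2 e2" using C1.ce_base[OF e t] C2.ce_base[OF e2(1) t(1,2) e2(3)] e2(2) by simp
      have P: "ce1 e \<in> C1.G.P ?v" using e by simp
      have uniq: "t' = t" if "0 < t'" "t' < 1" "q1 = edge_point \<Lambda>1 e t'" for t'
        using C1.L.edge_point_inj[of e t t'] t that e by simp
      have "?K ?v (ce1 e) = ?K ?v (C1.G.R ?v (ce2 e2) (einj \<Gamma> (bar \<Gamma> (emap f1 e)) \<one>\<^bsub>egroup \<Gamma> (emap f1 e)\<^esub>))"
        using P e ce by simp
      then have "?QE e (e2, \<one>\<^bsub>egroup \<Gamma> (emap f1 e)\<^esub>)" unfolding fst_conv snd_conv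
        using e2 e uniq C1.G.eone_in[OF C1.emap_in[OF e]] by blast
      then show ?thesis by blast
    next
      case False
      have v: "src \<Gamma> (emap f1 e) = ?v" using e by simp
      obtain e2 k where "e2 \<in> edges \<Lambda>2" "k \<in> carrier (egroup \<Gamma> (emap f1 e))" "emap f2 e2 = emap f1 e"
        "?K ?v (ce1 e) = ?K ?v (C1.G.R ?v (ce2 e2) (einj \<Gamma> (bar \<Gamma> (emap f1 e)) k))"
        using C2.ce_hcoset_ex[OF C1.emap_in[OF e], of "ce1 e"] C1.ce_in[OF e] unfolding v by blast
      then have "?QE e (e2, k)" unfolding fst_conv snd_conv using False by blast
      then show ?thesis by blast
    qed
  next
    fix e z assume e: "e \<in> edges \<Lambda>1" and z: "?QE e z"
    define e2 k where "e2 = fst z" and "k = snd z"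
    have z': "e2 \<in> edges \<Lambda>2" "emap f2 e2 = emap f1 e" "k \<in> carrier (egroup \<Gamma> (emap f1 e))"
      "?K (vmap f1 (src \<Lambda>1 e)) (ce1 e) = ?K (vmap f1 (src \<Lambda>1 e)) (C1.G.R (vmap f1 (src \<Lambda>1 e)) (ce2 e2) (einj \<Gamma> (bar \<Gamma> (emap f1 e)) k))"
      "\<And>t. 0 < t \<Longrightarrow> t < 1 \<Longrightarrow> q1 = edge_point \<Lambda>1 e t \<Longrightarrow> k = \<one>\<^bsub>egroup \<Gamma> (emap f1 e)\<^esub> \<and> q2 = edge_point \<Lambda>2 e2 t"
      using z unfolding e2_def k_def by blast+
    have P: "ce2 e2 \<in> C1.G.P (vmap f1 (src \<Lambda>1 e))" using C2.ce_in[OF z'(1)] src2[OF e z'(1,2)] by simp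
    have i: "einj \<Gamma> (bar \<Gamma> (emap f1 e)) k \<in> carrier (vgroup \<Gamma> (vmap f1 (src \<Lambda>1 e)))" using e z'(3) by simp
    \<comment> \<open>Extending both sides along the edge turns the condition for \<open>e\<close>
      into that for the reverse edge, with the same \<open>k\<close>.\<close>
    have "?K (vmap f1 (tgt \<Lambda>1 e)) (C1.G.X (emap f1 e) (ce1 e)) = ?K (vmap f1 (tgt \<Lambda>1 e)) (C1.G.X (emap f1 e)
       (C1.G.R (vmap f1 (src \<Lambda>1 e)) (ce2 e2) (einj \<Gamma> (bar \<Gamma> (emap f1 e)) k)))"
      using C2.G.hcoset_extend[of "emap f1 e" "ce1 e" "C1.G.R (vmap f1 (src \<Lambda>1 e)) (ce2 e2) (einj \<Gamma> (bar \<Gamma> (emap f1 e)) k)"]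
        z'(4) e P i by simp
    also have "C1.G.X (emap f1 e) (C1.G.R (vmap f1 (src \<Lambda>1 e)) (ce2 e2) (einj \<Gamma> (bar \<Gamma> (emap f1 e)) k))
       = C1.G.R (vmap f1 (tgt \<Lambda>1 e)) (ce2 (bar \<Lambda>2 e2)) (einj \<Gamma> (emap f1 e) k)"
      using C1.G.extend_ract[of "emap f1 e" k "ce2 e2"] C2.ce_bar[OF z'(1)] z'(2,3) e P by simp
    finally have K: "?K (vmap f1 (tgt \<Lambda>1 e)) (ce1 (bar \<Lambda>1 e)) = ?K (vmap f1 (tgt \<Lambda>1 e)) (C1.G.R (vmap f1 (tgt \<Lambda>1 e)) (ce2 (bar \<Lambda>2 e2)) (einj \<Gamma> (emap f1 e) k))"
      using C1.ce_bar[OF e] by simp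
    have base: "k = \<one>\<^bsub>egroup \<Gamma> (emap f1 e)\<^esub> \<and> q2 = edge_point \<Lambda>2 (bar \<Lambda>2 e2) t"
      if t: "0 < t" "t < 1" "q1 = edge_point \<Lambda>1 (bar \<Lambda>1 e) t" for t
    proof -
      have "q1 = edge_point \<Lambda>1 e (1 - t)" using t(3) C1.L.edge_point_bar[OF e, of "1 - t"] by simp
      from z'(5)[OF _ _ this] show ?thesis using t(1,2) C2.L.edge_point_bar[OF z'(1), of "1 - t"] by simp
    qed
    have "?QE (bar \<Lambda>1 e) (bar \<Lambda>2 e2, k)"
      unfolding fst_conv snd_conv using z'(1-3) e K base by simp
    moreover have "(bar \<Lambda>2 (fst (bar \<Lambda>2 e2, k)), snd (bar \<Lambda>2 e2, k)) = z" using z'(1) by (simp add: e2_def k_def)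
    ultimately show "?QE (bar \<Lambda>1 e) (bar \<Lambda>2 (fst z), snd z) \<and> (bar \<Lambda>2 (fst (bar \<Lambda>2 (fst z), snd z)), snd (bar \<Lambda>2 (fst z), snd z)) = z"
      unfolding e2_def k_def by blast
  qed blast
  let ?pv = "\<lambda>w. fst (va w)" and ?a = "\<lambda>w. snd (va w)" and ?pe = "\<lambda>e. fst (eb e)" and ?b = "\<lambda>e. snd (eb e)"
  interpret C: comparison \<Lambda>1 \<Lambda>2 \<Gamma> f1 f2 q1 q2 p H1 cv1 ce1 H2 cv2 ce2 ?pv ?pe ?a ?b
    by (intro comparison.intro comparison_axioms.intro c1 c2 le) (use va eb eb_bar in auto)
  obtain fvh where fvh: "\<And>w l. \<lbrakk>w \<in> verts \<Lambda>1; l \<in> carrier (vgroup \<Lambda>1 w)\<rbrakk> \<Longrightarrow> fvh w l \<in> carrier (vgroup \<Lambda>2 (?pv w)) \<and>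
    vhom f2 (?pv w) (fvh w l) = ?a w \<otimes>\<^bsub>vgroup \<Gamma> (vmap f1 w)\<^esub> vhom f1 w l \<otimes>\<^bsub>vgroup \<Gamma> (vmap f1 w)\<^esub> inv\<^bsub>vgroup \<Gamma> (vmap f1 w)\<^esub> ?a w"
    using C.vhom_ex by metis
  obtain feh where feh: "\<And>e j. \<lbrakk>e \<in> edges \<Lambda>1; j \<in> carrier (egroup \<Lambda>1 e)\<rbrakk> \<Longrightarrow> feh e j \<in> carrier (egroup \<Lambda>2 (?pe e)) \<and>
    ehom f2 (?pe e) (feh e j) = ?b e \<otimes>\<^bsub>egroup \<Gamma> (emap f1 e)\<^esub> ehom f1 e j \<otimes>\<^bsub>egroup \<Gamma> (emap f1 e)\<^esub> inv\<^bsub>egroup \<Gamma> (emap f1 e)\<^esub> ?b e"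
    using C.ehom_ex by metis
  obtain tw where tw: "\<And>e. e \<in> edges \<Lambda>1 \<Longrightarrow> tw e \<in> carrier (vgroup \<Lambda>2 (?pv (tgt \<Lambda>1 e))) \<and>
     ?a (tgt \<Lambda>1 e) \<otimes>\<^bsub>vgroup \<Gamma> (vmap f1 (tgt \<Lambda>1 e))\<^esub> twist f1 e
       = vhom f2 (?pv (tgt \<Lambda>1 e)) (tw e) \<otimes>\<^bsub>vgroup \<Gamma> (vmap f1 (tgt \<Lambda>1 e))\<^esub>
          (twist f2 (?pe e) \<otimes>\<^bsub>vgroup \<Gamma> (vmap f1 (tgt \<Lambda>1 e))\<^esub> einj \<Gamma> (emap f1 e) (?b e))"
    using C.twist_ex by metis
  define \<phi> where "\<phi> = \<lparr>vmap = ?pv, emap = ?pe, vhom = fvh, ehom = feh, twist = tw\<rparr>"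
  have "comparison_morphism \<Lambda>1 \<Lambda>2 \<Gamma> f1 f2 q1 q2 p H1 cv1 ce1 H2 cv2 ce2 \<phi> ?a ?b"
  proof (intro comparison_morphism.intro comparison_morphism_axioms.intro)
    show "comparison \<Lambda>1 \<Lambda>2 \<Gamma> f1 f2 q1 q2 p H1 cv1 ce1 H2 cv2 ce2 (vmap \<phi>) (emap \<phi>) ?a ?b"
      unfolding \<phi>_def using C.comparison_axioms by simp
    show "map_point (vmap \<phi>) (emap \<phi>) q1 = q2"
      using C1.L.p_in
    proof (cases rule: C1.L.pointsE)
      case (Vertex w)
      then show ?thesis using va[OF Vertex(1)] by (simp add: \<phi>_def)
    next
      case (Edge e t)
      then have "q2 = edge_point \<Lambda>2 (?pe e) t" using eb[OF Edge(1)] by blast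
      then show ?thesis using Edge eb_bar[OF Edge(1)] by (simp add: \<phi>_def edge_point_def)
    qed
    show "?a w = \<one>\<^bsub>vgroup \<Gamma> (vmap f1 w)\<^esub>" if "q1 = Vertex w" for w
      using va[of w] that C1.L.p_in by simp
    show "?b e = \<one>\<^bsub>egroup \<Gamma> (emap f1 e)\<^esub>" if "q1 = Interior S" "(e, t) \<in> S" for S e t
      using C1.L.interior_pointD[OF C1.L.p_in that] eb[of e] by blast
  qed (use fvh feh tw in \<open>simp_all add: \<phi>_def\<close>)
  then show ?thesis by blast
qed

section \<open>Induced homomorphisms of equivalent and composite morphisms\<close>

text \<open>The maps on classes of paths to \<open>w\<close> differ by right multiplication with the
  inverse of \<open>a w\<close>; at the root there is no difference beyond this because the
  correction is trivial at the base point. Right multiplication commutes with loops, so the induced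
  homomorphisms agree.\<close>

lemma same_pointed_induced:
  assumes m1: "pointed_morphism \<Lambda> \<Gamma> f q p" and m2: "pointed_morphism \<Lambda> \<Gamma> f' q p"
    and same: "same_pointed \<Lambda> q \<Gamma> f f'" and m: "m \<in> carrier (fundamental_group \<Lambda> q)"
  shows "induced_hom \<Lambda> q \<Gamma> p f' m = induced_hom \<Lambda> q \<Gamma> p f m"
proof -
  interpret A: pointed_morphism \<Lambda> \<Gamma> f q p by fact
  interpret B: pointed_morphism \<Lambda> \<Gamma> f' q p by fact
  from same[unfolded same_pointed_def] obtain a b where S1: "\<forall>w\<in>verts \<Lambda>. vmap f' w = vmap f w \<and> a w \<in> carrier (vgroup \<Gamma> (vmap f w)) \<and>
      (q = Vertex w \<longrightarrow> a w = \<one>\<^bsub>vgroup \<Gamma> (vmap f w)\<^esub>) \<and>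
      (\<forall>g\<in>carrier (vgroup \<Lambda> w). vhom f' w g = a w \<otimes>\<^bsub>vgroup \<Gamma> (vmap f w)\<^esub> vhom f w g
         \<otimes>\<^bsub>vgroup \<Gamma> (vmap f w)\<^esub> inv\<^bsub>vgroup \<Gamma> (vmap f w)\<^esub> a w)"
    and S2: "\<forall>e\<in>edges \<Lambda>. emap f' e = emap f e \<and> b e \<in> carrier (egroup \<Gamma> (emap f e)) \<and> b (bar \<Lambda> e) = b e \<and>
      (\<forall>S t. q = Interior S \<and> (e, t) \<in> S \<longrightarrow> b e = \<one>\<^bsub>egroup \<Gamma> (emap f e)\<^esub>) \<and>
      (\<forall>h\<in>carrier (egroup \<Lambda> e). ehom f' e h = b e \<otimes>\<^bsub>egroup \<Gamma> (emap f e)\<^esub> ehom f e h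
         \<otimes>\<^bsub>egroup \<Gamma> (emap f e)\<^esub> inv\<^bsub>egroup \<Gamma> (emap f e)\<^esub> b e) \<and>
      twist f' e = a (tgt \<Lambda> e) \<otimes>\<^bsub>vgroup \<Gamma> (tgt \<Gamma> (emap f e))\<^esub> twist f e
         \<otimes>\<^bsub>vgroup \<Gamma> (tgt \<Gamma> (emap f e))\<^esub> einj \<Gamma> (emap f e) (inv\<^bsub>egroup \<Gamma> (emap f e)\<^esub> b e)"
    by (elim exE conjE)
  have v: "\<And>w. w \<in> verts \<Lambda> \<Longrightarrow> vmap f' w = vmap f w" "\<And>w. w \<in> verts \<Lambda> \<Longrightarrow> a w \<in> carrier (vgroup \<Gamma> (vmap f w))"
      "\<And>w. w \<in> verts \<Lambda> \<Longrightarrow> q = Vertex w \<Longrightarrow> a w = \<one>\<^bsub>vgroup \<Gamma> (vmap f w)\<^esub>"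
      "\<And>w g. w \<in> verts \<Lambda> \<Longrightarrow> g \<in> carrier (vgroup \<Lambda> w) \<Longrightarrow> vhom f' w g = a w \<otimes>\<^bsub>vgroup \<Gamma> (vmap f w)\<^esub> vhom f w g
                \<otimes>\<^bsub>vgroup \<Gamma> (vmap f w)\<^esub> inv\<^bsub>vgroup \<Gamma> (vmap f w)\<^esub> a w"
    using S1 by blast+
  have e: "\<And>e. e \<in> edges \<Lambda> \<Longrightarrow> emap f' e = emap f e" "\<And>e. e \<in> edges \<Lambda> \<Longrightarrow> b e \<in> carrier (egroup \<Gamma> (emap f e))"
      "\<And>e. e \<in> edges \<Lambda> \<Longrightarrow> b (bar \<Lambda> e) = b e"
      "\<And>e S t. e \<in> edges \<Lambda> \<Longrightarrow> q = Interior S \<and> (e, t) \<in> S \<Longrightarrow> b e = \<one>\<^bsub>egroup \<Gamma> (emap f e)\<^esub>"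
      "\<And>e. e \<in> edges \<Lambda> \<Longrightarrow> twist f' e = a (tgt \<Lambda> e) \<otimes>\<^bsub>vgroup \<Gamma> (tgt \<Gamma> (emap f e))\<^esub> twist f e
               \<otimes>\<^bsub>vgroup \<Gamma> (tgt \<Gamma> (emap f e))\<^esub> einj \<Gamma> (emap f e) (inv\<^bsub>egroup \<Gamma> (emap f e)\<^esub> b e)"
    using S2 by blast+
  obtain w0 B0 where root: "root_path \<Lambda> q w0 B0" using A.L.root_exists by blast
  have key: "B.F w B = A.G.R (vmap f w) (A.F w B) (inv\<^bsub>vgroup \<Gamma> (vmap f w)\<^esub> a w)" if "B \<in> A.L.P w" for w B
    using root _ _ _ that
  proof (rule A.L.vpaths_induct)
    have w: "w0 \<in> verts \<Lambda>" and Bw: "B0 \<in> A.L.P w0" using A.L.root_in[OF root] A.L.vpaths_vert by auto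
    interpret V: group "vgroup \<Gamma> (vmap f w0)" using w by (intro A.G.vgroup_group) simp
    show "B.F w0 B0 = A.G.R (vmap f w0) (A.F w0 B0) (inv\<^bsub>vgroup \<Gamma> (vmap f w0)\<^esub> a w0)"
      using root[unfolded root_path_def]
    proof (elim disjE exE conjE)
      assume *: "q = Vertex w0" "B0 = hclass \<Lambda> q q []"
      then show ?thesis using A.pmap_one[OF *(1)] B.pmap_one[OF *(1)] v(3)[OF w *(1)] A.pmap_vpaths[OF Bw] w by simp
    next
      fix d t assume *: "d \<in> edges \<Lambda>" "0 < t" "t < 1" "q = edge_point \<Lambda> d t" "w0 = src \<Lambda> d"
        "B0 = initial_seg \<Lambda> q d t"
      let ?\<delta> = "twist f (bar \<Lambda> d)" and ?G = "vgroup \<Gamma> (vmap f w0)"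
      \<comment> \<open>The root runs inside the edge \<open>d\<close> that contains the base point,
        where the edge correction is trivial; this keeps it out of the twist.\<close>
      have b1: "b d = \<one>\<^bsub>egroup \<Gamma> (emap f d)\<^esub>"
        by (rule e(4)[OF *(1), of "{(d, t), (bar \<Lambda> d, 1 - t)}" t]) (use * in \<open>simp add: edge_point_def\<close>)
      have cl: "?\<delta> \<in> carrier ?G" "a w0 \<in> carrier ?G" using A.twist_bar_in[OF *(1)] *(5) v(2)[OF w] by auto
      interpret E: group "egroup \<Gamma> (emap f d)" using * by (intro A.G.egroup_group) simp
      have tw: "twist f' (bar \<Lambda> d) = a w0 \<otimes>\<^bsub>?G\<^esub> ?\<delta>"
        using e(5)[of "bar \<Lambda> d"] *(1) *(5)[symmetric] b1 e(3)[OF *(1)] cl by simp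
      have "A.G.R (vmap f w0) (B.F w0 B0) (a w0 \<otimes>\<^bsub>?G\<^esub> ?\<delta>) = A.G.R (vmap f w0) (A.F w0 B0) ?\<delta>"
        using A.pmap_initial_seg[OF *(1-4)] B.pmap_initial_seg[OF *(1-4)] *(5,6) tw v(1)[OF w] e(1)[OF *(1)] by simp
      then have "B.F w0 B0 = A.G.R (vmap f w0) (A.F w0 B0) (?\<delta> \<otimes>\<^bsub>?G\<^esub> inv\<^bsub>?G\<^esub> (a w0 \<otimes>\<^bsub>?G\<^esub> ?\<delta>))"
        by (rule A.G.ract_solve) (use cl B.pmap_vpaths[OF Bw] A.pmap_vpaths[OF Bw] v(1)[OF w] in simp_all)
      also have "?\<delta> \<otimes>\<^bsub>?G\<^esub> inv\<^bsub>?G\<^esub> (a w0 \<otimes>\<^bsub>?G\<^esub> ?\<delta>) = inv\<^bsub>?G\<^esub> a w0"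
        using cl by (simp add: V.inv_mult_group)
      finally show ?thesis .
    qed
  next
    fix w B g assume B: "B \<in> A.L.P w" and g: "g \<in> carrier (vgroup \<Lambda> w)"
      and IH: "B.F w B = A.G.R (vmap f w) (A.F w B) (inv\<^bsub>vgroup \<Gamma> (vmap f w)\<^esub> a w)"
    have w: "w \<in> verts \<Lambda>" using A.L.vpaths_vert[OF B] .
    interpret V: group "vgroup \<Gamma> (vmap f w)" using w by (intro A.G.vgroup_group) simp
    show "B.F w (A.L.R w B g) = A.G.R (vmap f w) (A.F w (A.L.R w B g)) (inv\<^bsub>vgroup \<Gamma> (vmap f w)\<^esub> a w)"
      using B.pmap_ract[OF B g] A.pmap_ract[OF B g] IH v(1,2)[OF w] v(4)[OF w g] A.pmap_vpaths[OF B] w g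
      by (simp add: V.m_assoc flip: A.G.ract_mult)
  next
    fix d B assume d: "d \<in> edges \<Lambda>" and B: "B \<in> A.L.P (src \<Lambda> d)"
      and IH: "B.F (src \<Lambda> d) B = A.G.R (vmap f (src \<Lambda> d)) (A.F (src \<Lambda> d) B) (inv\<^bsub>vgroup \<Gamma> (vmap f (src \<Lambda> d))\<^esub> a (src \<Lambda> d))"
    let ?u = "vmap f (src \<Lambda> d)" and ?v = "vmap f (tgt \<Lambda> d)" and ?e = "emap f d"
    let ?k = "inv\<^bsub>egroup \<Gamma> ?e\<^esub> b d" and ?i = "einj \<Gamma> (bar \<Gamma> ?e)" and ?j = "einj \<Gamma> ?e"
    let ?GU = "vgroup \<Gamma> ?u" and ?GV = "vgroup \<Gamma> ?v"
    interpret U: group ?GU using d by (intro A.G.vgroup_group) simp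
    interpret V: group ?GV using d by (intro A.G.vgroup_group) simp
    have k: "?k \<in> carrier (egroup \<Gamma> ?e)" using e(2)[OF d] d by simp
    have cl: "twist f (bar \<Lambda> d) \<in> carrier ?GU" "a (src \<Lambda> d) \<in> carrier ?GU" "?i ?k \<in> carrier ?GU"
      "twist f d \<in> carrier ?GV" "a (tgt \<Lambda> d) \<in> carrier ?GV" "?j ?k \<in> carrier ?GV"
      using d v(2) k by simp_all
    have vv: "vmap f' (src \<Lambda> d) = ?u" "vmap f' (tgt \<Lambda> d) = ?v" "emap f' d = ?e" using v(1) e(1) d by simp_all
    have tws: "twist f' (bar \<Lambda> d) = a (src \<Lambda> d) \<otimes>\<^bsub>?GU\<^esub> twist f (bar \<Lambda> d) \<otimes>\<^bsub>?GU\<^esub> ?i ?k"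
      "twist f' d = a (tgt \<Lambda> d) \<otimes>\<^bsub>?GV\<^esub> twist f d \<otimes>\<^bsub>?GV\<^esub> ?j ?k"
      using e(5)[of "bar \<Lambda> d"] e(5)[OF d] e(3)[OF d] d by simp_all
    have P: "A.F (src \<Lambda> d) B \<in> A.G.P ?u" "A.F (tgt \<Lambda> d) (A.L.X d B) \<in> A.G.P ?v" "B.F (tgt \<Lambda> d) (A.L.X d B) \<in> A.G.P ?v"
      using A.pmap_vpaths[OF B] A.pmap_vpaths[of "A.L.X d B"] B.pmap_vpaths[of "A.L.X d B" "tgt \<Lambda> d"] vv d B by simp_all
    have "A.G.R ?v (B.F (tgt \<Lambda> d) (A.L.X d B)) (twist f' d) = A.G.X ?e (A.G.R ?u (B.F (src \<Lambda> d) B) (twist f' (bar \<Lambda> d)))"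
      using B.pmap_extend[OF d B] vv by simp
    also have "A.G.R ?u (B.F (src \<Lambda> d) B) (twist f' (bar \<Lambda> d))
      = A.G.R ?u (A.G.R ?u (A.F (src \<Lambda> d) B) (twist f (bar \<Lambda> d))) (?i ?k)"
      using IH P cl unfolding vv tws by (simp add: U.m_assoc flip: A.G.ract_mult)
    also have "A.G.X ?e \<dots> = A.G.R ?v (A.G.X ?e (A.G.R ?u (A.F (src \<Lambda> d) B) (twist f (bar \<Lambda> d)))) (?j ?k)"
      using A.G.extend_ract[of ?e ?k "A.G.R ?u (A.F (src \<Lambda> d) B) (twist f (bar \<Lambda> d))"] d k P cl by simp
    also have "\<dots> = A.G.R ?v (A.F (tgt \<Lambda> d) (A.L.X d B)) (twist f d \<otimes>\<^bsub>?GV\<^esub> ?j ?k)"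
      unfolding A.pmap_extend[OF d B, symmetric] using P cl by (simp add: A.G.ract_mult)
    finally have "A.G.R ?v (B.F (tgt \<Lambda> d) (A.L.X d B)) (a (tgt \<Lambda> d) \<otimes>\<^bsub>?GV\<^esub> (twist f d \<otimes>\<^bsub>?GV\<^esub> ?j ?k))
       = A.G.R ?v (A.F (tgt \<Lambda> d) (A.L.X d B)) (twist f d \<otimes>\<^bsub>?GV\<^esub> ?j ?k)"
      using cl unfolding tws by (simp add: V.m_assoc)
    then have "B.F (tgt \<Lambda> d) (A.L.X d B) = A.G.R ?v (A.F (tgt \<Lambda> d) (A.L.X d B))
       ((twist f d \<otimes>\<^bsub>?GV\<^esub> ?j ?k) \<otimes>\<^bsub>?GV\<^esub> inv\<^bsub>?GV\<^esub> (a (tgt \<Lambda> d) \<otimes>\<^bsub>?GV\<^esub> (twist f d \<otimes>\<^bsub>?GV\<^esub> ?j ?k)))"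
      by (rule A.G.ract_solve) (use P cl in simp_all)
    also have "(twist f d \<otimes>\<^bsub>?GV\<^esub> ?j ?k) \<otimes>\<^bsub>?GV\<^esub> inv\<^bsub>?GV\<^esub> (a (tgt \<Lambda> d) \<otimes>\<^bsub>?GV\<^esub> (twist f d \<otimes>\<^bsub>?GV\<^esub> ?j ?k)) = inv\<^bsub>?GV\<^esub> a (tgt \<Lambda> d)"
      using cl by (simp add: V.inv_mult_group V.m_assoc)
    finally show "B.F (tgt \<Lambda> d) (A.L.X d B) = A.G.R ?v (A.F (tgt \<Lambda> d) (A.L.X d B)) (inv\<^bsub>?GV\<^esub> a (tgt \<Lambda> d))" .
  qed
  have Bw: "B0 \<in> A.L.P w0" "w0 \<in> verts \<Lambda>" using A.L.root_in[OF root] A.L.vpaths_vert by auto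
  \<comment> \<open>The image of one translated class is computed through both morphisms; freeness
    of the left action compares the two loops.\<close>
  have "B.F w0 (A.L.L w0 m B0) = A.G.L (vmap f w0) (induced_hom \<Lambda> q \<Gamma> p f m) (B.F w0 B0)"
    unfolding key[OF A.L.lact_closed[OF m Bw(1)]] A.pmap_lact[OF m Bw(1)]
    using key[OF Bw(1)] A.G.lact_ract[of "induced_hom \<Lambda> q \<Gamma> p f m" "A.F w0 B0" "vmap f w0"] A.induced_hom_in[OF m] A.pmap_vpaths[OF Bw(1)] v(2)[OF Bw(2)] Bw(2)
    by simp
  moreover have "B.F w0 (A.L.L w0 m B0) = A.G.L (vmap f w0) (induced_hom \<Lambda> q \<Gamma> p f' m) (B.F w0 B0)"
    using B.pmap_lact[OF m Bw(1)] v(1)[OF Bw(2)] by simp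
  moreover have "B.F w0 B0 \<in> A.G.P (vmap f w0)" using B.pmap_vpaths[OF Bw(1)] v(1)[OF Bw(2)] by simp
  ultimately show ?thesis
    using A.G.lact_free[OF B.induced_hom_in[OF m] A.induced_hom_in[OF m]] by metis
qed

section \<open>Composites of pointed morphisms\<close>

lemma gcompose_simps [simp]:
  "vmap (gcompose \<Lambda> \<Gamma> g f) w = vmap g (vmap f w)"
  "emap (gcompose \<Lambda> \<Gamma> g f) e = emap g (emap f e)"
  "vhom (gcompose \<Lambda> \<Gamma> g f) w x = vhom g (vmap f w) (vhom f w x)"
  "ehom (gcompose \<Lambda> \<Gamma> g f) e y = ehom g (emap f e) (ehom f e y)"
  "twist (gcompose \<Lambda> \<Gamma> g f) e = vhom g (vmap f (tgt \<Lambda> e)) (twist f e)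
        \<otimes>\<^bsub>vgroup \<Gamma> (vmap g (vmap f (tgt \<Lambda> e)))\<^esub> twist g (emap f e)"
  by (simp_all add: gcompose_def)

locale composite = A: pointed_morphism \<Lambda>1 \<Lambda>2 f q1 q2 + B: pointed_morphism \<Lambda>2 \<Gamma> g q2 p
  for \<Lambda>1 :: "('v1, 'e1, 'g1, 'h1) graph_of_groups" and \<Lambda>2 :: "('v2, 'e2, 'g2, 'h2) graph_of_groups"
    and \<Gamma> :: "('w, 'f, 'k, 'l) graph_of_groups" and f g q1 q2 p
begin

abbreviation gf where "gf \<equiv> gcompose \<Lambda>1 \<Gamma> g f"

lemma gcompose_morphism: "morphism \<Lambda>1 \<Gamma> gf"
  unfolding morphism_def gcompose_simps
proof (intro conjI ballI)
  fix w assume w: "w \<in> verts \<Lambda>1"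
  show "(\<lambda>x. vhom g (vmap f w) (vhom f w x)) \<in> hom (vgroup \<Lambda>1 w) (vgroup \<Gamma> (vmap g (vmap f w)))"
    by (rule homI) (use w in \<open>simp_all add: A.vhom_mult B.vhom_mult\<close>)
next
  fix e assume e: "e \<in> edges \<Lambda>1"
  let ?t = "tgt \<Lambda>1 e"
  let ?v = "vmap g (vmap f ?t)"
  interpret V: group "vgroup \<Gamma> ?v" using e by (intro B.G.vgroup_group) simp
  show "(\<lambda>y. ehom g (emap f e) (ehom f e y)) \<in> hom (egroup \<Lambda>1 e) (egroup \<Gamma> (emap g (emap f e)))"
    using hom_compose[OF A.ehom_hom[OF e] B.ehom_hom[OF A.emap_in[OF e]]] by (simp add: comp_def)
  have tg: "twist g (emap f e) \<in> carrier (vgroup \<Gamma> ?v)" using B.twist_in[of "emap f e"] e by simp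
  then show "vhom g (vmap f ?t) (twist f e) \<otimes>\<^bsub>vgroup \<Gamma> ?v\<^esub> twist g (emap f e)
    \<in> carrier (vgroup \<Gamma> (tgt \<Gamma> (emap g (emap f e))))" using e by simp
  fix j assume j: "j \<in> carrier (egroup \<Lambda>1 e)"
  show "ehom g (emap f (bar \<Lambda>1 e)) (ehom f (bar \<Lambda>1 e) j) = ehom g (emap f e) (ehom f e j)"
    using e j by simp
  let ?x = "vhom g (vmap f ?t) (vhom f ?t (einj \<Lambda>1 e j))" and ?y = "vhom g (vmap f ?t) (twist f e)"
  let ?z = "vhom g (vmap f ?t) (einj \<Lambda>2 (emap f e) (ehom f e j))" and ?i = "einj \<Gamma> (emap g (emap f e)) (ehom g (emap f e) (ehom f e j))"
  have ic: "einj \<Lambda>2 (emap f e) (ehom f e j) \<in> carrier (vgroup \<Lambda>2 (vmap f ?t))" using e j by simp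
  have cl: "?x \<in> carrier (vgroup \<Gamma> ?v)" "?y \<in> carrier (vgroup \<Gamma> ?v)" "?z \<in> carrier (vgroup \<Gamma> ?v)" "?i \<in> carrier (vgroup \<Gamma> ?v)"
    using e j ic B.einj_ehom_in(1)[of "emap f e" "ehom g (emap f e) (ehom f e j)"] by simp_all
  have 1: "?x \<otimes>\<^bsub>vgroup \<Gamma> ?v\<^esub> ?y = ?y \<otimes>\<^bsub>vgroup \<Gamma> ?v\<^esub> ?z"
    using arg_cong[OF A.vhom_einj[OF e j], of "vhom g (vmap f ?t)"] e j ic by (simp add: B.vhom_mult)
  have 2: "?z \<otimes>\<^bsub>vgroup \<Gamma> ?v\<^esub> twist g (emap f e) = twist g (emap f e) \<otimes>\<^bsub>vgroup \<Gamma> ?v\<^esub> ?i"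
    using B.vhom_einj[of "emap f e" "ehom f e j"] e j by simp
  have "?x = ?y \<otimes>\<^bsub>vgroup \<Gamma> ?v\<^esub> ?z \<otimes>\<^bsub>vgroup \<Gamma> ?v\<^esub> inv\<^bsub>vgroup \<Gamma> ?v\<^esub> ?y" unfolding 1[symmetric] using cl by (simp add: V.m_assoc)
  also have "?z = twist g (emap f e) \<otimes>\<^bsub>vgroup \<Gamma> ?v\<^esub> ?i \<otimes>\<^bsub>vgroup \<Gamma> ?v\<^esub> inv\<^bsub>vgroup \<Gamma> ?v\<^esub> twist g (emap f e)"
    unfolding 2[symmetric] using cl tg by (simp add: V.m_assoc)
  finally have "?x = ?y \<otimes>\<^bsub>vgroup \<Gamma> ?v\<^esub> twist g (emap f e) \<otimes>\<^bsub>vgroup \<Gamma> ?v\<^esub> ?i \<otimes>\<^bsub>vgroup \<Gamma> ?v\<^esub> inv\<^bsub>vgroup \<Gamma> ?v\<^esub> (?y \<otimes>\<^bsub>vgroup \<Gamma> ?v\<^esub> twist g (emap f e))"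
    using cl tg by (simp add: V.m_assoc V.inv_mult_group)
  then show "?x = ?y \<otimes>\<^bsub>vgroup \<Gamma> ?v\<^esub> twist g (emap f e) \<otimes>\<^bsub>vgroup \<Gamma> (tgt \<Gamma> (emap g (emap f e)))\<^esub> ?i
     \<otimes>\<^bsub>vgroup \<Gamma> (tgt \<Gamma> (emap g (emap f e)))\<^esub> inv\<^bsub>vgroup \<Gamma> (tgt \<Gamma> (emap g (emap f e)))\<^esub> (?y \<otimes>\<^bsub>vgroup \<Gamma> ?v\<^esub> twist g (emap f e))"
    using e by simp
qed (use A.gog_morphism_axioms B.gog_morphism_axioms in simp_all)

sublocale C: pointed_morphism \<Lambda>1 \<Gamma> gf q1 p
proof (intro pointed_morphism.intro pointed_morphism_axioms.intro gog_morphism.intro gog_morphism_axioms.intro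
    A.L.gog_axioms B.G.gog_axioms A.L.pgog_axioms B.G.pgog_axioms gcompose_morphism)
  show "map_point (vmap gf) (emap gf) q1 = p"
    using A.base B.base by (cases q1) (auto simp: gcompose_def image_comp comp_def case_prod_unfold)
qed

text \<open>The paths themselves differ: the composite inserts one product at a vertex where the two
  maps in succession insert two letters. On classes the difference disappears, and the generation of
  path classes reduces the claim to the twist of the composite.\<close>

lemma pmap_gcompose:
  assumes "D \<in> A.L.P w"
  shows "C.F w D = B.F (vmap f w) (A.F w D)"
proof -
  obtain w0 D0 where root: "root_path \<Lambda>1 q1 w0 D0" using A.L.root_exists by blast
  show ?thesis
    using root _ _ _ assms
  proof (rule A.L.vpaths_induct)
    have w: "w0 \<in> verts \<Lambda>1" and D: "D0 \<in> A.L.P w0" using A.L.root_in[OF root] A.L.vpaths_vert by auto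
    show "C.F w0 D0 = B.F (vmap f w0) (A.F w0 D0)"
      using root[unfolded root_path_def]
    proof (elim disjE exE conjE)
      assume *: "q1 = Vertex w0" "D0 = hclass \<Lambda>1 q1 q1 []"
      have "q2 = Vertex (vmap f w0)" using A.base *(1) by simp
      then show ?thesis using A.pmap_one[OF *(1)] B.pmap_one C.pmap_one[OF *(1)] * by metis
    next
      fix d t assume *: "d \<in> edges \<Lambda>1" "0 < t" "t < 1" "q1 = edge_point \<Lambda>1 d t" "w0 = src \<Lambda>1 d"
        "D0 = initial_seg \<Lambda>1 q1 d t"
      let ?v = "vmap g (vmap f w0)"
      interpret V: group "vgroup \<Gamma> ?v" using w by (intro B.G.vgroup_group) simp
      have q2: "q2 = edge_point \<Lambda>2 (emap f d) t" using A.base *(1,4) by auto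
      have FD: "A.F w0 D0 \<in> A.G.P (vmap f w0)" "B.F (vmap f w0) (A.F w0 D0) \<in> B.G.P ?v" "C.F w0 D0 \<in> B.G.P ?v"
        using A.pmap_vpaths[OF D] B.pmap_vpaths[OF A.pmap_vpaths[OF D]] C.pmap_vpaths[OF D] by simp_all
      have cl: "twist f (bar \<Lambda>1 d) \<in> carrier (vgroup \<Lambda>2 (vmap f w0))" "twist g (bar \<Lambda>2 (emap f d)) \<in> carrier (vgroup \<Gamma> ?v)"
        using *(1,5) B.twist_bar_in[of "emap f d"] by simp_all
      have "B.G.R ?v (B.F (vmap f w0) (A.F w0 D0)) (vhom g (vmap f w0) (twist f (bar \<Lambda>1 d)) \<otimes>\<^bsub>vgroup \<Gamma> ?v\<^esub> twist g (bar \<Lambda>2 (emap f d)))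
        = B.G.R ?v (B.F (vmap f w0) (A.G.R (vmap f w0) (A.F w0 D0) (twist f (bar \<Lambda>1 d)))) (twist g (bar \<Lambda>2 (emap f d)))"
        using FD cl w B.pmap_ract[OF FD(1) cl(1)] by (simp add: B.G.ract_mult)
      also have "\<dots> = initial_seg \<Gamma> p (emap g (emap f d)) t"
        using A.pmap_initial_seg[OF *(1-4)] B.pmap_initial_seg[OF A.emap_in[OF *(1)] *(2,3) q2] *(1,5,6) by simp
      also have "\<dots> = B.G.R ?v (C.F w0 D0) (vhom g (vmap f w0) (twist f (bar \<Lambda>1 d)) \<otimes>\<^bsub>vgroup \<Gamma> ?v\<^esub> twist g (bar \<Lambda>2 (emap f d)))"
        using C.pmap_initial_seg[OF *(1-4)] *(1,5,6) by simp
      finally have eq: "B.G.R ?v (B.F (vmap f w0) (A.F w0 D0)) (vhom g (vmap f w0) (twist f (bar \<Lambda>1 d)) \<otimes>\<^bsub>vgroup \<Gamma> ?v\<^esub> twist g (bar \<Lambda>2 (emap f d)))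
        = B.G.R ?v (C.F w0 D0) (vhom g (vmap f w0) (twist f (bar \<Lambda>1 d)) \<otimes>\<^bsub>vgroup \<Gamma> ?v\<^esub> twist g (bar \<Lambda>2 (emap f d)))" .
      have "vhom g (vmap f w0) (twist f (bar \<Lambda>1 d)) \<otimes>\<^bsub>vgroup \<Gamma> ?v\<^esub> twist g (bar \<Lambda>2 (emap f d)) \<in> carrier (vgroup \<Gamma> ?v)"
        using cl w by simp
      with arg_cong[OF eq, of "\<lambda>A. B.G.R ?v A (inv\<^bsub>vgroup \<Gamma> ?v\<^esub> (vhom g (vmap f w0) (twist f (bar \<Lambda>1 d)) \<otimes>\<^bsub>vgroup \<Gamma> ?v\<^esub> twist g (bar \<Lambda>2 (emap f d))))"]
      show ?thesis using FD by simp
    qed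
  next
    fix w D l assume D: "D \<in> A.L.P w" and l: "l \<in> carrier (vgroup \<Lambda>1 w)" and IH: "C.F w D = B.F (vmap f w) (A.F w D)"
    have w: "w \<in> verts \<Lambda>1" using A.L.vpaths_vert[OF D] .
    show "C.F w (A.L.R w D l) = B.F (vmap f w) (A.F w (A.L.R w D l))"
      unfolding A.pmap_ract[OF D l] C.pmap_ract[OF D l] IH
      using B.pmap_ract[OF A.pmap_vpaths[OF D]] w l by simp
  next
    fix d D assume d: "d \<in> edges \<Lambda>1" and D: "D \<in> A.L.P (src \<Lambda>1 d)"
      and IH: "C.F (src \<Lambda>1 d) D = B.F (vmap f (src \<Lambda>1 d)) (A.F (src \<Lambda>1 d) D)"
    let ?u = "vmap f (src \<Lambda>1 d)" and ?v = "vmap f (tgt \<Lambda>1 d)" and ?XD = "A.L.X d D"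
    interpret V: group "vgroup \<Gamma> (vmap g ?v)" using d by (intro B.G.vgroup_group) simp
    have XD: "?XD \<in> A.L.P (tgt \<Lambda>1 d)" using d D by simp
    have FD: "A.F (src \<Lambda>1 d) D \<in> A.G.P ?u" "A.F (tgt \<Lambda>1 d) ?XD \<in> A.G.P ?v"
      using A.pmap_vpaths[OF D] A.pmap_vpaths[OF XD] by simp_all
    have FFD: "B.F ?u (A.F (src \<Lambda>1 d) D) \<in> B.G.P (vmap g ?u)" "B.F ?v (A.F (tgt \<Lambda>1 d) ?XD) \<in> B.G.P (vmap g ?v)"
      "C.F (tgt \<Lambda>1 d) ?XD \<in> B.G.P (vmap g ?v)"
      using B.pmap_vpaths[OF FD(1)] B.pmap_vpaths[OF FD(2)] C.pmap_vpaths[OF XD] by simp_all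
    let ?fu = "vhom g ?u (twist f (bar \<Lambda>1 d))" and ?gu = "twist g (bar \<Lambda>2 (emap f d))"
    let ?fv = "vhom g ?v (twist f d)" and ?gv = "twist g (emap f d)"
    have cl: "?fu \<in> carrier (vgroup \<Gamma> (vmap g ?u))" "?gu \<in> carrier (vgroup \<Gamma> (vmap g ?u))"
      "?fv \<in> carrier (vgroup \<Gamma> (vmap g ?v))" "?gv \<in> carrier (vgroup \<Gamma> (vmap g ?v))"
      using d B.twist_bar_in[of "emap f d"] B.twist_in[of "emap f d"] by simp_all
    have "B.G.R (vmap g ?v) (C.F (tgt \<Lambda>1 d) ?XD) (?fv \<otimes>\<^bsub>vgroup \<Gamma> (vmap g ?v)\<^esub> ?gv)
      = B.G.X (emap g (emap f d)) (B.G.R (vmap g ?u) (B.F ?u (A.F (src \<Lambda>1 d) D)) (?fu \<otimes>\<^bsub>vgroup \<Gamma> (vmap g ?u)\<^esub> ?gu))"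
      using C.pmap_extend[OF d D] IH d by simp
    also have "B.G.R (vmap g ?u) (B.F ?u (A.F (src \<Lambda>1 d) D)) (?fu \<otimes>\<^bsub>vgroup \<Gamma> (vmap g ?u)\<^esub> ?gu)
      = B.G.R (vmap g ?u) (B.F ?u (A.G.R ?u (A.F (src \<Lambda>1 d) D) (twist f (bar \<Lambda>1 d)))) ?gu"
      using B.pmap_ract[OF FD(1), of "twist f (bar \<Lambda>1 d)"] d FFD cl by (simp add: B.G.ract_mult)
    also have "B.G.X (emap g (emap f d)) \<dots> = B.G.R (vmap g ?v) (B.F ?v (A.G.X (emap f d) (A.G.R ?u (A.F (src \<Lambda>1 d) D) (twist f (bar \<Lambda>1 d))))) ?gv"
      using B.pmap_extend[of "emap f d" "A.G.R ?u (A.F (src \<Lambda>1 d) D) (twist f (bar \<Lambda>1 d))"] d FD by simp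
    also have "A.G.X (emap f d) (A.G.R ?u (A.F (src \<Lambda>1 d) D) (twist f (bar \<Lambda>1 d))) = A.G.R ?v (A.F (tgt \<Lambda>1 d) ?XD) (twist f d)"
      using A.pmap_extend[OF d D] by simp
    also have "B.G.R (vmap g ?v) (B.F ?v \<dots>) ?gv = B.G.R (vmap g ?v) (B.F ?v (A.F (tgt \<Lambda>1 d) ?XD)) (?fv \<otimes>\<^bsub>vgroup \<Gamma> (vmap g ?v)\<^esub> ?gv)"
      using B.pmap_ract[OF FD(2), of "twist f d"] d FFD cl by (simp add: B.G.ract_mult)
    finally have eq: "B.G.R (vmap g ?v) (C.F (tgt \<Lambda>1 d) ?XD) (?fv \<otimes>\<^bsub>vgroup \<Gamma> (vmap g ?v)\<^esub> ?gv)
      = B.G.R (vmap g ?v) (B.F ?v (A.F (tgt \<Lambda>1 d) ?XD)) (?fv \<otimes>\<^bsub>vgroup \<Gamma> (vmap g ?v)\<^esub> ?gv)" .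
    have "?fv \<otimes>\<^bsub>vgroup \<Gamma> (vmap g ?v)\<^esub> ?gv \<in> carrier (vgroup \<Gamma> (vmap g ?v))" using cl by simp
    with arg_cong[OF eq, of "\<lambda>A. B.G.R (vmap g ?v) A (inv\<^bsub>vgroup \<Gamma> (vmap g ?v)\<^esub> (?fv \<otimes>\<^bsub>vgroup \<Gamma> (vmap g ?v)\<^esub> ?gv))"]
    show "C.F (tgt \<Lambda>1 d) ?XD = B.F ?v (A.F (tgt \<Lambda>1 d) ?XD)" using FFD by simp
  qed
qed

text \<open>Both loops have the same effect on the image of one class \<open>D\<close>, and the left
  action is free.\<close>

lemma induced_gcompose:
  assumes m: "m \<in> carrier A.L.\<pi>"
  shows "C.f_sharp m = B.f_sharp (A.f_sharp m)"
proof -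
  obtain w D where "root_path \<Lambda>1 q1 w D" using A.L.root_exists by blast
  then have D: "D \<in> A.L.P w" using A.L.root_in by blast
  have FD: "A.F w D \<in> A.G.P (vmap f w)" "C.F w D \<in> B.G.P (vmap g (vmap f w))"
    using A.pmap_vpaths[OF D] C.pmap_vpaths[OF D] by simp_all
  have "B.G.L (vmap g (vmap f w)) (C.f_sharp m) (C.F w D) = C.F w (A.L.L w m D)"
    using C.pmap_lact[OF m D] by simp
  also have "\<dots> = B.F (vmap f w) (A.G.L (vmap f w) (A.f_sharp m) (A.F w D))"
    using pmap_gcompose[of "A.L.L w m D"] m D A.pmap_lact[OF m D] by simp
  also have "\<dots> = B.G.L (vmap g (vmap f w)) (B.f_sharp (A.f_sharp m)) (C.F w D)"
    using B.pmap_lact[OF A.induced_hom_in[OF m] FD(1)] pmap_gcompose[OF D] by simp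
  finally show ?thesis using B.G.lact_free[OF _ _ FD(2)] C.induced_hom_in[OF m] B.induced_hom_in[OF A.induced_hom_in[OF m]] by blast
qed

end

section \<open>Factorisation and isomorphism of pointed coverings\<close>

lemma pointed_coveringD:
  assumes "pointed_covering \<Lambda> q \<Gamma> p f"
  shows "pointed_covering_morphism \<Lambda> \<Gamma> f q p"
proof -
  interpret gog_morphism \<Lambda> \<Gamma> f
    using assms by unfold_locales (auto simp: pointed_covering_def covering_def)
  have "q \<in> points \<Lambda>" "map_point (vmap f) (emap f) q = p" "covering \<Lambda> \<Gamma> f"
    using assms by (auto simp: pointed_covering_def)
  then show ?thesis using map_point_in[of q] by unfold_locales auto
qed

lemma factors_through_subset:
  assumes c1: "pointed_covering \<Lambda>1 q1 \<Gamma> p \<rho>1" and c2: "pointed_covering \<Lambda>2 q2 \<Gamma> p \<rho>2"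
    and f: "pointed_covering \<Lambda>1 q1 \<Lambda>2 q2 f" and same: "same_pointed \<Lambda>1 q1 \<Gamma> (gcompose \<Lambda>1 \<Gamma> \<rho>2 f) \<rho>1"
  shows "covering_subgroup \<Lambda>1 q1 \<Gamma> p \<rho>1 = induced_hom \<Lambda>2 q2 \<Gamma> p \<rho>2 ` covering_subgroup \<Lambda>1 q1 \<Lambda>2 q2 f"
proof -
  interpret C1: pointed_covering_morphism \<Lambda>1 \<Gamma> \<rho>1 q1 p by (rule pointed_coveringD[OF c1])
  interpret C2: pointed_covering_morphism \<Lambda>2 \<Gamma> \<rho>2 q2 p by (rule pointed_coveringD[OF c2])
  interpret F: pointed_covering_morphism \<Lambda>1 \<Lambda>2 f q1 q2 by (rule pointed_coveringD[OF f])
  interpret FC: composite \<Lambda>1 \<Lambda>2 \<Gamma> f \<rho>2 q1 q2 p ..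
  have "C1.f_sharp m = C2.f_sharp (F.f_sharp m)" if m: "m \<in> carrier C1.L.\<pi>" for m
    using same_pointed_induced[OF FC.C.pointed_morphism_axioms C1.pointed_morphism_axioms same m]
      FC.induced_gcompose[OF m] by simp
  then show ?thesis unfolding covering_subgroup_def image_image by (rule image_cong[OF HOL.refl])
qed

text \<open>A factorisation exhibits the first subgroup as the image of a subgroup of the
  fundamental group of \<open>\<Lambda>2\<close>. In the other direction, charts of the two
  coverings can be compared as soon as the subgroups are nested.\<close>

theorem factors_through_iff:
  assumes c1: "pointed_covering \<Lambda>1 q1 \<Gamma> p \<rho>1" and c2: "pointed_covering \<Lambda>2 q2 \<Gamma> p \<rho>2"
  shows "factors_through \<Gamma> \<Lambda>1 q1 \<rho>1 \<Lambda>2 q2 \<rho>2 \<longleftrightarrow>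
    covering_subgroup \<Lambda>1 q1 \<Gamma> p \<rho>1 \<subseteq> covering_subgroup \<Lambda>2 q2 \<Gamma> p \<rho>2"
proof
  assume "factors_through \<Gamma> \<Lambda>1 q1 \<rho>1 \<Lambda>2 q2 \<rho>2"
  then obtain f where f: "pointed_covering \<Lambda>1 q1 \<Lambda>2 q2 f" "same_pointed \<Lambda>1 q1 \<Gamma> (gcompose \<Lambda>1 \<Gamma> \<rho>2 f) \<rho>1"
    by (auto simp: factors_through_def)
  interpret F: pointed_covering_morphism \<Lambda>1 \<Lambda>2 f q1 q2 by (rule pointed_coveringD[OF f(1)])
  have "covering_subgroup \<Lambda>1 q1 \<Lambda>2 q2 f \<subseteq> carrier (fundamental_group \<Lambda>2 q2)"
    using F.covering_subgroup_subgroup by (rule subgroup.subset)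
  then show "covering_subgroup \<Lambda>1 q1 \<Gamma> p \<rho>1 \<subseteq> covering_subgroup \<Lambda>2 q2 \<Gamma> p \<rho>2"
    unfolding factors_through_subset[OF c1 c2 f] by (auto simp: covering_subgroup_def[of \<Lambda>2])
next
  assume le: "covering_subgroup \<Lambda>1 q1 \<Gamma> p \<rho>1 \<subseteq> covering_subgroup \<Lambda>2 q2 \<Gamma> p \<rho>2"
  obtain cv1 ce1 cv2 ce2 where "chart \<Lambda>1 \<Gamma> \<rho>1 q1 p (covering_subgroup \<Lambda>1 q1 \<Gamma> p \<rho>1) cv1 ce1"
    "chart \<Lambda>2 \<Gamma> \<rho>2 q2 p (covering_subgroup \<Lambda>2 q2 \<Gamma> p \<rho>2) cv2 ce2"
    using pointed_covering_morphism.chart_exists[OF pointed_coveringD] c1 c2 by metis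
  from comparison_exists[OF this le] show "factors_through \<Gamma> \<Lambda>1 q1 \<rho>1 \<Lambda>2 q2 \<rho>2"
    unfolding factors_through_def
    using comparison_morphism.pointed_covering_phi comparison_morphism.same_pointed_phi by metis
qed

text \<open>Bijectivity on edges and edge groups gives injectivity on stars; for surjectivity, the
  only edge over a given one ends at the right vertex because the vertex map is injective, and the
  local group there covers everything.\<close>

lemma isomorphism_covering:
  assumes \<Lambda>: "graph_of_groups \<Lambda>" and \<Gamma>: "graph_of_groups \<Gamma>" and i: "isomorphism \<Lambda> \<Gamma> f"
  shows "covering \<Lambda> \<Gamma> f"
proof -
  interpret gog_morphism \<Lambda> \<Gamma> f
    using assms by unfold_locales (auto simp: isomorphism_def)
  have bv: "bij_betw (vmap f) (verts \<Lambda>) (verts \<Gamma>)" and be: "bij_betw (emap f) (edges \<Lambda>) (edges \<Gamma>)"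
    and vi: "\<And>v. v \<in> verts \<Lambda> \<Longrightarrow> vhom f v \<in> iso (vgroup \<Lambda> v) (vgroup \<Gamma> (vmap f v))"
    and ei: "\<And>e. e \<in> edges \<Lambda> \<Longrightarrow> ehom f e \<in> iso (egroup \<Lambda> e) (egroup \<Gamma> (emap f e))"
    using i by (auto simp: isomorphism_def)
  have inj: "locally_inj v" if v: "v \<in> verts \<Lambda>" for v
    unfolding locally_inj_def
  proof (intro ballI impI)
    let ?G = "vgroup \<Gamma> (vmap f v)"
    interpret V: group ?G using v by (intro G.vgroup_group) simp
    fix e e' l l' k
    assume e: "e \<in> edges \<Lambda>" "e' \<in> edges \<Lambda>" and l: "l \<in> carrier (vgroup \<Lambda> v)" "l' \<in> carrier (vgroup \<Lambda> v)"
      and k: "k \<in> carrier (egroup \<Gamma> (emap f e))" and t: "tgt \<Lambda> e = v" "tgt \<Lambda> e' = v" and ee: "emap f e = emap f e'"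
      and eq: "vhom f v l \<otimes>\<^bsub>?G\<^esub> twist f e \<otimes>\<^bsub>?G\<^esub> einj \<Gamma> (emap f e) k = vhom f v l' \<otimes>\<^bsub>?G\<^esub> twist f e'"
    have e': "e' = e" using inj_onD[OF bij_betw_imp_inj_on[OF be] ee] e by simp
    have "k \<in> ehom f e ` carrier (egroup \<Lambda> e)" using ei[OF e(1)] k by (simp add: iso_def bij_betw_def)
    then obtain j where j: "j \<in> carrier (egroup \<Lambda> e)" "k = ehom f e j" by blast
    have jc: "einj \<Lambda> e j \<in> carrier (vgroup \<Lambda> v)" using L.einj_in[OF e(1) j(1)] t by simp
    have cl: "twist f e \<in> carrier ?G" "vhom f v l \<in> carrier ?G" "vhom f v (einj \<Lambda> e j) \<in> carrier ?G"
      "einj \<Gamma> (emap f e) k \<in> carrier ?G"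
      using twist_in[OF e(1)] einj_ehom_in(1)[OF e(1) k] t v l jc by auto
    have "vhom f v (l \<otimes>\<^bsub>vgroup \<Lambda> v\<^esub> einj \<Lambda> e j) \<otimes>\<^bsub>?G\<^esub> twist f e = vhom f v l' \<otimes>\<^bsub>?G\<^esub> twist f e"
      using eq vhom_einj[OF e(1) j(1)] cl jc v l t j unfolding e' by (simp add: vhom_mult V.m_assoc)
    then have "vhom f v (l \<otimes>\<^bsub>vgroup \<Lambda> v\<^esub> einj \<Lambda> e j) = vhom f v l'" using cl jc v l by simp
    moreover have "inj_on (vhom f v) (carrier (vgroup \<Lambda> v))" using vi[OF v] by (simp add: iso_def bij_betw_def)
    ultimately have "l \<otimes>\<^bsub>vgroup \<Lambda> v\<^esub> einj \<Lambda> e j = l'" using v l jc by (simp add: inj_on_def)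
    then show "e = e' \<and> (\<exists>j\<in>carrier (egroup \<Lambda> e). l \<otimes>\<^bsub>vgroup \<Lambda> v\<^esub> einj \<Lambda> e j = l')" using e' j(1) by blast
  qed
  have surj: "locally_surj v" if v: "v \<in> verts \<Lambda>" for v
    unfolding locally_surj_def
  proof (intro ballI impI)
    let ?G = "vgroup \<Gamma> (vmap f v)"
    interpret V: group ?G using v by (intro G.vgroup_group) simp
    fix e' g assume e': "e' \<in> edges \<Gamma>" and g: "g \<in> carrier ?G" and t: "tgt \<Gamma> e' = vmap f v"
    obtain e where e: "e \<in> edges \<Lambda>" "emap f e = e'" using bij_betw_imp_surj_on[OF be] e' by (metis imageE)
    have te: "tgt \<Lambda> e = v"
      using inj_onD[OF bij_betw_imp_inj_on[OF bv], of "tgt \<Lambda> e" v] tgt_emap[OF e(1)] e t v by simp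
    have tw: "twist f e \<in> carrier ?G" using twist_in[OF e(1)] te by simp
    have "g \<otimes>\<^bsub>?G\<^esub> inv\<^bsub>?G\<^esub> twist f e \<in> vhom f v ` carrier (vgroup \<Lambda> v)"
      using vi[OF v] g tw by (simp add: iso_def bij_betw_def)
    then obtain l where l: "l \<in> carrier (vgroup \<Lambda> v)" "g \<otimes>\<^bsub>?G\<^esub> inv\<^bsub>?G\<^esub> twist f e = vhom f v l" by blast
    have "g = vhom f v l \<otimes>\<^bsub>?G\<^esub> twist f e \<otimes>\<^bsub>?G\<^esub> einj \<Gamma> e' \<one>\<^bsub>egroup \<Gamma> e'\<^esub>"
      unfolding l(2)[symmetric] using g tw e' t by (simp add: V.m_assoc)
    then show "\<exists>e\<in>edges \<Lambda>. \<exists>l\<in>carrier (vgroup \<Lambda> v). \<exists>k\<in>carrier (egroup \<Gamma> e'). tgt \<Lambda> e = v \<and> emap f e = e' \<and>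
        g = vhom f v l \<otimes>\<^bsub>?G\<^esub> twist f e \<otimes>\<^bsub>?G\<^esub> einj \<Gamma> e' k"
      using e te l(1) G.eone_in[OF e'] by blast
  qed
  show ?thesis unfolding covering_def
  proof (intro conjI ballI)
    show "bij_betw (star_map \<Gamma> f v) (star \<Lambda> v) (star \<Gamma> (vmap f v))" if "v \<in> verts \<Lambda>" for v
      using star_bij_iff[OF that] inj[OF that] surj[OF that] by simp
  qed (use mor bv be vi ei in \<open>auto simp: bij_betw_def iso_def mon_def\<close>)
qed

text \<open>The translate by \<open>m\<close> of the image of \<open>B\<close> lifts. The lift must
  end at the same vertex, and its remainder comes from the local group, so it is again the image of
  a path to \<open>w\<close> and differs from \<open>B\<close> by a loop.\<close>

lemma isomorphism_covering_subgroup: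
  assumes c: "pointed_covering \<Lambda> q \<Gamma> p f" and i: "isomorphism \<Lambda> \<Gamma> f"
  shows "carrier (fundamental_group \<Gamma> p) \<subseteq> covering_subgroup \<Lambda> q \<Gamma> p f"
proof
  interpret C: pointed_covering_morphism \<Lambda> \<Gamma> f q p by (rule pointed_coveringD[OF c])
  fix m assume m: "m \<in> carrier C.G.\<pi>"
  obtain w B where "root_path \<Lambda> q w B" using C.L.root_exists by blast
  then have B: "B \<in> C.L.P w" and w: "w \<in> verts \<Lambda>" using C.L.root_in C.L.vpaths_vert by auto
  let ?v = "vmap f w"
  have FB: "C.F w B \<in> C.G.P ?v" using B by simp
  then have "C.G.L ?v m (C.F w B) \<in> C.G.P ?v" using m by simp
  from C.lift_exists[OF this] obtain w' B' g where *: "w' \<in> verts \<Lambda>" "B' \<in> C.L.P w'" "g \<in> carrier (vgroup \<Gamma> ?v)"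
    "vmap f w' = ?v" "C.G.L ?v m (C.F w B) = C.G.R ?v (C.F w' B') g" by blast
  have w': "w' = w" using i *(1,4) w by (auto simp: isomorphism_def bij_betw_def inj_on_def)
  have "g \<in> vhom f w ` carrier (vgroup \<Lambda> w)" using i w *(3) by (auto simp: isomorphism_def iso_def bij_betw_def)
  then obtain l where l: "l \<in> carrier (vgroup \<Lambda> w)" "g = vhom f w l" by blast
  have B': "B' \<in> C.L.P w" using *(2) w' by simp
  obtain n where n: "n \<in> carrier C.L.\<pi>" "C.L.L w n B = C.L.R w B' l"
    using C.L.lact_trans[OF B C.L.ract_closed[OF B' l(1)]] by blast
  have "C.G.L ?v (C.f_sharp n) (C.F w B) = C.G.L ?v m (C.F w B)"
    unfolding *(5) w' l(2) C.pmap_lact[OF n(1) B, symmetric] n(2) using C.pmap_ract[OF B' l(1)] .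
  then have "C.f_sharp n = m" using C.G.lact_free[OF _ m FB] C.induced_hom_in[OF n(1)] by blast
  then show "m \<in> covering_subgroup \<Lambda> q \<Gamma> p f" using n(1) by (auto simp: covering_subgroup_def)
qed

text \<open>An isomorphism is a factorisation whose own subgroup is the whole fundamental group, so
  the subgroups agree. Conversely the comparison of two charts for one subgroup is an
  isomorphism.\<close>

theorem covering_iso_iff:
  assumes c1: "pointed_covering \<Lambda>1 q1 \<Gamma> p \<rho>1" and c2: "pointed_covering \<Lambda>2 q2 \<Gamma> p \<rho>2"
  shows "covering_iso \<Gamma> \<Lambda>1 q1 \<rho>1 \<Lambda>2 q2 \<rho>2 \<longleftrightarrow>
    covering_subgroup \<Lambda>1 q1 \<Gamma> p \<rho>1 = covering_subgroup \<Lambda>2 q2 \<Gamma> p \<rho>2"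
proof
  assume "covering_iso \<Gamma> \<Lambda>1 q1 \<rho>1 \<Lambda>2 q2 \<rho>2"
  then obtain f where f: "isomorphism \<Lambda>1 \<Lambda>2 f" "map_point (vmap f) (emap f) q1 = q2"
    "same_pointed \<Lambda>1 q1 \<Gamma> (gcompose \<Lambda>1 \<Gamma> \<rho>2 f) \<rho>1" by (auto simp: covering_iso_def)
  have c: "pointed_covering \<Lambda>1 q1 \<Lambda>2 q2 f"
    using c1 c2 f(1,2) isomorphism_covering by (auto simp: pointed_covering_def)
  interpret F: pointed_covering_morphism \<Lambda>1 \<Lambda>2 f q1 q2 by (rule pointed_coveringD[OF c])
  have "covering_subgroup \<Lambda>1 q1 \<Lambda>2 q2 f = carrier (fundamental_group \<Lambda>2 q2)"
    using subgroup.subset[OF F.covering_subgroup_subgroup] isomorphism_covering_subgroup[OF c f(1)] by blast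
  then show "covering_subgroup \<Lambda>1 q1 \<Gamma> p \<rho>1 = covering_subgroup \<Lambda>2 q2 \<Gamma> p \<rho>2"
    using factors_through_subset[OF c1 c2 c f(3)] by (simp add: covering_subgroup_def[of \<Lambda>2])
next
  assume eq: "covering_subgroup \<Lambda>1 q1 \<Gamma> p \<rho>1 = covering_subgroup \<Lambda>2 q2 \<Gamma> p \<rho>2"
  obtain cv1 ce1 cv2 ce2 where "chart \<Lambda>1 \<Gamma> \<rho>1 q1 p (covering_subgroup \<Lambda>1 q1 \<Gamma> p \<rho>1) cv1 ce1"
    "chart \<Lambda>2 \<Gamma> \<rho>2 q2 p (covering_subgroup \<Lambda>2 q2 \<Gamma> p \<rho>2) cv2 ce2"
    using pointed_covering_morphism.chart_exists[OF pointed_coveringD] c1 c2 by metis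
  from comparison_exists[OF this] eq obtain \<phi> a b where c: "comparison_morphism \<Lambda>1 \<Lambda>2 \<Gamma> \<rho>1 \<rho>2 q1 q2 p
    (covering_subgroup \<Lambda>1 q1 \<Gamma> p \<rho>1) cv1 ce1 (covering_subgroup \<Lambda>2 q2 \<Gamma> p \<rho>2) cv2 ce2 \<phi> a b" by auto
  then show "covering_iso \<Gamma> \<Lambda>1 q1 \<rho>1 \<Lambda>2 q2 \<rho>2"
    unfolding covering_iso_def
    using comparison_morphism.isomorphism_phi[OF c eq] comparison_morphism.same_pointed_phi[OF c]
      comparison_morphism.base_phi[OF c] by blast
qed

section \<open>The Bass--Serre tree\<close>

context pgog
begin

abbreviation T where "T \<equiv> bs_tree \<Gamma> p"
abbreviation bv where "bv \<equiv> bs_vertex \<Gamma> p"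
abbreviation be where "be \<equiv> bs_edge \<Gamma> p"

lemma bs_vertex_ract: "bv v A = (v, R v A ` carrier (vgroup \<Gamma> v))"
  by (simp add: bs_vertex_def ract_def)

lemma bs_edge_ract: "be e A = (e, (\<lambda>k. R (src \<Gamma> e) A (einj \<Gamma> (bar \<Gamma> e) k)) ` carrier (egroup \<Gamma> e))"
  by (simp add: bs_edge_def ract_def)

lemma fst_bs [simp]: "fst (bv v A) = v" "fst (be e A) = e"
  by (simp_all add: bs_vertex_def bs_edge_def)

lemma bs_vertex_ract_eq [simp]:
  assumes "A \<in> P v" "g \<in> carrier (vgroup \<Gamma> v)"
  shows "bv v (R v A g) = bv v A"
proof -
  have v: "v \<in> verts \<Gamma>" using assms vpaths_vert by blast
  interpret V: group "vgroup \<Gamma> v" using v by (rule vgroup_group)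
  have "R v (R v A g) x \<in> R v A ` carrier (vgroup \<Gamma> v)" if "x \<in> carrier (vgroup \<Gamma> v)" for x
    using assms that by (simp flip: ract_mult)
  moreover have "R v A x \<in> R v (R v A g) ` carrier (vgroup \<Gamma> v)" if "x \<in> carrier (vgroup \<Gamma> v)" for x
    by (rule image_eqI[of _ _ "inv\<^bsub>vgroup \<Gamma> v\<^esub> g \<otimes>\<^bsub>vgroup \<Gamma> v\<^esub> x"]) (use assms that in \<open>simp_all flip: ract_mult\<close>)
  ultimately show ?thesis unfolding bs_vertex_ract by blast
qed

lemma bs_edge_ract_eq [simp]:
  assumes "e \<in> edges \<Gamma>" "A \<in> P (src \<Gamma> e)" "k \<in> carrier (egroup \<Gamma> e)"
  shows "be e (R (src \<Gamma> e) A (einj \<Gamma> (bar \<Gamma> e) k)) = be e A"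
proof -
  interpret E: group "egroup \<Gamma> e" using assms by (intro egroup_group)
  let ?R = "\<lambda>A k. R (src \<Gamma> e) A (einj \<Gamma> (bar \<Gamma> e) k)"
  have m: "?R (?R A x) y = ?R A (x \<otimes>\<^bsub>egroup \<Gamma> e\<^esub> y)" if "x \<in> carrier (egroup \<Gamma> e)" "y \<in> carrier (egroup \<Gamma> e)" for x y
    using assms that by (simp add: einj_bar_mult ract_mult)
  have "?R (?R A k) x \<in> ?R A ` carrier (egroup \<Gamma> e)" if "x \<in> carrier (egroup \<Gamma> e)" for x
    using assms that by (simp add: m)
  moreover have "?R A x \<in> ?R (?R A k) ` carrier (egroup \<Gamma> e)" if "x \<in> carrier (egroup \<Gamma> e)" for x
    by (rule image_eqI[of _ _ "inv\<^bsub>egroup \<Gamma> e\<^esub> k \<otimes>\<^bsub>egroup \<Gamma> e\<^esub> x"]) (use assms that in \<open>simp_all add: m\<close>)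
  ultimately show ?thesis unfolding bs_edge_ract by blast
qed

lemma bs_vertex_self: "A \<in> P v \<Longrightarrow> A \<in> snd (bv v A)"
  unfolding bs_vertex_ract using vpaths_vert ract_one vone_in by (metis image_eqI snd_conv)

lemma bs_edge_self: "e \<in> edges \<Gamma> \<Longrightarrow> A \<in> P (src \<Gamma> e) \<Longrightarrow> A \<in> snd (be e A)"
  unfolding bs_edge_ract snd_conv by (rule image_eqI[of _ _ "\<one>\<^bsub>egroup \<Gamma> e\<^esub>"]) simp_all

lemma bs_vertex_memD: "B \<in> snd (bv v A) \<Longrightarrow> \<exists>g\<in>carrier (vgroup \<Gamma> v). B = R v A g"
  unfolding bs_vertex_ract by auto

lemma bs_edge_memD: "B \<in> snd (be e A) \<Longrightarrow> \<exists>k\<in>carrier (egroup \<Gamma> e). B = R (src \<Gamma> e) A (einj \<Gamma> (bar \<Gamma> e) k)"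
  unfolding bs_edge_ract by auto

lemma bs_vertex_eqD: "bv v A = bv v B \<Longrightarrow> B \<in> P v \<Longrightarrow> \<exists>g\<in>carrier (vgroup \<Gamma> v). B = R v A g"
  using bs_vertex_self[of B v] bs_vertex_memD by metis

lemma bs_edge_eqD: "be e A = be e B \<Longrightarrow> e \<in> edges \<Gamma> \<Longrightarrow> B \<in> P (src \<Gamma> e) \<Longrightarrow>
    \<exists>k\<in>carrier (egroup \<Gamma> e). B = R (src \<Gamma> e) A (einj \<Gamma> (bar \<Gamma> e) k)"
  using bs_edge_self[of e B] bs_edge_memD by metis

lemma verts_T: "verts T = {bv v A | v A. A \<in> P v}"
proof -
  have "(v \<in> verts \<Gamma> \<and> A \<in> pclasses \<Gamma> p (Vertex v)) = (A \<in> P v)" for v A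
    using vpaths_vert[of A v] by (auto simp: vpaths_def)
  then show ?thesis by (simp add: bs_tree_def)
qed

lemma edges_T: "edges T = {be e A | e A. e \<in> edges \<Gamma> \<and> A \<in> P (src \<Gamma> e)}"
  by (simp add: bs_tree_def vpaths_def)

lemma bs_vertex_in [simp]: "A \<in> P v \<Longrightarrow> bv v A \<in> verts T"
  and bs_edge_in [simp]: "e \<in> edges \<Gamma> \<Longrightarrow> A \<in> P (src \<Gamma> e) \<Longrightarrow> be e A \<in> edges T"
  unfolding verts_T edges_T by blast+

lemma verts_TD:
  assumes "x \<in> verts T" "A \<in> snd x"
  shows "A \<in> P (fst x)" "x = bv (fst x) A"
proof -
  obtain v B where x: "x = bv v B" "B \<in> P v" using assms(1) unfolding verts_T by blast
  then obtain g where "g \<in> carrier (vgroup \<Gamma> v)" "A = R v B g" using assms(2) bs_vertex_memD by blast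
  then show "A \<in> P (fst x)" "x = bv (fst x) A" using x by simp_all
qed

lemma edges_TD:
  assumes "y \<in> edges T" "A \<in> snd y"
  shows "fst y \<in> edges \<Gamma>" "A \<in> P (src \<Gamma> (fst y))" "y = be (fst y) A"
proof -
  obtain e B where y: "y = be e B" "e \<in> edges \<Gamma>" "B \<in> P (src \<Gamma> e)" using assms(1) unfolding edges_T by blast
  then obtain k where "k \<in> carrier (egroup \<Gamma> e)" "A = R (src \<Gamma> e) B (einj \<Gamma> (bar \<Gamma> e) k)" using assms(2) bs_edge_memD by blast
  then show "fst y \<in> edges \<Gamma>" "A \<in> P (src \<Gamma> (fst y))" "y = be (fst y) A" using y by simp_all
qed

lemma bar_T [simp]:
  assumes "e \<in> edges \<Gamma>" "A \<in> P (src \<Gamma> e)"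
  shows "bar T (be e A) = be (bar \<Gamma> e) (X e A)"
proof -
  have "X e (R (src \<Gamma> e) A (einj \<Gamma> (bar \<Gamma> e) k)) = R (tgt \<Gamma> e) (X e A) (einj \<Gamma> e k)" if "k \<in> carrier (egroup \<Gamma> e)" for k
    using extend_ract assms that by simp
  then have "X e ` (\<lambda>k. R (src \<Gamma> e) A (einj \<Gamma> (bar \<Gamma> e) k)) ` carrier (egroup \<Gamma> e)
    = (\<lambda>k. R (tgt \<Gamma> e) (X e A) (einj \<Gamma> e k)) ` carrier (egroup \<Gamma> e)"
    unfolding image_image by (rule image_cong[OF HOL.refl])
  then show ?thesis using assms by (simp add: bs_tree_def bs_edge_ract)
qed

text \<open>Elements of the edge coset differ by the edge group, which after extension lies in the
  vertex group at the target; hence all sets in the defining union are equal.\<close>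

lemma tgt_T [simp]:
  assumes "e \<in> edges \<Gamma>" "A \<in> P (src \<Gamma> e)"
  shows "tgt T (be e A) = bv (tgt \<Gamma> e) (X e A)"
proof -
  have "snd (bv (tgt \<Gamma> e) (X e B)) = snd (bv (tgt \<Gamma> e) (X e A))" if B: "B \<in> snd (be e A)" for B
  proof -
    obtain k where "k \<in> carrier (egroup \<Gamma> e)" "B = R (src \<Gamma> e) A (einj \<Gamma> (bar \<Gamma> e) k)" using bs_edge_memD[OF B] by blast
    then show ?thesis using extend_ract assms by simp
  qed
  then have "(\<Union>B\<in>snd (be e A). snd (bv (tgt \<Gamma> e) (X e B))) = snd (bv (tgt \<Gamma> e) (X e A))"
    using bs_edge_self[OF assms] by (intro UN_constant_eq ballI)
  then show ?thesis by (simp add: bs_tree_def case_prod_unfold prod_eq_iff)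
qed

lemma src_T [simp]: "e \<in> edges \<Gamma> \<Longrightarrow> A \<in> P (src \<Gamma> e) \<Longrightarrow> src T (be e A) = bv (src \<Gamma> e) A"
  unfolding src_def[of T] by simp

lemma vgroup_T [simp]: "vgroup T x = singleton_group ()" "egroup T y = singleton_group ()" "einj T y k = ()"
  by (simp_all add: bs_tree_def)

text \<open>Read step by step, a path to \<open>v\<close> traces an edge path in the tree starting
  at the vertex of the root; right multiplication does not move the vertex.\<close>

lemma root_connected:
  assumes root: "root_path \<Gamma> p u \<beta>" and "A \<in> P v"
  shows "(bv u \<beta>, bv v A) \<in> ((\<lambda>e. (src T e, tgt T e)) ` edges T)\<^sup>*"
  using root _ _ _ assms(2)
proof (rule vpaths_induct)
  fix e A assume e: "e \<in> edges \<Gamma>" "A \<in> P (src \<Gamma> e)"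
    and IH: "(bv u \<beta>, bv (src \<Gamma> e) A) \<in> ((\<lambda>e. (src T e, tgt T e)) ` edges T)\<^sup>*"
  have "(bv (src \<Gamma> e) A, bv (tgt \<Gamma> e) (X e A)) \<in> (\<lambda>e. (src T e, tgt T e)) ` edges T"
    by (rule image_eqI[of _ _ "be e A"]) (use e in simp_all)
  then show "(bv u \<beta>, bv (tgt \<Gamma> e) (X e A)) \<in> ((\<lambda>e. (src T e, tgt T e)) ` edges T)\<^sup>*"
    using IH by (rule rtrancl_into_rtrancl[rotated])
qed simp_all

lemma bar_T_in:
  assumes "y \<in> edges T"
  shows "bar T y \<in> edges T" "bar T (bar T y) = y" "bar T y \<noteq> y" "tgt T y \<in> verts T" "fst (bar T y) = bar \<Gamma> (fst y)"
    "fst (tgt T y) = tgt \<Gamma> (fst y)" "fst (src T y) = src \<Gamma> (fst y)" "fst y \<in> edges \<Gamma>"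
proof -
  obtain e A where y: "y = be e A" "e \<in> edges \<Gamma>" "A \<in> P (src \<Gamma> e)" using assms unfolding edges_T by blast
  show "bar T y \<in> edges T" "bar T (bar T y) = y" "tgt T y \<in> verts T" "fst (bar T y) = bar \<Gamma> (fst y)"
    "fst (tgt T y) = tgt \<Gamma> (fst y)" "fst (src T y) = src \<Gamma> (fst y)" "fst y \<in> edges \<Gamma>"
    using y by simp_all
  then show "bar T y \<noteq> y" using bar_neq by metis
qed

lemma gog_T: "graph_of_groups T"
  unfolding graph_of_groups_def
proof (intro conjI ballI)
  show "verts T \<noteq> {}" using root_exists root_in unfolding verts_T by blast
  fix x y assume x: "x \<in> verts T" and y: "y \<in> verts T"
  let ?S = "(\<lambda>e. (src T e, tgt T e)) ` edges T"
  have "sym ?S"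
  proof (rule symI)
    fix a b assume "(a, b) \<in> ?S"
    then obtain e where e: "e \<in> edges T" "a = src T e" "b = tgt T e" by auto
    show "(b, a) \<in> ?S"
      by (rule image_eqI[of _ _ "bar T e"]) (use e bar_T_in[OF e(1)] in \<open>simp_all add: src_def[of T]\<close>)
  qed
  then have s: "sym (?S\<^sup>*)" by (rule sym_rtrancl)
  obtain u \<beta> where root: "root_path \<Gamma> p u \<beta>" using root_exists by blast
  have "(bv u \<beta>, x) \<in> ?S\<^sup>*" "(bv u \<beta>, y) \<in> ?S\<^sup>*" using root_connected[OF root] x y unfolding verts_T by auto
  then show "(x, y) \<in> ?S\<^sup>*" using s by (meson symD rtrancl_trans)
next
  fix y assume y: "y \<in> edges T"
  show "bar T y \<in> edges T" "bar T (bar T y) = y" "bar T y \<noteq> y" "tgt T y \<in> verts T" using bar_T_in[OF y] by simp_all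
  show "group (egroup T y)" "egroup T (bar T y) = egroup T y" by simp_all
  show "einj T y \<in> mon (egroup T y) (vgroup T (tgt T y))" by (simp add: mon_def hom_def singleton_group_def)
qed simp

sublocale T: gog T by unfold_locales (rule gog_T)

text \<open>For an interior base point, the lifts of its two descriptions must be descriptions of
  one point of the tree; \<open>initial_seg_bar\<close> says that the lifted edges are reverse to
  each other.\<close>

lemma bs_base_in: "bs_base \<Gamma> p \<in> points T"
  using p_in
proof (cases rule: pointsE)
  case (Vertex v)
  then have "hclass \<Gamma> p p [] \<in> P v" using p_in by (auto simp: vpaths_def)
  then have "Vertex (bv v (hclass \<Gamma> p p [])) \<in> points T" by simp
  moreover have "bs_base \<Gamma> p = Vertex (bv v (hclass \<Gamma> p p []))" using Vertex by (simp add: bs_base_def)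
  ultimately show ?thesis by metis
next
  case (Edge e t)
  have i: "initial_seg \<Gamma> p e t \<in> P (src \<Gamma> e)" using initial_seg_in Edge by blast
  have pI: "p = Interior {(e, t), (bar \<Gamma> e, 1 - t)}" using Edge by (simp add: edge_point_def)
  have "bs_base \<Gamma> p = Interior ((\<lambda>(e, t). (be e (initial_seg \<Gamma> p e t), t)) ` {(e, t), (bar \<Gamma> e, 1 - t)})"
    unfolding bs_base_def by (subst (1) pI) simp
  also have "\<dots> = edge_point T (be e (initial_seg \<Gamma> p e t)) t"
    using Edge(1-3) i initial_seg_bar[OF Edge] by (simp add: edge_point_def[of T])
  finally show ?thesis using T.edge_point_in[of "be e (initial_seg \<Gamma> p e t)" t] i Edge(1-3) by simp
qed

lemma bs_base_Vertex: "bs_base \<Gamma> p = Vertex x \<Longrightarrow> p = Vertex (fst x) \<and> x = bv (fst x) (hclass \<Gamma> p p [])"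
  by (cases p) (auto simp: bs_base_def bs_vertex_def)

lemma bs_base_Interior:
  assumes "bs_base \<Gamma> p = Interior S" "(y, t) \<in> S"
  shows "fst y \<in> edges \<Gamma>" "0 < t" "t < 1" "p = edge_point \<Gamma> (fst y) t" "y = be (fst y) (initial_seg \<Gamma> p (fst y) t)"
proof -
  obtain S0 where p: "p = Interior S0" using assms(1) by (cases p) (auto simp: bs_base_def)
  then obtain e where e: "(e, t) \<in> S0" "y = be e (initial_seg \<Gamma> p e t)" using assms by (auto simp: bs_base_def)
  note * = interior_pointD[OF p_in p e(1)]
  show "fst y \<in> edges \<Gamma>" "0 < t" "t < 1" "p = edge_point \<Gamma> (fst y) t" "y = be (fst y) (initial_seg \<Gamma> p (fst y) t)"
    unfolding e(2) fst_bs by (rule * HOL.refl)+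
qed

text \<open>The base point prescribes a class at a vertex or at the two edges through it. The
  prescription on edges is consistent because an edge contains the base point with only one
  parameter, and it is preserved by reversal.\<close>

lemma path_section_exists: "\<exists>vs es. path_section \<Gamma> p vs es"
proof -
  let ?QV = "\<lambda>x A. A \<in> snd x \<and> (bs_base \<Gamma> p = Vertex x \<longrightarrow> A = hclass \<Gamma> p p [])"
  have "\<exists>A. ?QV x A" if x: "x \<in> verts T" for x
  proof (cases "bs_base \<Gamma> p = Vertex x")
    case True
    then have "p = Vertex (fst x)" "x = bv (fst x) (hclass \<Gamma> p p [])" using bs_base_Vertex by auto
    moreover have "hclass \<Gamma> p p [] \<in> P (fst x)" using calculation(1) p_in by (auto simp: vpaths_def)
    ultimately have "hclass \<Gamma> p p [] \<in> snd x" using bs_vertex_self by metis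
    then show ?thesis by blast
  next
    case False
    obtain v A where "x = bv v A" "A \<in> P v" using x unfolding verts_T by blast
    then show ?thesis using bs_vertex_self False by blast
  qed
  then obtain vs where vs: "\<And>x. x \<in> verts T \<Longrightarrow> ?QV x (vs x)" by metis
  let ?QE = "\<lambda>y A. A \<in> snd y \<and> (\<forall>S t. bs_base \<Gamma> p = Interior S \<and> (y, t) \<in> S \<longrightarrow> A = initial_seg \<Gamma> p (fst y) t)"
  obtain es where es: "\<And>y. y \<in> edges T \<Longrightarrow> ?QE y (es y)" and es_bar: "\<And>y. y \<in> edges T \<Longrightarrow> es (bar T y) = X (fst y) (es y)"
  proof (rule T.bar_equivariant_choice[of ?QE "\<lambda>y. X (fst y)"])
    fix y assume y: "y \<in> edges T"
    show "\<exists>A. ?QE y A"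
    proof (cases "\<exists>S t. bs_base \<Gamma> p = Interior S \<and> (y, t) \<in> S")
      case True
      then obtain S t where St: "bs_base \<Gamma> p = Interior S" "(y, t) \<in> S" by blast
      note * = bs_base_Interior[OF St]
      have "initial_seg \<Gamma> p (fst y) t \<in> snd y" using bs_edge_self[OF *(1) initial_seg_in[OF *(1-4)]] *(5) by simp
      moreover have "t' = t" if "bs_base \<Gamma> p = Interior S'" "(y, t') \<in> S'" for S' t'
        using bs_base_Interior[OF that] * edge_point_inj[of "fst y" t t'] by simp
      ultimately show ?thesis by metis
    next
      case False
      obtain e A where "y = be e A" "e \<in> edges \<Gamma>" "A \<in> P (src \<Gamma> e)" using y unfolding edges_T by blast
      then show ?thesis using bs_edge_self False by blast
    qed
  next
    fix y A assume y: "y \<in> edges T" and A: "?QE y A"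
    note * = edges_TD[OF y conjunct1[OF A]]
    have bar: "bar T y = be (bar \<Gamma> (fst y)) (X (fst y) A)" using bar_T[OF *(1,2)] *(3) by simp
    have "X (fst y) A \<in> snd (bar T y)" unfolding bar using *(1,2) by (intro bs_edge_self) simp_all
    moreover have "X (fst y) A = initial_seg \<Gamma> p (fst (bar T y)) t" if St: "bs_base \<Gamma> p = Interior S" "(bar T y, t) \<in> S" for S t
    proof -
      note b = bs_base_Interior[OF St]
      have f: "fst (bar T y) = bar \<Gamma> (fst y)" using bar by simp
      have q: "bs_base \<Gamma> p = edge_point T (bar T y) t" "0 < t" "t < 1"
        using T.interior_pointD[OF bs_base_in St] by simp_all
      then have "bs_base \<Gamma> p = edge_point T y (1 - t)" using T.edge_point_bar[OF y, of "1 - t"] by simp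
      then have "A = initial_seg \<Gamma> p (fst y) (1 - t)"
        using A q(2,3) by (simp add: edge_point_def)
      moreover have "p = edge_point \<Gamma> (fst y) (1 - t)" using b(4) edge_point_bar[OF *(1), of "1 - t"] unfolding f by simp
      ultimately show ?thesis using initial_seg_bar[OF *(1), of "1 - t"] q(2,3) f by simp
    qed
    moreover have "X (fst (bar T y)) (X (fst y) A) = A" using *(1,2) bar by simp
    ultimately show "?QE (bar T y) (X (fst y) A) \<and> X (fst (bar T y)) (X (fst y) A) = A" by blast
  qed blast
  have "path_section \<Gamma> p vs es"
    unfolding path_section_def
    using vs es es_bar bs_base_in T.interior_pointD[OF bs_base_in] by auto
  then show ?thesis by blast
qed

end

section \<open>The natural projection of the tree\<close>

locale sectioned = pgog \<Gamma> p for \<Gamma> :: "('v, 'e, 'g, 'h) graph_of_groups" and p +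
  fixes vs es
  assumes path_sec: "path_section \<Gamma> p vs es"
begin

lemma vs: "x \<in> verts T \<Longrightarrow> vs x \<in> P (fst x)" "x \<in> verts T \<Longrightarrow> bv (fst x) (vs x) = x"
  using verts_TD[of x "vs x"] path_sec by (auto simp: path_section_def)

lemma es: "y \<in> edges T \<Longrightarrow> es y \<in> P (src \<Gamma> (fst y))" "y \<in> edges T \<Longrightarrow> be (fst y) (es y) = y"
  using edges_TD[of y "es y"] path_sec by (auto simp: path_section_def)

lemma es_bar: "y \<in> edges T \<Longrightarrow> es (bar T y) = X (fst y) (es y)"
  using path_sec by (simp add: path_section_def)

lemma vs_base: "bs_base \<Gamma> p = Vertex x \<Longrightarrow> vs x = hclass \<Gamma> p p []"
  and es_base: "bs_base \<Gamma> p = Interior S \<Longrightarrow> (y, t) \<in> S \<Longrightarrow> es y = initial_seg \<Gamma> p (fst y) t"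
  using path_sec unfolding path_section_def by blast+

lemma es_bar_in: "y \<in> edges T \<Longrightarrow> es (bar T y) \<in> P (tgt \<Gamma> (fst y))"
  using es(1)[of "bar T y"] bar_T_in[of y] by simp

lemma bv_es_bar: "y \<in> edges T \<Longrightarrow> bv (tgt \<Gamma> (fst y)) (es (bar T y)) = tgt T y"
  using tgt_T[of "fst y" "es y"] es[of y] es_bar[of y] bar_T_in[of y] by simp

text \<open>Both classes represent the same vertex of the tree, which gives \<open>g\<close>, and
  \<open>ract_free\<close> makes it unique. This is what gives the definite description in
  \<open>bs_projection\<close> its meaning.\<close>

lemma twist_ex1:
  assumes "y \<in> edges T"
  shows "\<exists>!g. g \<in> carrier (vgroup \<Gamma> (tgt \<Gamma> (fst y))) \<and> R (tgt \<Gamma> (fst y)) (vs (tgt T y)) g = es (bar T y)"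
proof -
  have x: "tgt T y \<in> verts T" "fst (tgt T y) = tgt \<Gamma> (fst y)" using bar_T_in[OF assms] by auto
  have "bv (tgt \<Gamma> (fst y)) (vs (tgt T y)) = bv (tgt \<Gamma> (fst y)) (es (bar T y))"
    using vs(2)[OF x(1)] bv_es_bar[OF assms] x by simp
  from bs_vertex_eqD[OF this es_bar_in[OF assms]] show ?thesis
    using ract_free[OF vs(1)[OF x(1)]] x by auto
qed

abbreviation proj where "proj \<equiv> bs_projection \<Gamma> p vs es"

lemma proj_simps [simp]: "vmap proj = fst" "emap proj = fst" "vhom proj x u = \<one>\<^bsub>vgroup \<Gamma> (fst x)\<^esub>"
  "ehom proj y u = \<one>\<^bsub>egroup \<Gamma> (fst y)\<^esub>"
  by (simp_all add: bs_projection_def)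

lemma proj_twist:
  assumes "y \<in> edges T"
  shows "twist proj y \<in> carrier (vgroup \<Gamma> (tgt \<Gamma> (fst y)))" "R (tgt \<Gamma> (fst y)) (vs (tgt T y)) (twist proj y) = es (bar T y)"
  using theI'[OF twist_ex1[OF assms]] by (simp_all add: bs_projection_def ract_def)

lemma morphism_proj: "morphism T \<Gamma> proj"
  unfolding morphism_def
proof (intro conjI ballI)
  fix x assume x: "x \<in> verts T"
  then have v: "fst x \<in> verts \<Gamma>" using vs(1) vpaths_vert by blast
  then show "vmap proj x \<in> verts \<Gamma>" by simp
  interpret V: group "vgroup \<Gamma> (fst x)" using v by (rule vgroup_group)
  show "vhom proj x \<in> hom (vgroup T x) (vgroup \<Gamma> (vmap proj x))" using v by (auto intro!: homI)
next
  fix y assume y: "y \<in> edges T"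
  note * = bar_T_in[OF y]
  interpret V: group "vgroup \<Gamma> (tgt \<Gamma> (fst y))" using * by (intro vgroup_group) simp
  interpret E: group "egroup \<Gamma> (fst y)" using * by (intro egroup_group)
  show "emap proj y \<in> edges \<Gamma>" "emap proj (bar T y) = bar \<Gamma> (emap proj y)" "tgt \<Gamma> (emap proj y) = vmap proj (tgt T y)"
    using * by simp_all
  show "ehom proj y \<in> hom (egroup T y) (egroup \<Gamma> (emap proj y))" using * by (auto intro!: homI)
  show "twist proj y \<in> carrier (vgroup \<Gamma> (tgt \<Gamma> (emap proj y)))" using proj_twist[OF y] by simp
  fix h assume "h \<in> carrier (egroup T y)"
  show "ehom proj (bar T y) h = ehom proj y h" using * by simp
  show "vhom proj (tgt T y) (einj T y h) = twist proj y \<otimes>\<^bsub>vgroup \<Gamma> (tgt \<Gamma> (emap proj y))\<^esub> einj \<Gamma> (emap proj y) (ehom proj y h)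
     \<otimes>\<^bsub>vgroup \<Gamma> (tgt \<Gamma> (emap proj y))\<^esub> inv\<^bsub>vgroup \<Gamma> (tgt \<Gamma> (emap proj y))\<^esub> twist proj y"
    using * proj_twist(1)[OF y] by simp
qed

lemma base_proj: "map_point (vmap proj) (emap proj) (bs_base \<Gamma> p) = p"
  unfolding proj_simps
  by (cases p) (auto simp: bs_base_def bs_vertex_def bs_edge_def image_image case_prod_unfold)

text \<open>For the trivial subgroup, double cosets are just cosets of the local groups, and these
  are the vertices and edges of the tree. Freeness of right multiplication makes the stabilising
  factors trivial, in agreement with the trivial local groups.\<close>

lemma chart_T: "chart T \<Gamma> proj (bs_base \<Gamma> p) p {\<one>\<^bsub>\<pi>\<^esub>} vs es"
proof (intro chart.intro chart_axioms.intro pointed_morphism.intro pointed_morphism_axioms.intro gog_morphism.intro gog_morphism_axioms.intro)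
  show "gog T" "gog \<Gamma>" "morphism T \<Gamma> proj" "pgog \<Gamma> p" by (intro T.gog_axioms gog_axioms morphism_proj pgog_axioms)+
  show "pgog T (bs_base \<Gamma> p)" by unfold_locales (rule bs_base_in)
  show "map_point (vmap proj) (emap proj) (bs_base \<Gamma> p) = p" by (rule base_proj)
  show "subgroup {\<one>\<^bsub>\<pi>\<^esub>} \<pi>" by (rule pi.triv_subgroup)
  show "vs x \<in> P (vmap proj x)" if "x \<in> verts T" for x using vs that by simp
  show "es y \<in> P (vmap proj (src T y))" if "y \<in> edges T" for y using es(1)[OF that] bar_T_in[OF that] by simp
  show "es (bar T y) = X (emap proj y) (es y)" if "y \<in> edges T" for y using es_bar that by simp
  show "\<exists>x\<in>verts T. \<exists>h\<in>{\<one>\<^bsub>\<pi>\<^esub>}. \<exists>g\<in>carrier (vgroup \<Gamma> v). vmap proj x = v \<and> A = L v h (R v (vs x) g)" if A: "A \<in> P v" for A v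
  proof -
    have x: "bv v A \<in> verts T" using A by simp
    have "\<exists>g\<in>carrier (vgroup \<Gamma> v). A = R v (vs (bv v A)) g" using bs_vertex_eqD[OF _ A, of "vs (bv v A)"] vs(2)[OF x] by simp
    then show ?thesis using x vs(1)[OF x] by (intro bexI[of _ "bv v A"]) auto
  qed
  show "x' = x" if "x \<in> verts T" "x' \<in> verts T" "vmap proj x' = vmap proj x" "h \<in> {\<one>\<^bsub>\<pi>\<^esub>}" "g \<in> carrier (vgroup \<Gamma> (vmap proj x))"
      "vs x' = L (vmap proj x) h (R (vmap proj x) (vs x) g)" for x x' h g
  proof -
    have "vs x' = R (fst x) (vs x) g" using that vs(1)[OF that(1)] by simp
    then have "bv (fst x') (vs x') = bv (fst x) (vs x)" using that vs(1)[OF that(1)] by simp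
    then show ?thesis unfolding vs(2)[OF that(1)] vs(2)[OF that(2)] .
  qed
  show "inj_on (vhom proj x) (carrier (vgroup T x))" "inj_on (ehom proj y) (carrier (egroup T y))" for x y by simp_all
  show "\<exists>h\<in>{\<one>\<^bsub>\<pi>\<^esub>}. L (vmap proj x) h (vs x) = R (vmap proj x) (vs x) (vhom proj x l)" if "x \<in> verts T" for x l
    using vs(1)[OF that] by simp
  show "\<exists>l\<in>carrier (vgroup T x). g = vhom proj x l" if "x \<in> verts T" "h \<in> {\<one>\<^bsub>\<pi>\<^esub>}" "g \<in> carrier (vgroup \<Gamma> (vmap proj x))"
      "L (vmap proj x) h (vs x) = R (vmap proj x) (vs x) g" for x h g
    using ract_free[OF vs(1)[OF that(1)], of g "\<one>\<^bsub>vgroup \<Gamma> (fst x)\<^esub>"] that vs(1)[OF that(1)] vpaths_vert[OF vs(1)[OF that(1)]] by simp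
  show "\<exists>y\<in>edges T. \<exists>h\<in>{\<one>\<^bsub>\<pi>\<^esub>}. \<exists>k\<in>carrier (egroup \<Gamma> e). emap proj y = e \<and>
      A = L (src \<Gamma> e) h (R (src \<Gamma> e) (es y) (einj \<Gamma> (bar \<Gamma> e) k))" if e: "e \<in> edges \<Gamma>" and A: "A \<in> P (src \<Gamma> e)" for e A
  proof -
    have y: "be e A \<in> edges T" using e A by simp
    have "\<exists>k\<in>carrier (egroup \<Gamma> e). A = R (src \<Gamma> e) (es (be e A)) (einj \<Gamma> (bar \<Gamma> e) k)"
      using bs_edge_eqD[OF _ e A, of "es (be e A)"] es(2)[OF y] by simp
    then show ?thesis using y es(1)[OF y] e by (intro bexI[of _ "be e A"]) auto
  qed
  have srcT: "vmap proj (src T y) = src \<Gamma> (fst y)" if "y \<in> edges T" for y using bar_T_in[OF that] by simp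
  show "y' = y" if "y \<in> edges T" "y' \<in> edges T" "emap proj y' = emap proj y" "h \<in> {\<one>\<^bsub>\<pi>\<^esub>}" "k \<in> carrier (egroup \<Gamma> (emap proj y))"
      "es y' = L (vmap proj (src T y)) h (R (vmap proj (src T y)) (es y) (einj \<Gamma> (bar \<Gamma> (emap proj y)) k))" for y y' h k
  proof -
    have "es y' = R (src \<Gamma> (fst y)) (es y) (einj \<Gamma> (bar \<Gamma> (fst y)) k)" using that es(1)[OF that(1)] srcT[OF that(1)] bar_T_in[OF that(1)] by simp
    then have "be (fst y') (es y') = be (fst y) (es y)" using that es(1)[OF that(1)] bar_T_in[OF that(1)] by simp
    then show ?thesis unfolding es(2)[OF that(1)] es(2)[OF that(2)] .
  qed
  show "\<exists>h\<in>{\<one>\<^bsub>\<pi>\<^esub>}. L (vmap proj (src T y)) h (es y) = R (vmap proj (src T y)) (es y) (einj \<Gamma> (bar \<Gamma> (emap proj y)) (ehom proj y j))"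
    if "y \<in> edges T" for y j using es(1)[OF that] srcT[OF that] bar_T_in[OF that] by simp
  show "\<exists>j\<in>carrier (egroup T y). k = ehom proj y j" if "y \<in> edges T" "h \<in> {\<one>\<^bsub>\<pi>\<^esub>}" "k \<in> carrier (egroup \<Gamma> (emap proj y))"
      "L (vmap proj (src T y)) h (es y) = R (vmap proj (src T y)) (es y) (einj \<Gamma> (bar \<Gamma> (emap proj y)) k)" for y h k
  proof -
    note * = bar_T_in[OF that(1)]
    have "einj \<Gamma> (bar \<Gamma> (fst y)) k = einj \<Gamma> (bar \<Gamma> (fst y)) \<one>\<^bsub>egroup \<Gamma> (fst y)\<^esub>"
      using ract_free[OF es(1)[OF that(1)], of "einj \<Gamma> (bar \<Gamma> (fst y)) k" "\<one>\<^bsub>vgroup \<Gamma> (src \<Gamma> (fst y))\<^esub>"]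
        that es(1)[OF that(1)] * srcT[OF that(1)] by simp
    then show ?thesis using einj_bar_eq[of "fst y" k "\<one>\<^bsub>egroup \<Gamma> (fst y)\<^esub>"] that(3) * by simp
  qed
  show "\<exists>h\<in>{\<one>\<^bsub>\<pi>\<^esub>}. L (vmap proj (tgt T y)) h (R (vmap proj (tgt T y)) (vs (tgt T y)) (twist proj y)) = es (bar T y)"
    if "y \<in> edges T" for y
    using proj_twist[OF that] es_bar_in[OF that] bar_T_in[OF that] by simp
  show "vs x = hclass \<Gamma> p p []" if "bs_base \<Gamma> p = Vertex x" for x using vs_base that by simp
  show "es y = initial_seg \<Gamma> p (emap proj y) t" if "y \<in> edges T" "0 < t" "t < 1" "bs_base \<Gamma> p = edge_point T y t" for y t
    using es_base[of "{(y, t), (bar T y, 1 - t)}" y t] that by (simp add: edge_point_def)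
qed

end

section \<open>Orbits in the tree\<close>

context pgog
begin

abbreviation VA where "VA \<equiv> bs_vact \<Gamma> p"
abbreviation EA where "EA \<equiv> bs_eact \<Gamma> p"

lemma bs_vact_bs [simp]:
  assumes "h \<in> carrier \<pi>" "A \<in> P v"
  shows "VA h (bv v A) = bv v (L v h A)"
proof -
  have "L v h ` R v A ` carrier (vgroup \<Gamma> v) = R v (L v h A) ` carrier (vgroup \<Gamma> v)"
    unfolding image_image by (rule image_cong[OF HOL.refl]) (use assms in \<open>simp add: lact_ract\<close>)
  then show ?thesis by (simp add: bs_vact_def bs_vertex_ract lact_def[abs_def])
qed

lemma bs_eact_bs [simp]:
  assumes "h \<in> carrier \<pi>" "e \<in> edges \<Gamma>" "A \<in> P (src \<Gamma> e)"
  shows "EA h (be e A) = be e (L (src \<Gamma> e) h A)"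
proof -
  let ?R = "\<lambda>A k. R (src \<Gamma> e) A (einj \<Gamma> (bar \<Gamma> e) k)"
  have "L (src \<Gamma> e) h ` ?R A ` carrier (egroup \<Gamma> e) = ?R (L (src \<Gamma> e) h A) ` carrier (egroup \<Gamma> e)"
    unfolding image_image by (rule image_cong[OF HOL.refl]) (use assms in \<open>simp add: lact_ract\<close>)
  then show ?thesis by (simp add: bs_eact_def bs_edge_ract lact_def[abs_def])
qed

lemma fst_act [simp]: "fst (VA h x) = fst x" "fst (EA h y) = fst y"
  by (simp_all add: bs_vact_def bs_eact_def)

lemma vact_in [simp]: "h \<in> carrier \<pi> \<Longrightarrow> x \<in> verts T \<Longrightarrow> VA h x \<in> verts T"
  and eact_in [simp]: "h \<in> carrier \<pi> \<Longrightarrow> y \<in> edges T \<Longrightarrow> EA h y \<in> edges T"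
  unfolding verts_T edges_T by auto (metis lact_closed)+

lemma vact_one [simp]: "x \<in> verts T \<Longrightarrow> VA \<one>\<^bsub>\<pi>\<^esub> x = x"
  and eact_one [simp]: "y \<in> edges T \<Longrightarrow> EA \<one>\<^bsub>\<pi>\<^esub> y = y"
  unfolding verts_T edges_T by auto

lemma vact_mult: "\<lbrakk>h \<in> carrier \<pi>; h' \<in> carrier \<pi>; x \<in> verts T\<rbrakk> \<Longrightarrow> VA (h \<otimes>\<^bsub>\<pi>\<^esub> h') x = VA h (VA h' x)"
  and eact_mult: "\<lbrakk>h \<in> carrier \<pi>; h' \<in> carrier \<pi>; y \<in> edges T\<rbrakk> \<Longrightarrow> EA (h \<otimes>\<^bsub>\<pi>\<^esub> h') y = EA h (EA h' y)"
  unfolding verts_T edges_T by (auto simp: lact_mult)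

lemma vact_inv [simp]:
  assumes "h \<in> carrier \<pi>" "x \<in> verts T"
  shows "VA (inv\<^bsub>\<pi>\<^esub> h) (VA h x) = x"
  using assms by (simp flip: vact_mult)

lemma eact_inv [simp]:
  assumes "h \<in> carrier \<pi>" "y \<in> edges T"
  shows "EA (inv\<^bsub>\<pi>\<^esub> h) (EA h y) = y"
  using assms by (simp flip: eact_mult)

lemma bar_T_eact: "h \<in> carrier \<pi> \<Longrightarrow> y \<in> edges T \<Longrightarrow> bar T (EA h y) = EA h (bar T y)"
  and tgt_T_eact: "h \<in> carrier \<pi> \<Longrightarrow> y \<in> edges T \<Longrightarrow> tgt T (EA h y) = VA h (tgt T y)"
  unfolding edges_T by (auto simp: extend_lact)

end

section \<open>Orbits of a subgroup and liftings\<close>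

context pgog_subgroup
begin

abbreviation VO where "VO \<equiv> vorbit \<Gamma> p H"
abbreviation EO where "EO \<equiv> eorbit \<Gamma> p H"

lemma vorbit_self: "x \<in> verts T \<Longrightarrow> x \<in> VO x"
  unfolding vorbit_def by (rule image_eqI[of _ _ "\<one>\<^bsub>\<pi>\<^esub>"]) simp_all

lemma eorbit_self: "y \<in> edges T \<Longrightarrow> y \<in> EO y"
  unfolding eorbit_def by (rule image_eqI[of _ _ "\<one>\<^bsub>\<pi>\<^esub>"]) simp_all

lemma vorbit_vact [simp]:
  assumes "h \<in> H" "x \<in> verts T"
  shows "VO (VA h x) = VO x"
proof -
  have "VA k (VA h x) \<in> VO x" if "k \<in> H" for k
    unfolding vorbit_def by (rule image_eqI[of _ _ "k \<otimes>\<^bsub>\<pi>\<^esub> h"]) (use that assms in \<open>simp_all add: vact_mult\<close>)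
  moreover have "VA k x \<in> VO (VA h x)" if "k \<in> H" for k
    unfolding vorbit_def by (rule image_eqI[of _ _ "k \<otimes>\<^bsub>\<pi>\<^esub> inv\<^bsub>\<pi>\<^esub> h"]) (use that assms in \<open>simp_all add: vact_mult\<close>)
  ultimately show ?thesis unfolding vorbit_def by blast
qed

lemma eorbit_eact [simp]:
  assumes "h \<in> H" "y \<in> edges T"
  shows "EO (EA h y) = EO y"
proof -
  have "EA k (EA h y) \<in> EO y" if "k \<in> H" for k
    unfolding eorbit_def by (rule image_eqI[of _ _ "k \<otimes>\<^bsub>\<pi>\<^esub> h"]) (use that assms in \<open>simp_all add: eact_mult\<close>)
  moreover have "EA k y \<in> EO (EA h y)" if "k \<in> H" for k
    unfolding eorbit_def by (rule image_eqI[of _ _ "k \<otimes>\<^bsub>\<pi>\<^esub> inv\<^bsub>\<pi>\<^esub> h"]) (use that assms in \<open>simp_all add: eact_mult\<close>)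
  ultimately show ?thesis unfolding eorbit_def by blast
qed

lemma vorbitD: "x' \<in> VO x \<Longrightarrow> x \<in> verts T \<Longrightarrow> x' \<in> verts T \<and> fst x' = fst x \<and> VO x' = VO x \<and> (\<exists>h\<in>H. VA h x' = x)"
proof -
  assume "x' \<in> VO x" and x: "x \<in> verts T"
  then obtain h where h: "h \<in> H" "x' = VA h x" unfolding vorbit_def by blast
  then show ?thesis using x by (auto intro!: bexI[of _ "inv\<^bsub>\<pi>\<^esub> h"])
qed

lemma eorbitD: "y' \<in> EO y \<Longrightarrow> y \<in> edges T \<Longrightarrow> y' \<in> edges T \<and> fst y' = fst y \<and> EO y' = EO y \<and> (\<exists>h\<in>H. EA h y' = y)"
proof -
  assume "y' \<in> EO y" and y: "y \<in> edges T"
  then obtain h where h: "h \<in> H" "y' = EA h y" unfolding eorbit_def by blast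
  then show ?thesis using y by (auto intro!: bexI[of _ "inv\<^bsub>\<pi>\<^esub> h"])
qed

lemma bar_eorbit: "y \<in> edges T \<Longrightarrow> bar T ` EO y = EO (bar T y)"
  and tgt_eorbit: "y \<in> edges T \<Longrightarrow> tgt T ` EO y = VO (tgt T y)"
  unfolding eorbit_def vorbit_def image_image by (rule image_cong; simp add: bar_T_eact tgt_T_eact)+

text \<open>The action does not change the underlying edge of \<open>\<Gamma>\<close>, while
  reversal does; so no edge is inverted by \<open>H\<close>.\<close>

lemma bar_eorbit_neq: "y \<in> edges T \<Longrightarrow> EO (bar T y) \<noteq> EO y"
  using eorbitD[of y "bar T y"] eorbit_self[of y] bar_T_in[of y] bar_neq by metis

text \<open>The base point prescribes the representative of the orbit of each edge through it. Edges
  in one orbit have the same image in \<open>\<Gamma>\<close>, so this excludes conflicting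
  prescriptions.\<close>

lemma base_edge_unique:
  assumes "bs_base \<Gamma> p = Interior S" "(y, t) \<in> S" "(y', t') \<in> S" "fst y' = fst y"
  shows "y' = y"
proof -
  note b = bs_base_Interior[OF assms(1,2)] and b' = bs_base_Interior[OF assms(1,3)]
  have "t' = t" using edge_point_inj[of "fst y" t t'] b b' assms(4) by simp
  then show ?thesis using b(5) b'(5) assms(4) by simp
qed

lemma base_edge_bar:
  assumes "bs_base \<Gamma> p = Interior S" "(y, t) \<in> S"
  shows "y \<in> edges T" "(bar T y, 1 - t) \<in> S"
proof -
  note b = T.interior_pointD[OF bs_base_in assms]
  show "y \<in> edges T" by (rule b(1))
  have "Interior S = edge_point T y t" using b(4) assms(1) by simp
  then show "(bar T y, 1 - t) \<in> S" using b(2,3) by (simp add: edge_point_def)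
qed

text \<open>Edge representatives and the elements \<open>etrans\<close> are chosen in pairs under
  reversal, vertex data freely, all subject to the prescription at the base point. The elements
  \<open>shift\<close> are tied to neither and can be chosen once the representatives are
  fixed.\<close>

lemma lifting_exists: "\<exists>D. is_lifting \<Gamma> p H D"
proof -
  let ?QV = "\<lambda>W z. z \<in> W \<and> (\<forall>x. bs_base \<Gamma> p = Vertex x \<and> W = VO x \<longrightarrow> z = x)"
  have base_V: "x \<in> verts T" if "bs_base \<Gamma> p = Vertex x" for x using bs_base_in that by simp
  have ex: "\<exists>z. ?QV (VO x) z" if "x \<in> verts T" for x
    using vorbit_self base_V that by (cases "\<exists>x'. bs_base \<Gamma> p = Vertex x' \<and> VO x = VO x'") fastforce+
  define vl where "vl W = (SOME z. ?QV W z)" for W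
  have vl: "?QV (VO x) (vl (VO x))" if "x \<in> verts T" for x unfolding vl_def by (rule someI_ex[OF ex[OF that]])
  have "\<exists>h. h \<in> H \<and> VA h (vl (VO x)) = x \<and> (bs_base \<Gamma> p = Vertex x \<longrightarrow> h = \<one>\<^bsub>\<pi>\<^esub>)" if x: "x \<in> verts T" for x
  proof (cases "bs_base \<Gamma> p = Vertex x")
    case True
    then have "vl (VO x) = x" using vl[OF x] by blast
    then show ?thesis using x by (intro exI[of _ "\<one>\<^bsub>\<pi>\<^esub>"]) simp
  next
    case False
    then show ?thesis using vorbitD[OF conjunct1[OF vl[OF x]] x] by blast
  qed
  then obtain vt where vt: "\<And>x. x \<in> verts T \<Longrightarrow> vt x \<in> H \<and> VA (vt x) (vl (VO x)) = x \<and> (bs_base \<Gamma> p = Vertex x \<longrightarrow> vt x = \<one>\<^bsub>\<pi>\<^esub>)"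
    by metis
  let ?QE = "\<lambda>E z. z \<in> E \<and> (\<forall>S y t. bs_base \<Gamma> p = Interior S \<and> (y, t) \<in> S \<and> E = EO y \<longrightarrow> z = y)"
  obtain el where el: "\<And>E. E \<in> EO ` edges T \<Longrightarrow> ?QE E (el E)"
    and el_bar: "\<And>E. E \<in> EO ` edges T \<Longrightarrow> el (bar T ` E) = bar T (el E)"
  proof (rule equivariant_choice[of "EO ` edges T" "\<lambda>E. bar T ` E" ?QE "\<lambda>E. bar T"])
    fix E assume "E \<in> EO ` edges T"
    then obtain y where y: "y \<in> edges T" "E = EO y" by blast
    note b = bar_T_in[OF y(1)]
    show "bar T ` E \<in> EO ` edges T \<and> bar T ` bar T ` E = E \<and> bar T ` E \<noteq> E"
      unfolding y(2) bar_eorbit[OF y(1)] bar_eorbit[OF b(1)] b(2) using b(1) bar_eorbit_neq[OF y(1)] by blast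
    show "\<exists>z. ?QE E z"
    proof (cases "\<exists>S y' t. bs_base \<Gamma> p = Interior S \<and> (y', t) \<in> S \<and> E = EO y'")
      case True
      then obtain S y' t where y': "bs_base \<Gamma> p = Interior S" "(y', t) \<in> S" "E = EO y'" by blast
      have y'T: "y' \<in> edges T" by (rule base_edge_bar[OF y'(1,2)])
      have "z = y'" if "bs_base \<Gamma> p = Interior S'" "(z, t') \<in> S'" "E = EO z" for S' z t'
      proof -
        have "z \<in> edges T" by (rule base_edge_bar[OF that(1,2)])
        then have "z \<in> EO y'" using eorbit_self that(3) y'(3) by blast
        then have "fst z = fst y'" using eorbitD y'T by blast
        moreover have "(z, t') \<in> S" using that y'(1) by simp
        ultimately show ?thesis using base_edge_unique[OF y'(1,2)] by blast
      qed
      then show ?thesis using eorbit_self[OF y'T] y'(3) by blast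
    next
      case False
      then show ?thesis using eorbit_self[OF y(1)] y(2) by blast
    qed
  next
    fix E z assume "E \<in> EO ` edges T" and z: "?QE E z"
    then obtain y where y: "y \<in> edges T" "E = EO y" by blast
    have zT: "z \<in> edges T" using eorbitD y z by blast
    have "bar T z = y'" if y': "bs_base \<Gamma> p = Interior S" "(y', t) \<in> S" "bar T ` E = EO y'" for S y' t
    proof -
      note b = base_edge_bar[OF y'(1,2)]
      have "bar T ` bar T ` E = EO (bar T y')" unfolding y'(3) by (rule bar_eorbit[OF b(1)])
      then have "E = EO (bar T y')" unfolding y(2) bar_eorbit[OF y(1)] using bar_eorbit[of "bar T y"] bar_T_in[OF y(1)] by simp
      then have "z = bar T y'" using z y'(1) b(2) by blast
      then show ?thesis using bar_T_in[OF b(1)] by simp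
    qed
    then show "?QE (bar T ` E) (bar T z) \<and> bar T (bar T z) = z" using z bar_T_in[OF zT] by blast
  qed blast
  have el: "?QE (EO y) (el (EO y))" if "y \<in> edges T" for y by (rule el[OF imageI[OF that]])
  have el_bar: "el (EO (bar T y)) = bar T (el (EO y))" if "y \<in> edges T" for y
    using el_bar[OF imageI[OF that]] bar_eorbit[OF that] by simp
  let ?QT = "\<lambda>y h. h \<in> H \<and> EA h (el (EO y)) = y \<and> (\<forall>S t. bs_base \<Gamma> p = Interior S \<and> (y, t) \<in> S \<longrightarrow> h = \<one>\<^bsub>\<pi>\<^esub>)"
  obtain et where et: "\<And>y. y \<in> edges T \<Longrightarrow> ?QT y (et y)" and et_bar: "\<And>y. y \<in> edges T \<Longrightarrow> et (bar T y) = et y"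
  proof (rule T.bar_equivariant_choice[of ?QT "\<lambda>_ h. h"])
    fix y assume y: "y \<in> edges T"
    show "\<exists>h. ?QT y h"
    proof (cases "\<exists>S t. bs_base \<Gamma> p = Interior S \<and> (y, t) \<in> S")
      case True
      then have "el (EO y) = y" using el[OF y] by blast
      then show ?thesis using y by (intro exI[of _ "\<one>\<^bsub>\<pi>\<^esub>"]) simp
    next
      case False
      then show ?thesis using eorbitD[OF conjunct1[OF el[OF y]] y] by blast
    qed
  next
    fix y h assume y: "y \<in> edges T" and h: "?QT y h"
    have "el (EO y) \<in> edges T" using eorbitD[OF conjunct1[OF el[OF y]] y] by blast
    then have "EA h (el (EO (bar T y))) = bar T (EA h (el (EO y)))" unfolding el_bar[OF y] using bar_T_eact[of h "el (EO y)"] h by simp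
    also have "\<dots> = bar T y" using h by simp
    finally have 1: "EA h (el (EO (bar T y))) = bar T y" .
    have "h = \<one>\<^bsub>\<pi>\<^esub>" if "bs_base \<Gamma> p = Interior S" "(bar T y, t) \<in> S" for S t
      using base_edge_bar(2)[OF that] bar_T_in[OF y] h that(1) by auto
    then show "?QT (bar T y) h \<and> h = h" using h 1 by blast
  qed blast
  have exs: "\<exists>s. s \<in> H \<and> VA s (vl (tgt T ` EO y)) = tgt T (el (EO y))" if y: "y \<in> edges T" for y
  proof -
    have z: "el (EO y) \<in> edges T" "EO (el (EO y)) = EO y" using eorbitD[OF conjunct1[OF el[OF y]] y] by auto
    note x = bar_T_in(4)[OF z(1)]
    have "tgt T ` EO y = VO (tgt T (el (EO y)))" using tgt_eorbit[OF z(1)] z(2) by simp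
    then show ?thesis using vorbitD[OF conjunct1[OF vl[OF x]] x] by auto
  qed
  \<comment> \<open>The choice must be a function of the orbit, so the condition is phrased with
    \<open>E\<close> in place of an edge \<open>y\<close> in it.\<close>
  define sh where "sh E = (SOME s. s \<in> H \<and> VA s (vl (tgt T ` E)) = tgt T (el E))" for E
  have sh: "sh (EO y) \<in> H \<and> VA (sh (EO y)) (vl (VO (tgt T y))) = tgt T (el (EO y))" if "y \<in> edges T" for y
    using someI_ex[OF exs[OF that]] unfolding sh_def tgt_eorbit[OF that] .
  let ?D = "\<lparr>vlift = vl, elift = el, shift = sh, vtrans = vt, etrans = et\<rparr>"
  have "is_lifting \<Gamma> p H ?D"
    unfolding is_lifting_def lifting.simps
  proof (intro conjI ballI allI impI)
    fix x assume x: "x \<in> verts T"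
    show "vl (VO x) \<in> VO x" using vl[OF x] by blast
    show "vt x \<in> H" "VA (vt x) (vl (VO x)) = x" using vt[OF x] by auto
  next
    fix y assume y: "y \<in> edges T"
    show "el (EO y) \<in> EO y" using el[OF y] by blast
    show "el (EO (bar T y)) = bar T (el (EO y))" by (rule el_bar[OF y])
    show "sh (EO y) \<in> H" "VA (sh (EO y)) (vl (VO (tgt T y))) = tgt T (el (EO y))" using sh[OF y] by auto
    show "et y \<in> H" "EA (et y) (el (EO y)) = y" using et[OF y] by auto
    show "et (bar T y) = et y" by (rule et_bar[OF y])
  next
    fix x assume x: "bs_base \<Gamma> p = Vertex x"
    show "vl (VO x) = x" using vl[OF base_V[OF x]] x by blast
    show "vt x = \<one>\<^bsub>\<pi>\<^esub>" using vt[OF base_V[OF x]] x by blast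
  next
    fix S y t assume "bs_base \<Gamma> p = Interior S \<and> (y, t) \<in> S"
    then have S: "bs_base \<Gamma> p = Interior S" "(y, t) \<in> S" by auto
    note y = base_edge_bar(1)[OF S]
    show "el (EO y) = y" "et y = \<one>\<^bsub>\<pi>\<^esub>" using el[OF y] et[OF y] S by blast+
  qed
  then show ?thesis by blast
qed

end

section \<open>The quotient by a subgroup\<close>

context sectioned
begin

text \<open>With \<open>vact_eqI\<close> a dictionary between the action on the tree and equations
  among chosen classes: a vertex is a coset of the vertex group, so moving one vertex to another
  relates their chosen classes up to a factor \<open>g\<close>. Freeness of right multiplication
  will make the factor unique.\<close>

lemma vact_eqD:
  assumes "x \<in> verts T" "x' \<in> verts T" "h \<in> carrier \<pi>" "VA h x' = x"
  shows "\<exists>g\<in>carrier (vgroup \<Gamma> (fst x)). vs x = L (fst x) h (R (fst x) (vs x') g)"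
proof -
  have f: "fst x' = fst x" using assms(4) fst_act by metis
  have c: "vs x' \<in> P (fst x)" "L (fst x) h (vs x') \<in> P (fst x)" using vs(1)[OF assms(2)] assms(3) f by simp_all
  have "bv (fst x) (L (fst x) h (vs x')) = VA h (bv (fst x) (vs x'))" using assms(3) c by simp
  also have "\<dots> = bv (fst x) (vs x)" using vs(2)[OF assms(2)] vs(2)[OF assms(1)] f assms(4) by simp
  finally show ?thesis using bs_vertex_eqD[OF _ vs(1)[OF assms(1)]] assms(3) c by (auto simp: lact_ract)
qed

lemma vact_eqI:
  assumes "x \<in> verts T" "x' \<in> verts T" "h \<in> carrier \<pi>" "fst x' = fst x" "g \<in> carrier (vgroup \<Gamma> (fst x))"
    "vs x = L (fst x) h (R (fst x) (vs x') g)"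
  shows "VA h x' = x"
proof -
  have c: "vs x' \<in> P (fst x)" using vs(1)[OF assms(2)] assms(4) by simp
  have "x = bv (fst x) (L (fst x) h (R (fst x) (vs x') g))" using vs(2)[OF assms(1)] assms(6) by simp
  also have "\<dots> = VA h (bv (fst x) (R (fst x) (vs x') g))" using assms(3,5) c by (simp add: lact_ract)
  also have "\<dots> = VA h x'" using assms(4,5) c vs(2)[OF assms(2)] by (simp del: bs_vact_bs)
  finally show ?thesis by simp
qed

lemma eact_eqD:
  assumes "y \<in> edges T" "y' \<in> edges T" "h \<in> carrier \<pi>" "EA h y' = y"
  shows "\<exists>k\<in>carrier (egroup \<Gamma> (fst y)). es y = L (src \<Gamma> (fst y)) h (R (src \<Gamma> (fst y)) (es y') (einj \<Gamma> (bar \<Gamma> (fst y)) k))"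
proof -
  have f: "fst y' = fst y" using assms(4) fst_act by metis
  have e: "fst y \<in> edges \<Gamma>" using bar_T_in[OF assms(1)] by simp
  have c: "es y' \<in> P (src \<Gamma> (fst y))" "L (src \<Gamma> (fst y)) h (es y') \<in> P (src \<Gamma> (fst y))"
    using es(1)[OF assms(2)] assms(3) f by simp_all
  have "be (fst y) (L (src \<Gamma> (fst y)) h (es y')) = EA h (be (fst y) (es y'))" using assms(3) c e by simp
  also have "\<dots> = be (fst y) (es y)" using es(2)[OF assms(2)] es(2)[OF assms(1)] f assms(4) by simp
  finally obtain k where "k \<in> carrier (egroup \<Gamma> (fst y))"
    "es y = R (src \<Gamma> (fst y)) (L (src \<Gamma> (fst y)) h (es y')) (einj \<Gamma> (bar \<Gamma> (fst y)) k)"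
    using bs_edge_eqD[OF _ e es(1)[OF assms(1)]] by blast
  then show ?thesis using assms(3) c e by (intro bexI[of _ k]) (simp_all add: lact_ract)
qed

lemma eact_eqI:
  assumes "y \<in> edges T" "y' \<in> edges T" "h \<in> carrier \<pi>" "fst y' = fst y" "k \<in> carrier (egroup \<Gamma> (fst y))"
    "es y = L (src \<Gamma> (fst y)) h (R (src \<Gamma> (fst y)) (es y') (einj \<Gamma> (bar \<Gamma> (fst y)) k))"
  shows "EA h y' = y"
proof -
  have e: "fst y \<in> edges \<Gamma>" using bar_T_in[OF assms(1)] by simp
  have c: "es y' \<in> P (src \<Gamma> (fst y))" using es(1)[OF assms(2)] assms(4) by simp
  have "y = be (fst y) (L (src \<Gamma> (fst y)) h (R (src \<Gamma> (fst y)) (es y') (einj \<Gamma> (bar \<Gamma> (fst y)) k)))"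
    using es(2)[OF assms(1)] assms(6) by simp
  also have "\<dots> = EA h (be (fst y) (R (src \<Gamma> (fst y)) (es y') (einj \<Gamma> (bar \<Gamma> (fst y)) k)))" using assms(3,5) c e by (simp add: lact_ract)
  also have "\<dots> = EA h y'" using assms(4,5) c e es(2)[OF assms(2)] by (simp del: bs_eact_bs)
  finally show ?thesis by simp
qed

lemma edge_ract_free:
  assumes "e \<in> edges \<Gamma>" "A \<in> P (src \<Gamma> e)" "k \<in> carrier (egroup \<Gamma> e)" "k' \<in> carrier (egroup \<Gamma> e)"
    "R (src \<Gamma> e) A (einj \<Gamma> (bar \<Gamma> e) k) = R (src \<Gamma> e) A (einj \<Gamma> (bar \<Gamma> e) k')"
  shows "k = k'"
  using ract_free[OF assms(2) _ _ assms(5)] einj_bar_eq[of e k k'] assms(1,3,4) by simp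

end

locale lifted = sectioned \<Gamma> p vs es + pgog_subgroup \<Gamma> p H
  for \<Gamma> :: "('v, 'e, 'g, 'h) graph_of_groups" and p vs es H +
  fixes D
  assumes lif: "is_lifting \<Gamma> p H D"
begin

abbreviation Q where "Q \<equiv> quotient_gog \<Gamma> p H D"
abbreviation q where "q \<equiv> quotient_base \<Gamma> p H D"
abbreviation r where "r \<equiv> quotient_covering \<Gamma> p vs es D"
abbreviation rv where "rv W \<equiv> vlift D W"
abbreviation re where "re E \<equiv> elift D E"
abbreviation VS where "VS W \<equiv> {h \<in> H. VA h (rv W) = rv W}"
abbreviation ES where "ES E \<equiv> {h \<in> H. EA h (re E) = re E}"

lemma Q_simps [simp]:
  "verts Q = VO ` verts T" "edges Q = EO ` edges T" "bar Q E = bar T ` E" "tgt Q E = tgt T ` E"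
  "vgroup Q W = \<pi>\<lparr>carrier := VS W\<rparr>" "egroup Q E = \<pi>\<lparr>carrier := ES E\<rparr>"
  "einj Q E h = inv\<^bsub>\<pi>\<^esub> shift D E \<otimes>\<^bsub>\<pi>\<^esub> h \<otimes>\<^bsub>\<pi>\<^esub> shift D E"
  by (simp_all add: quotient_gog_def)

lemma vtrans:
  assumes "x \<in> verts T"
  shows "vtrans D x \<in> H" "VA (vtrans D x) (rv (VO x)) = x"
  using lif assms unfolding is_lifting_def by blast+

lemma etrans:
  assumes "y \<in> edges T"
  shows "etrans D y \<in> H" "EA (etrans D y) (re (EO y)) = y" "etrans D (bar T y) = etrans D y"
  using lif assms unfolding is_lifting_def by blast+

lemma lift_base:
  "bs_base \<Gamma> p = Vertex x \<Longrightarrow> rv (VO x) = x \<and> vtrans D x = \<one>\<^bsub>\<pi>\<^esub>"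
  "bs_base \<Gamma> p = Interior S \<Longrightarrow> (y, t) \<in> S \<Longrightarrow> re (EO y) = y \<and> etrans D y = \<one>\<^bsub>\<pi>\<^esub>"
  using lif unfolding is_lifting_def by blast+

lemma vlift:
  assumes "W \<in> VO ` verts T"
  shows "rv W \<in> verts T" "VO (rv W) = W"
proof -
  obtain x where x: "x \<in> verts T" "W = VO x" using assms by blast
  have "rv W \<in> VO x" using lif x unfolding is_lifting_def by blast
  from vorbitD[OF this x(1)] show "rv W \<in> verts T" "VO (rv W) = W" using x(2) by auto
qed

lemma elift:
  assumes "E \<in> EO ` edges T"
  shows "re E \<in> edges T" "EO (re E) = E" "re (bar T ` E) = bar T (re E)" "shift D E \<in> H"
    "VA (shift D E) (rv (tgt T ` E)) = tgt T (re E)" "tgt T ` E = VO (tgt T (re E))" "bar T ` E = EO (bar T (re E))"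
proof -
  obtain y where y: "y \<in> edges T" "E = EO y" using assms by blast
  have "re E \<in> EO y" using lif y unfolding is_lifting_def by blast
  from eorbitD[OF this y(1)] show 1: "re E \<in> edges T" "EO (re E) = E" using y(2) by auto
  show "re (bar T ` E) = bar T (re E)" "shift D E \<in> H" "VA (shift D E) (rv (tgt T ` E)) = tgt T (re E)"
    unfolding y(2) bar_eorbit[OF y(1)] tgt_eorbit[OF y(1)] using lif y(1) unfolding is_lifting_def by blast+
  show "tgt T ` E = VO (tgt T (re E))" "bar T ` E = EO (bar T (re E))"
    using tgt_eorbit[OF 1(1)] bar_eorbit[OF 1(1)] unfolding 1(2) by simp_all
qed

lemma elift_in:
  assumes "E \<in> EO ` edges T"
  shows "tgt T ` E \<in> VO ` verts T" "bar T ` E \<in> EO ` edges T" "bar T ` bar T ` E = E" "bar T ` E \<noteq> E"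
    "fst (re E) \<in> edges \<Gamma>" "fst (re (bar T ` E)) = bar \<Gamma> (fst (re E))" "fst (rv (tgt T ` E)) = tgt \<Gamma> (fst (re E))"
    "fst (rv (tgt T ` bar T ` E)) = src \<Gamma> (fst (re E))"
proof -
  note l = elift[OF assms] note b = bar_T_in[OF l(1)]
  show W: "tgt T ` E \<in> VO ` verts T" unfolding l(6) using b(4) by simp
  show B: "bar T ` E \<in> EO ` edges T" unfolding l(7) using b(1) by simp
  show "bar T ` bar T ` E = E" unfolding l(7) bar_eorbit[OF b(1)] b(2) l(2) by (rule HOL.refl)
  show "bar T ` E \<noteq> E" using bar_eorbit_neq[OF l(1)] unfolding l(7) l(2) .
  show "fst (re E) \<in> edges \<Gamma>" "fst (re (bar T ` E)) = bar \<Gamma> (fst (re E))" unfolding l(3) using b by simp_all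
  have t: "fst (rv (tgt T ` E)) = tgt \<Gamma> (fst (re E))" if "E \<in> EO ` edges T" for E
    using arg_cong[OF elift(5)[OF that], of fst] bar_T_in(6)[OF elift(1)[OF that]] by simp
  show "fst (rv (tgt T ` E)) = tgt \<Gamma> (fst (re E))" by (rule t[OF assms])
  show "fst (rv (tgt T ` bar T ` E)) = src \<Gamma> (fst (re E))" using t[OF B] unfolding l(3) b(5) src_def .
qed

lemma stabilizer_subgroup:
  "W \<in> VO ` verts T \<Longrightarrow> subgroup (VS W) \<pi>"
  "E \<in> EO ` edges T \<Longrightarrow> subgroup (ES E) \<pi>"
proof -
  assume "W \<in> VO ` verts T"
  note x = vlift(1)[OF this]
  have "VA (inv\<^bsub>\<pi>\<^esub> h) (rv W) = rv W" if "h \<in> carrier \<pi>" "VA h (rv W) = rv W" for h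
    using vact_inv[OF that(1) x] that(2) by simp
  then show "subgroup (VS W) \<pi>" by (intro pi.subgroupI) (use x in \<open>auto simp: vact_mult intro: exI[of _ "\<one>\<^bsub>\<pi>\<^esub>"]\<close>)
next
  assume "E \<in> EO ` edges T"
  note y = elift(1)[OF this]
  have "EA (inv\<^bsub>\<pi>\<^esub> h) (re E) = re E" if "h \<in> carrier \<pi>" "EA h (re E) = re E" for h
    using eact_inv[OF that(1) y] that(2) by simp
  then show "subgroup (ES E) \<pi>" by (intro pi.subgroupI) (use y in \<open>auto simp: eact_mult intro: exI[of _ "\<one>\<^bsub>\<pi>\<^esub>"]\<close>)
qed

lemma eact_bar_iff: "h \<in> carrier \<pi> \<Longrightarrow> y \<in> edges T \<Longrightarrow> EA h (bar T y) = bar T y \<longleftrightarrow> EA h y = y"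
  using bar_T_eact[of h y] bar_T_in(2)[of y] bar_T_in(2)[of "EA h y"] eact_in[of h y] by metis

lemma ES_bar: "E \<in> EO ` edges T \<Longrightarrow> ES (bar T ` E) = ES E"
  unfolding elift(3) by (rule Collect_cong) (use eact_bar_iff[OF H_in elift(1)] in blast)

text \<open>An element fixing the representative of \<open>E\<close> fixes its terminal vertex;
  \<open>shift\<close> takes the representative of the terminal orbit to that vertex, so conjugating
  by it lands in the stabiliser of the representative.\<close>

lemma ES_shift:
  assumes E: "E \<in> EO ` edges T" and h: "h \<in> ES E"
  shows "inv\<^bsub>\<pi>\<^esub> shift D E \<otimes>\<^bsub>\<pi>\<^esub> h \<otimes>\<^bsub>\<pi>\<^esub> shift D E \<in> VS (tgt T ` E)"
proof -
  note l = elift[OF E] note x = vlift(1)[OF elift_in(1)[OF E]]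
  have "VA h (tgt T (re E)) = tgt T (re E)" using tgt_T_eact[of h "re E"] h l(1) by simp
  then have "VA (inv\<^bsub>\<pi>\<^esub> shift D E \<otimes>\<^bsub>\<pi>\<^esub> h \<otimes>\<^bsub>\<pi>\<^esub> shift D E) (rv (tgt T ` E)) = VA (inv\<^bsub>\<pi>\<^esub> shift D E) (tgt T (re E))"
    using h l(4,5) x bar_T_in(4)[OF l(1)] by (simp add: vact_mult)
  also have "\<dots> = rv (tgt T ` E)" using vact_inv[of "shift D E", OF _ x] l(4,5) by simp
  finally show ?thesis using h l(4) by simp
qed

lemma gog_Q: "graph_of_groups Q"
  unfolding graph_of_groups_def
proof (intro conjI ballI)
  show "verts Q \<noteq> {}" using T.gog by (simp add: graph_of_groups_def)
  fix U W assume "U \<in> verts Q" "W \<in> verts Q"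
  then obtain x y where xy: "x \<in> verts T" "y \<in> verts T" "U = VO x" "W = VO y" by auto
  have "(x, y) \<in> ((\<lambda>e. (src T e, tgt T e)) ` edges T)\<^sup>*" using T.gog xy(1,2) by (simp add: graph_of_groups_def)
  then show "(U, W) \<in> ((\<lambda>e. (src Q e, tgt Q e)) ` edges Q)\<^sup>*"
    unfolding xy(3,4)
  proof (induction rule: rtrancl_induct)
    case (step y z)
    then obtain e where e: "e \<in> edges T" "y = src T e" "z = tgt T e" by auto
    have "(VO y, VO z) \<in> (\<lambda>e. (src Q e, tgt Q e)) ` edges Q"
    proof (rule image_eqI[of _ _ "EO e"])
      have "src Q (EO e) = VO y"
        unfolding src_def[of Q] Q_simps bar_eorbit[OF e(1)] tgt_eorbit[OF bar_T_in(1)[OF e(1)]] e(2) src_def[of T] by (rule HOL.refl)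
      moreover have "tgt Q (EO e) = VO z" using tgt_eorbit[OF e(1)] e(3) by simp
      ultimately show "(VO y, VO z) = (src Q (EO e), tgt Q (EO e))" by metis
      show "EO e \<in> edges Q" using e(1) by simp
    qed
    then show ?case using step.IH by (rule rtrancl_into_rtrancl[rotated])
  qed simp
next
  fix E assume "E \<in> edges Q"
  then have E: "E \<in> EO ` edges T" by simp
  note i = elift_in[OF E] note l = elift[OF E]
  show "bar Q E \<in> edges Q" "bar Q (bar Q E) = E" "bar Q E \<noteq> E" "tgt Q E \<in> verts Q" unfolding Q_simps by (rule i)+
  show "egroup Q (bar Q E) = egroup Q E" by (simp add: ES_bar[OF E])
  show "group (egroup Q E)" using pi.subgroup_imp_group[OF stabilizer_subgroup(2)[OF E]] by simp
  have s: "shift D E \<in> carrier \<pi>" using l(4) by simp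
  show "einj Q E \<in> mon (egroup Q E) (vgroup Q (tgt Q E))"
    unfolding mon_def
  proof (intro CollectI conjI homI inj_onI)
    show "einj Q E h \<in> carrier (vgroup Q (tgt Q E))" if "h \<in> carrier (egroup Q E)" for h
      using ES_shift[OF E, of h] that by simp
    show "einj Q E (h \<otimes>\<^bsub>egroup Q E\<^esub> k) = einj Q E h \<otimes>\<^bsub>vgroup Q (tgt Q E)\<^esub> einj Q E k"
      if "h \<in> carrier (egroup Q E)" "k \<in> carrier (egroup Q E)" for h k
      using that s by (simp add: pi.m_assoc)
    show "h = k" if "h \<in> carrier (egroup Q E)" "k \<in> carrier (egroup Q E)" "einj Q E h = einj Q E k" for h k
      using that s by simp
  qed
qed (use pi.subgroup_imp_group[OF stabilizer_subgroup(1)] in auto)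

section \<open>The covering from the quotient to \<open>\<Gamma>\<close>\<close>

sublocale Q: gog Q by unfold_locales (rule gog_Q)

lemma r_maps [simp]: "vmap r W = fst (rv W)" "emap r E = fst (re E)"
  by (simp_all add: quotient_covering_def)

text \<open>Existence comes from \<open>vact_eqD\<close>, applied to the inverse of \<open>h\<close>
  because the factor there stands inside the translate, and uniqueness from
  \<open>ract_free\<close>; together they give the definite description its value.\<close>

lemma r_vhom:
  assumes "W \<in> VO ` verts T" "h \<in> VS W"
  shows "vhom r W h \<in> carrier (vgroup \<Gamma> (fst (rv W)))"
    "L (fst (rv W)) h (vs (rv W)) = R (fst (rv W)) (vs (rv W)) (vhom r W h)"
proof -
  note x = vlift(1)[OF assms(1)]
  have "VA (inv\<^bsub>\<pi>\<^esub> h) (rv W) = rv W" using vact_inv[of h, OF _ x] assms(2) by simp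
  then obtain g where g: "g \<in> carrier (vgroup \<Gamma> (fst (rv W)))" "vs (rv W) = L (fst (rv W)) (inv\<^bsub>\<pi>\<^esub> h) (R (fst (rv W)) (vs (rv W)) g)"
    using vact_eqD[OF x x, of "inv\<^bsub>\<pi>\<^esub> h"] assms(2) by auto
  have "L (fst (rv W)) h (vs (rv W)) = R (fst (rv W)) (vs (rv W)) g"
    using arg_cong[OF g(2), of "L (fst (rv W)) h"] assms(2) vs(1)[OF x] g(1) by simp
  with g(1) have "\<exists>!g. g \<in> carrier (vgroup \<Gamma> (fst (rv W))) \<and> L (fst (rv W)) h (vs (rv W)) = R (fst (rv W)) (vs (rv W)) g"
    using ract_free[OF vs(1)[OF x]] by auto
  from theI'[OF this] show "vhom r W h \<in> carrier (vgroup \<Gamma> (fst (rv W)))"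
    "L (fst (rv W)) h (vs (rv W)) = R (fst (rv W)) (vs (rv W)) (vhom r W h)"
    by (simp_all add: quotient_covering_def Let_def lact_def ract_def)
qed

lemma r_ehom:
  assumes "E \<in> EO ` edges T" "h \<in> ES E"
  defines "e \<equiv> fst (re E)"
  shows "ehom r E h \<in> carrier (egroup \<Gamma> e)"
    "L (src \<Gamma> e) h (es (re E)) = R (src \<Gamma> e) (es (re E)) (einj \<Gamma> (bar \<Gamma> e) (ehom r E h))"
proof -
  note y = elift(1)[OF assms(1)] note e = elift_in(5)[OF assms(1), folded e_def]
  have c: "es (re E) \<in> P (src \<Gamma> e)" unfolding e_def by (rule es(1)[OF y])
  have "EA (inv\<^bsub>\<pi>\<^esub> h) (re E) = re E" using eact_inv[of h, OF _ y] assms(2) by simp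
  then obtain k where k: "k \<in> carrier (egroup \<Gamma> e)" "es (re E) = L (src \<Gamma> e) (inv\<^bsub>\<pi>\<^esub> h) (R (src \<Gamma> e) (es (re E)) (einj \<Gamma> (bar \<Gamma> e) k))"
    using eact_eqD[OF y y, of "inv\<^bsub>\<pi>\<^esub> h"] assms(2) unfolding e_def by auto
  have "L (src \<Gamma> e) h (es (re E)) = R (src \<Gamma> e) (es (re E)) (einj \<Gamma> (bar \<Gamma> e) k)"
    using arg_cong[OF k(2), of "L (src \<Gamma> e) h"] assms(2) c k(1) e by simp
  with k(1) have "\<exists>!k. k \<in> carrier (egroup \<Gamma> e) \<and> L (src \<Gamma> e) h (es (re E)) = R (src \<Gamma> e) (es (re E)) (einj \<Gamma> (bar \<Gamma> e) k)"
    using edge_ract_free[OF e c] by auto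
  from theI'[OF this] show "ehom r E h \<in> carrier (egroup \<Gamma> e)"
    "L (src \<Gamma> e) h (es (re E)) = R (src \<Gamma> e) (es (re E)) (einj \<Gamma> (bar \<Gamma> e) (ehom r E h))"
    by (simp_all add: quotient_covering_def Let_def lact_def ract_def e_def)
qed

text \<open>The twist is a product of two factors: one compares the class chosen at the terminal
  vertex of the lifted edge with the translate of the one chosen at the orbit representative, the
  other is the twist of the natural projection at the lifted edge.\<close>

lemma r_twist:
  assumes "E \<in> EO ` edges T"
  defines "v \<equiv> tgt \<Gamma> (fst (re E))"
  shows "twist r E \<in> carrier (vgroup \<Gamma> v)"
    "L v (shift D E) (R v (vs (rv (tgt T ` E))) (twist r E)) = es (bar T (re E))"
proof -
  note l = elift[OF assms(1)] note x = vlift(1)[OF elift_in(1)[OF assms(1)]] note b = bar_T_in[OF l(1)]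
  have v: "fst (rv (tgt T ` E)) = v" "fst (tgt T (re E)) = v" unfolding v_def using elift_in(7)[OF assms(1)] b by auto
  have c: "vs (rv (tgt T ` E)) \<in> P v" using vs(1)[OF x] v by simp
  obtain g where g: "g \<in> carrier (vgroup \<Gamma> v)" "vs (tgt T (re E)) = L v (shift D E) (R v (vs (rv (tgt T ` E))) g)"
    using vact_eqD[OF b(4) x _ l(5)] l(4) v by auto
  obtain g' where g': "g' \<in> carrier (vgroup \<Gamma> v)" "R v (vs (tgt T (re E))) g' = es (bar T (re E))"
    using twist_ex1[OF l(1)] unfolding v_def by blast
  have vv: "v \<in> verts \<Gamma>" using c by (rule vpaths_vert)
  interpret V: group "vgroup \<Gamma> v" using vv by (rule vgroup_group)
  have "L v (shift D E) (R v (vs (rv (tgt T ` E))) (g \<otimes>\<^bsub>vgroup \<Gamma> v\<^esub> g')) = es (bar T (re E))"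
    using g' g(1) c l(4) unfolding g(2) by (simp add: ract_mult lact_ract)
  moreover have "g \<otimes>\<^bsub>vgroup \<Gamma> v\<^esub> g' \<in> carrier (vgroup \<Gamma> v)" using g(1) g'(1) by simp
  moreover have "m = m'" if m: "m \<in> carrier (vgroup \<Gamma> v)" "m' \<in> carrier (vgroup \<Gamma> v)"
    "L v (shift D E) (R v (vs (rv (tgt T ` E))) m) = L v (shift D E) (R v (vs (rv (tgt T ` E))) m')" for m m'
  proof -
    have "R v (vs (rv (tgt T ` E))) m = R v (vs (rv (tgt T ` E))) m'"
      using arg_cong[OF m(3), of "L v (inv\<^bsub>\<pi>\<^esub> shift D E)"] m(1,2) c l(4) by simp
    then show ?thesis by (rule ract_free[OF c m(1,2)])
  qed
  ultimately have "\<exists>!g. g \<in> carrier (vgroup \<Gamma> v) \<and> L v (shift D E) (R v (vs (rv (tgt T ` E))) g) = es (bar T (re E))"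
    by metis
  from theI'[OF this] show "twist r E \<in> carrier (vgroup \<Gamma> v)"
    "L v (shift D E) (R v (vs (rv (tgt T ` E))) (twist r E)) = es (bar T (re E))"
    by (simp_all add: quotient_covering_def Let_def lact_def ract_def v_def)
qed

lemma vhom_unique:
  assumes "W \<in> VO ` verts T" "h \<in> VS W" "g \<in> carrier (vgroup \<Gamma> (fst (rv W)))"
    "L (fst (rv W)) h (vs (rv W)) = R (fst (rv W)) (vs (rv W)) g"
  shows "vhom r W h = g"
  using ract_free[OF vs(1)[OF vlift(1)[OF assms(1)]] r_vhom(1)[OF assms(1,2)] assms(3)] r_vhom(2)[OF assms(1,2)] assms(4) by simp

lemma ehom_unique:
  assumes "E \<in> EO ` edges T" "h \<in> ES E" "k \<in> carrier (egroup \<Gamma> (fst (re E)))"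
    "L (src \<Gamma> (fst (re E))) h (es (re E)) = R (src \<Gamma> (fst (re E))) (es (re E)) (einj \<Gamma> (bar \<Gamma> (fst (re E))) k)"
  shows "ehom r E h = k"
  using edge_ract_free[OF elift_in(5)[OF assms(1)] es(1)[OF elift(1)[OF assms(1)]] r_ehom(1)[OF assms(1,2)] assms(3)]
    r_ehom(2)[OF assms(1,2)] assms(4) by simp

lemma vhom_mult:
  assumes W: "W \<in> VO ` verts T" and h: "h \<in> VS W" and k: "k \<in> VS W"
  shows "vhom r W (h \<otimes>\<^bsub>\<pi>\<^esub> k) = vhom r W h \<otimes>\<^bsub>vgroup \<Gamma> (fst (rv W))\<^esub> vhom r W k"
proof (rule vhom_unique[OF W])
  let ?v = "fst (rv W)"
  note x = vlift(1)[OF W] note c = vs(1)[OF x] note h' = r_vhom[OF W h] and k' = r_vhom[OF W k]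
  interpret V: group "vgroup \<Gamma> ?v" using vpaths_vert[OF c] by (rule vgroup_group)
  show "h \<otimes>\<^bsub>\<pi>\<^esub> k \<in> VS W" using subgroup.m_closed[OF stabilizer_subgroup(1)[OF W] h k] .
  show "vhom r W h \<otimes>\<^bsub>vgroup \<Gamma> ?v\<^esub> vhom r W k \<in> carrier (vgroup \<Gamma> ?v)" using h'(1) k'(1) by simp
  have hk: "h \<in> carrier \<pi>" "k \<in> carrier \<pi>" using h k by simp_all
  have "L ?v (h \<otimes>\<^bsub>\<pi>\<^esub> k) (vs (rv W)) = R ?v (L ?v h (vs (rv W))) (vhom r W k)"
    unfolding lact_mult[OF hk c] k'(2) using hk c k'(1) by (rule_tac lact_ract)
  also have "\<dots> = R ?v (vs (rv W)) (vhom r W h \<otimes>\<^bsub>vgroup \<Gamma> ?v\<^esub> vhom r W k)"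
    unfolding h'(2) using c h'(1) k'(1) by (rule_tac ract_mult[symmetric])
  finally show "L ?v (h \<otimes>\<^bsub>\<pi>\<^esub> k) (vs (rv W)) = R ?v (vs (rv W)) (vhom r W h \<otimes>\<^bsub>vgroup \<Gamma> ?v\<^esub> vhom r W k)" .
qed

lemma ehom_mult:
  assumes E: "E \<in> EO ` edges T" and h: "h \<in> ES E" and k: "k \<in> ES E"
  shows "ehom r E (h \<otimes>\<^bsub>\<pi>\<^esub> k) = ehom r E h \<otimes>\<^bsub>egroup \<Gamma> (fst (re E))\<^esub> ehom r E k"
proof (rule ehom_unique[OF E])
  let ?e = "fst (re E)"
  let ?u = "src \<Gamma> ?e"
  let ?i = "einj \<Gamma> (bar \<Gamma> ?e)"
  note y = elift(1)[OF E] note c = es(1)[OF y] note h' = r_ehom[OF E h] and k' = r_ehom[OF E k] note e = elift_in(5)[OF E]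
  interpret E: group "egroup \<Gamma> ?e" using e by (rule egroup_group)
  show "h \<otimes>\<^bsub>\<pi>\<^esub> k \<in> ES E" using subgroup.m_closed[OF stabilizer_subgroup(2)[OF E] h k] .
  show "ehom r E h \<otimes>\<^bsub>egroup \<Gamma> ?e\<^esub> ehom r E k \<in> carrier (egroup \<Gamma> ?e)" using h'(1) k'(1) by simp
  have hk: "h \<in> carrier \<pi>" "k \<in> carrier \<pi>" using h k by simp_all
  have i: "?i (ehom r E h) \<in> carrier (vgroup \<Gamma> ?u)" "?i (ehom r E k) \<in> carrier (vgroup \<Gamma> ?u)" using h'(1) k'(1) e by simp_all
  have "L ?u (h \<otimes>\<^bsub>\<pi>\<^esub> k) (es (re E)) = R ?u (L ?u h (es (re E))) (?i (ehom r E k))"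
    unfolding lact_mult[OF hk c] k'(2) using hk c i(2) by (rule_tac lact_ract)
  also have "\<dots> = R ?u (es (re E)) (?i (ehom r E h) \<otimes>\<^bsub>vgroup \<Gamma> ?u\<^esub> ?i (ehom r E k))"
    unfolding h'(2) using c i by (rule_tac ract_mult[symmetric])
  finally show "L ?u (h \<otimes>\<^bsub>\<pi>\<^esub> k) (es (re E)) = R ?u (es (re E)) (?i (ehom r E h \<otimes>\<^bsub>egroup \<Gamma> ?e\<^esub> ehom r E k))"
    unfolding einj_bar_mult[OF e h'(1) k'(1)] .
qed

text \<open>Extension along the edge commutes with loops and carries the edge group from one end to
  the other, so the element describing the action of \<open>h\<close> at the source also describes
  it at the target.\<close>

lemma ehom_tgt:
  assumes E: "E \<in> EO ` edges T" and h: "h \<in> ES E"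
  defines "e \<equiv> fst (re E)"
  shows "L (tgt \<Gamma> e) h (es (bar T (re E))) = R (tgt \<Gamma> e) (es (bar T (re E))) (einj \<Gamma> e (ehom r E h))"
proof -
  note y = elift(1)[OF E] note c = es(1)[OF y, folded e_def] note e = elift_in(5)[OF E, folded e_def]
    and h' = r_ehom[OF E h, folded e_def]
  have hp: "h \<in> carrier \<pi>" using h by simp
  have "L (tgt \<Gamma> e) h (X e (es (re E))) = X e (L (src \<Gamma> e) h (es (re E)))" using e hp c by (rule extend_lact[symmetric])
  also have "\<dots> = R (tgt \<Gamma> e) (X e (es (re E))) (einj \<Gamma> e (ehom r E h))" unfolding h'(2) using e h'(1) c by (rule extend_ract)
  finally show ?thesis unfolding es_bar[OF y, folded e_def] .
qed

lemma ehom_bar: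
  assumes E: "E \<in> EO ` edges T" and h: "h \<in> ES E"
  shows "ehom r (bar T ` E) h = ehom r E h"
proof (rule ehom_unique)
  note i = elift_in[OF E]
  show "bar T ` E \<in> EO ` edges T" by (rule i)
  show "h \<in> ES (bar T ` E)" unfolding ES_bar[OF E] by (rule h)
  show "ehom r E h \<in> carrier (egroup \<Gamma> (fst (re (bar T ` E))))" unfolding i(6) using r_ehom(1)[OF E h] i(5) by simp
  show "L (src \<Gamma> (fst (re (bar T ` E)))) h (es (re (bar T ` E)))
    = R (src \<Gamma> (fst (re (bar T ` E)))) (es (re (bar T ` E))) (einj \<Gamma> (bar \<Gamma> (fst (re (bar T ` E)))) (ehom r E h))"
    unfolding i(6) src_bar[OF i(5)] bar_bar[OF i(5)] unfolding elift(3)[OF E] by (rule ehom_tgt[OF E h])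
qed

text \<open>Evaluated on the representative at the terminal vertex times the twist, the conjugate of
  \<open>h\<close> acts as \<open>h\<close> does on the class of the reverse edge, that is as right
  multiplication by the edge element; removing the twist conjugates this element.\<close>

lemma vhom_einj_r:
  assumes E: "E \<in> EO ` edges T" and h: "h \<in> ES E"
  defines "v \<equiv> tgt \<Gamma> (fst (re E))"
  shows "vhom r (tgt T ` E) (inv\<^bsub>\<pi>\<^esub> shift D E \<otimes>\<^bsub>\<pi>\<^esub> h \<otimes>\<^bsub>\<pi>\<^esub> shift D E)
    = twist r E \<otimes>\<^bsub>vgroup \<Gamma> v\<^esub> einj \<Gamma> (fst (re E)) (ehom r E h) \<otimes>\<^bsub>vgroup \<Gamma> v\<^esub> inv\<^bsub>vgroup \<Gamma> v\<^esub> twist r E"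
proof (rule vhom_unique)
  note i = elift_in[OF E] and l = elift[OF E] and \<delta> = r_twist[OF E, folded v_def]
  have v: "fst (rv (tgt T ` E)) = v" unfolding v_def by (rule i(7))
  have c: "vs (rv (tgt T ` E)) \<in> P v" using vs(1)[OF vlift(1)[OF i(1)]] v by simp
  have vv: "v \<in> verts \<Gamma>" using c by (rule vpaths_vert)
  interpret V: group "vgroup \<Gamma> v" using vv by (rule vgroup_group)
  let ?s = "shift D E" and ?\<delta> = "twist r E" and ?k = "einj \<Gamma> (fst (re E)) (ehom r E h)" and ?c = "vs (rv (tgt T ` E))"
  have s: "?s \<in> carrier \<pi>" "h \<in> carrier \<pi>" using l(4) h by simp_all
  have k: "?k \<in> carrier (vgroup \<Gamma> v)" unfolding v_def using r_ehom(1)[OF E h] i(5) by simp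
  have d: "es (bar T (re E)) \<in> P v" unfolding v_def by (rule es_bar_in[OF l(1)])
  show "tgt T ` E \<in> VO ` verts T" by (rule i)
  show "inv\<^bsub>\<pi>\<^esub> ?s \<otimes>\<^bsub>\<pi>\<^esub> h \<otimes>\<^bsub>\<pi>\<^esub> ?s \<in> VS (tgt T ` E)" by (rule ES_shift[OF E h])
  show "?\<delta> \<otimes>\<^bsub>vgroup \<Gamma> v\<^esub> ?k \<otimes>\<^bsub>vgroup \<Gamma> v\<^esub> inv\<^bsub>vgroup \<Gamma> v\<^esub> ?\<delta> \<in> carrier (vgroup \<Gamma> (fst (rv (tgt T ` E))))"
    unfolding v using \<delta>(1) k by simp
  have cd: "R v ?c ?\<delta> = L v (inv\<^bsub>\<pi>\<^esub> ?s) (es (bar T (re E)))"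
    using arg_cong[OF \<delta>(2), of "L v (inv\<^bsub>\<pi>\<^esub> ?s)"] c \<delta>(1) s by simp
  have "L v (inv\<^bsub>\<pi>\<^esub> ?s \<otimes>\<^bsub>\<pi>\<^esub> h \<otimes>\<^bsub>\<pi>\<^esub> ?s) (R v ?c ?\<delta>) = L v (inv\<^bsub>\<pi>\<^esub> ?s) (L v h (es (bar T (re E))))"
    unfolding cd using s d by (simp add: lact_mult)
  also have "\<dots> = R v (R v ?c ?\<delta>) ?k"
    unfolding cd ehom_tgt[OF E h, folded v_def] using s d k by (simp add: lact_ract)
  finally have 1: "L v (inv\<^bsub>\<pi>\<^esub> ?s \<otimes>\<^bsub>\<pi>\<^esub> h \<otimes>\<^bsub>\<pi>\<^esub> ?s) (R v ?c ?\<delta>) = R v (R v ?c ?\<delta>) ?k" .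
  have m: "inv\<^bsub>\<pi>\<^esub> ?s \<otimes>\<^bsub>\<pi>\<^esub> h \<otimes>\<^bsub>\<pi>\<^esub> ?s \<in> carrier \<pi>" using s by simp
  have "L v (inv\<^bsub>\<pi>\<^esub> ?s \<otimes>\<^bsub>\<pi>\<^esub> h \<otimes>\<^bsub>\<pi>\<^esub> ?s) ?c = L v (inv\<^bsub>\<pi>\<^esub> ?s \<otimes>\<^bsub>\<pi>\<^esub> h \<otimes>\<^bsub>\<pi>\<^esub> ?s) (R v (R v ?c ?\<delta>) (inv\<^bsub>vgroup \<Gamma> v\<^esub> ?\<delta>))"
    using c \<delta>(1) by simp
  also have "\<dots> = R v (L v (inv\<^bsub>\<pi>\<^esub> ?s \<otimes>\<^bsub>\<pi>\<^esub> h \<otimes>\<^bsub>\<pi>\<^esub> ?s) (R v ?c ?\<delta>)) (inv\<^bsub>vgroup \<Gamma> v\<^esub> ?\<delta>)"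
    using m c \<delta>(1) by (intro lact_ract) simp_all
  also have "\<dots> = R v ?c (?\<delta> \<otimes>\<^bsub>vgroup \<Gamma> v\<^esub> ?k \<otimes>\<^bsub>vgroup \<Gamma> v\<^esub> inv\<^bsub>vgroup \<Gamma> v\<^esub> ?\<delta>)"
    unfolding 1 using c \<delta>(1) k by (simp add: ract_mult)
  finally show "L (fst (rv (tgt T ` E))) (inv\<^bsub>\<pi>\<^esub> ?s \<otimes>\<^bsub>\<pi>\<^esub> h \<otimes>\<^bsub>\<pi>\<^esub> ?s) ?c
    = R (fst (rv (tgt T ` E))) ?c (?\<delta> \<otimes>\<^bsub>vgroup \<Gamma> v\<^esub> ?k \<otimes>\<^bsub>vgroup \<Gamma> v\<^esub> inv\<^bsub>vgroup \<Gamma> v\<^esub> ?\<delta>)"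
    unfolding v .
qed

lemma morphism_r: "morphism Q \<Gamma> r"
  unfolding morphism_def
proof (intro conjI ballI)
  fix W assume "W \<in> verts Q"
  then have W: "W \<in> VO ` verts T" by simp
  show "vmap r W \<in> verts \<Gamma>" using vpaths_vert[OF vs(1)[OF vlift(1)[OF W]]] by simp
  show "vhom r W \<in> hom (vgroup Q W) (vgroup \<Gamma> (vmap r W))"
    using r_vhom(1)[OF W] vhom_mult[OF W] by (intro homI) simp_all
next
  fix E assume "E \<in> edges Q"
  then have E: "E \<in> EO ` edges T" by simp
  note i = elift_in[OF E]
  show "emap r E \<in> edges \<Gamma>" "emap r (bar Q E) = bar \<Gamma> (emap r E)" "tgt \<Gamma> (emap r E) = vmap r (tgt Q E)" using i by simp_all
  show "ehom r E \<in> hom (egroup Q E) (egroup \<Gamma> (emap r E))"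
    using r_ehom(1)[OF E] ehom_mult[OF E] by (intro homI) simp_all
  show "twist r E \<in> carrier (vgroup \<Gamma> (tgt \<Gamma> (emap r E)))" using r_twist(1)[OF E] by simp
  fix h assume "h \<in> carrier (egroup Q E)"
  then have h: "h \<in> ES E" by simp
  show "ehom r (bar Q E) h = ehom r E h" using ehom_bar[OF E h] by simp
  show "vhom r (tgt Q E) (einj Q E h) = twist r E \<otimes>\<^bsub>vgroup \<Gamma> (tgt \<Gamma> (emap r E))\<^esub> einj \<Gamma> (emap r E) (ehom r E h)
     \<otimes>\<^bsub>vgroup \<Gamma> (tgt \<Gamma> (emap r E))\<^esub> inv\<^bsub>vgroup \<Gamma> (tgt \<Gamma> (emap r E))\<^esub> twist r E"
    unfolding Q_simps r_maps by (rule vhom_einj_r[OF E h])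
qed

lemma q_map: "q = map_point VO EO (bs_base \<Gamma> p)"
  by (simp add: quotient_base_def orbit_projection_def)

text \<open>The representative of an orbit through the base point is the prescribed lift itself, so
  passing to orbits and back does not change the image of the base point.\<close>

lemma base_r: "map_point (vmap r) (emap r) q = p"
proof -
  have "map_point (vmap r) (emap r) q = map_point (vmap proj) (emap proj) (bs_base \<Gamma> p)"
  proof (cases "bs_base \<Gamma> p")
    case (Vertex x)
    then show ?thesis unfolding q_map using lift_base(1) by simp
  next
    case (Interior S)
    have "(\<lambda>(e, t). (fst (re e), t)) ` (\<lambda>(e, t). (EO e, t)) ` S = (\<lambda>(e, t). (fst e, t)) ` S"
      unfolding image_image
    proof (rule image_cong[OF HOL.refl])
      fix z assume "z \<in> S"
      then show "(case case z of (e, t) \<Rightarrow> (EO e, t) of (e, t) \<Rightarrow> (fst (re e), t)) = (case z of (e, t) \<Rightarrow> (fst e, t))"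
        using lift_base(2)[OF Interior, of "fst z" "snd z"] by (simp add: case_prod_unfold)
    qed
    then show ?thesis unfolding q_map Interior by simp
  qed
  then show ?thesis using base_proj by simp
qed

lemma q_in: "q \<in> points Q"
  using bs_base_in
proof (cases rule: T.pointsE)
  case (Vertex x)
  then show ?thesis unfolding q_map using Q.vertex_in_points[of "VO x"] by simp
next
  case (Edge y t)
  have "q = edge_point Q (EO y) t"
    unfolding q_map Edge(4) using Edge(2,3) bar_eorbit[OF Edge(1)] by (simp add: edge_point_def)
  then show ?thesis using Q.edge_point_in[of "EO y" t] Edge(1-3) by simp
qed

lemma fst_src_lift:
  assumes "E \<in> EO ` edges T"
  shows "vmap r (src Q E) = src \<Gamma> (fst (re E))"
  unfolding r_maps src_def[of Q] Q_simps by (rule elift_in(8)[OF assms])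

text \<open>Vertices and edges of the tree are path classes modulo local groups, so their
  \<open>H\<close>-orbits are double cosets, and \<open>vtrans\<close> and \<open>etrans\<close>
  supply the elements of \<open>H\<close> that reach a given class from the representative. The
  local groups of the quotient are stabilisers by construction; the dictionary between action and
  chosen classes turns this into the stabiliser clauses of the chart, and \<open>shift\<close>
  witnesses the twist clause.\<close>

lemma chart_Q: "chart Q \<Gamma> r q p H (\<lambda>W. vs (rv W)) (\<lambda>E. es (re E))"
proof (intro chart.intro chart_axioms.intro pointed_morphism.intro pointed_morphism_axioms.intro gog_morphism.intro gog_morphism_axioms.intro)
  show "gog Q" "gog \<Gamma>" "morphism Q \<Gamma> r" "pgog \<Gamma> p" by (intro Q.gog_axioms gog_axioms morphism_r pgog_axioms)+
  show "pgog Q q" by unfold_locales (rule q_in)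
  show "map_point (vmap r) (emap r) q = p" by (rule base_r)
  show "subgroup H \<pi>" by (rule H)
  show "vs (rv W) \<in> P (vmap r W)" if "W \<in> verts Q" for W using vs(1)[OF vlift(1)] that by simp
  show "es (re E) \<in> P (vmap r (src Q E))" if "E \<in> edges Q" for E
    using es(1)[OF elift(1)] fst_src_lift that by simp
  show "es (re (bar Q E)) = X (emap r E) (es (re E))" if "E \<in> edges Q" for E
    using es_bar[OF elift(1)] elift(3) that by simp
  show "\<exists>W\<in>verts Q. \<exists>h\<in>H. \<exists>g\<in>carrier (vgroup \<Gamma> v). vmap r W = v \<and> A = L v h (R v (vs (rv W)) g)" if A: "A \<in> P v" for A v
  proof -
    let ?x = "bv v A"
    have x: "?x \<in> verts T" using A by simp
    then have W: "VO ?x \<in> VO ` verts T" by simp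
    note t = vtrans[OF x] and l = vlift[OF W]
    have f: "fst (rv (VO ?x)) = v" using arg_cong[OF t(2), of fst] by simp
    have c: "vs (rv (VO ?x)) \<in> P v" using vs(1)[OF l(1)] f by simp
    obtain g where g: "g \<in> carrier (vgroup \<Gamma> v)" "vs ?x = L v (vtrans D ?x) (R v (vs (rv (VO ?x))) g)"
      using vact_eqD[OF x l(1) _ t(2)] t(1) by auto
    have "bv v (vs ?x) = bv v A" using vs(2)[OF x] by simp
    from bs_vertex_eqD[OF this A] obtain g' where g': "g' \<in> carrier (vgroup \<Gamma> v)" "A = R v (vs ?x) g'" by blast
    have v: "v \<in> verts \<Gamma>" using A by (rule vpaths_vert)
    interpret V: group "vgroup \<Gamma> v" using v by (rule vgroup_group)
    have "A = R v (vs ?x) g'" by (rule g'(2))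
    also have "\<dots> = L v (vtrans D ?x) (R v (vs (rv (VO ?x))) (g \<otimes>\<^bsub>vgroup \<Gamma> v\<^esub> g'))"
      unfolding g(2) using g(1) g'(1) c t(1) by (simp add: lact_ract ract_mult)
    finally have 1: "A = L v (vtrans D ?x) (R v (vs (rv (VO ?x))) (g \<otimes>\<^bsub>vgroup \<Gamma> v\<^esub> g'))" .
    have "g \<otimes>\<^bsub>vgroup \<Gamma> v\<^esub> g' \<in> carrier (vgroup \<Gamma> v)" using g(1) g'(1) by simp
    moreover have "VO ?x \<in> verts Q" "vmap r (VO ?x) = v" using x f by simp_all
    ultimately show ?thesis using t(1) 1 by blast
  qed
  show "W' = W" if "W \<in> verts Q" "W' \<in> verts Q" "vmap r W' = vmap r W" "h \<in> H" "g \<in> carrier (vgroup \<Gamma> (vmap r W))"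
      "vs (rv W') = L (vmap r W) h (R (vmap r W) (vs (rv W)) g)" for W W' h g
  proof -
    have W: "W \<in> VO ` verts T" "W' \<in> VO ` verts T" using that by simp_all
    have f: "fst (rv W) = fst (rv W')" using that(3) by simp
    have "VA h (rv W) = rv W'"
      using that(5,6) unfolding r_maps f
      by (intro vact_eqI[of "rv W'" "rv W" h g]) (use W vlift(1) that(4) f in simp_all)
    then have "VO (rv W') = VO (rv W)" using vorbit_vact[OF that(4) vlift(1)[OF W(1)]] by simp
    then show ?thesis unfolding vlift(2)[OF W(1)] vlift(2)[OF W(2)] .
  qed
  show "inj_on (vhom r W) (carrier (vgroup Q W))" if "W \<in> verts Q" for W
  proof (rule inj_onI)
    fix h k assume hk: "h \<in> carrier (vgroup Q W)" "k \<in> carrier (vgroup Q W)" "vhom r W h = vhom r W k"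
    have W: "W \<in> VO ` verts T" using that by simp
    have "L (fst (rv W)) h (vs (rv W)) = L (fst (rv W)) k (vs (rv W))"
      using r_vhom(2)[OF W, of h] r_vhom(2)[OF W, of k] hk by simp
    then show "h = k" by (rule lact_free[OF _ _ vs(1)[OF vlift(1)[OF W]], rotated -1]) (use hk in simp_all)
  qed
  show "\<exists>h\<in>H. L (vmap r W) h (vs (rv W)) = R (vmap r W) (vs (rv W)) (vhom r W l)"
    if "W \<in> verts Q" "l \<in> carrier (vgroup Q W)" for W l
    using r_vhom(2)[of W l] that by (intro bexI[of _ l]) simp_all
  show "\<exists>l\<in>carrier (vgroup Q W). g = vhom r W l" if "W \<in> verts Q" "h \<in> H" "g \<in> carrier (vgroup \<Gamma> (vmap r W))"
      "L (vmap r W) h (vs (rv W)) = R (vmap r W) (vs (rv W)) g" for W h g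
  proof -
    have W: "W \<in> VO ` verts T" using that by simp
    note x = vlift(1)[OF W] note c = vs(1)[OF x]
    \<comment> \<open>Solved for the chosen class, as \<open>vact_eqI\<close> expects, the equation
      features the inverse of \<open>h\<close>; that \<open>h\<close> itself fixes the vertex
      follows afterwards.\<close>
    have "vs (rv W) = L (fst (rv W)) (inv\<^bsub>\<pi>\<^esub> h) (R (fst (rv W)) (vs (rv W)) g)"
      using arg_cong[OF that(4), of "L (fst (rv W)) (inv\<^bsub>\<pi>\<^esub> h)"] c that(2) unfolding r_maps by simp
    from vact_eqI[OF x x _ _ _ this] have "VA (inv\<^bsub>\<pi>\<^esub> h) (rv W) = rv W" using that(2,3) by simp
    then have "VA h (rv W) = rv W" using vact_inv[of "inv\<^bsub>\<pi>\<^esub> h" "rv W"] x that(2) by simp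
    then have h: "h \<in> VS W" using that(2) by simp
    have "vhom r W h = g" by (rule vhom_unique[OF W h]) (use that(3,4) in simp_all)
    then show ?thesis using h by (intro bexI[of _ h]) simp_all
  qed
  show "\<exists>E\<in>edges Q. \<exists>h\<in>H. \<exists>k\<in>carrier (egroup \<Gamma> e). emap r E = e \<and>
      A = L (src \<Gamma> e) h (R (src \<Gamma> e) (es (re E)) (einj \<Gamma> (bar \<Gamma> e) k))" if e: "e \<in> edges \<Gamma>" and A: "A \<in> P (src \<Gamma> e)" for e A
  proof -
    let ?y = "be e A"
    have y: "?y \<in> edges T" using e A by simp
    then have E: "EO ?y \<in> EO ` edges T" by simp
    note t = etrans[OF y] and l = elift(1,2)[OF E]
    have f: "fst (re (EO ?y)) = e" using arg_cong[OF t(2), of fst] by simp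
    have c: "es (re (EO ?y)) \<in> P (src \<Gamma> e)" using es(1)[OF l(1)] f by simp
    obtain k where k: "k \<in> carrier (egroup \<Gamma> e)"
      "es ?y = L (src \<Gamma> e) (etrans D ?y) (R (src \<Gamma> e) (es (re (EO ?y))) (einj \<Gamma> (bar \<Gamma> e) k))"
      using eact_eqD[OF y l(1) _ t(2)] t(1) by auto
    have "be e (es ?y) = be e A" using es(2)[OF y] by simp
    from bs_edge_eqD[OF this e A] obtain k' where k': "k' \<in> carrier (egroup \<Gamma> e)"
      "A = R (src \<Gamma> e) (es ?y) (einj \<Gamma> (bar \<Gamma> e) k')" by blast
    interpret E: group "egroup \<Gamma> e" using e by (rule egroup_group)
    have "A = R (src \<Gamma> e) (es ?y) (einj \<Gamma> (bar \<Gamma> e) k')" by (rule k'(2))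
    also have "\<dots> = L (src \<Gamma> e) (etrans D ?y) (R (src \<Gamma> e) (es (re (EO ?y))) (einj \<Gamma> (bar \<Gamma> e) (k \<otimes>\<^bsub>egroup \<Gamma> e\<^esub> k')))"
      unfolding k(2) using k(1) k'(1) c t(1) e by (simp add: lact_ract ract_mult einj_bar_mult)
    finally have 1: "A = L (src \<Gamma> e) (etrans D ?y) (R (src \<Gamma> e) (es (re (EO ?y))) (einj \<Gamma> (bar \<Gamma> e) (k \<otimes>\<^bsub>egroup \<Gamma> e\<^esub> k')))" .
    have "k \<otimes>\<^bsub>egroup \<Gamma> e\<^esub> k' \<in> carrier (egroup \<Gamma> e)" using k(1) k'(1) by simp
    moreover have "EO ?y \<in> edges Q" "emap r (EO ?y) = e" using y f by simp_all
    ultimately show ?thesis using t(1) 1 by blast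
  qed
  show "E' = E" if "E \<in> edges Q" "E' \<in> edges Q" "emap r E' = emap r E" "h \<in> H" "k \<in> carrier (egroup \<Gamma> (emap r E))"
      "es (re E') = L (vmap r (src Q E)) h (R (vmap r (src Q E)) (es (re E)) (einj \<Gamma> (bar \<Gamma> (emap r E)) k))" for E E' h k
  proof -
    have E: "E \<in> EO ` edges T" "E' \<in> EO ` edges T" using that by simp_all
    have f: "fst (re E) = fst (re E')" using that(3) by simp
    have "EA h (re E) = re E'"
      using that(5,6) unfolding fst_src_lift[OF E(1)] unfolding r_maps f
      by (intro eact_eqI[of "re E'" "re E" h k]) (use E elift(1) that(4) f in simp_all)
    then have "EO (re E') = EO (re E)" using eorbit_eact[OF that(4) elift(1)[OF E(1)]] by simp
    then show ?thesis unfolding elift(2)[OF E(1)] elift(2)[OF E(2)] .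
  qed
  show "inj_on (ehom r E) (carrier (egroup Q E))" if "E \<in> edges Q" for E
  proof (rule inj_onI)
    fix h k assume hk: "h \<in> carrier (egroup Q E)" "k \<in> carrier (egroup Q E)" "ehom r E h = ehom r E k"
    have E: "E \<in> EO ` edges T" using that by simp
    have "L (src \<Gamma> (fst (re E))) h (es (re E)) = L (src \<Gamma> (fst (re E))) k (es (re E))"
      using r_ehom(2)[OF E, of h] r_ehom(2)[OF E, of k] hk by simp
    then show "h = k" by (rule lact_free[OF _ _ es(1)[OF elift(1)[OF E]], rotated -1]) (use hk in simp_all)
  qed
  show "\<exists>h\<in>H. L (vmap r (src Q E)) h (es (re E)) = R (vmap r (src Q E)) (es (re E)) (einj \<Gamma> (bar \<Gamma> (emap r E)) (ehom r E j))"
    if "E \<in> edges Q" "j \<in> carrier (egroup Q E)" for E j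
    using r_ehom(2)[of E j] fst_src_lift[of E] that by (intro bexI[of _ j]) simp_all
  show "\<exists>j\<in>carrier (egroup Q E). k = ehom r E j" if "E \<in> edges Q" "h \<in> H" "k \<in> carrier (egroup \<Gamma> (emap r E))"
      "L (vmap r (src Q E)) h (es (re E)) = R (vmap r (src Q E)) (es (re E)) (einj \<Gamma> (bar \<Gamma> (emap r E)) k)" for E h k
  proof -
    have E: "E \<in> EO ` edges T" using that by simp
    note y = elift(1)[OF E] and e = elift_in(5)[OF E] note c = es(1)[OF y]
    let ?u = "src \<Gamma> (fst (re E))"
    have eq: "L ?u h (es (re E)) = R ?u (es (re E)) (einj \<Gamma> (bar \<Gamma> (fst (re E))) k)"
      using that(4) unfolding fst_src_lift[OF E] unfolding r_maps .
    have "es (re E) = L ?u (inv\<^bsub>\<pi>\<^esub> h) (R ?u (es (re E)) (einj \<Gamma> (bar \<Gamma> (fst (re E))) k))"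
      using arg_cong[OF eq, of "L ?u (inv\<^bsub>\<pi>\<^esub> h)"] c that(2) by simp
    from eact_eqI[OF y y _ _ _ this] have "EA (inv\<^bsub>\<pi>\<^esub> h) (re E) = re E" using that(2,3) by simp
    then have "EA h (re E) = re E" using eact_inv[of "inv\<^bsub>\<pi>\<^esub> h" "re E"] y that(2) by simp
    then have h: "h \<in> ES E" using that(2) by simp
    have "ehom r E h = k" by (rule ehom_unique[OF E h _ eq]) (use that(3) in simp)
    then show ?thesis using h by (intro bexI[of _ h]) simp_all
  qed
  show "\<exists>h\<in>H. L (vmap r (tgt Q E)) h (R (vmap r (tgt Q E)) (vs (rv (tgt Q E))) (twist r E)) = es (re (bar Q E))"
    if "E \<in> edges Q" for E
  proof -
    have E: "E \<in> EO ` edges T" using that by simp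
    show ?thesis using r_twist(2)[OF E] elift(3,4)[OF E] elift_in(7)[OF E] by (intro bexI[of _ "shift D E"]) simp_all
  qed
  show "vs (rv W) = hclass \<Gamma> p p []" if "q = Vertex W" for W
  proof -
    obtain x where x: "bs_base \<Gamma> p = Vertex x" "W = VO x" using \<open>q = Vertex W\<close> unfolding q_map by (cases "bs_base \<Gamma> p") auto
    then show ?thesis using vs_base lift_base(1) by simp
  qed
  show "es (re E) = initial_seg \<Gamma> p (emap r E) t" if "E \<in> edges Q" "0 < t" "t < 1" "q = edge_point Q E t" for E t
  proof -
    have qI: "q = Interior {(E, t), (bar Q E, 1 - t)}" using that by (simp add: edge_point_def)
    obtain S where S: "bs_base \<Gamma> p = Interior S" "(\<lambda>(e, t). (EO e, t)) ` S = {(E, t), (bar Q E, 1 - t)}"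
      using qI unfolding q_map by (cases "bs_base \<Gamma> p") auto
    then have "(E, t) \<in> (\<lambda>(e, t). (EO e, t)) ` S" by blast
    then obtain y where y: "(y, t) \<in> S" "E = EO y" by auto
    show ?thesis unfolding y(2) r_maps using lift_base(2)[OF S(1) y(1)] es_base[OF S(1) y(1)] by simp
  qed
qed

section \<open>The projection from the tree to the quotient\<close>

abbreviation \<rho> where "\<rho> \<equiv> orbit_projection \<Gamma> p H D"

lemma rho_simps [simp]: "vmap \<rho> = VO" "emap \<rho> = EO" "vhom \<rho> x u = \<one>\<^bsub>\<pi>\<^esub>" "ehom \<rho> y u = \<one>\<^bsub>\<pi>\<^esub>"
  "twist \<rho> y = inv\<^bsub>\<pi>\<^esub> vtrans D (tgt T y) \<otimes>\<^bsub>\<pi>\<^esub> etrans D y \<otimes>\<^bsub>\<pi>\<^esub> shift D (EO y)"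
  by (simp_all add: orbit_projection_def)

lemma fst_lift:
  "x \<in> verts T \<Longrightarrow> fst (rv (VO x)) = fst x" "y \<in> edges T \<Longrightarrow> fst (re (EO y)) = fst y"
  using vtrans(2)[of x] etrans(2)[of y] fst_act by metis+

text \<open>Followed from the representative of the terminal orbit: \<open>shift\<close> leads to
  the end of the lifted edge, \<open>etrans\<close> to the end of \<open>y\<close>, and the inverse
  of \<open>vtrans\<close> back to the start.\<close>

lemma rho_twist:
  assumes y: "y \<in> edges T"
  shows "twist \<rho> y \<in> VS (VO (tgt T y))"
proof -
  have E: "EO y \<in> EO ` edges T" using y by simp
  note b = bar_T_in[OF y] and l = elift[OF E] and et = etrans[OF y] and vt = vtrans[OF bar_T_in(4)[OF y]]
  have W: "VO (tgt T y) \<in> VO ` verts T" using b by simp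
  have s: "VA (shift D (EO y)) (rv (VO (tgt T y))) = tgt T (re (EO y))" using l(5) unfolding tgt_eorbit[OF y] .
  have "VA (twist \<rho> y) (rv (VO (tgt T y))) = VA (inv\<^bsub>\<pi>\<^esub> vtrans D (tgt T y)) (VA (etrans D y) (tgt T (re (EO y))))"
    using s l(4) et(1) vt(1) vlift(1)[OF W] bar_T_in(4)[OF l(1)] by (simp add: vact_mult)
  also have "\<dots> = VA (inv\<^bsub>\<pi>\<^esub> vtrans D (tgt T y)) (tgt T y)" using tgt_T_eact[of "etrans D y" "re (EO y)"] et(1,2) l(1) by simp
  also have "\<dots> = rv (VO (tgt T y))" using vact_inv[of "vtrans D (tgt T y)", OF _ vlift(1)[OF W]] vt by simp
  finally show ?thesis using l(4) et(1) vt(1) by simp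
qed

text \<open>Once \<open>\<rho>\<close> is seen to solve the comparison equations, that it is a
  covering and that it composes with \<open>r\<close> to the natural projection are instances of
  general facts. The corrections \<open>a\<close> and \<open>b\<close> measure how far the section
  is from being equivariant under \<open>vtrans\<close> and \<open>etrans\<close>.\<close>

lemma orbit_comparison:
  "\<exists>a b. comparison_morphism T Q \<Gamma> proj r (bs_base \<Gamma> p) q p {\<one>\<^bsub>\<pi>\<^esub>} vs es H (\<lambda>W. vs (rv W)) (\<lambda>E. es (re E)) \<rho> a b"
proof -
  have W: "VO x \<in> VO ` verts T" if "x \<in> verts T" for x using that by simp
  have E: "EO y \<in> EO ` edges T" if "y \<in> edges T" for y using that by simp
  \<comment> \<open>The class chosen at \<open>x\<close> and the translate of the one chosen at the
    representative of its orbit both lie in the coset \<open>x\<close>; \<open>a x\<close> is their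
    quotient.\<close>
  have "\<exists>g. g \<in> carrier (vgroup \<Gamma> (fst x)) \<and> vs x = L (fst x) (vtrans D x) (R (fst x) (vs (rv (VO x))) g)" if x: "x \<in> verts T" for x
    using vact_eqD[OF x vlift(1)[OF W[OF x]] _ vtrans(2)[OF x]] vtrans(1)[OF x] by auto
  then obtain a where a: "\<And>x. x \<in> verts T \<Longrightarrow> a x \<in> carrier (vgroup \<Gamma> (fst x))"
    "\<And>x. x \<in> verts T \<Longrightarrow> vs x = L (fst x) (vtrans D x) (R (fst x) (vs (rv (VO x))) (a x))" by metis
  have "\<exists>k. k \<in> carrier (egroup \<Gamma> (fst y)) \<and>
      es y = L (src \<Gamma> (fst y)) (etrans D y) (R (src \<Gamma> (fst y)) (es (re (EO y))) (einj \<Gamma> (bar \<Gamma> (fst y)) k))" if y: "y \<in> edges T" for y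
    using eact_eqD[OF y elift(1)[OF E[OF y]] _ etrans(2)[OF y]] etrans(1)[OF y] by auto
  then obtain b where b: "\<And>y. y \<in> edges T \<Longrightarrow> b y \<in> carrier (egroup \<Gamma> (fst y))"
    "\<And>y. y \<in> edges T \<Longrightarrow> es y = L (src \<Gamma> (fst y)) (etrans D y) (R (src \<Gamma> (fst y)) (es (re (EO y))) (einj \<Gamma> (bar \<Gamma> (fst y)) (b y)))"
    by metis
  have cV: "vs (rv (VO x)) \<in> P (fst x)" if "x \<in> verts T" for x using vs(1)[OF vlift(1)[OF W[OF that]]] fst_lift(1)[OF that] by simp
  have cE: "es (re (EO y)) \<in> P (src \<Gamma> (fst y))" if "y \<in> edges T" for y
    using es(1)[OF elift(1)[OF E[OF that]]] fst_lift(2)[OF that] by simp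
  \<comment> \<open>Extension carries the defining equation of \<open>b y\<close> to the far end of
    the edge. The reverse edge has the same \<open>etrans\<close>, so freeness of right
    multiplication makes \<open>b\<close> invariant under reversal.\<close>
  have b_tgt: "es (bar T y) = L (tgt \<Gamma> (fst y)) (etrans D y) (R (tgt \<Gamma> (fst y)) (es (bar T (re (EO y)))) (einj \<Gamma> (fst y) (b y)))"
    if y: "y \<in> edges T" for y
  proof -
    let ?c = "es (re (EO y))" and ?k = "einj \<Gamma> (bar \<Gamma> (fst y)) (b y)" and ?e = "fst y"
    note e = bar_T_in(8)[OF y] and c = cE[OF y] and bk = b(1)[OF y]
    have t: "etrans D y \<in> carrier \<pi>" using etrans(1)[OF y] by simp
    have k: "?k \<in> carrier (vgroup \<Gamma> (src \<Gamma> ?e))" using bk e by simp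
    have "es (bar T y) = X ?e (L (src \<Gamma> ?e) (etrans D y) (R (src \<Gamma> ?e) ?c ?k))"
      unfolding es_bar[OF y] by (rule arg_cong[OF b(2)[OF y]])
    also have "\<dots> = L (tgt \<Gamma> ?e) (etrans D y) (X ?e (R (src \<Gamma> ?e) ?c ?k))" using e t c k by (intro extend_lact) simp_all
    also have "X ?e (R (src \<Gamma> ?e) ?c ?k) = R (tgt \<Gamma> ?e) (X ?e ?c) (einj \<Gamma> ?e (b y))" by (rule extend_ract[OF e bk c])
    finally show ?thesis using es_bar[OF elift(1)[OF E[OF y]]] fst_lift(2)[OF y] by simp
  qed
  have b_bar: "b (bar T y) = b y" if y: "y \<in> edges T" for y
  proof -
    let ?v = "tgt \<Gamma> (fst y)"
    note yb = bar_T_in[OF y]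
    have l: "re (EO (bar T y)) = bar T (re (EO y))" using elift(3)[OF E[OF y]] bar_eorbit[OF y] by simp
    have bb: "b (bar T y) \<in> carrier (egroup \<Gamma> (fst y))" using b(1)[OF yb(1)] yb by simp
    have c: "es (bar T (re (EO y))) \<in> P ?v" using es_bar_in[OF elift(1)[OF E[OF y]]] fst_lift(2)[OF y] by simp
    have "es (bar T y) = L ?v (etrans D y) (R ?v (es (bar T (re (EO y)))) (einj \<Gamma> (fst y) (b (bar T y))))"
      using b(2)[OF yb(1)] yb(5,8) etrans(3)[OF y] l by simp
    then have eq: "L ?v (etrans D y) (R ?v (es (bar T (re (EO y)))) (einj \<Gamma> (fst y) (b (bar T y))))
      = L ?v (etrans D y) (R ?v (es (bar T (re (EO y)))) (einj \<Gamma> (fst y) (b y)))" using b_tgt[OF y] by metis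
    have i: "einj \<Gamma> (fst y) (b (bar T y)) \<in> carrier (vgroup \<Gamma> ?v)" "einj \<Gamma> (fst y) (b y) \<in> carrier (vgroup \<Gamma> ?v)"
      using bb b(1)[OF y] yb(8) by simp_all
    have "R ?v (es (bar T (re (EO y)))) (einj \<Gamma> (fst y) (b (bar T y))) = R ?v (es (bar T (re (EO y)))) (einj \<Gamma> (fst y) (b y))"
      using arg_cong[OF eq, of "L ?v (inv\<^bsub>\<pi>\<^esub> etrans D y)"] etrans(1)[OF y] c i by simp
    from ract_free[OF c i this] show ?thesis using einj_eq[OF yb(8) bb b(1)[OF y]] by simp
  qed
  have "comparison_morphism T Q \<Gamma> proj r (bs_base \<Gamma> p) q p {\<one>\<^bsub>\<pi>\<^esub>} vs es H (\<lambda>W. vs (rv W)) (\<lambda>E. es (re E)) \<rho> a b"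
  proof (intro comparison_morphism.intro comparison.intro comparison_axioms.intro comparison_morphism_axioms.intro chart_T chart_Q)
    show "{\<one>\<^bsub>\<pi>\<^esub>} \<subseteq> H" by simp
    fix x assume x: "x \<in> verts T"
    show "vmap \<rho> x \<in> verts Q" "vmap r (vmap \<rho> x) = vmap proj x" using x fst_lift(1) by simp_all
    show "a x \<in> carrier (vgroup \<Gamma> (vmap proj x))" using a(1)[OF x] by simp
    have "K (fst x) (L (fst x) (vtrans D x) (R (fst x) (vs (rv (VO x))) (a x))) = K (fst x) (R (fst x) (vs (rv (VO x))) (a x))"
      by (rule hcoset_lact[OF vtrans(1)[OF x]]) (use cV[OF x] a(1)[OF x] in simp)
    then show "K (vmap proj x) (vs x) = K (vmap proj x) (R (vmap proj x) (vs (rv (vmap \<rho> x))) (a x))"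
      unfolding a(2)[OF x, symmetric] by simp
    fix u assume "u \<in> carrier (vgroup T x)"
    have o: "\<one>\<^bsub>\<pi>\<^esub> \<in> VS (VO x)" using vlift(1)[OF W[OF x]] by simp
    then show "vhom \<rho> x u \<in> carrier (vgroup Q (vmap \<rho> x))" by simp
    have v: "fst x \<in> verts \<Gamma>" using cV[OF x] by (rule vpaths_vert)
    interpret V: group "vgroup \<Gamma> (fst x)" using v by (rule vgroup_group)
    have "vhom r (VO x) \<one>\<^bsub>\<pi>\<^esub> = \<one>\<^bsub>vgroup \<Gamma> (fst x)\<^esub>"
      by (rule vhom_unique[OF W[OF x] o]) (use fst_lift(1)[OF x] cV[OF x] v in simp_all)
    then show "vhom r (vmap \<rho> x) (vhom \<rho> x u) = a x \<otimes>\<^bsub>vgroup \<Gamma> (vmap proj x)\<^esub> vhom proj x u \<otimes>\<^bsub>vgroup \<Gamma> (vmap proj x)\<^esub> inv\<^bsub>vgroup \<Gamma> (vmap proj x)\<^esub> a x"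
      using a(1)[OF x] by simp
  next
    fix y assume y: "y \<in> edges T"
    note yb = bar_T_in[OF y]
    show "emap \<rho> y \<in> edges Q" "emap r (emap \<rho> y) = emap proj y" "emap \<rho> (bar T y) = bar Q (emap \<rho> y)"
      using y fst_lift(2) bar_eorbit by simp_all
    show "b y \<in> carrier (egroup \<Gamma> (emap proj y))" "b (bar T y) = b y" using b(1)[OF y] b_bar[OF y] by simp_all
    have f: "vmap proj (src T y) = src \<Gamma> (fst y)" using yb by simp
    have "K (src \<Gamma> (fst y)) (L (src \<Gamma> (fst y)) (etrans D y) (R (src \<Gamma> (fst y)) (es (re (EO y))) (einj \<Gamma> (bar \<Gamma> (fst y)) (b y))))
      = K (src \<Gamma> (fst y)) (R (src \<Gamma> (fst y)) (es (re (EO y))) (einj \<Gamma> (bar \<Gamma> (fst y)) (b y)))"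
      by (rule hcoset_lact[OF etrans(1)[OF y]]) (use cE[OF y] b(1)[OF y] yb in simp)
    then show "K (vmap proj (src T y)) (es y)
      = K (vmap proj (src T y)) (R (vmap proj (src T y)) (es (re (emap \<rho> y))) (einj \<Gamma> (bar \<Gamma> (emap proj y)) (b y)))"
      unfolding f b(2)[OF y, symmetric] by simp
    interpret E: group "egroup \<Gamma> (fst y)" using yb by (intro egroup_group)
    fix u assume "u \<in> carrier (egroup T y)"
    have o: "\<one>\<^bsub>\<pi>\<^esub> \<in> ES (EO y)" using elift(1)[OF E[OF y]] by simp
    then show "ehom \<rho> y u \<in> carrier (egroup Q (emap \<rho> y))" by simp
    have "ehom r (EO y) \<one>\<^bsub>\<pi>\<^esub> = \<one>\<^bsub>egroup \<Gamma> (fst y)\<^esub>"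
      by (rule ehom_unique[OF E[OF y] o]) (use fst_lift(2)[OF y] cE[OF y] yb in simp_all)
    then show "ehom r (emap \<rho> y) (ehom \<rho> y u) = b y \<otimes>\<^bsub>egroup \<Gamma> (emap proj y)\<^esub> ehom proj y u \<otimes>\<^bsub>egroup \<Gamma> (emap proj y)\<^esub> inv\<^bsub>egroup \<Gamma> (emap proj y)\<^esub> b y"
      using b(1)[OF y] by simp
  next
    fix y assume y: "y \<in> edges T"
    note yb = bar_T_in[OF y]
    show "twist \<rho> y \<in> carrier (vgroup Q (vmap \<rho> (tgt T y)))" using rho_twist[OF y] by (simp del: rho_simps(5))
    let ?v = "tgt \<Gamma> (fst y)" and ?x = "tgt T y"
    let ?G = "vgroup \<Gamma> ?v" and ?c = "vs (rv (VO (tgt T y)))" and ?n = "inv\<^bsub>\<pi>\<^esub> vtrans D ?x" and ?h = "vhom r (VO ?x) (twist \<rho> y)"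
    let ?\<delta> = "twist r (EO y)" and ?k = "einj \<Gamma> (fst y) (b y)"
    interpret V: group ?G using yb by (intro vgroup_group) simp
    note x = yb(4) and l = elift[OF E[OF y]]
    have c: "?c \<in> P ?v" using cV[OF x] yb by simp
    have fx: "fst (rv (VO ?x)) = ?v" using fst_lift(1)[OF x] yb by simp
    have ax: "a ?x \<in> carrier ?G" using a(1)[OF x] yb by simp
    have k: "?k \<in> carrier ?G" using b(1)[OF y] yb by simp
    have \<delta>: "?\<delta> \<in> carrier ?G" "L ?v (shift D (EO y)) (R ?v ?c ?\<delta>) = es (bar T (re (EO y)))"
      using r_twist[OF E[OF y]] unfolding fst_lift(2)[OF y] tgt_eorbit[OF y] by simp_all
    have h: "?h \<in> carrier ?G" "L ?v (twist \<rho> y) ?c = R ?v ?c ?h"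
      using r_vhom[OF W[OF x] rho_twist[OF y]] unfolding fx by simp_all
    have vt: "vtrans D ?x \<in> carrier \<pi>" and et: "etrans D y \<in> carrier \<pi>" and s: "shift D (EO y) \<in> carrier \<pi>"
      using vtrans(1)[OF x] etrans(1)[OF y] l(4) by simp_all
    \<comment> \<open>The twist equation is tested on the class of the orbit representative: both
      sides produce the translate of \<open>es (bar T y)\<close> by the inverse of
      \<open>vtrans\<close>, the right-hand one after the factors of \<open>rho_twist\<close> are
      unfolded from the inside. Freeness then removes the class.\<close>
    have "R ?v ?c (a ?x \<otimes>\<^bsub>?G\<^esub> twist proj y) = R ?v (L ?v ?n (vs ?x)) (twist proj y)"
      using arg_cong[OF a(2)[OF x], of "L ?v ?n"] yb(6) c ax vt proj_twist(1)[OF y] by (simp add: ract_mult)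
    also have "\<dots> = L ?v ?n (es (bar T y))"
      unfolding proj_twist(2)[OF y, symmetric] using vs(1)[OF x] yb(6) vt proj_twist(1)[OF y] by (simp add: lact_ract)
    finally have 1: "R ?v ?c (a ?x \<otimes>\<^bsub>?G\<^esub> twist proj y) = L ?v ?n (es (bar T y))" .
    have tw: "twist \<rho> y \<in> carrier \<pi>" using rho_twist[OF y] by (simp del: rho_simps(5))
    have "R ?v ?c (?h \<otimes>\<^bsub>?G\<^esub> (?\<delta> \<otimes>\<^bsub>?G\<^esub> ?k)) = R ?v (R ?v (L ?v (twist \<rho> y) ?c) ?\<delta>) ?k"
      unfolding h(2) using c h(1) \<delta>(1) k by (simp add: ract_mult)
    also have "\<dots> = L ?v (twist \<rho> y) (R ?v (R ?v ?c ?\<delta>) ?k)" using c \<delta>(1) k tw by (simp add: lact_ract del: rho_simps(5))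
    also have "\<dots> = L ?v ?n (L ?v (etrans D y) (R ?v (L ?v (shift D (EO y)) (R ?v ?c ?\<delta>)) ?k))"
      using c \<delta>(1) k vt et s by (simp add: lact_ract lact_mult)
    also have "\<dots> = L ?v ?n (es (bar T y))" unfolding \<delta>(2) b_tgt[OF y] by (rule HOL.refl)
    finally have "R ?v ?c (a ?x \<otimes>\<^bsub>?G\<^esub> twist proj y) = R ?v ?c (?h \<otimes>\<^bsub>?G\<^esub> (?\<delta> \<otimes>\<^bsub>?G\<^esub> ?k))" using 1 by simp
    then have "a ?x \<otimes>\<^bsub>?G\<^esub> twist proj y = ?h \<otimes>\<^bsub>?G\<^esub> (?\<delta> \<otimes>\<^bsub>?G\<^esub> ?k)"
      by (rule ract_free[OF c, rotated -1]) (use ax h(1) \<delta>(1) k proj_twist(1)[OF y] in simp_all)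
    then show "a ?x \<otimes>\<^bsub>vgroup \<Gamma> (vmap proj ?x)\<^esub> twist proj y
      = vhom r (vmap \<rho> ?x) (twist \<rho> y) \<otimes>\<^bsub>vgroup \<Gamma> (vmap proj ?x)\<^esub>
        (twist r (emap \<rho> y) \<otimes>\<^bsub>vgroup \<Gamma> (vmap proj ?x)\<^esub> einj \<Gamma> (emap proj y) (b y))"
      using yb(6) by (simp del: rho_simps(5))
  next
    show "map_point (vmap \<rho>) (emap \<rho>) (bs_base \<Gamma> p) = q" by (simp add: q_map)
    \<comment> \<open>At the base point the vertex is its own orbit representative and
      \<open>vtrans\<close> is trivial, so the correction fixes the class and vanishes by
      freeness.\<close>
    show "a x = \<one>\<^bsub>vgroup \<Gamma> (vmap proj x)\<^esub>" if base: "bs_base \<Gamma> p = Vertex x" for x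
    proof -
      have x: "x \<in> verts T" using bs_base_in base by simp
      have c: "vs x \<in> P (fst x)" using vs(1)[OF x] .
      have v: "fst x \<in> verts \<Gamma>" using c by (rule vpaths_vert)
      have "vs x = R (fst x) (vs x) (a x)" using a[OF x] lift_base(1)[OF base] c by simp
      then have "R (fst x) (vs x) (a x) = R (fst x) (vs x) \<one>\<^bsub>vgroup \<Gamma> (fst x)\<^esub>" unfolding ract_one[OF c] by (rule HOL.sym)
      from ract_free[OF c a(1)[OF x] _ this] show ?thesis using v by simp
    qed
    show "b y = \<one>\<^bsub>egroup \<Gamma> (emap proj y)\<^esub>" if base: "bs_base \<Gamma> p = Interior S" "(y, t) \<in> S" for S y t
    proof -
      have y: "y \<in> edges T" by (rule base_edge_bar(1)[OF base])
      have c: "es y \<in> P (src \<Gamma> (fst y))" using es(1)[OF y] .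
      note e = bar_T_in(8)[OF y]
      have "es y = R (src \<Gamma> (fst y)) (es y) (einj \<Gamma> (bar \<Gamma> (fst y)) (b y))"
        using b[OF y] lift_base(2)[OF base] c e by simp
      then have "R (src \<Gamma> (fst y)) (es y) (einj \<Gamma> (bar \<Gamma> (fst y)) (b y))
        = R (src \<Gamma> (fst y)) (es y) (einj \<Gamma> (bar \<Gamma> (fst y)) \<one>\<^bsub>egroup \<Gamma> (fst y)\<^esub>)"
        using c e by simp
      from edge_ract_free[OF e c b(1)[OF y] _ this] show ?thesis using e by simp
    qed
  qed
  then show ?thesis by blast
qed

theorem quotient_coverings:
  "pointed_covering T (bs_base \<Gamma> p) Q q \<rho>" "pointed_covering Q q \<Gamma> p r"
  "same_pointed T (bs_base \<Gamma> p) \<Gamma> (gcompose T \<Gamma> r \<rho>) proj" "covering_subgroup Q q \<Gamma> p r = H"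
proof -
  obtain a b where *: "comparison_morphism T Q \<Gamma> proj r (bs_base \<Gamma> p) q p {\<one>\<^bsub>\<pi>\<^esub>} vs es H (\<lambda>W. vs (rv W)) (\<lambda>E. es (re E)) \<rho> a b"
    using orbit_comparison by blast
  show "pointed_covering T (bs_base \<Gamma> p) Q q \<rho>" by (rule comparison_morphism.pointed_covering_phi[OF *])
  show "same_pointed T (bs_base \<Gamma> p) \<Gamma> (gcompose T \<Gamma> r \<rho>) proj" by (rule comparison_morphism.same_pointed_phi[OF *])
  show "pointed_covering Q q \<Gamma> p r" by (rule chart.chart_pointed_covering[OF chart_Q])
  show "covering_subgroup Q q \<Gamma> p r = H" by (rule chart.chart_subgroup[OF chart_Q])
qed

end

section \<open>The Galois correspondence\<close>

text \<open>Being mutually inverse is expressed from both sides: the quotient covering of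
  \<open>H\<close> has subgroup \<open>H\<close>, and a covering is isomorphic to the quotient
  covering of its subgroup, which \<open>covering_iso_iff\<close> derives from the equality of
  subgroups. Sections and liftings are quantified universally, so nothing depends on a particular
  choice; separate clauses provide that they exist. The types of the coverings are independent of
  each other, so coverings with different carrier types can be compared.\<close>

theorem theorem1p12p6:
  fixes \<Gamma> :: "('v, 'e, 'g, 'h) graph_of_groups" and p :: "('v, 'e) point"
  assumes "graph_of_groups \<Gamma>" and "p \<in> points \<Gamma>"
  shows
    "(\<forall>(\<Lambda> :: ('v1, 'e1, 'g1, 'h1) graph_of_groups) q \<rho>.
        pointed_covering \<Lambda> q \<Gamma> p \<rho> \<longrightarrow>
          subgroup (covering_subgroup \<Lambda> q \<Gamma> p \<rho>) (fundamental_group \<Gamma> p)) \<and>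
     (\<exists>vs es. path_section \<Gamma> p vs es) \<and>
     (\<forall>H. subgroup H (fundamental_group \<Gamma> p) \<longrightarrow> (\<exists>D. is_lifting \<Gamma> p H D)) \<and>
     (\<forall>vs es H D.
        path_section \<Gamma> p vs es \<and> subgroup H (fundamental_group \<Gamma> p) \<and> is_lifting \<Gamma> p H D \<longrightarrow>
          pointed_covering (bs_tree \<Gamma> p) (bs_base \<Gamma> p)
            (quotient_gog \<Gamma> p H D) (quotient_base \<Gamma> p H D) (orbit_projection \<Gamma> p H D) \<and>
          pointed_covering (quotient_gog \<Gamma> p H D) (quotient_base \<Gamma> p H D) \<Gamma> p
            (quotient_covering \<Gamma> p vs es D) \<and>
          same_pointed (bs_tree \<Gamma> p) (bs_base \<Gamma> p) \<Gamma>
            (gcompose (bs_tree \<Gamma> p) \<Gamma> (quotient_covering \<Gamma> p vs es D) (orbit_projection \<Gamma> p H D))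
            (bs_projection \<Gamma> p vs es) \<and>
          covering_subgroup (quotient_gog \<Gamma> p H D) (quotient_base \<Gamma> p H D) \<Gamma> p
            (quotient_covering \<Gamma> p vs es D) = H) \<and>
     (\<forall>(\<Lambda> :: ('v1, 'e1, 'g1, 'h1) graph_of_groups) q \<rho> vs es D.
        pointed_covering \<Lambda> q \<Gamma> p \<rho> \<and> path_section \<Gamma> p vs es \<and>
        is_lifting \<Gamma> p (covering_subgroup \<Lambda> q \<Gamma> p \<rho>) D \<longrightarrow>
          covering_iso \<Gamma> \<Lambda> q \<rho>
            (quotient_gog \<Gamma> p (covering_subgroup \<Lambda> q \<Gamma> p \<rho>) D)
            (quotient_base \<Gamma> p (covering_subgroup \<Lambda> q \<Gamma> p \<rho>) D)
            (quotient_covering \<Gamma> p vs es D)) \<and>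
     (\<forall>(\<Lambda>1 :: ('v1, 'e1, 'g1, 'h1) graph_of_groups) q1 \<rho>1
        (\<Lambda>2 :: ('v2, 'e2, 'g2, 'h2) graph_of_groups) q2 \<rho>2.
        pointed_covering \<Lambda>1 q1 \<Gamma> p \<rho>1 \<and> pointed_covering \<Lambda>2 q2 \<Gamma> p \<rho>2 \<longrightarrow>
          (covering_iso \<Gamma> \<Lambda>1 q1 \<rho>1 \<Lambda>2 q2 \<rho>2 \<longleftrightarrow>
             covering_subgroup \<Lambda>1 q1 \<Gamma> p \<rho>1 = covering_subgroup \<Lambda>2 q2 \<Gamma> p \<rho>2) \<and>
          (factors_through \<Gamma> \<Lambda>1 q1 \<rho>1 \<Lambda>2 q2 \<rho>2 \<longleftrightarrow>
             covering_subgroup \<Lambda>1 q1 \<Gamma> p \<rho>1 \<subseteq> covering_subgroup \<Lambda>2 q2 \<Gamma> p \<rho>2))"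
proof -
  interpret pgog \<Gamma> p by unfold_locales (use assms in simp_all)
  have sub: "subgroup (covering_subgroup \<Lambda> q \<Gamma> p \<rho>) \<pi>" if "pointed_covering \<Lambda> q \<Gamma> p \<rho>"
    for \<Lambda> :: "('v1, 'e1, 'g1, 'h1) graph_of_groups" and q \<rho>
    by (rule pointed_morphism.covering_subgroup_subgroup[OF pointed_covering_morphism.axioms(1)[OF pointed_coveringD[OF that]]])
  have lifted: "lifted \<Gamma> p vs es H D" if "path_section \<Gamma> p vs es" "subgroup H \<pi>" "is_lifting \<Gamma> p H D" for vs es H D
    by (intro lifted.intro lifted_axioms.intro sectioned.intro sectioned_axioms.intro
        pgog_subgroup.intro pgog_subgroup_axioms.intro pgog_axioms that)
  have lifting: "\<exists>D. is_lifting \<Gamma> p H D" if "subgroup H \<pi>" for H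
    by (rule pgog_subgroup.lifting_exists[OF pgog_subgroup.intro[OF pgog_axioms pgog_subgroup_axioms.intro[OF that]]])
  have iso: "covering_iso \<Gamma> \<Lambda> q \<rho> (quotient_gog \<Gamma> p (covering_subgroup \<Lambda> q \<Gamma> p \<rho>) D)
      (quotient_base \<Gamma> p (covering_subgroup \<Lambda> q \<Gamma> p \<rho>) D) (quotient_covering \<Gamma> p vs es D)"
    if c: "pointed_covering \<Lambda> q \<Gamma> p \<rho>" and "path_section \<Gamma> p vs es" "is_lifting \<Gamma> p (covering_subgroup \<Lambda> q \<Gamma> p \<rho>) D"
    for \<Lambda> :: "('v1, 'e1, 'g1, 'h1) graph_of_groups" and q \<rho> vs es D
    using lifted.quotient_coverings(2,4)[OF lifted[OF that(2) sub[OF c] that(3)]] covering_iso_iff[OF c] by metis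
  show ?thesis
    by (intro conjI allI impI; (elim conjE)?)
      (rule sub path_section_exists lifting lifted.quotient_coverings lifted iso covering_iso_iff factors_through_iff; assumption?)+
qed

end
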